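(* Let $q=p-1$, $0<\lambda<\lambda_1$, and $g\in L^1(\Omega)$ with $g\ge0$, $g\not\equiv0$. Then the problem $(-\Delta)^s_{p,\beta}u=\lambda u^{p-1}+g$ in $\Omega$, $u\ge0$ in $\Omega$, $u=0$ in $\mathbb R^N\setminus\Omega$, has a minimal positive entropy solution, i.e. a measurable $u\ge0$ with $u^{p-1}\in L^1(\Omega)$ that is an entropy solution with datum $\lambda u^{p-1}+g$, and such that $u\le\bar u$ a.e. for every other such solution $\bar u$.
   Context: Standing assumptions: $s\in(0,1)$, $1<p<N$, $ps<N$, $0\le\beta<\frac{N-ps}{2}$, and $\Omega\subset\mathbb R^N$ is a smooth bounded domain containing the origin. Set $d\mu=|x|^{-2\beta}dx$ and $d\nu=\frac{dx\,dy}{|x-y|^{N+ps}|x|^\beta|y|^\beta}$. $D_\Omega=(\mathbb R^N\times\mathbb R^N)\setminus\big((\mathbb R^N\setminus\Omega)\times(\mathbb R^N\setminus\Omega)\big)$. $W^{s,p}_{\beta,0}(\Omega)$ is the closure of $C_c^\infty(\Omega)$ under the norm $(\int_\Omega|\phi|^pd\mu)^{1/p}+(\int_\Omega\int_\Omega|\phi(x)-\phi(y)|^pd\nu)^{1/p}$; its elements are extended by $0$ outside $\Omega$. $\lambda_1=\inf_{\phi\in W^{s,p}_{\beta,0}(\Omega),\phi\ne0}\frac{\frac12\iint_{D_\Omega}|\phi(x)-\phi(y)|^pd\nu}{\int_\Omega|\phi|^pdx}$. For $k>0$, $T_k(a)=\max\{-k,\min\{k,a\}\}$. Entropy solution: given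 $f\in L^1(\Omega)$, a measurable $u$ vanishing outside $\Omega$ with $T_k(u)\in W^{s,p}_{\beta,0}(\Omega)$ for all $k>0$ is an entropy solution of $(-\Delta)^s_{p,\beta}u=f$ if (i) $\iint_{R_h}|u(x)-u(y)|^{p-1}d\nu\to0$ as $h\to\infty$, where $R_h=\{(x,y)\in\mathbb R^N\times\mathbb R^N:\ h+1\le\max\{|u(x)|,|u(y)|\}$ and ($\min\{|u(x)|,|u(y)|\}\le h$ or $u(x)u(y)<0$)$\}$; and (ii) for all $k>0$ and all $\varphi\in W^{s,p}_{\beta,0}(\Omega)\cap L^\infty(\Omega)$, $\frac12\iint_{D_\Omega}|u(x)-u(y)|^{p-2}(u(x)-u(y))[T_k(u(x)-\varphi(x))-T_k(u(y)-\varphi(y))]d\nu\le\int_\Omega f\,T_k(u-\varphi)\,dx$. *)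

theory Defs
  imports "HOL-Analysis.Analysis"
begin

fun Ck_on :: "nat \<Rightarrow> 'a::euclidean_space set \<Rightarrow> ('a \<Rightarrow> real) \<Rightarrow> bool" where
  "Ck_on 0 U f = continuous_on U f"
| "Ck_on (Suc k) U f = (continuous_on U f \<and> f differentiable_on U \<and>
     (\<forall>b\<in>Basis. Ck_on k U (\<lambda>x. frechet_derivative f (at x) b)))"

definition smooth_on :: "'a::euclidean_space set \<Rightarrow> ('a \<Rightarrow> real) \<Rightarrow> bool" where
  "smooth_on U f \<longleftrightarrow> (\<forall>k. Ck_on k U f)"

definition Cc_infty :: "'a::euclidean_space set \<Rightarrow> ('a \<Rightarrow> real) set" where
  "Cc_infty \<Omega> = {\<phi>. smooth_on \<Omega> \<phi> \<and> compact (closure {x. \<phi> x \<noteq> 0})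
       \<and> closure {x. \<phi> x \<noteq> 0} \<subseteq> \<Omega>}"

definition smooth_bounded_domain :: "'a::euclidean_space set \<Rightarrow> bool" where
  "smooth_bounded_domain \<Omega> \<longleftrightarrow> open \<Omega> \<and> bounded \<Omega> \<and> connected \<Omega> \<and> \<Omega> \<noteq> {} \<and>
     (\<forall>z\<in>frontier \<Omega>. \<exists>r>0. \<exists>\<psi>. smooth_on (ball z r) \<psi> \<and>
        frechet_derivative \<psi> (at z) \<noteq> (\<lambda>_. 0) \<and>
        \<Omega> \<inter> ball z r = {x\<in>ball z r. \<psi> x < 0})"

definition wmu :: "real \<Rightarrow> 'a::euclidean_space \<Rightarrow> real" where
  "wmu \<beta> x = 1 / (norm x powr (2 * \<beta>))"

definition knu :: "real \<Rightarrow> real \<Rightarrow> real \<Rightarrow> 'a::euclidean_space \<Rightarrow> 'a \<Rightarrow> real" where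
  "knu s p \<beta> x y = 1 / (norm (x - y) powr (real DIM('a) + p * s)
       * norm x powr \<beta> * norm y powr \<beta>)"

definition nu :: "real \<Rightarrow> real \<Rightarrow> real \<Rightarrow> ('a::euclidean_space \<times> 'a) measure" where
  "nu s p \<beta> = density (lborel \<Otimes>\<^sub>M lborel) (\<lambda>(x,y). ennreal (knu s p \<beta> x y))"

definition D_set :: "'a set \<Rightarrow> ('a \<times> 'a) set" where
  "D_set \<Omega> = UNIV - ((- \<Omega>) \<times> (- \<Omega>))"

text \<open>The two p-th power pieces of the norm defining W^{s,p}_{beta,0}(Omega)
  (as extended nonnegative reals).  Since p > 0, the norm
  (wpart1)^(1/p) + (wpart2)^(1/p) tends to 0 iff both pieces tend to 0.\<close>
definition wpart1 :: "real \<Rightarrow> real \<Rightarrow> 'a::euclidean_space set \<Rightarrow> ('a \<Rightarrow> real) \<Rightarrow> ennreal" where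
  "wpart1 p \<beta> \<Omega> \<phi> = (\<integral>\<^sup>+ x. indicator \<Omega> x * ennreal (\<bar>\<phi> x\<bar> powr p * wmu \<beta> x) \<partial>lborel)"

definition wpart2 :: "real \<Rightarrow> real \<Rightarrow> real \<Rightarrow> 'a::euclidean_space set \<Rightarrow> ('a \<Rightarrow> real) \<Rightarrow> ennreal" where
  "wpart2 s p \<beta> \<Omega> \<phi> = (\<integral>\<^sup>+ z. indicator (\<Omega> \<times> \<Omega>) z * ennreal (\<bar>\<phi> (fst z) - \<phi> (snd z)\<bar> powr p)
        \<partial>(nu s p \<beta>))"

definition Wsp0 :: "real \<Rightarrow> real \<Rightarrow> real \<Rightarrow> 'a::euclidean_space set \<Rightarrow> ('a \<Rightarrow> real) set" where
  "Wsp0 s p \<beta> \<Omega> = {u. u \<in> borel_measurable lborel \<and> (\<forall>x. x \<notin> \<Omega> \<longrightarrow> u x = 0) \<and>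
      (\<exists>\<phi>. (\<forall>n. \<phi> n \<in> Cc_infty \<Omega>) \<and>
           (\<lambda>n. wpart1 p \<beta> \<Omega> (\<lambda>x. \<phi> n x - u x)) \<longlonglongrightarrow> 0 \<and>
           (\<lambda>n. wpart2 s p \<beta> \<Omega> (\<lambda>x. \<phi> n x - u x)) \<longlonglongrightarrow> 0)}"

definition lambda1 :: "real \<Rightarrow> real \<Rightarrow> real \<Rightarrow> 'a::euclidean_space set \<Rightarrow> ennreal" where
  "lambda1 s p \<beta> \<Omega> = (INF \<phi>\<in>{\<phi>\<in>Wsp0 s p \<beta> \<Omega>. \<not> (AE x in lborel. \<phi> x = 0)}.
      ((1/2) * (\<integral>\<^sup>+ z. indicator (D_set \<Omega>) z * ennreal (\<bar>\<phi> (fst z) - \<phi> (snd z)\<bar> powr p)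
                  \<partial>(nu s p \<beta>)))
      / (\<integral>\<^sup>+ x. indicator \<Omega> x * ennreal (\<bar>\<phi> x\<bar> powr p) \<partial>lborel))"

definition Tk :: "real \<Rightarrow> real \<Rightarrow> real" where
  "Tk k a = max (- k) (min k a)"

definition Rh :: "('a \<Rightarrow> real) \<Rightarrow> real \<Rightarrow> ('a \<times> 'a) set" where
  "Rh u h = {(x,y). h + 1 \<le> max \<bar>u x\<bar> \<bar>u y\<bar> \<and>
                 (min \<bar>u x\<bar> \<bar>u y\<bar> \<le> h \<or> u x * u y < 0)}"

definition entropy_solution ::
  "real \<Rightarrow> real \<Rightarrow> real \<Rightarrow> 'a::euclidean_space set \<Rightarrow> ('a \<Rightarrow> real) \<Rightarrow> ('a \<Rightarrow> real) \<Rightarrow> bool" where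
  "entropy_solution s p \<beta> \<Omega> f u \<longleftrightarrow>
     u \<in> borel_measurable lborel \<and> (\<forall>x. x \<notin> \<Omega> \<longrightarrow> u x = 0) \<and>
     (\<forall>k>0. (\<lambda>x. Tk k (u x)) \<in> Wsp0 s p \<beta> \<Omega>) \<and>
     ((\<lambda>h. \<integral>\<^sup>+ z. indicator (Rh u h) z * ennreal (\<bar>u (fst z) - u (snd z)\<bar> powr (p - 1))
              \<partial>(nu s p \<beta>)) \<longlongrightarrow> 0) at_top \<and>
     (\<forall>k>0. \<forall>\<phi>\<in>Wsp0 s p \<beta> \<Omega>. (\<exists>C. AE x in lborel. \<bar>\<phi> x\<bar> \<le> C) \<longrightarrow>
        (let F = (\<lambda>z. \<bar>u (fst z) - u (snd z)\<bar> powr (p - 2) * (u (fst z) - u (snd z))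
                   * (Tk k (u (fst z) - \<phi> (fst z)) - Tk k (u (snd z) - \<phi> (snd z))))
         in set_integrable (nu s p \<beta>) (D_set \<Omega>) F \<and>
            (1/2) * (\<integral>z\<in>D_set \<Omega>. F z \<partial>(nu s p \<beta>))
              \<le> (\<integral>x\<in>\<Omega>. f x * Tk k (u x - \<phi> x) \<partial>lborel)))"

definition pos_entropy_sol ::
  "real \<Rightarrow> real \<Rightarrow> real \<Rightarrow> 'a::euclidean_space set \<Rightarrow> real \<Rightarrow> ('a \<Rightarrow> real) \<Rightarrow> ('a \<Rightarrow> real) \<Rightarrow> bool" where
  "pos_entropy_sol s p \<beta> \<Omega> lam g u \<longleftrightarrow>
     u \<in> borel_measurable lborel \<and> (\<forall>x. u x \<ge> 0) \<and>
     set_integrable lborel \<Omega> (\<lambda>x. u x powr (p - 1)) \<and>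
     entropy_solution s p \<beta> \<Omega> (\<lambda>x. lam * u x powr (p - 1) + g x) u"

end

theory Submission
  imports Defs
begin

text \<open>
  The data are truncated and the solution is reached from below: \<open>u\<^sub>0 = 0\<close>, and \<open>u\<^sub>n\<^sub>+\<^sub>1\<close> minimises the energy
  with the bounded datum \<open>\<lambda> min(n, u\<^sub>n)\<^sup>p\<^sup>-\<^sup>1 + min(n, g)\<close>.  Comparison makes the sequence increasing and keeps it
  below every entropy solution, so its limit is minimal as soon as it is a solution.

  The heart of the matter is a bound for the integrals of \<open>u\<^sub>n\<^sup>p\<^sup>-\<^sup>1\<close>.  An elementary Faber--Krahn inequality turns
  the energy bound for the truncations into fast decay of the tails of \<open>u\<^sub>n\<close> above the level \<open>L\<close> at which
  \<open>{u\<^sub>n > L}\<close> becomes small; testing with a truncation at a multiple of \<open>L\<close> and using \<open>\<lambda> < \<lambda>\<^sub>1\<close> bounds \<open>L\<close>.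

  Membership of the truncations of the limit in \<open>W\<close> follows from uniform convexity, and the entropy inequality from
  Fatou's lemma: its integrand is bounded below by \<open>- |\<phi>(x) - \<phi>(y)|\<^sup>p\<close> inside \<open>\<Omega> \<times> \<Omega>\<close>, and outside by a multiple of
  \<open>|u(x) - u(y)|\<^sup>p\<^sup>-\<^sup>1\<close>, which is integrable there.  The latter also covers test functions whose energy
  over \<open>D\<^sub>\<Omega>\<close> is infinite, so no Hardy inequality is needed.
\<close>

section \<open>Calculus of smooth functions\<close>

text \<open>Two obstacles shape the proof. The norm of W sees only differences inside \<Omega>
  \<times> \<Omega>, whereas the equation and \<lambda>_1 see all of D; and finite energy is not
  shown to control the weighted L^p part of that norm. The variational work therefore takes place in
  a class X of functions of finite energy over the whole space, of which only the truncations are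
  required to lie in W. Uniform convexity replaces weak compactness: near minimisers are Cauchy, so
  limits are strong. The other obstacle is the a priori bound. Testing with T_k(u) leaves the tail k
  \<lambda> \<integral> u^(p-1) over {u > k} on the right, and this tail has the size of the very
  norm to be bounded. It can be absorbed at k = 2^J L with a fixed J: by the choice of L the left
  side is at least a fixed multiple of L^p, while the tail at that level is a small multiple of
  L^(p-1) plus a multiple of the mass of g. Hence L is bounded in terms of that mass.\<close>

lemma Ck_on_cong:
  assumes "open U" "\<And>x. x \<in> U \<Longrightarrow> f x = g x" "Ck_on k U f"
  shows "Ck_on k U g"
  using assms(2,3)
proof (induction k arbitrary: f g)
  case 0
  then show ?case using continuous_on_cong[of U U f g] by auto
next
  case (Suc k)
  have der: "(g has_derivative D) (at x)" if "(f has_derivative D) (at x)" "x \<in> U" for D x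
    using has_derivative_transform_within_open[OF that(1) assms(1) that(2)] Suc.prems(1) by blast
  have fd: "(f has_derivative frechet_derivative f (at x)) (at x)" if "x \<in> U" for x
  proof -
    have "f differentiable at x"
      using Suc.prems(2) that assms(1) by (auto simp: differentiable_on_def at_within_open[of _ U])
    then show ?thesis by (simp add: frechet_derivative_works)
  qed
  have eq: "frechet_derivative g (at x) = frechet_derivative f (at x)" if "x \<in> U" for x
    using frechet_derivative_at[OF der[OF fd[OF that] that]] by simp
  have "g differentiable_on U"
    unfolding differentiable_on_def
    using der[OF fd] by (auto simp: differentiable_def intro: has_derivative_at_withinI)
  moreover have "continuous_on U g" using Suc.prems continuous_on_cong[of U U f g] by auto
  moreover have "Ck_on k U (\<lambda>x. frechet_derivative g (at x) b)" if "b \<in> Basis" for b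
    by (rule Suc.IH[of "\<lambda>x. frechet_derivative f (at x) b"]) (use eq Suc.prems that in auto)
  ultimately show ?case by auto
qed

lemma Ck_on_Suc_has_derivative:
  assumes "open U" "Ck_on (Suc k) U f" "x \<in> U"
  shows "(f has_derivative frechet_derivative f (at x)) (at x)"
proof -
  have "f differentiable at x"
    using assms by (auto simp: differentiable_on_def at_within_open[of _ U])
  then show ?thesis by (simp add: frechet_derivative_works)
qed

text \<open>\<open>frechet_derivative\<close> is a choice operator. Derivatives on an open set are
  unique, so any explicit formula D may replace it, and the closure properties below can be proved
  with the usual rules.\<close>

lemma Ck_on_SucI:
  assumes "open U" and der: "\<And>x. x \<in> U \<Longrightarrow> (f has_derivative D x) (at x)"
    and Ck: "\<And>b. b \<in> Basis \<Longrightarrow> Ck_on k U (\<lambda>x. D x b)"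
  shows "Ck_on (Suc k) U f"
proof -
  have "f differentiable_on U"
    unfolding differentiable_on_def
    using der by (auto simp: differentiable_def intro: has_derivative_at_withinI)
  moreover have "D x = frechet_derivative f (at x)" if "x \<in> U" for x
    using frechet_derivative_at[OF der[OF that]] .
  then have "Ck_on k U (\<lambda>x. frechet_derivative f (at x) b)" if "b \<in> Basis" for b
    by (intro Ck_on_cong[OF assms(1) _ Ck[OF that]]) auto
  ultimately show ?thesis
    by (auto intro: differentiable_imp_continuous_on)
qed

lemma Ck_on_SucD: "Ck_on (Suc k) U f \<Longrightarrow> Ck_on k U f"
  by (induction k arbitrary: f) auto

lemma Ck_on_const: "open U \<Longrightarrow> Ck_on k U (\<lambda>_. c)"
proof (induction k arbitrary: c)
  case (Suc k)
  show ?case by (rule Ck_on_SucI[where D="\<lambda>x h. 0"]) (use Suc in auto)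
qed auto

lemma Ck_on_add: "open U \<Longrightarrow> Ck_on k U f \<Longrightarrow> Ck_on k U g \<Longrightarrow> Ck_on k U (\<lambda>x. f x + g x)"
proof (induction k arbitrary: f g)
  case 0
  then show ?case by (auto intro: continuous_on_add)
next
  case (Suc k)
  show ?case
  proof (rule Ck_on_SucI[OF Suc.prems(1)])
    show "((\<lambda>x. f x + g x) has_derivative (\<lambda>h. frechet_derivative f (at x) h + frechet_derivative g (at x) h)) (at x)"
      if "x \<in> U" for x
      using that Suc.prems by (intro has_derivative_add Ck_on_Suc_has_derivative)
    show "Ck_on k U (\<lambda>x. frechet_derivative f (at x) b + frechet_derivative g (at x) b)" if "b \<in> Basis" for b
      using Suc that by auto
  qed
qed

lemma Ck_on_mult: "open U \<Longrightarrow> Ck_on k U f \<Longrightarrow> Ck_on k U g \<Longrightarrow> Ck_on k U (\<lambda>x. f x * g x)"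
proof (induction k arbitrary: f g)
  case 0
  then show ?case by (auto intro: continuous_on_mult)
next
  case (Suc k)
  show ?case
  proof (rule Ck_on_SucI[OF Suc.prems(1)])
    show "((\<lambda>x. f x * g x) has_derivative (\<lambda>h. f x * frechet_derivative g (at x) h + frechet_derivative f (at x) h * g x)) (at x)"
      if "x \<in> U" for x
      using that Suc.prems by (intro has_derivative_mult Ck_on_Suc_has_derivative)
    show "Ck_on k U (\<lambda>x. f x * frechet_derivative g (at x) b + frechet_derivative f (at x) b * g x)" if "b \<in> Basis" for b
      using Suc that by (intro Ck_on_add Suc.IH Ck_on_SucD[of k U f] Ck_on_SucD[of k U g]) auto
  qed
qed

text \<open>The exponent varies in the induction because differentiation lowers it by one;
  positivity of f keeps all these powers smooth.\<close>

lemma Ck_on_powr: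
  assumes "open U" "Ck_on k U f" "\<And>x. x \<in> U \<Longrightarrow> f x > 0"
  shows "Ck_on k U (\<lambda>x. f x powr a)"
  using assms(2)
proof (induction k arbitrary: a)
  case 0
  then show ?case using assms(3) by (force intro!: continuous_intros)
next
  case (Suc k)
  show ?case
  proof (rule Ck_on_SucI[OF assms(1)])
    show "((\<lambda>x. f x powr a) has_derivative (\<lambda>h. (a * f x powr (a - 1)) * frechet_derivative f (at x) h)) (at x)"
      if "x \<in> U" for x
    proof -
      have "((\<lambda>y. y powr a) has_field_derivative a * f x powr (a - 1)) (at (f x))"
        using assms(3)[OF that] by (rule has_real_derivative_powr)
      from has_derivative_compose[OF Ck_on_Suc_has_derivative[OF assms(1) Suc.prems that]
          this[unfolded has_field_derivative_def]]
      show ?thesis .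
    qed
    show "Ck_on k U (\<lambda>x. (a * f x powr (a - 1)) * frechet_derivative f (at x) b)" if "b \<in> Basis" for b
      using Suc that assms(1) by (intro Ck_on_mult Ck_on_const Suc.IH Ck_on_SucD[of k U f]) auto
  qed
qed

section \<open>Truncations and their smooth approximations\<close>

definition clamp_real :: "real \<Rightarrow> real \<Rightarrow> real \<Rightarrow> real" where
  "clamp_real a b t = max a (min b t)"

lemma Tk_eq_clamp: "Tk k = clamp_real (- k) k"
  by (auto simp: Tk_def clamp_real_def)

lemma clamp_real_lipschitz: "\<bar>clamp_real a b s - clamp_real a b t\<bar> \<le> \<bar>s - t\<bar>"
  by (auto simp: clamp_real_def max_def min_def)

lemma clamp_real_0: "a \<le> 0 \<Longrightarrow> 0 \<le> b \<Longrightarrow> clamp_real a b 0 = 0"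
  by (auto simp: clamp_real_def)

lemma clamp_real_measurable [measurable]: "clamp_real a b \<in> borel_measurable borel"
  unfolding clamp_real_def by measurable

lemma Tk_measurable [measurable]: "Tk k \<in> borel_measurable borel"
  unfolding Tk_eq_clamp by measurable

definition smooth_abs :: "real \<Rightarrow> real \<Rightarrow> real" where
  "smooth_abs e t = sqrt (t\<^sup>2 + e\<^sup>2)"

text \<open>For a \<le> 0 \<le> b the clamp equals (|t - a| - |t - b| - (|a| - |b|)) / 2; here each
  modulus is replaced by \<open>smooth_abs\<close>. The constant is regularised too, so that 0 is
  mapped exactly to 0 and supports do not grow.\<close>

definition smooth_clamp :: "real \<Rightarrow> real \<Rightarrow> real \<Rightarrow> real \<Rightarrow> real" where
  "smooth_clamp e a b t = (smooth_abs e (t - a) - smooth_abs e (t - b)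
     - (smooth_abs e (- a) - smooth_abs e (- b))) / 2"

lemma smooth_abs_bounds:
  assumes "e > 0" shows "\<bar>t\<bar> \<le> smooth_abs e t" "smooth_abs e t \<le> \<bar>t\<bar> + e"
proof -
  show "\<bar>t\<bar> \<le> smooth_abs e t" unfolding smooth_abs_def by (rule real_le_rsqrt) simp
  show "smooth_abs e t \<le> \<bar>t\<bar> + e"
    unfolding smooth_abs_def
    by (rule real_le_lsqrt) (use assms in \<open>auto simp: power2_eq_square algebra_simps\<close>)
qed

lemma smooth_clamp_close:
  assumes "e > 0" "a \<le> 0" "0 \<le> b"
  shows "\<bar>smooth_clamp e a b t - clamp_real a b t\<bar> \<le> 2 * e"
proof -
  have "clamp_real a b t = (\<bar>t - a\<bar> - \<bar>t - b\<bar> - (\<bar>- a\<bar> - \<bar>- b\<bar>)) / 2"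
    using assms by (auto simp: clamp_real_def max_def min_def)
  then show ?thesis
    using smooth_abs_bounds[OF assms(1), of "t - a"] smooth_abs_bounds[OF assms(1), of "t - b"]
      smooth_abs_bounds[OF assms(1), of "-a"] smooth_abs_bounds[OF assms(1), of "-b"] assms
    unfolding smooth_clamp_def by argo
qed

lemma smooth_abs_has_derivative:
  assumes "e > 0"
  shows "(smooth_abs e has_real_derivative t / smooth_abs e t) (at t)"
proof -
  have "t\<^sup>2 + e\<^sup>2 > 0" using assms by (simp add: add_nonneg_pos)
  then show ?thesis unfolding smooth_abs_def
    by (auto intro!: derivative_eq_intros simp: field_simps)
qed

text \<open>Convexity of \<open>smooth_abs\<close>, stated for its derivative; it makes
  \<open>smooth_clamp\<close> nondecreasing.\<close>

lemma smooth_abs_deriv_mono: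
  assumes "e > 0" "s \<le> t"
  shows "s / smooth_abs e s \<le> t / smooth_abs e t"
proof (rule DERIV_nonneg_imp_nondecreasing[OF assms(2)])
  fix x
  have pos: "x\<^sup>2 + e\<^sup>2 > 0" using assms by (simp add: add_nonneg_pos)
  have sp: "smooth_abs e x > 0" using pos by (simp add: smooth_abs_def)
  have sq: "smooth_abs e x * smooth_abs e x = x\<^sup>2 + e\<^sup>2" using pos by (simp add: smooth_abs_def)
  have "((\<lambda>x. x / smooth_abs e x) has_real_derivative
      (1 * smooth_abs e x - x * (x / smooth_abs e x)) / (smooth_abs e x * smooth_abs e x)) (at x)"
    using sp by (intro DERIV_divide DERIV_ident smooth_abs_has_derivative assms) auto
  moreover have "(1 * smooth_abs e x - x * (x / smooth_abs e x)) / (smooth_abs e x * smooth_abs e x) \<ge> 0"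
  proof -
    have "x * (x / smooth_abs e x) \<le> smooth_abs e x"
      using sp sq by (simp add: field_simps power2_eq_square)
    then show ?thesis using sp by (intro divide_nonneg_nonneg) auto
  qed
  ultimately show "\<exists>y. ((\<lambda>x. x / smooth_abs e x) has_real_derivative y) (at x) \<and> 0 \<le> y" by blast
qed

text \<open>The derivative is half the difference of two values, at ordered points, of an increasing
  function with values in [-1, 1], hence lies in [0, 1]. The constant 1 matters: composition must
  not increase the energy.\<close>

lemma smooth_clamp_lipschitz:
  assumes "e > 0" "a \<le> b"
  shows "\<bar>smooth_clamp e a b s - smooth_clamp e a b t\<bar> \<le> \<bar>s - t\<bar>"
proof -
  let ?d = "\<lambda>x. ((x - a) / smooth_abs e (x - a) - (x - b) / smooth_abs e (x - b)) / 2"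
  have der: "(smooth_clamp e a b has_real_derivative ?d x) (at x within S)" for x S
  proof -
    have "((\<lambda>x. smooth_abs e (x - c)) has_real_derivative (x - c) / smooth_abs e (x - c) * 1) (at x within S)" for c
      by (rule DERIV_chain2[OF smooth_abs_has_derivative[OF assms(1)]]) (auto intro!: derivative_eq_intros)
    note * = this[of a] this[of b]
    show ?thesis unfolding smooth_clamp_def
      using DERIV_cdivide[OF DERIV_diff[OF DERIV_diff[OF *] DERIV_const], where c=2] by simp
  qed
  have b1: "\<bar>x / smooth_abs e x\<bar> \<le> 1" for x
    using smooth_abs_bounds(1)[OF assms(1), of x] by (auto simp: abs_divide divide_le_eq_1)
  have "0 \<le> ?d x" for x
    using smooth_abs_deriv_mono[OF assms(1), of "x - b" "x - a"] assms(2) by simp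
  moreover have "?d x \<le> 1" for x
    using b1[of "x - a"] b1[of "x - b"] by argo
  ultimately have "norm (smooth_clamp e a b s - smooth_clamp e a b t) \<le> 1 * norm (s - t)"
    by (intro field_differentiable_bound[where S=UNIV and f'="?d"] der) auto
  then show ?thesis by simp
qed

lemma smooth_clamp_0: "smooth_clamp e a b 0 = 0"
  by (simp add: smooth_clamp_def)

lemma Ck_on_smooth_clamp:
  assumes "e > 0" "open U" "Ck_on k U f"
  shows "Ck_on k U (\<lambda>x. smooth_clamp e a b (f x))"
proof -
  have sa: "Ck_on k U (\<lambda>x. smooth_abs e (f x - c))" for c
  proof -
    have *: "smooth_abs e (f x - c) = ((f x + - c) * (f x + - c) + e\<^sup>2) powr (1/2)" for x
      by (simp add: smooth_abs_def powr_half_sqrt power2_eq_square)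
    have "0 < (f x + - c) * (f x + - c) + e\<^sup>2" for x
      using assms(1) by (simp add: add_nonneg_pos)
    then show ?thesis unfolding *
      using assms by (intro Ck_on_powr Ck_on_add Ck_on_mult Ck_on_const) auto
  qed
  have "smooth_clamp e a b (f x) = (smooth_abs e (f x - a) * (1/2) + smooth_abs e (f x - b) * (-1/2))
     + - (smooth_abs e (- a) - smooth_abs e (- b)) / 2" for x
    by (simp add: smooth_clamp_def field_simps)
  then show ?thesis
    by (simp only:) (intro Ck_on_add Ck_on_mult Ck_on_const sa assms)
qed

section \<open>The power function\<close>

text \<open>The monotone nonlinearity of the p-Laplacian, up to the factor p the derivative of
  |t|^p. Since \<open>0 powr a = 0\<close> for every a, it vanishes at 0 also when p < 2.\<close>

definition sgp :: "real \<Rightarrow> real \<Rightarrow> real" where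
  "sgp p t = \<bar>t\<bar> powr (p - 2) * t"

lemma sgp_nonneg_eq: "p > 1 \<Longrightarrow> t \<ge> 0 \<Longrightarrow> sgp p t = t powr (p - 1)"
  by (cases "t = 0") (auto simp: sgp_def powr_diff field_simps power2_eq_square)

lemma sgp_minus: "sgp p (- t) = - sgp p t"
  by (simp add: sgp_def)

lemma abs_sgp: "p > 1 \<Longrightarrow> \<bar>sgp p t\<bar> = \<bar>t\<bar> powr (p - 1)"
  using sgp_nonneg_eq[of p "\<bar>t\<bar>"] by (simp add: sgp_def abs_mult)

lemma sgp_mult_self: "p > 1 \<Longrightarrow> sgp p t * t = \<bar>t\<bar> powr p"
  by (cases "t = 0") (auto simp: sgp_def powr_diff field_simps power2_eq_square)

lemma sgp_0 [simp]: "sgp p 0 = 0"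
  by (simp add: sgp_def)

lemma sgp_measurable [measurable]: "sgp p \<in> borel_measurable borel"
  unfolding sgp_def by measurable

lemma sgp_strict_mono:
  assumes "p > 1" "s < t" shows "sgp p s < sgp p t"
proof (cases "s \<ge> 0")
  case True
  then show ?thesis using assms by (simp add: sgp_nonneg_eq powr_less_mono2)
next
  case False
  show ?thesis
  proof (cases "t > 0")
    case True
    have "sgp p t > 0" using True by (simp add: sgp_def)
    moreover have "sgp p s < 0" using False by (simp add: sgp_def mult_pos_neg)
    ultimately show ?thesis by simp
  next
    case nt: False
    have "sgp p (- t) < sgp p (- s)"
      using assms nt False by (simp add: sgp_nonneg_eq powr_less_mono2)
    then show ?thesis by (simp add: sgp_minus)
  qed
qed

lemma sgp_mono: "p > 1 \<Longrightarrow> s \<le> t \<Longrightarrow> sgp p s \<le> sgp p t"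
  using sgp_strict_mono[of p s t] by (cases "s = t") auto

lemma DERIV_abs_powr:
  assumes "p > 1"
  shows "((\<lambda>t. \<bar>t\<bar> powr p) has_real_derivative p * sgp p x) (at x)"
proof -
  consider "x > 0" | "x < 0" | "x = 0" by linarith
  then show ?thesis
  proof cases
    case 1
    have "((\<lambda>t. t powr p) has_real_derivative p * x powr (p - 1)) (at x)"
      using 1 by (rule has_real_derivative_powr)
    moreover have "eventually (\<lambda>t. t powr p = \<bar>t\<bar> powr p) (nhds x)"
      by (rule eventually_mono[OF eventually_nhds_in_open[of "{0<..}"]]) (use 1 in auto)
    ultimately show ?thesis using 1 assms
      by (simp add: sgp_nonneg_eq DERIV_cong_ev[OF refl _ refl])
  next
    case 2
    have "((\<lambda>t. (- t) powr p) has_real_derivative (p * (- x) powr (p - 1)) * (- 1)) (at x)"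
      by (rule DERIV_chain2[of "\<lambda>t. t powr p"]) (use 2 in \<open>auto intro!: has_real_derivative_powr derivative_eq_intros\<close>)
    moreover have "eventually (\<lambda>t. (- t) powr p = \<bar>t\<bar> powr p) (nhds x)"
      by (rule eventually_mono[OF eventually_nhds_in_open[of "{..<0}"]]) (use 2 in auto)
    moreover have "sgp p x = - ((- x) powr (p - 1))"
      using sgp_minus[of p "-x"] sgp_nonneg_eq[of p "-x"] assms 2 by simp
    ultimately show ?thesis
      by (simp add: DERIV_cong_ev[OF refl _ refl])
  next
    case 3
    \<comment> \<open>At 0 the difference quotient has modulus |h|^(p-1), which tends to 0 because p
      > 1.\<close>
    have "((\<lambda>h. \<bar>h\<bar> powr (p - 1)) \<longlongrightarrow> 0) (at 0)"
      using assms by (auto intro!: tendsto_eq_intros simp: eventually_at_filter)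
    then have "((\<lambda>h. \<bar>\<bar>h\<bar> powr p / h\<bar>) \<longlongrightarrow> 0) (at 0)"
    proof (rule Lim_transform_eventually)
      show "\<forall>\<^sub>F h in at 0. \<bar>h\<bar> powr (p - 1) = \<bar>\<bar>h\<bar> powr p / h\<bar>"
        by (rule eventually_at_filter[THEN iffD2]) (auto intro!: always_eventually simp: powr_diff)
    qed
    then show ?thesis using 3 assms
      unfolding tendsto_rabs_zero_iff by (simp add: DERIV_def)
  qed
qed

lemma abs_powr_mvt:
  assumes "p > 1" "a < b"
  obtains z where "a < z" "z < b" "\<bar>b\<bar> powr p - \<bar>a\<bar> powr p = (b - a) * (p * sgp p z)"
  using MVT2[OF assms(2), of "\<lambda>t. \<bar>t\<bar> powr p" "\<lambda>x. p * sgp p x"] DERIV_abs_powr[OF assms(1)] by blast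

text \<open>Convexity from the mean value theorem and the monotonicity of \<open>sgp\<close>. It is
  applied later with x the perturbed difference, which bounds a perturbed energy from above.\<close>

lemma abs_powr_tangent:
  assumes "p > 1"
  shows "\<bar>x\<bar> powr p + p * sgp p x * (a - x) \<le> \<bar>a\<bar> powr p"
proof -
  consider "a < x" | "a = x" | "x < a" by linarith
  then show ?thesis
  proof cases
    case 1
    obtain z where z: "a < z" "z < x" "\<bar>x\<bar> powr p - \<bar>a\<bar> powr p = (x - a) * (p * sgp p z)"
      using abs_powr_mvt[OF assms 1] by blast
    have "(x - a) * (p * sgp p z) \<le> (x - a) * (p * sgp p x)"
      using z assms by (intro mult_left_mono sgp_mono) auto
    then show ?thesis using z by (simp add: algebra_simps)
  next
    case 3
    obtain z where z: "x < z" "z < a" "\<bar>a\<bar> powr p - \<bar>x\<bar> powr p = (a - x) * (p * sgp p z)"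
      using abs_powr_mvt[OF assms 3] by blast
    have "(a - x) * (p * sgp p x) \<le> (a - x) * (p * sgp p z)"
      using z assms by (intro mult_left_mono sgp_mono) auto
    then show ?thesis using z by (simp add: algebra_simps)
  qed auto
qed

text \<open>The mean slope over the left half of the interval is strictly below that over the right
  half, as \<open>sgp\<close> is strictly increasing.\<close>

lemma abs_powr_midpoint_strict:
  fixes a b p :: real
  assumes "p > 1" "a \<noteq> b"
  shows "\<bar>(a + b) / 2\<bar> powr p < (\<bar>a\<bar> powr p + \<bar>b\<bar> powr p) / 2"
proof -
  have *: "\<bar>(x + y) / 2\<bar> powr p < (\<bar>x\<bar> powr p + \<bar>y\<bar> powr p) / 2" if "x < y" for x y :: real
  proof -
    define m where "m = (x + y) / 2"
    have m: "x < m" "m < y" "y - m = m - x" using that by (auto simp: m_def field_simps)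
    obtain z1 where z1: "x < z1" "z1 < m" "\<bar>m\<bar> powr p - \<bar>x\<bar> powr p = (m - x) * (p * sgp p z1)"
      using abs_powr_mvt[OF assms(1) m(1)] by blast
    obtain z2 where z2: "m < z2" "z2 < y" "\<bar>y\<bar> powr p - \<bar>m\<bar> powr p = (y - m) * (p * sgp p z2)"
      using abs_powr_mvt[OF assms(1) m(2)] by blast
    have "(m - x) * (p * sgp p z1) < (m - x) * (p * sgp p z2)"
      using m z1 z2 assms by (intro mult_strict_left_mono sgp_strict_mono) auto
    then have "\<bar>m\<bar> powr p - \<bar>x\<bar> powr p < \<bar>y\<bar> powr p - \<bar>m\<bar> powr p"
      unfolding z1(3) z2(3) m(3) .
    then show ?thesis unfolding m_def[symmetric] by simp
  qed
  show ?thesis using *[of a b] *[of b a] assms(2) by (cases "a < b") (auto simp: add.commute)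
qed

lemma abs_add_powr_le:
  fixes a b p :: real
  assumes "p \<ge> 0"
  shows "\<bar>a + b\<bar> powr p \<le> 2 powr p * (\<bar>a\<bar> powr p + \<bar>b\<bar> powr (p::real))"
proof -
  have "\<bar>a + b\<bar> powr p \<le> (2 * max \<bar>a\<bar> \<bar>b\<bar>) powr p"
    using assms by (intro powr_mono2) auto
  also have "\<dots> = 2 powr p * (max \<bar>a\<bar> \<bar>b\<bar>) powr p" by (simp add: powr_mult)
  also have "\<dots> \<le> 2 powr p * (\<bar>a\<bar> powr p + \<bar>b\<bar> powr p)"
    by (intro mult_left_mono) (auto simp: max_def)
  finally show ?thesis .
qed

text \<open>Strict convexity, made uniform by homogeneity and compactness of the unit sphere.\<close>

lemma abs_powr_uniform_convexity:
  fixes p e :: real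
  assumes p: "p > 1" and e: "e > 0"
  obtains C :: real where "C \<ge> 0" "\<And>a b. \<bar>a - b\<bar> powr p + C * \<bar>(a + b) / 2\<bar> powr p
      \<le> (e + C / 2) * (\<bar>a\<bar> powr p + \<bar>b\<bar> powr p)"
proof -
  \<comment> \<open>By homogeneity pairs may be normalised to |a|^p + |b|^p = 1, and only those with
    |a - b|^p > e need the help of C. On the compact set S the convexity defect D is bounded away
    from 0.\<close>
  define S where "S = {x :: real \<times> real. \<bar>fst x\<bar> powr p + \<bar>snd x\<bar> powr p = 1 \<and> e \<le> \<bar>fst x - snd x\<bar> powr p}"
  define D where "D x = (\<bar>fst x\<bar> powr p + \<bar>snd x\<bar> powr p) / 2 - \<bar>(fst x + snd x) / 2\<bar> powr p" for x :: "real \<times> real"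
  have cont: "continuous_on UNIV (\<lambda>x. \<bar>f x\<bar> powr p)" if "continuous_on UNIV f" for f :: "real \<times> real \<Rightarrow> real"
    by (rule continuous_on_powr') (use p that in \<open>auto intro!: continuous_intros\<close>)
  have contD: "continuous_on UNIV D" unfolding D_def by (intro continuous_intros cont) auto
  have "closed S" unfolding S_def
    by (intro closed_Collect_conj closed_Collect_eq closed_Collect_le cont continuous_intros)
  moreover have "bounded S"
  proof (rule boundedI)
    fix x assume "x \<in> S"
    then have 1: "\<bar>fst x\<bar> powr p + \<bar>snd x\<bar> powr p = 1" unfolding S_def by blast
    have *: "\<bar>t\<bar> \<le> 1" if "\<bar>t\<bar> powr p \<le> 1" for t :: real
    proof (rule ccontr)
      assume "\<not> \<bar>t\<bar> \<le> 1"
      then have "1 powr p < \<bar>t\<bar> powr p" using p by (intro powr_less_mono2) auto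
      then show False using that by simp
    qed
    have "\<bar>fst x\<bar> \<le> 1" "\<bar>snd x\<bar> \<le> 1"
      using 1 powr_ge_zero[of "\<bar>fst x\<bar>" p] powr_ge_zero[of "\<bar>snd x\<bar>" p]
      by (intro *; linarith)+
    then show "norm x \<le> 2"
      using norm_Pair_le[of "fst x" "snd x"] by simp
  qed
  ultimately have comp: "compact S" by (simp add: compact_eq_bounded_closed)
  have pos: "D x > 0" if "x \<in> S" for x
  proof -
    have "fst x \<noteq> snd x" using that e by (auto simp: S_def)
    from abs_powr_midpoint_strict[OF p this] show ?thesis by (simp add: D_def)
  qed
  \<comment> \<open>For large e the set S is empty, and then any positive d will do.\<close>
  obtain d where d: "d > 0" "\<And>x. x \<in> S \<Longrightarrow> d \<le> D x"
  proof (cases "S = {}")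
    case False
    then obtain x0 where "x0 \<in> S" "\<forall>x\<in>S. D x0 \<le> D x"
      using continuous_attains_inf[OF comp False continuous_on_subset[OF contD]] by auto
    with pos that show ?thesis by blast
  qed (use that[of 1] in auto)
  \<comment> \<open>C = 2^p / d: if |a - b|^p exceeds e s, where s = |a|^p + |b|^p, the normalised
    pair lies in S, so the defect is at least d s, whereas |a - b|^p is at most 2^p s in any
    case.\<close>
  have "\<bar>a - b\<bar> powr p + 2 powr p / d * \<bar>(a + b) / 2\<bar> powr p
      \<le> (e + (2 powr p / d) / 2) * (\<bar>a\<bar> powr p + \<bar>b\<bar> powr p)" for a b :: real
  proof -
    define s where "s = \<bar>a\<bar> powr p + \<bar>b\<bar> powr p"
    have s0: "s \<ge> 0" by (simp add: s_def)
    have Dab: "D (a, b) \<ge> 0" using abs_powr_midpoint_strict[OF p, of a b] by (cases "a = b") (auto simp: D_def)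
    have key: "\<bar>a - b\<bar> powr p \<le> e * s + 2 powr p / d * D (a, b)"
    proof (cases "\<bar>a - b\<bar> powr p \<le> e * s")
      case True
      moreover have "2 powr p / d * D (a, b) \<ge> 0" using Dab d(1) by simp
      ultimately show ?thesis by linarith
    next
      case False
      have spos: "s > 0"
      proof (rule ccontr)
        assume "\<not> s > 0"
        then have "s = 0" using s0 by simp
        then have "a = 0" "b = 0" by (auto simp: s_def add_nonneg_eq_0_iff)
        with False \<open>s = 0\<close> show False by simp
      qed
      define r where "r = s powr (1/p)"
      have r: "r > 0" "r powr p = s" using spos p by (auto simp: r_def powr_powr)
      have sc: "\<bar>t / r\<bar> powr p = \<bar>t\<bar> powr p / s" for t
        using r by (simp add: abs_divide powr_divide)
      have "e \<le> \<bar>a - b\<bar> powr p / s" using False spos by (simp add: field_simps)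
      moreover have "a / r - b / r = (a - b) / r" by (simp add: diff_divide_distrib)
      moreover have "\<bar>a / r\<bar> powr p + \<bar>b / r\<bar> powr p = 1"
        unfolding sc using spos by (simp add: add_divide_distrib[symmetric] flip: s_def)
      ultimately have "(a / r, b / r) \<in> S"
        unfolding S_def by (simp only: mem_Collect_eq fst_conv snd_conv sc simp_thms)
      from d(2)[OF this] have "d \<le> D (a / r, b / r)" .
      also have "(a / r + b / r) / 2 = ((a + b) / 2) / r" by (simp add: add_divide_distrib)
      then have "D (a / r, b / r) = D (a, b) / s"
        unfolding D_def fst_conv snd_conv by (simp only: sc) (simp add: diff_divide_distrib add_divide_distrib)
      finally have "d \<le> D (a, b) / s" .
      then have "2 powr p * s \<le> 2 powr p / d * D (a, b)"
        using spos d(1) by (simp add: field_simps)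
      moreover have "\<bar>a - b\<bar> powr p \<le> 2 powr p * s"
        using abs_add_powr_le[of p a "-b"] p by (simp add: s_def)
      moreover have "e * s \<ge> 0" using s0 e by simp
      ultimately show ?thesis by linarith
    qed
    have eq: "K * D (a, b) = K / 2 * s - K * \<bar>(a + b) / 2\<bar> powr p" for K
      by (simp add: D_def s_def field_simps)
    show ?thesis using key unfolding s_def[symmetric] eq by (simp add: algebra_simps)
  qed
  then show thesis using that[of "2 powr p / d"] d(1) by simp
qed

section \<open>Radial integrals\<close>

text \<open>A substitute for polar coordinates: each point where h is positive lies in some ball on
  which h is charged with the constant c j, and that ball has volume proportional to the N-th power
  of R j.\<close>

lemma nn_integral_dyadic_finite:
  fixes h :: "'a::euclidean_space \<Rightarrow> real"
  assumes c: "\<And>j. c j \<ge> 0" and R: "\<And>j. R j \<ge> 0"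
    and cover: "\<And>x. x \<in> S \<Longrightarrow> h x > 0 \<Longrightarrow> \<exists>j::nat. x \<in> ball 0 (R j) \<and> h x \<le> c j"
    and sum: "summable (\<lambda>j. c j * R j ^ DIM('a))"
  shows "(\<integral>\<^sup>+ x. indicator S x * ennreal (h x) \<partial>lborel) < \<infinity>"
proof -
  let ?V = "unit_ball_vol (real DIM('a))"
  have "(\<integral>\<^sup>+ x. indicator S x * ennreal (h x) \<partial>lborel)
      \<le> (\<integral>\<^sup>+ x. (\<Sum>j. ennreal (c j) * indicator (ball (0::'a) (R j)) x) \<partial>lborel)"
  proof (rule nn_integral_mono)
    fix x :: 'a
    show "indicator S x * ennreal (h x) \<le> (\<Sum>j. ennreal (c j) * indicator (ball 0 (R j)) x)"
    proof (cases "x \<in> S \<and> h x > 0")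
      case True
      then obtain j where j: "x \<in> ball 0 (R j)" "h x \<le> c j" using cover by blast
      have "indicator S x * ennreal (h x) \<le> (\<Sum>i\<in>{j}. ennreal (c i) * indicator (ball 0 (R i)) x)"
        using j True by (simp add: ennreal_leI)
      also have "\<dots> \<le> (\<Sum>i. ennreal (c i) * indicator (ball 0 (R i)) x)"
        by (rule sum_le_suminf) auto
      finally show ?thesis .
    qed (auto simp: indicator_def ennreal_neg not_less)
  qed
  also have "\<dots> = (\<Sum>j. \<integral>\<^sup>+ x. ennreal (c j) * indicator (ball (0::'a) (R j)) x \<partial>lborel)"
    by (rule nn_integral_suminf) (auto intro!: borel_measurable_times_ennreal borel_measurable_indicator)
  also have "\<dots> = (\<Sum>j. ennreal (c j * R j ^ DIM('a) * ?V))"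
    using c R by (intro suminf_cong, subst nn_integral_cmult_indicator)
       (auto simp: emeasure_ball ennreal_mult[symmetric] mult_ac)
  also have "\<dots> < \<infinity>"
    using summable_mult2[OF sum, of ?V] c R by (subst suminf_ennreal2) auto
  finally show ?thesis .
qed

lemma two_power_powr: "(2 ^ n) powr c = 2 powr (c * real n)"
  by (subst powr_realpow[symmetric]) (auto simp: powr_powr mult.commute)

text \<open>On the shells r/2^(j+1) \<le> |x| < r/2^j the majorants form a geometric series of ratio
  2^(a - N).\<close>

lemma nn_integral_radial_ball_finite:
  fixes a r :: real
  assumes "0 \<le> a" "a < DIM('a)" "r > 0"
  shows "(\<integral>\<^sup>+ x. indicator (ball (0::'a::euclidean_space) r) x * ennreal (1 / norm x powr a) \<partial>lborel) < \<infinity>"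
proof (rule nn_integral_dyadic_finite[where c="\<lambda>j. 1 / (r / 2 ^ Suc j) powr a" and R="\<lambda>j. r / 2 ^ j"])
  fix x :: 'a assume x: "x \<in> ball 0 r" "0 < 1 / norm x powr a"
  \<comment> \<open>Positivity of the integrand excludes the origin, where
    \<open>norm x powr a\<close> is 0 and the quotient is 0 by convention.\<close>
  then have x0: "norm x > 0" "norm x < r" by (auto simp: dist_norm)
  have "(\<lambda>j. r / 2 ^ j) \<longlonglongrightarrow> 0" by (rule LIMSEQ_divide_realpow_zero) simp
  from order_tendstoD(2)[OF this x0(1)] obtain n where "\<forall>j\<ge>n. r / 2 ^ j < norm x"
    unfolding eventually_sequentially by blast
  then have "r / 2 ^ n \<le> norm x" by (simp add: less_imp_le)
  then have "\<exists>j. r / 2 ^ j \<le> norm x" by blast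
  then obtain j where j: "r / 2 ^ j \<le> norm x" "\<And>i. i < j \<Longrightarrow> \<not> r / 2 ^ i \<le> norm x"
    using exists_least_iff[of "\<lambda>j. r / 2 ^ j \<le> norm x"] by auto
  have "j \<noteq> 0" using j(1) x0 by (cases j) auto
  then obtain i where i: "j = Suc i" using not0_implies_Suc by auto
  have "norm x < r / 2 ^ i" using j(2)[of i] i by simp
  moreover have "1 / norm x powr a \<le> 1 / (r / 2 ^ Suc i) powr a"
    using j(1) i assms(1,3) x0(1)
    by (intro divide_left_mono powr_mono2 mult_pos_pos) (simp_all add: divide_nonneg_pos)
  ultimately show "\<exists>j. x \<in> ball 0 (r / 2 ^ j) \<and> 1 / norm x powr a \<le> 1 / (r / 2 ^ Suc j) powr a"
    by auto
next
  have eq: "1 / (r / 2 ^ Suc j) powr a * (r / 2 ^ j) ^ DIM('a)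
     = (2 powr a * (r powr DIM('a) / r powr a)) * (2 powr (a - DIM('a))) ^ j" for j
  proof -
    have e1: "1 / (r / 2 ^ Suc j) powr a = 2 powr (a * real (Suc j)) / r powr a"
      using assms two_power_powr[of "Suc j" a] by (simp add: powr_divide del: power_Suc of_nat_Suc)
    have e2: "(r / 2 ^ j) ^ DIM('a) = r powr DIM('a) / 2 powr (DIM('a) * real j)"
      using assms two_power_powr[of j "DIM('a)"] powr_realpow[of "r / 2 ^ j" "DIM('a)"]
      by (simp add: powr_divide)
    have e3: "2 powr (a * real (Suc j)) = 2 powr a * 2 powr (a * real j)"
      by (simp add: powr_add distrib_left)
    have e4: "2 powr (a * real j) / 2 powr (DIM('a) * real j) = (2 powr (a - DIM('a))) ^ j"
      by (subst powr_realpow[symmetric], simp, subst powr_powr, simp add: left_diff_distrib powr_diff)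
    show ?thesis unfolding e1 e2 e3 e4[symmetric] by simp
  qed
  show "summable (\<lambda>j. 1 / (r / 2 ^ Suc j) powr a * (r / 2 ^ j) ^ DIM('a))"
    unfolding eq using assms by (intro summable_mult summable_geometric) (auto simp: powr_less_one)
qed (use assms in auto)

text \<open>The same with growing shells r 2^j \<le> |x| < r 2^(j+1); now the ratio is 2^(N -
  b).\<close>

lemma nn_integral_radial_compl_finite:
  fixes b r :: real
  assumes "b > DIM('a)" "r > 0"
  shows "(\<integral>\<^sup>+ x. indicator (- ball (0::'a::euclidean_space) r) x * ennreal (1 / norm x powr b) \<partial>lborel) < \<infinity>"
proof (rule nn_integral_dyadic_finite[where c="\<lambda>j. 1 / (r * 2 ^ j) powr b" and R="\<lambda>j. r * 2 ^ Suc j"])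
  fix x :: 'a assume x: "x \<in> - ball 0 r"
  have x0: "norm x \<ge> r" using x by auto
  have "\<exists>j. norm x < r * 2 ^ j"
    using real_arch_pow[of 2 "norm x / r"] assms by (auto simp: field_simps)
  then obtain j where j: "norm x < r * 2 ^ j" "\<And>i. i < j \<Longrightarrow> \<not> norm x < r * 2 ^ i"
    using exists_least_iff[of "\<lambda>j. norm x < r * 2 ^ j"] by auto
  have "j \<noteq> 0" using j(1) x0 by (cases j) auto
  then obtain i where i: "j = Suc i" using not0_implies_Suc by auto
  have "r * 2 ^ i \<le> norm x" using j(2)[of i] i by simp
  then have "1 / norm x powr b \<le> 1 / (r * 2 ^ i) powr b"
    using assms x0 by (intro divide_left_mono powr_mono2 mult_pos_pos) auto
  then show "\<exists>j. x \<in> ball 0 (r * 2 ^ Suc j) \<and> 1 / norm x powr b \<le> 1 / (r * 2 ^ j) powr b"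
    using j(1) i by auto
next
  have eq: "1 / (r * 2 ^ j) powr b * (r * 2 ^ Suc j) ^ DIM('a)
     = (2 powr DIM('a) * (r powr DIM('a) / r powr b)) * (2 powr (DIM('a) - b)) ^ j" for j
  proof -
    have e1: "1 / (r * 2 ^ j) powr b = 1 / (r powr b * 2 powr (b * real j))"
      using assms two_power_powr[of j b] by (simp add: powr_mult)
    have e2: "(r * 2 ^ Suc j) ^ DIM('a) = r powr DIM('a) * 2 powr (DIM('a) * real (Suc j))"
      using assms two_power_powr[of "Suc j" "DIM('a)"] powr_realpow[of "r * 2 ^ Suc j" "DIM('a)"]
      by (simp add: powr_mult del: power_Suc of_nat_Suc)
    have e3: "2 powr (DIM('a) * real (Suc j)) = 2 powr DIM('a) * 2 powr (DIM('a) * real j)"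
      by (simp add: powr_add distrib_left)
    have e4: "2 powr (DIM('a) * real j) / 2 powr (b * real j) = (2 powr (DIM('a) - b)) ^ j"
      by (subst powr_realpow[symmetric], simp, subst powr_powr, simp add: left_diff_distrib powr_diff)
    show ?thesis unfolding e1 e2 e3 e4[symmetric] by simp
  qed
  show "summable (\<lambda>j. 1 / (r * 2 ^ j) powr b * (r * 2 ^ Suc j) ^ DIM('a))"
    unfolding eq using assms by (intro summable_mult summable_geometric) (auto simp: powr_less_one)
qed (use assms in auto)

section \<open>Convergence in the mean of order p\<close>

text \<open>The hypothesis \<open>mid\<close> says that passing to a midpoint gains at most d n in
  energy. Uniform convexity then bounds the p-th power of the distance by a small multiple of the
  energies plus C times d n.\<close>

lemma Lp_uniform_convex_Cauchy:
  fixes f :: "nat \<Rightarrow> 'b \<Rightarrow> real"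
  assumes p: "p > 1" and [measurable]: "\<And>n. f n \<in> borel_measurable M"
    and e: "\<And>n. (\<integral>\<^sup>+ z. ennreal (\<bar>f n z\<bar> powr p) \<partial>M) = ennreal (e n)" "\<And>n. 0 \<le> e n" "\<And>n. e n \<le> K"
    and mid: "\<And>n m. n \<le> m \<Longrightarrow> ennreal ((e n + e m) / 2 - d n) \<le> (\<integral>\<^sup>+ z. ennreal (\<bar>(f n z + f m z) / 2\<bar> powr p) \<partial>M)"
    and d: "d \<longlonglongrightarrow> 0" and eps: "\<epsilon> > 0"
  shows "\<exists>N. \<forall>n\<ge>N. \<forall>m\<ge>n. (\<integral>\<^sup>+ z. ennreal (\<bar>f n z - f m z\<bar> powr p) \<partial>M) \<le> ennreal \<epsilon>"
proof -
  have K: "K \<ge> 0" using e(2,3)[of 0] by linarith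
  \<comment> \<open>With energies at most K, the term e0 (e n + e m) is at most half of \<epsilon>;
    the choice of N makes C d n at most the other half.\<close>
  define e0 where "e0 = \<epsilon> / (4 * (K + 1))"
  have e0: "e0 > 0" using eps K by (simp add: e0_def)
  obtain C where C: "C \<ge> 0" "\<And>a b. \<bar>a - b\<bar> powr p + C * \<bar>(a + b) / 2\<bar> powr p
      \<le> (e0 + C / 2) * (\<bar>a\<bar> powr p + \<bar>b\<bar> powr p)"
    using abs_powr_uniform_convexity[OF p e0] by metis
  have "\<epsilon> / (2 * (C + 1)) > 0" using eps C by simp
  from order_tendstoD(2)[OF d this] obtain N where N: "\<And>n. n \<ge> N \<Longrightarrow> d n < \<epsilon> / (2 * (C + 1))"
    unfolding eventually_sequentially by blast
  have "(\<integral>\<^sup>+ z. ennreal (\<bar>f n z - f m z\<bar> powr p) \<partial>M) \<le> ennreal \<epsilon>" if nm: "N \<le> n" "n \<le> m" for n m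
  proof -
    define X where "X = (\<integral>\<^sup>+ z. ennreal (\<bar>f n z - f m z\<bar> powr p) \<partial>M)"
    define Y where "Y = (\<integral>\<^sup>+ z. ennreal (\<bar>(f n z + f m z) / 2\<bar> powr p) \<partial>M)"
    have "X + ennreal C * Y = (\<integral>\<^sup>+ z. ennreal (\<bar>f n z - f m z\<bar> powr p + C * \<bar>(f n z + f m z) / 2\<bar> powr p) \<partial>M)"
      unfolding X_def Y_def using C(1)
      by (simp add: nn_integral_cmult[symmetric] nn_integral_add[symmetric] ennreal_plus ennreal_mult del: ennreal_plus[symmetric])
    also have "\<dots> \<le> (\<integral>\<^sup>+ z. ennreal ((e0 + C / 2) * (\<bar>f n z\<bar> powr p + \<bar>f m z\<bar> powr p)) \<partial>M)"
      by (intro nn_integral_mono ennreal_leI C(2))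
    also have "\<dots> = ennreal (e0 + C / 2) * (ennreal (e n) + ennreal (e m))"
      unfolding e(1)[symmetric] using C(1) e0
      by (simp add: nn_integral_cmult[symmetric] nn_integral_add[symmetric] ennreal_plus ennreal_mult del: ennreal_plus[symmetric])
    also have "\<dots> = ennreal ((e0 + C / 2) * (e n + e m))"
      using C(1) e0 e(2) by (simp add: ennreal_mult)
    finally have le: "X + ennreal C * Y \<le> ennreal ((e0 + C / 2) * (e n + e m))" .
    have "X < \<infinity>" using le by (auto simp: top_unique less_top[symmetric])
    then obtain x where x: "X = ennreal x" "x \<ge> 0" by (cases X) auto
    have mid': "ennreal ((e n + e m) / 2 - d n) \<le> Y" using mid[OF nm(2)] by (simp add: Y_def)
    \<comment> \<open>A negative lower bound for the midpoint becomes 0 under \<open>ennreal\<close>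
      and carries no information; in that case the C-term is nonpositive and may be dropped.\<close>
    have "x + C * ((e n + e m) / 2 - d n) \<le> (e0 + C / 2) * (e n + e m)"
    proof (cases "(e n + e m) / 2 - d n \<ge> 0")
      case True
      have "ennreal (x + C * ((e n + e m) / 2 - d n)) = ennreal x + ennreal C * ennreal ((e n + e m) / 2 - d n)"
        using True C(1) x(2) by (simp add: ennreal_mult)
      also have "\<dots> \<le> X + ennreal C * Y" unfolding x(1) by (intro add_left_mono mult_left_mono mid') auto
      finally have "ennreal (x + C * ((e n + e m) / 2 - d n)) \<le> ennreal ((e0 + C / 2) * (e n + e m))" using le by (rule order_trans)
      then show ?thesis using C(1) e0 e(2)
        by (subst (asm) ennreal_le_iff) (auto intro!: mult_nonneg_nonneg add_nonneg_nonneg)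
    next
      case False
      have "ennreal x \<le> ennreal ((e0 + C / 2) * (e n + e m))"
        using le x(1) by (metis le_iff_add order_trans)
      then have "x \<le> (e0 + C / 2) * (e n + e m)" using C(1) e0 e(2)
        by (subst (asm) ennreal_le_iff) (auto intro!: mult_nonneg_nonneg add_nonneg_nonneg)
      moreover have "C * ((e n + e m) / 2 - d n) \<le> 0" using False C(1) by (intro mult_nonneg_nonpos) auto
      ultimately show ?thesis by linarith
    qed
    then have "x \<le> e0 * (e n + e m) + C * d n" by (simp add: algebra_simps)
    also have "e0 * (e n + e m) \<le> e0 * (2 * (K + 1))"
      using e(3)[of n] e(3)[of m] e0 by (intro mult_left_mono) auto
    also have "e0 * (2 * (K + 1)) = \<epsilon> / 2" using K by (simp add: e0_def field_simps)
    also have "C * d n \<le> C * (\<epsilon> / (2 * (C + 1)))"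
      using N[OF nm(1)] C(1) by (intro mult_left_mono) auto
    also have "C * (\<epsilon> / (2 * (C + 1))) \<le> \<epsilon> / 2" using C(1) eps by (simp add: field_simps)
    finally have "x \<le> \<epsilon>" by simp
    then show ?thesis using x(1) X_def by (simp add: ennreal_leI)
  qed
  then show ?thesis by blast
qed

text \<open>Fatou's lemma in the index m turns the Cauchy estimate into an estimate for the distance
  to the pointwise limit.\<close>

lemma Lp_Cauchy_AE_limit:
  fixes f :: "nat \<Rightarrow> 'b \<Rightarrow> real"
  assumes p: "p > 1" and [measurable]: "\<And>n. f n \<in> borel_measurable M" "g \<in> borel_measurable M"
    and ae: "AE z in M. (\<lambda>n. f n z) \<longlonglongrightarrow> g z"
    and cau: "\<And>\<epsilon>. \<epsilon> > 0 \<Longrightarrow> \<exists>N. \<forall>n\<ge>N. \<forall>m\<ge>n. (\<integral>\<^sup>+ z. ennreal (\<bar>f n z - f m z\<bar> powr p) \<partial>M) \<le> ennreal \<epsilon>"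
  shows "(\<lambda>n. \<integral>\<^sup>+ z. ennreal (\<bar>f n z - g z\<bar> powr p) \<partial>M) \<longlonglongrightarrow> 0"
proof (rule order_tendstoI)
  fix a :: ennreal assume "0 < a"
  then obtain b where b: "0 < b" "b < a" using dense by blast
  then obtain \<epsilon> where eps: "\<epsilon> > 0" "ennreal \<epsilon> < a" by (cases b) auto
  obtain N where N: "\<And>n m. n \<ge> N \<Longrightarrow> m \<ge> n \<Longrightarrow> (\<integral>\<^sup>+ z. ennreal (\<bar>f n z - f m z\<bar> powr p) \<partial>M) \<le> ennreal \<epsilon>"
    using cau[OF eps(1)] by blast
  have "(\<integral>\<^sup>+ z. ennreal (\<bar>f n z - g z\<bar> powr p) \<partial>M) < a" if "n \<ge> N" for n
  proof -
    have "(\<integral>\<^sup>+ z. ennreal (\<bar>f n z - g z\<bar> powr p) \<partial>M)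
        = (\<integral>\<^sup>+ z. liminf (\<lambda>m. ennreal (\<bar>f n z - f m z\<bar> powr p)) \<partial>M)"
    proof (rule nn_integral_cong_AE, use ae in eventually_elim)
      fix z assume "(\<lambda>m. f m z) \<longlonglongrightarrow> g z"
      then have "(\<lambda>m. ennreal (\<bar>f n z - f m z\<bar> powr p)) \<longlonglongrightarrow> ennreal (\<bar>f n z - g z\<bar> powr p)"
        using p by (intro tendsto_ennrealI tendsto_powr' tendsto_intros) auto
      then show "ennreal (\<bar>f n z - g z\<bar> powr p) = liminf (\<lambda>m. ennreal (\<bar>f n z - f m z\<bar> powr p))"
        by (intro lim_imp_Liminf[symmetric]) auto
    qed
    also have "\<dots> \<le> liminf (\<lambda>m. \<integral>\<^sup>+ z. ennreal (\<bar>f n z - f m z\<bar> powr p) \<partial>M)"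
      by (rule nn_integral_liminf) measurable
    also have "\<dots> \<le> ennreal \<epsilon>"
      by (rule Liminf_le) (auto simp: eventually_sequentially intro!: exI[of _ n] N that)
    also have "\<dots> < a" by (rule eps)
    finally show ?thesis .
  qed
  then show "\<forall>\<^sub>F n in sequentially. (\<integral>\<^sup>+ z. ennreal (\<bar>f n z - g z\<bar> powr p) \<partial>M) < a"
    by (auto simp: eventually_sequentially)
qed auto

lemma nn_integral_tendsto_0_AE_subseq:
  fixes h :: "nat \<Rightarrow> 'b \<Rightarrow> real"
  assumes [measurable]: "\<And>n. h n \<in> borel_measurable M" and nn: "\<And>n z. h n z \<ge> 0"
    and lim: "(\<lambda>n. \<integral>\<^sup>+ z. ennreal (h n z) \<partial>M) \<longlonglongrightarrow> 0"
  shows "\<exists>r. strict_mono r \<and> (AE z in M. (\<lambda>n. h (r n) z) \<longlonglongrightarrow> 0)"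
proof -
  have "\<forall>\<^sub>F n in sequentially. (\<integral>\<^sup>+ z. ennreal (h n z) \<partial>M) < \<infinity>"
    using order_tendstoD(2)[OF lim, of \<infinity>] by simp
  then obtain N where N: "\<And>n. n \<ge> N \<Longrightarrow> (\<integral>\<^sup>+ z. ennreal (h n z) \<partial>M) < \<infinity>"
    by (auto simp: eventually_sequentially)
  let ?h = "\<lambda>n. h (n + N)"
  have int: "integrable M (?h n)" for n
    using N[of "n + N"] nn by (intro integrableI_nonneg) auto
  have "(\<lambda>n. \<integral>\<^sup>+ z. ennreal (?h n z) \<partial>M) \<longlonglongrightarrow> 0"
    using LIMSEQ_ignore_initial_segment[OF lim] .
  then have "(\<lambda>n. \<integral>z. norm (?h n z) \<partial>M) \<longlonglongrightarrow> 0"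
    using int nn by (simp add: nn_integral_eq_integral ennreal_tendsto_0_iff)
  from tendsto_L1_AE_subseq[OF int this] obtain r
    where "strict_mono r" "AE z in M. (\<lambda>n. ?h (r n) z) \<longlonglongrightarrow> 0" by blast
  then show ?thesis
    by (intro exI[of _ "\<lambda>n. r n + N"]) (auto simp: strict_mono_def)
qed

section \<open>The nonlocal energy\<close>

definition dif :: "('a \<Rightarrow> real) \<Rightarrow> 'a \<times> 'a \<Rightarrow> real" where
  "dif w z = w (fst z) - w (snd z)"

lemma sets_nu [measurable_cong]: "sets (nu s p \<beta>) = sets (borel \<Otimes>\<^sub>M borel)"
  unfolding nu_def sets_density by (rule sets_pair_measure_cong) auto

lemma space_nu [simp]: "space (nu s p \<beta>) = UNIV"
  using sets_eq_imp_space_eq[OF sets_nu] by (simp add: space_pair_measure)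

lemma dif_measurable [measurable]:
  assumes [measurable]: "w \<in> borel_measurable borel"
  shows "dif w \<in> borel_measurable (borel \<Otimes>\<^sub>M borel)"
  unfolding dif_def by measurable

lemma knu_measurable [measurable]: "(\<lambda>(x, y). ennreal (knu s p \<beta> x y)) \<in> borel_measurable (borel \<Otimes>\<^sub>M borel)"
  unfolding knu_def by measurable

lemma nn_integral_nu:
  assumes [measurable]: "f \<in> borel_measurable (borel \<Otimes>\<^sub>M borel)"
  shows "(\<integral>\<^sup>+ z. f z \<partial>nu s p \<beta>) = (\<integral>\<^sup>+ z. ennreal (knu s p \<beta> (fst z) (snd z)) * f z \<partial>(lborel \<Otimes>\<^sub>M lborel))"
proof -
  have "(\<integral>\<^sup>+ z. f z \<partial>nu s p \<beta>) = (\<integral>\<^sup>+ z. (case z of (x, y) \<Rightarrow> ennreal (knu s p \<beta> x y)) * f z \<partial>(lborel \<Otimes>\<^sub>M lborel))"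
    unfolding nu_def by (rule nn_integral_density) measurable
  then show ?thesis by (simp add: case_prod_beta)
qed

text \<open>\<open>nu\<close> has a density with respect to the product Lebesgue measure, and a null
  set of points spans only null sets of pairs.\<close>

lemma AE_nu:
  assumes "AE x in lborel. P x"
  shows "AE z in nu s p \<beta>. P (fst z) \<and> P (snd z)"
proof -
  obtain A where A: "{x \<in> space lborel. \<not> P x} \<subseteq> A" "A \<in> null_sets lborel"
    using assms unfolding eventually_ae_filter by auto
  then have [measurable]: "A \<in> sets borel" by (auto simp: null_sets_def)
  have nA: "AE x in lborel. x \<notin> A" using A(2) by (rule AE_not_in)
  have "AE z in lborel \<Otimes>\<^sub>M lborel. fst z \<notin> A \<and> snd z \<notin> A"
  proof (rule lborel_pair.AE_pair_measure)
    show "{z \<in> space (lborel \<Otimes>\<^sub>M lborel). fst z \<notin> A \<and> snd z \<notin> A} \<in> sets (lborel \<Otimes>\<^sub>M lborel)" by measurable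
    show "AE x in lborel. AE y in lborel. fst (x, y) \<notin> A \<and> snd (x, y) \<notin> A"
      using nA by (auto elim!: eventually_mono)
  qed
  then have "AE z in nu s p \<beta>. fst z \<notin> A \<and> snd z \<notin> A"
    unfolding nu_def
    by (subst AE_density, measurable) (rule eventually_mono, assumption, auto)
  then show ?thesis by (rule eventually_mono) (use A(1) in auto)
qed

lemma nn_integral_lborel_shift:
  fixes B :: "'a::euclidean_space \<Rightarrow> ennreal"
  assumes [measurable]: "B \<in> borel_measurable borel"
  shows "(\<integral>\<^sup>+ y. B (y - x) \<partial>lborel) = (\<integral>\<^sup>+ y. B y \<partial>lborel)"
proof -
  have "(\<integral>\<^sup>+ y. B y \<partial>lborel) = (\<integral>\<^sup>+ y. B y \<partial>distr lborel borel ((+) (- x)))"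
    by (simp only: lborel_distr_plus)
  also have "\<dots> = (\<integral>\<^sup>+ y. B (y - x) \<partial>lborel)"
    by (subst nn_integral_distr) (auto simp: algebra_simps)
  finally show ?thesis ..
qed


locale weighted_fractional =
  fixes s p \<beta> :: real and \<Omega> :: "'a::euclidean_space set"
  assumes s: "0 < s" "s < 1" and p: "1 < p" "p < real DIM('a)" "p * s < real DIM('a)"
    and \<beta>: "0 \<le> \<beta>" "\<beta> < (real DIM('a) - p * s) / 2"
    and open_\<Omega>: "open \<Omega>" and bounded_\<Omega>: "bounded \<Omega>"
begin

abbreviation "\<nu> \<equiv> nu s p \<beta> :: ('a \<times> 'a) measure"

text \<open>Unlike \<open>wpart2\<close>, this integrates over all pairs. For functions vanishing
  outside \<Omega> the difference is 0 off D, so this is twice the numerator in \<lambda>_1.\<close>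

definition energy :: "('a \<Rightarrow> real) \<Rightarrow> ennreal" where
  "energy w = (\<integral>\<^sup>+ z. ennreal (\<bar>dif w z\<bar> powr p) \<partial>\<nu>)"

lemma \<Omega>_sets [measurable]: "\<Omega> \<in> sets borel"
  using open_\<Omega> by simp

lemma two_\<beta>_less: "2 * \<beta> < real DIM('a)"
proof -
  have "0 < p * s" using p s by simp
  then show ?thesis using \<beta>(2) by simp
qed

text \<open>Near the diagonal the Lipschitz bound lowers the singularity to |x - y|^(p - N - ps),
  integrable as s < 1, and the weights are dominated by |x|^(-2\<beta>) + |y|^(-2\<beta>),
  integrable as 2\<beta> < N. Away from the diagonal the boundedness of \<phi> and the decay of the
  kernel at infinity suffice.\<close>

lemma energy_lipschitz_finite:
  fixes \<phi> :: "'a \<Rightarrow> real"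
  assumes [measurable]: "\<phi> \<in> borel_measurable borel"
    and lip: "\<And>x y. \<bar>\<phi> x - \<phi> y\<bar> \<le> L * norm (x - y)" and bd: "\<And>x. \<bar>\<phi> x\<bar> \<le> B"
    and supp: "\<And>x. x \<notin> \<Omega> \<Longrightarrow> \<phi> x = 0"
  shows "energy \<phi> < \<infinity>"
proof -
  obtain R where R: "R > 0" "\<Omega> \<subseteq> ball 0 R"
    using bounded_subset_ballD[OF bounded_\<Omega>, of 0] by auto
  define N where "N = real DIM('a)"
  define A1 where "A1 x = indicator (ball 0 (R + 1)) x * ennreal (1 / norm x powr (2 * \<beta>))" for x :: 'a
  define B1 where "B1 y = indicator (ball 0 1) y * ennreal (1 / norm y powr (N + p * s - p))" for y :: 'a
  define A2 where "A2 x = indicator (ball 0 (R + 1)) x * ennreal (1 / norm x powr \<beta>)" for x :: 'a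
  define B3 where "B3 y = indicator (- ball 0 1) y * ennreal (1 / norm y powr (N + p * s))" for y :: 'a
  have [measurable]: "ball (0::'a) r \<in> sets borel" for r by simp
  have [measurable]: "A1 \<in> borel_measurable borel" "B1 \<in> borel_measurable borel"
      "A2 \<in> borel_measurable borel" "B3 \<in> borel_measurable borel"
    unfolding A1_def A2_def B1_def B3_def by measurable
  \<comment> \<open>The three terms majorise the integrand for x in a bounded set: near the
    diagonal; far from it with |y| < 1, where |y|^(-\<beta>) is singular; far from it with |y| \<ge>
    1, where that factor is at most 1. The roles of x and y are exchanged by adding h y x.\<close>
  define h where "h x y = ennreal (L powr p) * (A1 x * B1 (y - x))
      + ennreal ((2 * B) powr p) * (A2 x * A2 y) + ennreal ((2 * B) powr p) * (A2 x * B3 (y - x))" for x y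
  have ps: "0 < p * s" "p * s < p" using p s by auto
  have fin: "(\<integral>\<^sup>+ x. A1 x \<partial>lborel) < \<infinity>" "(\<integral>\<^sup>+ x. A2 x \<partial>lborel) < \<infinity>"
      "(\<integral>\<^sup>+ x. B1 x \<partial>lborel) < \<infinity>" "(\<integral>\<^sup>+ x. B3 x \<partial>lborel) < \<infinity>"
    unfolding A1_def A2_def B1_def B3_def N_def
    by (rule nn_integral_radial_ball_finite nn_integral_radial_compl_finite;
        use two_\<beta>_less \<beta> R ps p in linarith)+
  have L0: "L \<ge> 0"
  proof -
    obtain b :: 'a where "b \<in> Basis" using nonempty_Basis by blast
    then show ?thesis using lip[of b 0] by simp
  qed
  have pw: "\<bar>\<phi> x - \<phi> y\<bar> powr p * knu s p \<beta> x y \<le> L powr p * (1 / norm x powr (2 * \<beta>) + 1 / norm y powr (2 * \<beta>)) * (1 / norm (y - x) powr (N + p * s - p))"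
    for x y
  proof (cases "x = y")
    case False
    let ?u = "1 / norm x powr \<beta>" and ?v = "1 / norm y powr \<beta>"
    have "\<bar>\<phi> x - \<phi> y\<bar> powr p \<le> (L * norm (x - y)) powr p"
      using lip[of x y] p by (intro powr_mono2) auto
    also have "\<dots> = L powr p * norm (x - y) powr p" using L0 by (simp add: powr_mult)
    finally have 1: "\<bar>\<phi> x - \<phi> y\<bar> powr p \<le> L powr p * norm (x - y) powr p" .
    have sq: "?u\<^sup>2 = 1 / norm x powr (2 * \<beta>)" "?v\<^sup>2 = 1 / norm y powr (2 * \<beta>)"
      by (simp_all add: power2_eq_square powr_add[symmetric])
    have "a * b \<le> a\<^sup>2 + b\<^sup>2" for a b :: real
      using sum_squares_bound[of a b] sum_power2_ge_zero[of a b] by linarith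
    from this[of ?u ?v] have "?u * ?v \<le> ?u\<^sup>2 + ?v\<^sup>2" .
    then have uv: "?u * ?v \<le> 1 / norm x powr (2 * \<beta>) + 1 / norm y powr (2 * \<beta>)" unfolding sq .
    have k: "knu s p \<beta> x y = 1 / norm (x - y) powr (N + p * s) * (?u * ?v)"
      by (simp add: knu_def N_def)
    have "\<bar>\<phi> x - \<phi> y\<bar> powr p * knu s p \<beta> x y
        \<le> (L powr p * norm (x - y) powr p) * (1 / norm (x - y) powr (N + p * s) * (1 / norm x powr (2 * \<beta>) + 1 / norm y powr (2 * \<beta>)))"
      unfolding k by (intro mult_mono 1 uv) auto
    also have "\<dots> = L powr p * (1 / norm x powr (2 * \<beta>) + 1 / norm y powr (2 * \<beta>)) * (norm (x - y) powr p / norm (x - y) powr (N + p * s))"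
      by (simp add: field_simps)
    also have "norm (x - y) powr p / norm (x - y) powr (N + p * s) = 1 / norm (y - x) powr (N + p * s - p)"
      by (subst norm_minus_commute[of y x]) (simp add: powr_diff[symmetric] powr_minus_divide[symmetric])
    finally show ?thesis .
  qed simp
  have far: "ennreal (\<bar>\<phi> x - \<phi> y\<bar> powr p * knu s p \<beta> x y) \<le> h x y" if x: "x \<in> \<Omega>" and d: "norm (x - y) \<ge> 1" for x y
  proof -
    have xR: "x \<in> ball 0 (R + 1)" using x R by auto
    have "\<bar>\<phi> x - \<phi> y\<bar> powr p \<le> (2 * B) powr p"
      using bd[of x] bd[of y] p by (intro powr_mono2) auto
    note 1 = this
    show ?thesis
    proof (cases "norm y < 1")
      case True
      have "knu s p \<beta> x y = 1 / norm (x - y) powr (N + p * s) * (1 / norm x powr \<beta> * (1 / norm y powr \<beta>))"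
        by (simp add: knu_def N_def)
      also have "\<dots> \<le> 1 * (1 / norm x powr \<beta> * (1 / norm y powr \<beta>))"
        using d ps p by (intro mult_right_mono) (auto simp: divide_le_eq_1 N_def intro!: ge_one_powr_ge_zero)
      finally have "\<bar>\<phi> x - \<phi> y\<bar> powr p * knu s p \<beta> x y \<le> (2 * B) powr p * (1 / norm x powr \<beta> * (1 / norm y powr \<beta>))"
        by (intro mult_mono 1) (auto simp: knu_def)
      then have "ennreal (\<bar>\<phi> x - \<phi> y\<bar> powr p * knu s p \<beta> x y) \<le> ennreal ((2 * B) powr p * (1 / norm x powr \<beta> * (1 / norm y powr \<beta>)))"
        by (rule ennreal_leI)
      also have "\<dots> = ennreal ((2 * B) powr p) * (A2 x * A2 y)"
        using xR True R by (simp add: A2_def ennreal_mult[symmetric])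
      also have "\<dots> \<le> h x y" unfolding h_def by (simp add: add_increasing add_increasing2)
      finally show ?thesis .
    next
      case False
      have "1 / norm y powr \<beta> \<le> 1"
        using False \<beta> by (auto simp: divide_le_eq_1 intro!: ge_one_powr_ge_zero)
      then have "1 / norm (x - y) powr (N + p * s) * (1 / norm x powr \<beta>) * (1 / norm y powr \<beta>) \<le> 1 / norm (x - y) powr (N + p * s) * (1 / norm x powr \<beta>) * 1"
        by (intro mult_left_mono) auto
      then have "knu s p \<beta> x y \<le> 1 / norm x powr \<beta> * (1 / norm (y - x) powr (N + p * s))"
        by (subst norm_minus_commute) (simp add: knu_def N_def mult.commute)
      then have "\<bar>\<phi> x - \<phi> y\<bar> powr p * knu s p \<beta> x y \<le> (2 * B) powr p * (1 / norm x powr \<beta> * (1 / norm (y - x) powr (N + p * s)))"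
        by (intro mult_mono 1) (auto simp: knu_def)
      then have "ennreal (\<bar>\<phi> x - \<phi> y\<bar> powr p * knu s p \<beta> x y) \<le> ennreal ((2 * B) powr p * (1 / norm x powr \<beta> * (1 / norm (y - x) powr (N + p * s))))"
        by (rule ennreal_leI)
      also have "\<dots> = ennreal ((2 * B) powr p) * (A2 x * B3 (y - x))"
        using xR d by (simp add: A2_def B3_def ennreal_mult[symmetric] norm_minus_commute)
      also have "\<dots> \<le> h x y" unfolding h_def by (simp add: add_increasing add_increasing2)
      finally show ?thesis .
    qed
  qed
  have knu_sym: "knu s p \<beta> x y = knu s p \<beta> y x" for x y :: 'a
    unfolding knu_def by (subst norm_minus_commute) (simp add: mult_ac)
  have bound: "ennreal (\<bar>\<phi> x - \<phi> y\<bar> powr p * knu s p \<beta> x y) \<le> h x y + h y x" for x y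
  proof -
    consider "x \<notin> \<Omega>" "y \<notin> \<Omega>" | "x \<in> \<Omega> \<or> y \<in> \<Omega>" "norm (x - y) < 1" | "x \<in> \<Omega>" "norm (x - y) \<ge> 1" | "y \<in> \<Omega>" "norm (x - y) \<ge> 1"
      by linarith
    then show ?thesis
    proof cases
      case 1
      then show ?thesis using supp p by simp
    next
      case 2
      have "norm x < R + 1 \<and> norm y < R + 1"
        using 2 R norm_triangle_ineq2[of x y] norm_triangle_ineq2[of y x]
        by (auto simp: norm_minus_commute)
      then have xy: "x \<in> ball 0 (R + 1)" "y \<in> ball 0 (R + 1)" by auto
      have "ennreal (\<bar>\<phi> x - \<phi> y\<bar> powr p * knu s p \<beta> x y)
         \<le> ennreal (L powr p * (1 / norm x powr (2 * \<beta>) + 1 / norm y powr (2 * \<beta>)) * (1 / norm (y - x) powr (N + p * s - p)))"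
        by (rule ennreal_leI[OF pw])
      also have "\<dots> = ennreal (L powr p) * (A1 x * B1 (y - x)) + ennreal (L powr p) * (A1 y * B1 (x - y))"
        using xy 2(2) unfolding A1_def B1_def
        by (simp add: norm_minus_commute[of x y] ennreal_mult[symmetric] ennreal_plus[symmetric] del: ennreal_plus)
          (simp add: algebra_simps add_divide_distrib)
      also have "\<dots> \<le> h x y + h y x" unfolding h_def by (intro add_mono) (simp_all add: add_increasing2 add.assoc)
      finally show ?thesis .
    next
      case 3
      then show ?thesis using far[of x y] by (simp add: add_increasing2)
    next
      case 4
      then have "ennreal (\<bar>\<phi> y - \<phi> x\<bar> powr p * knu s p \<beta> y x) \<le> h y x"
        by (intro far) (auto simp: norm_minus_commute)
      then show ?thesis by (simp add: add_increasing abs_minus_commute knu_sym)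
    qed
  qed
  have hm [measurable]: "(\<lambda>z. h (fst z) (snd z)) \<in> borel_measurable (borel \<Otimes>\<^sub>M borel)"
     "(\<lambda>z. h (snd z) (fst z)) \<in> borel_measurable (borel \<Otimes>\<^sub>M borel)"
    unfolding h_def by measurable
  have hm': "(\<lambda>z. h (fst z) (snd z)) \<in> borel_measurable (lborel \<Otimes>\<^sub>M lborel)"
     "(\<lambda>z. h (snd z) (fst z)) \<in> borel_measurable (lborel \<Otimes>\<^sub>M lborel)"
    by measurable
  have inner: "(\<integral>\<^sup>+ y. h x y \<partial>lborel) = ennreal (L powr p) * (A1 x * (\<integral>\<^sup>+ y. B1 y \<partial>lborel))
     + ennreal ((2 * B) powr p) * (A2 x * (\<integral>\<^sup>+ y. A2 y \<partial>lborel)) + ennreal ((2 * B) powr p) * (A2 x * (\<integral>\<^sup>+ y. B3 y \<partial>lborel))" for x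
    unfolding h_def by (simp add: nn_integral_add nn_integral_cmult nn_integral_lborel_shift)
  have hfin: "(\<integral>\<^sup>+ x. \<integral>\<^sup>+ y. h x y \<partial>lborel \<partial>lborel) < \<infinity>"
    unfolding inner using fin
    by (simp add: nn_integral_add nn_integral_cmult nn_integral_multc ennreal_mult_less_top less_top[symmetric] ennreal_mult_eq_top_iff)
  have "energy \<phi> = (\<integral>\<^sup>+ z. ennreal (knu s p \<beta> (fst z) (snd z)) * ennreal (\<bar>dif \<phi> z\<bar> powr p) \<partial>(lborel \<Otimes>\<^sub>M lborel))"
    unfolding energy_def by (rule nn_integral_nu) measurable
  also have "\<dots> \<le> (\<integral>\<^sup>+ z. h (fst z) (snd z) + h (snd z) (fst z) \<partial>(lborel \<Otimes>\<^sub>M lborel))"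
  proof (rule nn_integral_mono)
    fix z :: "'a \<times> 'a"
    show "ennreal (knu s p \<beta> (fst z) (snd z)) * ennreal (\<bar>dif \<phi> z\<bar> powr p) \<le> h (fst z) (snd z) + h (snd z) (fst z)"
      using bound[of "fst z" "snd z"] by (simp add: dif_def ennreal_mult[symmetric] knu_def mult.commute)
  qed
  also have "\<dots> = (\<integral>\<^sup>+ z. h (fst z) (snd z) \<partial>(lborel \<Otimes>\<^sub>M lborel)) + (\<integral>\<^sup>+ z. h (snd z) (fst z) \<partial>(lborel \<Otimes>\<^sub>M lborel))"
    by (rule nn_integral_add) measurable
  also have "(\<integral>\<^sup>+ z. h (fst z) (snd z) \<partial>(lborel \<Otimes>\<^sub>M lborel)) = (\<integral>\<^sup>+ x. \<integral>\<^sup>+ y. h x y \<partial>lborel \<partial>lborel)"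
    using lborel.nn_integral_fst[OF hm'(1)] by simp
  also have "(\<integral>\<^sup>+ z. h (snd z) (fst z) \<partial>(lborel \<Otimes>\<^sub>M lborel)) = (\<integral>\<^sup>+ x. \<integral>\<^sup>+ y. h x y \<partial>lborel \<partial>lborel)"
    using lborel_pair.nn_integral_snd[OF hm'(2)] by simp
  also have "(\<integral>\<^sup>+ x. \<integral>\<^sup>+ y. h x y \<partial>lborel \<partial>lborel) + (\<integral>\<^sup>+ x. \<integral>\<^sup>+ y. h x y \<partial>lborel \<partial>lborel) < \<infinity>"
    using hfin by simp
  finally show ?thesis .
qed


section \<open>The space of the problem\<close>

lemma Cc_infty_zero: "\<phi> \<in> Cc_infty \<Omega> \<Longrightarrow> x \<notin> \<Omega> \<Longrightarrow> \<phi> x = 0"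
  using closure_subset[of "{x. \<phi> x \<noteq> 0}"] by (auto simp: Cc_infty_def)

text \<open>The gradient is continuous on the compact support and 0 elsewhere, hence bounded on the
  whole space, which is convex.\<close>

lemma Cc_infty_lipschitz:
  assumes "\<phi> \<in> Cc_infty \<Omega>"
  obtains L where "\<And>x y. \<bar>\<phi> x - \<phi> y\<bar> \<le> L * norm (x - y)"
proof -
  let ?K = "closure {x. \<phi> x \<noteq> 0}"
  have K: "compact ?K" "?K \<subseteq> \<Omega>" and C1: "Ck_on (Suc 0) \<Omega> \<phi>"
    using assms by (auto simp: Cc_infty_def smooth_on_def simp del: Ck_on.simps)
  have "\<exists>B. \<forall>x\<in>?K. \<bar>frechet_derivative \<phi> (at x) b\<bar> \<le> B" if "b \<in> Basis" for b
  proof -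
    have "continuous_on ?K (\<lambda>x. frechet_derivative \<phi> (at x) b)"
      using C1 that K(2) by (auto intro: continuous_on_subset)
    then have "bounded ((\<lambda>x. frechet_derivative \<phi> (at x) b) ` ?K)"
      using K(1) by (intro compact_imp_bounded compact_continuous_image)
    then show ?thesis by (auto simp: bounded_iff)
  qed
  then obtain B where B: "\<And>b x. b \<in> Basis \<Longrightarrow> x \<in> ?K \<Longrightarrow> \<bar>frechet_derivative \<phi> (at x) b\<bar> \<le> B b" by metis
  define L where "L = (\<Sum>b\<in>Basis. \<bar>B b\<bar>)"
  \<comment> \<open>Smoothness is known only on \<Omega>; off the support the function vanishes near
    each point, so 0 is the derivative there, inside \<Omega> or not.\<close>
  define D where "D x = (if x \<in> ?K then frechet_derivative \<phi> (at x) else (\<lambda>_. 0))" for x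
  have der: "(\<phi> has_derivative D x) (at x)" for x
  proof (cases "x \<in> ?K")
    case True
    then show ?thesis using Ck_on_Suc_has_derivative[OF open_\<Omega> C1, of x] K(2) by (auto simp: D_def)
  next
    case False
    have d0: "((\<lambda>_. 0) has_derivative (\<lambda>_. 0)) (at x)" by simp
    have op: "open (- ?K)" by (intro open_Compl closed_closure)
    have "x \<in> - ?K" using False by simp
    from has_derivative_transform_within_open[OF d0 op this, of \<phi>]
    have "(\<phi> has_derivative (\<lambda>_. 0)) (at x)"
      using closure_subset[of "{x. \<phi> x \<noteq> 0}"] by force
    then show ?thesis using False by (simp add: D_def)
  qed
  have "onorm (D x) \<le> L" for x
  proof (rule onorm_le)
    fix h :: 'a
    show "norm (D x h) \<le> L * norm h"
    proof (cases "x \<in> ?K")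
      case True
      interpret D: bounded_linear "D x" using der[of x] by (rule has_derivative_bounded_linear)
      have "D x h = D x (\<Sum>b\<in>Basis. (h \<bullet> b) *\<^sub>R b)" by (simp add: euclidean_representation)
      also have "\<dots> = (\<Sum>b\<in>Basis. (h \<bullet> b) * D x b)" by (simp add: D.sum D.scaleR)
      finally have "norm (D x h) \<le> (\<Sum>b\<in>Basis. \<bar>(h \<bullet> b) * D x b\<bar>)" by simp
      also have "\<dots> \<le> (\<Sum>b\<in>Basis. norm h * \<bar>B b\<bar>)"
      proof (rule sum_mono)
        fix b :: 'a assume b: "b \<in> Basis"
        have "\<bar>D x b\<bar> \<le> \<bar>B b\<bar>" using B[OF b True] True by (simp add: D_def)
        then show "\<bar>(h \<bullet> b) * D x b\<bar> \<le> norm h * \<bar>B b\<bar>"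
          using Basis_le_norm[OF b, of h] by (simp add: abs_mult mult_mono)
      qed
      also have "\<dots> = L * norm h" by (simp add: L_def sum_distrib_left mult.commute)
      finally show ?thesis .
    next
      case False
      then show ?thesis by (simp add: D_def L_def sum_nonneg)
    qed
  qed
  then have "norm (\<phi> x - \<phi> y) \<le> L * norm (x - y)" for x y
    using der by (intro differentiable_bound[of UNIV \<phi> D]) auto
  then show ?thesis by (intro that[of L]) simp
qed

lemma Cc_infty_continuous:
  assumes "\<phi> \<in> Cc_infty \<Omega>" shows "continuous_on UNIV \<phi>"
proof -
  obtain L where L: "\<And>x y. \<bar>\<phi> x - \<phi> y\<bar> \<le> L * norm (x - y)"
    using Cc_infty_lipschitz[OF assms] by metis
  have "\<bar>L\<bar>-lipschitz_on UNIV \<phi>"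
  proof (rule lipschitz_onI)
    fix x y
    show "dist (\<phi> x) (\<phi> y) \<le> \<bar>L\<bar> * dist x y"
      using L[of x y] by (simp add: dist_norm) (smt (verit) mult_right_mono norm_ge_zero)
  qed simp
  then show ?thesis by (rule lipschitz_on_continuous_on)
qed

lemma Cc_infty_measurable: "\<phi> \<in> Cc_infty \<Omega> \<Longrightarrow> \<phi> \<in> borel_measurable borel"
  using Cc_infty_continuous borel_measurable_continuous_onI by blast

lemma Cc_infty_bounded:
  assumes "\<phi> \<in> Cc_infty \<Omega>"
  obtains B where "\<And>x. \<bar>\<phi> x\<bar> \<le> B"
proof -
  let ?K = "closure {x. \<phi> x \<noteq> 0}"
  have "compact ?K" using assms by (simp add: Cc_infty_def)
  then have "bounded (\<phi> ` ?K)"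
    using continuous_on_subset[OF Cc_infty_continuous[OF assms]]
    by (intro compact_imp_bounded compact_continuous_image) auto
  then obtain B where B: "\<And>x. x \<in> ?K \<Longrightarrow> \<bar>\<phi> x\<bar> \<le> B" by (auto simp: bounded_iff)
  have "\<bar>\<phi> x\<bar> \<le> max B 0" for x
  proof (cases "\<phi> x = 0")
    case False
    then have "x \<in> ?K" using closure_subset[of "{x. \<phi> x \<noteq> 0}"] by blast
    then show ?thesis using B by force
  qed simp
  then show ?thesis using that by blast
qed

lemma Cc_infty_energy: "\<phi> \<in> Cc_infty \<Omega> \<Longrightarrow> energy \<phi> < \<infinity>"
  by (metis Cc_infty_lipschitz Cc_infty_bounded Cc_infty_measurable Cc_infty_zero energy_lipschitz_finite)

lemma Cc_infty_lincomb:
  assumes "\<phi> \<in> Cc_infty \<Omega>" "\<psi> \<in> Cc_infty \<Omega>"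
  shows "(\<lambda>x. a * \<phi> x + b * \<psi> x) \<in> Cc_infty \<Omega>"
proof -
  let ?f = "\<lambda>x. a * \<phi> x + b * \<psi> x"
  let ?K = "closure {x. \<phi> x \<noteq> 0} \<union> closure {x. \<psi> x \<noteq> 0}"
  have K: "compact ?K" "?K \<subseteq> \<Omega>" using assms by (auto simp: Cc_infty_def)
  have "{x. ?f x \<noteq> 0} \<subseteq> {x. \<phi> x \<noteq> 0} \<union> {x. \<psi> x \<noteq> 0}" by auto
  also have "\<dots> \<subseteq> ?K" by (intro Un_mono closure_subset)
  finally have "{x. ?f x \<noteq> 0} \<subseteq> ?K" .
  then have sub: "closure {x. ?f x \<noteq> 0} \<subseteq> ?K" by (intro closure_minimal) auto
  then have "compact (closure {x. ?f x \<noteq> 0})"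
    using K(1) by (meson closed_closure compact_closure bounded_subset compact_imp_bounded compact_eq_bounded_closed)
  moreover have "smooth_on \<Omega> ?f"
    using assms open_\<Omega> unfolding smooth_on_def Cc_infty_def
    by (auto intro!: Ck_on_add Ck_on_mult Ck_on_const)
  ultimately show ?thesis using sub K(2) unfolding Cc_infty_def by auto
qed

lemma Cc_infty_smooth_clamp:
  assumes "\<phi> \<in> Cc_infty \<Omega>" "e > 0"
  shows "(\<lambda>x. smooth_clamp e a b (\<phi> x)) \<in> Cc_infty \<Omega>"
proof -
  let ?f = "\<lambda>x. smooth_clamp e a b (\<phi> x)"
  have sub: "closure {x. ?f x \<noteq> 0} \<subseteq> closure {x. \<phi> x \<noteq> 0}"
    by (intro closure_mono) (auto simp: smooth_clamp_0)
  moreover have "compact (closure {x. ?f x \<noteq> 0})"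
    using sub assms(1) unfolding Cc_infty_def
    by (auto simp: compact_eq_bounded_closed intro: bounded_subset)
  moreover have "smooth_on \<Omega> ?f"
    using assms open_\<Omega> unfolding smooth_on_def Cc_infty_def
    by (auto intro!: Ck_on_smooth_clamp)
  ultimately show ?thesis using assms(1) unfolding Cc_infty_def by auto
qed

abbreviation "W \<equiv> Wsp0 s p \<beta> \<Omega>"
abbreviation "w1 \<equiv> wpart1 p \<beta> \<Omega>"
abbreviation "w2 \<equiv> wpart2 s p \<beta> \<Omega>"

lemma w2_eq: "w2 f = (\<integral>\<^sup>+ z. ennreal (\<bar>indicator (\<Omega> \<times> \<Omega>) z * dif f z\<bar> powr p) \<partial>\<nu>)"
  unfolding wpart2_def dif_def by (rule nn_integral_cong) (auto simp: indicator_def)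

lemma w1_eq: "w1 f = (\<integral>\<^sup>+ x. ennreal (indicator \<Omega> x * (\<bar>f x\<bar> powr p * wmu \<beta> x)) \<partial>lborel)"
  unfolding wpart1_def by (rule nn_integral_cong) (auto simp: indicator_def)

lemma wmu_measurable [measurable]: "wmu \<beta> \<in> borel_measurable borel"
  unfolding wmu_def by measurable

lemma w2_le_energy: "w2 f \<le> energy f"
  unfolding w2_eq energy_def by (rule nn_integral_mono) (auto simp: indicator_def)

lemma W_measurable: "u \<in> W \<Longrightarrow> u \<in> borel_measurable borel"
  by (simp add: Wsp0_def)

lemma W_zero: "u \<in> W \<Longrightarrow> x \<notin> \<Omega> \<Longrightarrow> u x = 0"
  by (simp add: Wsp0_def)

lemma abs_lincomb_powr_le:
  "\<bar>a * x + b * y\<bar> powr p \<le> 2 powr p * \<bar>a\<bar> powr p * \<bar>x\<bar> powr p + 2 powr p * \<bar>b\<bar> powr p * \<bar>y\<bar> powr p"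
  using abs_add_powr_le[of p "a * x" "b * y"] p by (simp add: abs_mult powr_mult algebra_simps)

lemma w2_lincomb:
  assumes [measurable]: "f \<in> borel_measurable borel" "g \<in> borel_measurable borel"
  shows "w2 (\<lambda>x. a * f x + b * g x) \<le> ennreal (2 powr p * \<bar>a\<bar> powr p) * w2 f + ennreal (2 powr p * \<bar>b\<bar> powr p) * w2 g"
proof -
  have "w2 (\<lambda>x. a * f x + b * g x) \<le> (\<integral>\<^sup>+ z. ennreal (2 powr p * \<bar>a\<bar> powr p) * ennreal (\<bar>indicator (\<Omega> \<times> \<Omega>) z * dif f z\<bar> powr p)
     + ennreal (2 powr p * \<bar>b\<bar> powr p) * ennreal (\<bar>indicator (\<Omega> \<times> \<Omega>) z * dif g z\<bar> powr p) \<partial>\<nu>)"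
    unfolding w2_eq
  proof (rule nn_integral_mono)
    fix z
    have "\<bar>indicator (\<Omega> \<times> \<Omega>) z * dif (\<lambda>x. a * f x + b * g x) z\<bar> powr p
        = \<bar>a * (indicator (\<Omega> \<times> \<Omega>) z * dif f z) + b * (indicator (\<Omega> \<times> \<Omega>) z * dif g z)\<bar> powr p"
      by (simp add: dif_def algebra_simps)
    also note abs_lincomb_powr_le
    finally show "ennreal (\<bar>indicator (\<Omega> \<times> \<Omega>) z * dif (\<lambda>x. a * f x + b * g x) z\<bar> powr p)
      \<le> ennreal (2 powr p * \<bar>a\<bar> powr p) * ennreal (\<bar>indicator (\<Omega> \<times> \<Omega>) z * dif f z\<bar> powr p)
     + ennreal (2 powr p * \<bar>b\<bar> powr p) * ennreal (\<bar>indicator (\<Omega> \<times> \<Omega>) z * dif g z\<bar> powr p)"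
      by (simp add: ennreal_mult[symmetric] ennreal_plus[symmetric] ennreal_leI del: ennreal_plus)
  qed
  also have "\<dots> = ennreal (2 powr p * \<bar>a\<bar> powr p) * w2 f + ennreal (2 powr p * \<bar>b\<bar> powr p) * w2 g"
    unfolding w2_eq by (simp add: nn_integral_add nn_integral_cmult)
  finally show ?thesis .
qed

lemma energy_lincomb:
  assumes [measurable]: "f \<in> borel_measurable borel" "g \<in> borel_measurable borel"
  shows "energy (\<lambda>x. a * f x + b * g x) \<le> ennreal (2 powr p * \<bar>a\<bar> powr p) * energy f + ennreal (2 powr p * \<bar>b\<bar> powr p) * energy g"
proof -
  have "energy (\<lambda>x. a * f x + b * g x) \<le> (\<integral>\<^sup>+ z. ennreal (2 powr p * \<bar>a\<bar> powr p) * ennreal (\<bar>dif f z\<bar> powr p)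
     + ennreal (2 powr p * \<bar>b\<bar> powr p) * ennreal (\<bar>dif g z\<bar> powr p) \<partial>\<nu>)"
    unfolding energy_def
  proof (rule nn_integral_mono)
    fix z
    have "\<bar>dif (\<lambda>x. a * f x + b * g x) z\<bar> powr p = \<bar>a * dif f z + b * dif g z\<bar> powr p"
      by (simp add: dif_def algebra_simps)
    also note abs_lincomb_powr_le
    finally show "ennreal (\<bar>dif (\<lambda>x. a * f x + b * g x) z\<bar> powr p)
      \<le> ennreal (2 powr p * \<bar>a\<bar> powr p) * ennreal (\<bar>dif f z\<bar> powr p)
     + ennreal (2 powr p * \<bar>b\<bar> powr p) * ennreal (\<bar>dif g z\<bar> powr p)"
      by (simp add: ennreal_mult[symmetric] ennreal_plus[symmetric] ennreal_leI del: ennreal_plus)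
  qed
  also have "\<dots> = ennreal (2 powr p * \<bar>a\<bar> powr p) * energy f + ennreal (2 powr p * \<bar>b\<bar> powr p) * energy g"
    unfolding energy_def by (simp add: nn_integral_add nn_integral_cmult)
  finally show ?thesis .
qed

lemma w1_lincomb:
  assumes [measurable]: "f \<in> borel_measurable borel" "g \<in> borel_measurable borel"
  shows "w1 (\<lambda>x. a * f x + b * g x) \<le> ennreal (2 powr p * \<bar>a\<bar> powr p) * w1 f + ennreal (2 powr p * \<bar>b\<bar> powr p) * w1 g"
proof -
  have "w1 (\<lambda>x. a * f x + b * g x) \<le> (\<integral>\<^sup>+ x. ennreal (2 powr p * \<bar>a\<bar> powr p) * ennreal (indicator \<Omega> x * (\<bar>f x\<bar> powr p * wmu \<beta> x))
     + ennreal (2 powr p * \<bar>b\<bar> powr p) * ennreal (indicator \<Omega> x * (\<bar>g x\<bar> powr p * wmu \<beta> x)) \<partial>lborel)"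
    unfolding w1_eq
  proof (rule nn_integral_mono)
    fix x :: 'a
    have wm: "0 \<le> wmu \<beta> x" by (simp add: wmu_def)
    have "indicator \<Omega> x * (\<bar>a * f x + b * g x\<bar> powr p * wmu \<beta> x)
       \<le> indicator \<Omega> x * ((2 powr p * \<bar>a\<bar> powr p * \<bar>f x\<bar> powr p + 2 powr p * \<bar>b\<bar> powr p * \<bar>g x\<bar> powr p) * wmu \<beta> x)"
      using wm by (intro mult_left_mono mult_right_mono abs_lincomb_powr_le) auto
    also have "\<dots> = 2 powr p * \<bar>a\<bar> powr p * (indicator \<Omega> x * (\<bar>f x\<bar> powr p * wmu \<beta> x)) + 2 powr p * \<bar>b\<bar> powr p * (indicator \<Omega> x * (\<bar>g x\<bar> powr p * wmu \<beta> x))"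
      by (simp add: algebra_simps)
    finally show "ennreal (indicator \<Omega> x * (\<bar>a * f x + b * g x\<bar> powr p * wmu \<beta> x))
      \<le> ennreal (2 powr p * \<bar>a\<bar> powr p) * ennreal (indicator \<Omega> x * (\<bar>f x\<bar> powr p * wmu \<beta> x))
     + ennreal (2 powr p * \<bar>b\<bar> powr p) * ennreal (indicator \<Omega> x * (\<bar>g x\<bar> powr p * wmu \<beta> x))"
      using wm by (simp add: ennreal_mult[symmetric] ennreal_plus[symmetric] ennreal_leI del: ennreal_plus)
  qed
  also have "\<dots> = ennreal (2 powr p * \<bar>a\<bar> powr p) * w1 f + ennreal (2 powr p * \<bar>b\<bar> powr p) * w1 g"
    unfolding w1_eq by (simp add: nn_integral_add nn_integral_cmult)
  finally show ?thesis .
qed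

lemma ennreal_lincomb_tendsto_0:
  fixes f g h :: "nat \<Rightarrow> ennreal"
  assumes "f \<longlonglongrightarrow> 0" "g \<longlonglongrightarrow> 0" "\<And>n. h n \<le> ennreal a * f n + ennreal b * g n"
  shows "h \<longlonglongrightarrow> 0"
proof (rule tendsto_sandwich[where f="\<lambda>_. 0"])
  have "(\<lambda>n. ennreal a * f n + ennreal b * g n) \<longlonglongrightarrow> ennreal a * 0 + ennreal b * 0"
    using assms by (intro tendsto_add ennreal_tendsto_cmult) auto
  then show "(\<lambda>n. ennreal a * f n + ennreal b * g n) \<longlonglongrightarrow> 0" by simp
qed (use assms(3) in auto)

lemma W_lincomb:
  assumes u: "u \<in> W" and v: "v \<in> W"
  shows "(\<lambda>x. a * u x + b * v x) \<in> W"
proof -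
  note [measurable] = W_measurable[OF u] W_measurable[OF v]
  obtain \<phi> where \<phi>: "\<And>n. \<phi> n \<in> Cc_infty \<Omega>" "(\<lambda>n. w1 (\<lambda>x. \<phi> n x - u x)) \<longlonglongrightarrow> 0" "(\<lambda>n. w2 (\<lambda>x. \<phi> n x - u x)) \<longlonglongrightarrow> 0"
    using u by (auto simp: Wsp0_def)
  obtain \<psi> where \<psi>: "\<And>n. \<psi> n \<in> Cc_infty \<Omega>" "(\<lambda>n. w1 (\<lambda>x. \<psi> n x - v x)) \<longlonglongrightarrow> 0" "(\<lambda>n. w2 (\<lambda>x. \<psi> n x - v x)) \<longlonglongrightarrow> 0"
    using v by (auto simp: Wsp0_def)
  note [measurable] = Cc_infty_measurable[OF \<phi>(1)] Cc_infty_measurable[OF \<psi>(1)]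
  have eq: "(\<lambda>x. (a * \<phi> n x + b * \<psi> n x) - (a * u x + b * v x)) = (\<lambda>x. a * (\<phi> n x - u x) + b * (\<psi> n x - v x))" for n
    by (simp add: algebra_simps)
  have "(\<lambda>n. w1 (\<lambda>x. (a * \<phi> n x + b * \<psi> n x) - (a * u x + b * v x))) \<longlonglongrightarrow> 0"
    unfolding eq by (rule ennreal_lincomb_tendsto_0[OF \<phi>(2) \<psi>(2) w1_lincomb]) measurable
  moreover have "(\<lambda>n. w2 (\<lambda>x. (a * \<phi> n x + b * \<psi> n x) - (a * u x + b * v x))) \<longlonglongrightarrow> 0"
    unfolding eq by (rule ennreal_lincomb_tendsto_0[OF \<phi>(3) \<psi>(3) w2_lincomb]) measurable
  moreover have "(\<lambda>x. a * u x + b * v x) \<in> borel_measurable lborel" by measurable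
  ultimately show ?thesis
    unfolding Wsp0_def using W_zero[OF u] W_zero[OF v] Cc_infty_lincomb[OF \<phi>(1) \<psi>(1)]
    by (auto intro!: exI[of _ "\<lambda>n x. a * \<phi> n x + b * \<psi> n x"])
qed

lemma Cc_infty_W: "\<phi> \<in> Cc_infty \<Omega> \<Longrightarrow> \<phi> \<in> W"
  unfolding Wsp0_def using Cc_infty_zero[of \<phi>] Cc_infty_measurable[of \<phi>] p
  by (auto intro!: exI[of _ "\<lambda>_. \<phi>"] simp: wpart1_def wpart2_def)

text \<open>Finiteness is not part of the definition of W; it comes from an approximating test
  function at distance less than 1, which has finite energy.\<close>

lemma W_w2_finite:
  assumes u: "u \<in> W" shows "w2 u < \<infinity>"
proof -
  note [measurable] = W_measurable[OF u]
  obtain \<phi> where \<phi>: "\<And>n. \<phi> n \<in> Cc_infty \<Omega>" "(\<lambda>n. w2 (\<lambda>x. \<phi> n x - u x)) \<longlonglongrightarrow> 0"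
    using u by (auto simp: Wsp0_def)
  note [measurable] = Cc_infty_measurable[OF \<phi>(1)]
  obtain n where n: "w2 (\<lambda>x. \<phi> n x - u x) < 1"
    using order_tendstoD(2)[OF \<phi>(2), of 1] by (auto simp: eventually_sequentially)
  have "w2 u = w2 (\<lambda>x. 1 * \<phi> n x + (-1) * (\<phi> n x - u x))" by simp
  also have "\<dots> \<le> ennreal (2 powr p * \<bar>1\<bar> powr p) * w2 (\<phi> n) + ennreal (2 powr p * \<bar>-1\<bar> powr p) * w2 (\<lambda>x. \<phi> n x - u x)"
    by (rule w2_lincomb) measurable
  also have "\<dots> < \<infinity>"
    using n w2_le_energy[of "\<phi> n"] Cc_infty_energy[OF \<phi>(1)[of n]]
    by (auto simp: ennreal_mult_less_top intro: order_le_less_trans order_less_trans)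
  finally show ?thesis .
qed

lemma W_sequentially_closed:
  assumes c: "\<And>n. c n \<in> W" and [measurable]: "u \<in> borel_measurable borel" and u0: "\<And>x. x \<notin> \<Omega> \<Longrightarrow> u x = 0"
    and lim: "(\<lambda>n. w1 (\<lambda>x. c n x - u x)) \<longlonglongrightarrow> 0" "(\<lambda>n. w2 (\<lambda>x. c n x - u x)) \<longlonglongrightarrow> 0"
  shows "u \<in> W"
proof -
  note [measurable] = W_measurable[OF c]
  have "\<exists>\<phi>\<in>Cc_infty \<Omega>. w1 (\<lambda>x. \<phi> x - c n x) < ennreal (1 / Suc n) \<and> w2 (\<lambda>x. \<phi> x - c n x) < ennreal (1 / Suc n)" for n
  proof -
    obtain \<phi> where \<phi>: "\<And>i. \<phi> i \<in> Cc_infty \<Omega>" "(\<lambda>i. w1 (\<lambda>x. \<phi> i x - c n x)) \<longlonglongrightarrow> 0" "(\<lambda>i. w2 (\<lambda>x. \<phi> i x - c n x)) \<longlonglongrightarrow> 0"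
      using c[of n] by (auto simp: Wsp0_def)
    have pos: "(0::ennreal) < ennreal (1 / Suc n)" by simp
    from eventually_conj[OF order_tendstoD(2)[OF \<phi>(2) pos] order_tendstoD(2)[OF \<phi>(3) pos]]
    show ?thesis using \<phi>(1) by (auto simp: eventually_sequentially)
  qed
  then obtain \<phi> where \<phi>: "\<And>n. \<phi> n \<in> Cc_infty \<Omega>" "\<And>n. w1 (\<lambda>x. \<phi> n x - c n x) < ennreal (1 / Suc n)"
     "\<And>n. w2 (\<lambda>x. \<phi> n x - c n x) < ennreal (1 / Suc n)" by metis
  note [measurable] = Cc_infty_measurable[OF \<phi>(1)]
  have z: "(\<lambda>n. ennreal (1 / Suc n)) \<longlonglongrightarrow> 0"
    using LIMSEQ_inverse_real_of_nat by (simp add: ennreal_tendsto_0_iff inverse_eq_divide)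
  have t1: "(\<lambda>n. w1 (\<lambda>x. \<phi> n x - c n x)) \<longlonglongrightarrow> 0"
    by (rule tendsto_sandwich[OF _ _ tendsto_const z]) (use \<phi>(2) in \<open>auto intro!: always_eventually less_imp_le\<close>)
  have t2: "(\<lambda>n. w2 (\<lambda>x. \<phi> n x - c n x)) \<longlonglongrightarrow> 0"
    by (rule tendsto_sandwich[OF _ _ tendsto_const z]) (use \<phi>(3) in \<open>auto intro!: always_eventually less_imp_le\<close>)
  have eq: "(\<lambda>x. \<phi> n x - u x) = (\<lambda>x. 1 * (\<phi> n x - c n x) + 1 * (c n x - u x))" for n by simp
  have "(\<lambda>n. w1 (\<lambda>x. \<phi> n x - u x)) \<longlonglongrightarrow> 0"
    unfolding eq by (rule ennreal_lincomb_tendsto_0[OF t1 lim(1) w1_lincomb]) measurable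
  moreover have "(\<lambda>n. w2 (\<lambda>x. \<phi> n x - u x)) \<longlonglongrightarrow> 0"
    unfolding eq by (rule ennreal_lincomb_tendsto_0[OF t2 lim(2) w2_lincomb]) measurable
  ultimately show ?thesis using \<phi>(1) u0 by (auto simp: Wsp0_def)
qed

end

lemma abs_powr_tendsto_0D:
  assumes "p > 0" "(\<lambda>n. \<bar>t n\<bar> powr p) \<longlonglongrightarrow> (0::real)"
  shows "t \<longlonglongrightarrow> 0"
proof -
  have "(\<lambda>n. (\<bar>t n\<bar> powr p) powr (1 / p)) \<longlonglongrightarrow> 0 powr (1 / p)"
    using assms by (intro tendsto_powr') auto
  then show ?thesis using assms(1) by (simp add: powr_powr tendsto_rabs_zero_iff)
qed

context weighted_fractional
begin

lemma wmu_integrable: "(\<integral>\<^sup>+ x. indicator \<Omega> x * ennreal (c * wmu \<beta> x) \<partial>lborel) < \<infinity>"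
proof -
  obtain R where R: "R > 0" "\<Omega> \<subseteq> ball 0 R"
    using bounded_subset_ballD[OF bounded_\<Omega>, of 0] by auto
  have [measurable]: "ball (0::'a) r \<in> sets borel" for r by simp
  have "(\<integral>\<^sup>+ x. indicator \<Omega> x * ennreal (c * wmu \<beta> x) \<partial>lborel)
      \<le> (\<integral>\<^sup>+ x. ennreal \<bar>c\<bar> * (indicator (ball (0::'a) R) x * ennreal (wmu \<beta> x)) \<partial>lborel)"
    using R by (intro nn_integral_mono)
      (auto simp: indicator_def ennreal_mult[symmetric] wmu_def subset_eq intro!: ennreal_leI divide_right_mono)
  also have "\<dots> = ennreal \<bar>c\<bar> * (\<integral>\<^sup>+ x. indicator (ball (0::'a) R) x * ennreal (wmu \<beta> x) \<partial>lborel)"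
    by (rule nn_integral_cmult) measurable
  also have "\<dots> < \<infinity>"
    using nn_integral_radial_ball_finite[of "2 * \<beta>" R, where 'a='a] two_\<beta>_less \<beta>(1) R(1)
    unfolding wmu_def by (simp add: ennreal_mult_less_top)
  finally show ?thesis .
qed

text \<open>Mazur's lemma for bounded sequences.  The sets \<open>C n\<close> stand in for the convex hulls of the tails:
  they are closed under midpoints, and a sequence picked from them inherits the pointwise limit.  Near
  minimisers of the energy over \<open>C n\<close> form a Cauchy sequence by uniform convexity.\<close>

lemma W_closed_bounded:
  assumes w: "\<And>n. w n \<in> W" and bd: "\<And>n x. \<bar>w n x\<bar> \<le> k" and wK: "\<And>n. w2 (w n) \<le> ennreal K"
    and [measurable]: "u \<in> borel_measurable borel" and u0: "\<And>x. x \<notin> \<Omega> \<Longrightarrow> u x = 0"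
    and ae: "AE x in lborel. (\<lambda>n. w n x) \<longlonglongrightarrow> u x"
  shows "u \<in> W"
proof -
  define C where "C n = {c \<in> W. \<forall>x lo hi. (\<forall>m\<ge>n. lo \<le> w m x \<and> w m x \<le> hi) \<longrightarrow> lo \<le> c x \<and> c x \<le> hi}" for n :: nat
  define E where "E c = enn2real (w2 c)" for c
  define I where "I n = (INF c\<in>C n. E c)" for n
  have E: "w2 c = ennreal (E c)" "E c \<ge> 0" if "c \<in> W" for c
    using W_w2_finite[OF that] by (auto simp: E_def)
  have CW: "c \<in> W" if "c \<in> C n" for c n using that by (simp add: C_def)
  have wC: "w m \<in> C n" if "n \<le> m" for n m using that w by (auto simp: C_def)
  have Cmono: "C m \<subseteq> C n" if "n \<le> m" for n m using that unfolding C_def by (blast intro: order_trans)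
  have Cmid: "(\<lambda>x. (c x + d x) / 2) \<in> C n" if "c \<in> C n" "d \<in> C n" for c d n
  proof -
    have "(\<lambda>x. (1/2) * c x + (1/2) * d x) \<in> W" using W_lincomb[OF CW[OF that(1)] CW[OF that(2)]] .
    then have "(\<lambda>x. (c x + d x) / 2) \<in> W" by (simp add: field_simps)
    moreover have "lo \<le> (c x + d x) / 2 \<and> (c x + d x) / 2 \<le> hi" if "\<forall>m\<ge>n. lo \<le> w m x \<and> w m x \<le> hi" for x lo hi
    proof -
      have "lo \<le> c x \<and> c x \<le> hi" "lo \<le> d x \<and> d x \<le> hi"
        using that \<open>c \<in> C n\<close> \<open>d \<in> C n\<close> unfolding C_def by blast+
      then show ?thesis by auto
    qed
    ultimately show ?thesis unfolding C_def by blast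
  qed
  have Kw: "E (w n) \<le> max K 0" for n
  proof -
    have "ennreal (E (w n)) \<le> ennreal (max K 0)"
      unfolding E(1)[OF w, symmetric] by (rule order_trans[OF wK]) (auto intro: ennreal_leI)
    then show ?thesis by (subst (asm) ennreal_le_iff) auto
  qed
  have bb: "bdd_below (E ` C n)" for n
    by (rule bdd_belowI[of _ 0]) (use E(2) CW in auto)
  have Ile: "I n \<le> E c" if "c \<in> C n" for c n unfolding I_def using that by (intro cINF_lower bb)
  have Imono: "I n \<le> I m" if "n \<le> m" for n m
    unfolding I_def using that wC by (intro cINF_superset_mono bb Cmono) auto
  have IK: "I n \<le> max K 0" for n using Ile[OF wC[of n n]] Kw[of n] by simp
  \<comment> \<open>The sets C n shrink, so their infima increase; they stay below the energy bound
    because w n belongs to C n.\<close>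
  obtain d where d: "I \<longlonglongrightarrow> d" "\<And>n. I n \<le> d"
  proof -
    have "incseq I" using Imono by (auto simp: incseq_def)
    then show thesis using incseq_convergent[of I "max K 0"] IK that by metis
  qed
  have "\<exists>c\<in>C n. E c < I n + 1 / Suc n" for n
  proof -
    have "(INF c\<in>C n. E c) < I n + 1 / Suc n" unfolding I_def by simp
    then show ?thesis using wC[of n n] bb by (subst (asm) cINF_less_iff) auto
  qed
  then obtain c where c: "\<And>n. c n \<in> C n" "\<And>n. E (c n) < I n + 1 / Suc n" by metis
  have cW: "c n \<in> W" for n using c(1) CW by blast
  note [measurable] = W_measurable[OF cW]
  define f where "f n z = indicator (\<Omega> \<times> \<Omega>) z * dif (c n) z" for n z
  have [measurable]: "f n \<in> borel_measurable \<nu>" for n unfolding f_def by measurable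
  have sn: "1 / real (Suc m) \<le> 1 / real (Suc n)" if "n \<le> m" for n m using that by (simp add: frac_le)
  have cauchy: "\<exists>N. \<forall>n\<ge>N. \<forall>m\<ge>n. (\<integral>\<^sup>+ z. ennreal (\<bar>f n z - f m z\<bar> powr p) \<partial>\<nu>) \<le> ennreal \<epsilon>" if "\<epsilon> > 0" for \<epsilon>
  \<comment> \<open>For m \<ge> n the element c m is nearly minimal only over C m, whose infimum may
    exceed I n. The difference is at most d - I n, which is why this term joins 1/(n+1) in the
    error.\<close>
  proof (rule Lp_uniform_convex_Cauchy[OF p(1), where e="\<lambda>n. E (c n)" and K="max K 0 + 1" and d="\<lambda>n. 1 / Suc n + (d - I n)"])
    show "(\<integral>\<^sup>+ z. ennreal (\<bar>f n z\<bar> powr p) \<partial>\<nu>) = ennreal (E (c n))" for n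
      using E(1)[OF cW, of n] by (simp add: w2_eq f_def)
    show "0 \<le> E (c n)" for n by (rule E(2)[OF cW])
    have "1 / real (Suc n) \<le> 1" for n by simp
    then show "E (c n) \<le> max K 0 + 1" for n using c(2)[of n] IK[of n] by (smt (verit))
    show "ennreal ((E (c n) + E (c m)) / 2 - (1 / real (Suc n) + (d - I n)))
        \<le> (\<integral>\<^sup>+ z. ennreal (\<bar>(f n z + f m z) / 2\<bar> powr p) \<partial>\<nu>)" if nm: "n \<le> m" for n m
    proof -
      let ?m = "\<lambda>x. (c n x + c m x) / 2"
      have mC: "?m \<in> C n" using c(1) Cmono[OF nm] by (intro Cmid) auto
      have "(\<integral>\<^sup>+ z. ennreal (\<bar>(f n z + f m z) / 2\<bar> powr p) \<partial>\<nu>) = w2 ?m"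
      proof -
        have "(f n z + f m z) / 2 = indicator (\<Omega> \<times> \<Omega>) z * dif ?m z" for z
          by (simp add: f_def dif_def algebra_simps add_divide_distrib diff_divide_distrib)
        then show ?thesis by (simp add: w2_eq)
      qed
      also have "\<dots> = ennreal (E ?m)" by (rule E(1)[OF CW[OF mC]])
      finally have eq: "(\<integral>\<^sup>+ z. ennreal (\<bar>(f n z + f m z) / 2\<bar> powr p) \<partial>\<nu>) = ennreal (E ?m)" .
      have "(E (c n) + E (c m)) / 2 - (1 / real (Suc n) + (d - I n)) \<le> I n"
        using c(2)[of n] c(2)[of m] sn[OF nm] d(2)[of n] d(2)[of m] by argo
      also have "\<dots> \<le> E ?m" by (rule Ile[OF mC])
      finally show ?thesis unfolding eq by (rule ennreal_leI)
    qed
    have "(\<lambda>n. 1 / real (Suc n) + (d - I n)) \<longlonglongrightarrow> 0 + (d - d)"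
      using LIMSEQ_inverse_real_of_nat d(1) by (intro tendsto_intros) (simp_all add: inverse_eq_divide)
    then show "(\<lambda>n. 1 / real (Suc n) + (d - I n)) \<longlonglongrightarrow> 0" by simp
  qed (use that in auto)
  have cu: "AE x in lborel. (\<lambda>n. c n x) \<longlonglongrightarrow> u x"
    using ae
  proof eventually_elim
    fix x assume lim: "(\<lambda>n. w n x) \<longlonglongrightarrow> u x"
    show "(\<lambda>n. c n x) \<longlonglongrightarrow> u x"
    proof (rule LIMSEQ_I)
      fix r :: real assume "0 < r"
      then obtain N where N: "\<And>m. m \<ge> N \<Longrightarrow> \<bar>w m x - u x\<bar> < r / 2"
        using LIMSEQ_D[OF lim, of "r / 2"] by auto
      have "norm (c n x - u x) < r" if "n \<ge> N" for n
      proof -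
        \<comment> \<open>An interval around u x containing the whole tail of w at x also contains c
          n x, by the definition of C n.\<close>
        have "\<forall>m\<ge>n. u x - r / 2 \<le> w m x \<and> w m x \<le> u x + r / 2"
        proof (intro allI impI)
          fix m assume "n \<le> m"
          then have "\<bar>w m x - u x\<bar> < r / 2" using N that by (meson order_trans)
          then show "u x - r / 2 \<le> w m x \<and> w m x \<le> u x + r / 2" by (intro conjI; linarith)
        qed
        then have "u x - r / 2 \<le> c n x \<and> c n x \<le> u x + r / 2" using c(1)[of n] unfolding C_def by blast
        then show ?thesis using \<open>0 < r\<close> unfolding real_norm_def by linarith
      qed
      then show "\<exists>no. \<forall>n\<ge>no. norm (c n x - u x) < r" by blast
    qed
  qed
  have fu: "AE z in \<nu>. (\<lambda>n. f n z) \<longlonglongrightarrow> indicator (\<Omega> \<times> \<Omega>) z * dif u z"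
    using AE_nu[OF cu] by eventually_elim (auto simp: f_def dif_def intro!: tendsto_intros)
  have "(\<lambda>n. \<integral>\<^sup>+ z. ennreal (\<bar>f n z - indicator (\<Omega> \<times> \<Omega>) z * dif u z\<bar> powr p) \<partial>\<nu>) \<longlonglongrightarrow> 0"
    by (rule Lp_Cauchy_AE_limit[OF p(1) _ _ fu cauchy]) measurable
  moreover have "w2 (\<lambda>x. c n x - u x) = (\<integral>\<^sup>+ z. ennreal (\<bar>f n z - indicator (\<Omega> \<times> \<Omega>) z * dif u z\<bar> powr p) \<partial>\<nu>)" for n
    unfolding w2_eq by (intro nn_integral_cong) (simp add: f_def dif_def algebra_simps)
  ultimately have lim2: "(\<lambda>n. w2 (\<lambda>x. c n x - u x)) \<longlonglongrightarrow> 0" by simp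
  have cb: "\<bar>c n x\<bar> \<le> k" for n x
  proof -
    have "\<forall>m\<ge>n. - k \<le> w m x \<and> w m x \<le> k" using bd[of _ x] by (auto simp: abs_le_iff minus_le_iff)
    then have "- k \<le> c n x \<and> c n x \<le> k" using c(1)[of n] unfolding C_def by blast
    then show ?thesis by auto
  qed
  have ub: "AE x in lborel. \<bar>u x\<bar> \<le> k"
    using cu
  proof eventually_elim
    fix x assume "(\<lambda>n. c n x) \<longlonglongrightarrow> u x"
    then have "(\<lambda>n. \<bar>c n x\<bar>) \<longlonglongrightarrow> \<bar>u x\<bar>" by (rule tendsto_rabs)
    then show "\<bar>u x\<bar> \<le> k" by (rule LIMSEQ_le_const2) (use cb in auto)
  qed
  \<comment> \<open>The weighted part needs no convexity: the functions are uniformly bounded and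
    the weight is integrable on \<Omega>.\<close>
  have "(\<lambda>n. \<integral>\<^sup>+ x. ennreal (indicator \<Omega> x * (\<bar>c n x - u x\<bar> powr p * wmu \<beta> x)) \<partial>lborel) \<longlonglongrightarrow> (\<integral>\<^sup>+ (x::'a). 0 \<partial>lborel)"
  proof (rule nn_integral_dominated_convergence[where w="\<lambda>x. indicator \<Omega> x * ennreal ((2 * k) powr p * wmu \<beta> x)"])
    show "(\<integral>\<^sup>+ x. indicator \<Omega> x * ennreal ((2 * k) powr p * wmu \<beta> x) \<partial>lborel) < \<infinity>"
      by (rule wmu_integrable)
    show "AE x in lborel. ennreal (indicator \<Omega> x * (\<bar>c n x - u x\<bar> powr p * wmu \<beta> x)) \<le> indicator \<Omega> x * ennreal ((2 * k) powr p * wmu \<beta> x)" for n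
      using ub
    proof eventually_elim
      fix x assume ux: "\<bar>u x\<bar> \<le> k"
      have "\<bar>c n x - u x\<bar> \<le> 2 * k" using ux cb[of n x] by linarith
      then have "\<bar>c n x - u x\<bar> powr p * wmu \<beta> x \<le> (2 * k) powr p * wmu \<beta> x"
        using p by (intro mult_right_mono powr_mono2) (auto simp: wmu_def)
      then show "ennreal (indicator \<Omega> x * (\<bar>c n x - u x\<bar> powr p * wmu \<beta> x)) \<le> indicator \<Omega> x * ennreal ((2 * k) powr p * wmu \<beta> x)"
        by (auto simp: indicator_def ennreal_leI)
    qed
    show "AE x in lborel. (\<lambda>n. ennreal (indicator \<Omega> x * (\<bar>c n x - u x\<bar> powr p * wmu \<beta> x))) \<longlonglongrightarrow> 0"
      using cu
    proof eventually_elim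
      fix x assume "(\<lambda>n. c n x) \<longlonglongrightarrow> u x"
      then have "(\<lambda>n. \<bar>c n x - u x\<bar>) \<longlonglongrightarrow> \<bar>u x - u x\<bar>" by (intro tendsto_intros)
      then have "(\<lambda>n. \<bar>c n x - u x\<bar> powr p) \<longlonglongrightarrow> \<bar>u x - u x\<bar> powr p"
        using p by (intro tendsto_powr' tendsto_const) auto
      then have "(\<lambda>n. indicator \<Omega> x * (\<bar>c n x - u x\<bar> powr p * wmu \<beta> x)) \<longlonglongrightarrow> indicator \<Omega> x * (\<bar>u x - u x\<bar> powr p * wmu \<beta> x)"
        by (intro tendsto_mult tendsto_const)
      then have "(\<lambda>n. ennreal (indicator \<Omega> x * (\<bar>c n x - u x\<bar> powr p * wmu \<beta> x))) \<longlonglongrightarrow> ennreal (indicator \<Omega> x * (\<bar>u x - u x\<bar> powr p * wmu \<beta> x))"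
        by (rule tendsto_ennrealI)
      then show "(\<lambda>n. ennreal (indicator \<Omega> x * (\<bar>c n x - u x\<bar> powr p * wmu \<beta> x))) \<longlonglongrightarrow> 0" using p by simp
    qed
  qed measurable
  then have lim1: "(\<lambda>n. w1 (\<lambda>x. c n x - u x)) \<longlonglongrightarrow> 0" unfolding w1_eq by simp
  show ?thesis by (rule W_sequentially_closed[OF cW _ u0 lim1 lim2]) measurable
qed

lemma energy_contraction: "(\<And>x y. \<bar>f x - f y\<bar> \<le> \<bar>g x - g y\<bar>) \<Longrightarrow> energy f \<le> energy g"
  unfolding energy_def dif_def using p by (intro nn_integral_mono ennreal_leI powr_mono2) auto

lemma w2_contraction: "(\<And>x y. \<bar>f x - f y\<bar> \<le> \<bar>g x - g y\<bar>) \<Longrightarrow> w2 f \<le> w2 g"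
  unfolding w2_eq dif_def using p
  by (intro nn_integral_mono ennreal_leI powr_mono2) (auto simp: abs_mult intro!: mult_left_mono)

section \<open>Stability of W under truncation\<close>

lemma W_AE_approx:
  assumes u: "u \<in> W"
  obtains \<phi> where "\<And>n. \<phi> n \<in> Cc_infty \<Omega>" "AE x in lborel. (\<lambda>n. \<phi> n x) \<longlonglongrightarrow> u x"
    "(\<lambda>n. w2 (\<lambda>x. \<phi> n x - u x)) \<longlonglongrightarrow> 0" "\<And>n. w2 (\<lambda>x. \<phi> n x - u x) \<le> 1"
proof -
  note [measurable] = W_measurable[OF u]
  obtain \<phi>' where \<phi>': "\<And>n. \<phi>' n \<in> Cc_infty \<Omega>" "(\<lambda>n. w1 (\<lambda>x. \<phi>' n x - u x)) \<longlonglongrightarrow> 0" "(\<lambda>n. w2 (\<lambda>x. \<phi>' n x - u x)) \<longlonglongrightarrow> 0"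
    using u by (auto simp: Wsp0_def)
  obtain N where N: "\<And>n. n \<ge> N \<Longrightarrow> w2 (\<lambda>x. \<phi>' n x - u x) < 1"
    using order_tendstoD(2)[OF \<phi>'(3), of 1] by (auto simp: eventually_sequentially)
  define \<phi> where "\<phi> n = \<phi>' (n + N)" for n
  have \<phi>: "\<And>n. \<phi> n \<in> Cc_infty \<Omega>" "(\<lambda>n. w1 (\<lambda>x. \<phi> n x - u x)) \<longlonglongrightarrow> 0" "(\<lambda>n. w2 (\<lambda>x. \<phi> n x - u x)) \<longlonglongrightarrow> 0"
     "\<And>n. w2 (\<lambda>x. \<phi> n x - u x) < 1"
    unfolding \<phi>_def using \<phi>'(1) N LIMSEQ_ignore_initial_segment[OF \<phi>'(2)] LIMSEQ_ignore_initial_segment[OF \<phi>'(3)] by auto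
  note [measurable] = Cc_infty_measurable[OF \<phi>(1)]
  have "\<exists>r. strict_mono r \<and> (AE x in lborel. (\<lambda>n. indicator \<Omega> x * (\<bar>\<phi> (r n) x - u x\<bar> powr p * wmu \<beta> x)) \<longlonglongrightarrow> 0)"
    by (rule nn_integral_tendsto_0_AE_subseq) (use \<phi>(2) in \<open>auto simp: w1_eq wmu_def\<close>)
  then obtain r where r: "strict_mono r" "AE x in lborel. (\<lambda>n. indicator \<Omega> x * (\<bar>\<phi> (r n) x - u x\<bar> powr p * wmu \<beta> x)) \<longlonglongrightarrow> 0"
    by blast
  \<comment> \<open>At the origin \<open>wmu\<close> is 0 by the division convention, so weighted
    convergence says nothing about that point.\<close>
  have nz: "AE x in lborel. x \<noteq> (0::'a)"
    by (rule AE_I[where N="{0}"]) auto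
  have "AE x in lborel. (\<lambda>n. \<phi> (r n) x) \<longlonglongrightarrow> u x"
    using r(2) nz
  proof eventually_elim
    fix x :: 'a assume lim: "(\<lambda>n. indicator \<Omega> x * (\<bar>\<phi> (r n) x - u x\<bar> powr p * wmu \<beta> x)) \<longlonglongrightarrow> 0" and x: "x \<noteq> 0"
    show "(\<lambda>n. \<phi> (r n) x) \<longlonglongrightarrow> u x"
    proof (cases "x \<in> \<Omega>")
      case True
      have wp: "wmu \<beta> x > 0" using x by (simp add: wmu_def)
      have "(\<lambda>n. (\<bar>\<phi> (r n) x - u x\<bar> powr p * wmu \<beta> x) / wmu \<beta> x) \<longlonglongrightarrow> 0 / wmu \<beta> x"
        using lim True wp by (intro tendsto_intros) auto
      then have "(\<lambda>n. \<bar>\<phi> (r n) x - u x\<bar> powr p) \<longlonglongrightarrow> 0" using wp by simp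
      then have "(\<lambda>n. \<phi> (r n) x - u x) \<longlonglongrightarrow> 0" by (rule abs_powr_tendsto_0D[rotated]) (use p in simp)
      then show ?thesis by (simp add: LIM_zero_iff)
    next
      case False
      then show ?thesis using Cc_infty_zero[OF \<phi>(1)] W_zero[OF u] by simp
    qed
  qed
  moreover have "(\<lambda>n. w2 (\<lambda>x. \<phi> (r n) x - u x)) \<longlonglongrightarrow> 0"
    using LIMSEQ_subseq_LIMSEQ[OF \<phi>(3) r(1)] by (simp add: o_def)
  ultimately show ?thesis using \<phi>(1,4) by (intro that[of "\<lambda>n. \<phi> (r n)"]) (auto intro: less_imp_le)
qed

text \<open>Clamping test functions destroys smoothness, so they are composed with smooth clamps.
  These keep \<open>w2\<close> bounded and converge pointwise, but convergence in the norm of W is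
  not evident; \<open>W_closed_bounded\<close> makes it unnecessary.\<close>

lemma W_clamp:
  assumes u: "u \<in> W" and ab: "a \<le> 0" "0 \<le> b"
  shows "(\<lambda>x. clamp_real a b (u x)) \<in> W"
proof -
  note [measurable] = W_measurable[OF u]
  obtain \<phi> where \<phi>: "\<And>n. \<phi> n \<in> Cc_infty \<Omega>" "AE x in lborel. (\<lambda>n. \<phi> n x) \<longlonglongrightarrow> u x"
     "\<And>n. w2 (\<lambda>x. \<phi> n x - u x) \<le> 1"
    using W_AE_approx[OF u] by metis
  note [measurable] = Cc_infty_measurable[OF \<phi>(1)]
  obtain K where K: "w2 u = ennreal K" "K \<ge> 0" using W_w2_finite[OF u] by (cases "w2 u") auto
  let ?e = "\<lambda>n. 1 / real (Suc n)"
  show ?thesis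
  proof (rule W_closed_bounded[where w="\<lambda>n x. smooth_clamp (?e n) a b (\<phi> n x)" and k="\<bar>a\<bar> + \<bar>b\<bar> + 2" and K="2 powr p + 2 powr p * K"])
    show "(\<lambda>x. smooth_clamp (?e n) a b (\<phi> n x)) \<in> W" for n
      by (intro Cc_infty_W Cc_infty_smooth_clamp \<phi>) simp
    have e1: "?e n \<le> 1" for n by simp
    show "\<bar>smooth_clamp (?e n) a b (\<phi> n x)\<bar> \<le> \<bar>a\<bar> + \<bar>b\<bar> + 2" for n x
    proof -
      have "\<bar>clamp_real a b (\<phi> n x)\<bar> \<le> \<bar>a\<bar> + \<bar>b\<bar>" using ab by (auto simp: clamp_real_def max_def min_def)
      moreover have "\<bar>smooth_clamp (?e n) a b (\<phi> n x) - clamp_real a b (\<phi> n x)\<bar> \<le> 2 * ?e n"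
        using ab by (intro smooth_clamp_close) auto
      ultimately show ?thesis using e1[of n] by argo
    qed
    show "w2 (\<lambda>x. smooth_clamp (?e n) a b (\<phi> n x)) \<le> ennreal (2 powr p + 2 powr p * K)" for n
    proof -
      have "w2 (\<lambda>x. smooth_clamp (?e n) a b (\<phi> n x)) \<le> w2 (\<phi> n)"
        using ab by (intro w2_contraction smooth_clamp_lipschitz) auto
      also have "\<dots> = w2 (\<lambda>x. 1 * (\<phi> n x - u x) + 1 * u x)" by simp
      also have "\<dots> \<le> ennreal (2 powr p * \<bar>1\<bar> powr p) * w2 (\<lambda>x. \<phi> n x - u x) + ennreal (2 powr p * \<bar>1\<bar> powr p) * w2 u"
        by (rule w2_lincomb) measurable
      also have "\<dots> \<le> ennreal (2 powr p * \<bar>1\<bar> powr p) * 1 + ennreal (2 powr p * \<bar>1\<bar> powr p) * ennreal K"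
        unfolding K(1) by (intro add_mono mult_left_mono \<phi>(3)) auto
      also have "\<dots> = ennreal (2 powr p + 2 powr p * K)" using K(2) by (simp add: ennreal_mult)
      finally show ?thesis .
    qed
    show "AE x in lborel. (\<lambda>n. smooth_clamp (?e n) a b (\<phi> n x)) \<longlonglongrightarrow> clamp_real a b (u x)"
      using \<phi>(2)
    proof eventually_elim
      fix x assume lim: "(\<lambda>n. \<phi> n x) \<longlonglongrightarrow> u x"
      have "(\<lambda>n. 2 * ?e n + \<bar>\<phi> n x - u x\<bar>) \<longlonglongrightarrow> 2 * 0 + \<bar>u x - u x\<bar>"
        using LIMSEQ_inverse_real_of_nat lim by (intro tendsto_intros) (simp_all add: inverse_eq_divide)
      then have lim0: "(\<lambda>n. 2 * ?e n + \<bar>\<phi> n x - u x\<bar>) \<longlonglongrightarrow> 0" by simp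
      have "\<bar>smooth_clamp (?e n) a b (\<phi> n x) - clamp_real a b (u x)\<bar> \<le> 2 * ?e n + \<bar>\<phi> n x - u x\<bar>" for n
      proof -
        have "\<bar>smooth_clamp (?e n) a b (\<phi> n x) - clamp_real a b (\<phi> n x)\<bar> \<le> 2 * ?e n"
          using ab by (intro smooth_clamp_close) auto
        then show ?thesis using clamp_real_lipschitz[of a b "\<phi> n x" "u x"] by argo
      qed
      then have "\<forall>\<^sub>F n in sequentially. norm (smooth_clamp (?e n) a b (\<phi> n x) - clamp_real a b (u x)) \<le> 2 * ?e n + \<bar>\<phi> n x - u x\<bar>"
        by (intro always_eventually allI) (simp only: real_norm_def)
      from Lim_null_comparison[OF this lim0]
      have "(\<lambda>n. smooth_clamp (?e n) a b (\<phi> n x) - clamp_real a b (u x)) \<longlonglongrightarrow> 0" .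
      then show "(\<lambda>n. smooth_clamp (?e n) a b (\<phi> n x)) \<longlonglongrightarrow> clamp_real a b (u x)" by (simp add: LIM_zero_iff)
    qed
  qed (use W_zero[OF u] clamp_real_0[OF ab] in auto)
qed


section \<open>Functions of finite energy\<close>

text \<open>The class in which equations are solved and tested. Membership in W is required of
  truncations only: for bounded functions the weighted L^p part of the norm is harmless, while for
  unbounded ones finite energy is not shown to control it.\<close>

definition X :: "('a \<Rightarrow> real) set" where
  "X = {w. w \<in> borel_measurable borel \<and> (\<forall>x. x \<notin> \<Omega> \<longrightarrow> w x = 0) \<and> energy w < \<infinity>
      \<and> (\<forall>k>0. (\<lambda>x. Tk k (w x)) \<in> W)}"

lemma X_measurable: "w \<in> X \<Longrightarrow> w \<in> borel_measurable borel"
  by (simp add: X_def)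

lemma X_zero: "w \<in> X \<Longrightarrow> x \<notin> \<Omega> \<Longrightarrow> w x = 0"
  by (simp add: X_def)

lemma X_energy: "w \<in> X \<Longrightarrow> energy w < \<infinity>"
  by (simp add: X_def)

lemma X_Tk: "w \<in> X \<Longrightarrow> k > 0 \<Longrightarrow> (\<lambda>x. Tk k (w x)) \<in> W"
  by (simp add: X_def)

lemma W_finite_energy_X: "w \<in> W \<Longrightarrow> energy w < \<infinity> \<Longrightarrow> w \<in> X"
  unfolding X_def using W_measurable W_zero W_clamp[of w "- k" k for k] by (auto simp: Tk_eq_clamp)

lemma Cc_infty_X: "\<phi> \<in> Cc_infty \<Omega> \<Longrightarrow> \<phi> \<in> X"
  by (intro W_finite_energy_X Cc_infty_W Cc_infty_energy)

text \<open>Every clamp around 0 factors through a symmetric truncation at a higher level.\<close>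

lemma truncations_clamp_W:
  assumes w: "\<And>k. k > 0 \<Longrightarrow> (\<lambda>x. Tk k (w x)) \<in> W" and ab: "a \<le> 0" "0 \<le> b"
  shows "(\<lambda>x. clamp_real a b (w x)) \<in> W"
proof -
  define k where "k = max 1 (max (- a) b)"
  have "(\<lambda>x. clamp_real a b (Tk k (w x))) \<in> W" using w[of k] ab by (intro W_clamp) (auto simp: k_def)
  moreover have "clamp_real a b (Tk k t) = clamp_real a b t" for t
    using ab by (auto simp: clamp_real_def Tk_def k_def max_def min_def)
  ultimately show ?thesis by simp
qed

lemma X_clamp_W: "w \<in> X \<Longrightarrow> a \<le> 0 \<Longrightarrow> 0 \<le> b \<Longrightarrow> (\<lambda>x. clamp_real a b (w x)) \<in> W"
  using truncations_clamp_W[of w a b] X_Tk by blast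

lemma X_clamp:
  assumes "w \<in> X" "a \<le> 0" "0 \<le> b"
  shows "(\<lambda>x. clamp_real a b (w x)) \<in> X"
proof (rule W_finite_energy_X[OF X_clamp_W[OF assms]])
  have "energy (\<lambda>x. clamp_real a b (w x)) \<le> energy w"
    by (intro energy_contraction clamp_real_lipschitz)
  then show "energy (\<lambda>x. clamp_real a b (w x)) < \<infinity>" using X_energy[OF assms(1)] by (rule order_le_less_trans)
qed

lemma Tk_lipschitz: "\<bar>Tk k a - Tk k b\<bar> \<le> \<bar>a - b\<bar>"
  unfolding Tk_eq_clamp by (rule clamp_real_lipschitz)

lemma Tk_eventually: "\<forall>\<^sub>F n in sequentially. Tk (real (Suc n)) a = a"
proof -
  obtain N where "\<bar>a\<bar> \<le> real N" using real_arch_simple by blast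
  then have "\<forall>n\<ge>N. Tk (real (Suc n)) a = a" by (auto simp: Tk_def max_def min_def)
  then show ?thesis by (auto simp: eventually_sequentially)
qed

text \<open>The truncation of a combination is not the combination of truncations. It is the
  pointwise limit of T_k applied to combinations of T_n(u) and T_n(v), whose energies are bounded
  uniformly in n.\<close>

lemma X_lincomb:
  assumes u: "u \<in> X" and v: "v \<in> X"
  shows "(\<lambda>x. a * u x + b * v x) \<in> X"
proof -
  note [measurable] = X_measurable[OF u] X_measurable[OF v]
  let ?C = "ennreal (2 powr p * \<bar>a\<bar> powr p) * energy u + ennreal (2 powr p * \<bar>b\<bar> powr p) * energy v"
  have C: "?C < \<infinity>" using X_energy[OF u] X_energy[OF v] by (simp add: ennreal_mult_less_top)
  then obtain K where K: "?C = ennreal K" by (cases ?C) auto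
  have en: "energy (\<lambda>x. a * u x + b * v x) < \<infinity>"
    by (rule order_le_less_trans[OF energy_lincomb C]) measurable
  have "(\<lambda>x. Tk k (a * u x + b * v x)) \<in> W" if k: "k > 0" for k
  proof (rule W_closed_bounded[where w="\<lambda>n x. Tk k (a * Tk (Suc n) (u x) + b * Tk (Suc n) (v x))" and k=k and K=K])
    show "(\<lambda>x. Tk k (a * Tk (Suc n) (u x) + b * Tk (Suc n) (v x))) \<in> W" for n
      unfolding Tk_eq_clamp[of k] using k by (intro W_clamp W_lincomb X_Tk u v) auto
    show "\<bar>Tk k (a * Tk (real (Suc n)) (u x) + b * Tk (real (Suc n)) (v x))\<bar> \<le> k" for n x
      using k by (auto simp: Tk_def max_def min_def)
    show "w2 (\<lambda>x. Tk k (a * Tk (Suc n) (u x) + b * Tk (Suc n) (v x))) \<le> ennreal K" for n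
    proof -
      have "w2 (\<lambda>x. Tk k (a * Tk (Suc n) (u x) + b * Tk (Suc n) (v x))) \<le> energy (\<lambda>x. Tk k (a * Tk (Suc n) (u x) + b * Tk (Suc n) (v x)))"
        by (rule w2_le_energy)
      also have "\<dots> \<le> energy (\<lambda>x. a * Tk (Suc n) (u x) + b * Tk (Suc n) (v x))"
        by (intro energy_contraction Tk_lipschitz)
      also have "\<dots> \<le> ennreal (2 powr p * \<bar>a\<bar> powr p) * energy (\<lambda>x. Tk (Suc n) (u x)) + ennreal (2 powr p * \<bar>b\<bar> powr p) * energy (\<lambda>x. Tk (Suc n) (v x))"
        by (rule energy_lincomb) measurable
      also have "\<dots> \<le> ?C"
        by (intro add_mono mult_left_mono energy_contraction Tk_lipschitz) auto
      finally show ?thesis unfolding K .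
    qed
    show "AE x in lborel. (\<lambda>n. Tk k (a * Tk (Suc n) (u x) + b * Tk (Suc n) (v x))) \<longlonglongrightarrow> Tk k (a * u x + b * v x)"
    proof (rule AE_I2)
      fix x
      have "\<forall>\<^sub>F n in sequentially. Tk k (a * u x + b * v x) = Tk k (a * Tk (Suc n) (u x) + b * Tk (Suc n) (v x))"
        using eventually_conj[OF Tk_eventually[of "u x"] Tk_eventually[of "v x"]] by eventually_elim simp
      then show "(\<lambda>n. Tk k (a * Tk (Suc n) (u x) + b * Tk (Suc n) (v x))) \<longlonglongrightarrow> Tk k (a * u x + b * v x)"
        by (rule Lim_transform_eventually[OF tendsto_const])
    qed
  qed (use k X_zero[OF u] X_zero[OF v] in \<open>auto simp: Tk_def\<close>)
  then show ?thesis using en X_zero[OF u] X_zero[OF v] unfolding X_def by auto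
qed

lemma X_abs:
  assumes u: "u \<in> X" shows "(\<lambda>x. \<bar>u x\<bar>) \<in> X"
proof -
  have "(\<lambda>x. Tk k \<bar>u x\<bar>) \<in> W" if k: "k > 0" for k
  proof -
    have "(\<lambda>x. 1 * clamp_real 0 k (u x) + (-1) * clamp_real (- k) 0 (u x)) \<in> W"
      using k u by (intro W_lincomb X_clamp_W) auto
    moreover have "Tk k \<bar>t\<bar> = 1 * clamp_real 0 k t + (-1) * clamp_real (- k) 0 t" for t
      using k by (auto simp: Tk_def clamp_real_def max_def min_def)
    ultimately show ?thesis by simp
  qed
  moreover have "energy (\<lambda>x. \<bar>u x\<bar>) \<le> energy u" by (intro energy_contraction) auto
  ultimately show ?thesis using u unfolding X_def by (auto intro: order_le_less_trans)
qed

text \<open>A ball of twice the volume of \<open>S\<close> around a point of \<open>S\<close> is at least half outside \<open>S\<close>,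
  where \<open>\<phi>\<close> vanishes.\<close>

lemma faber_krahn:
  obtains C where "C > 0" "\<And>\<phi> S. \<phi> \<in> borel_measurable borel \<Longrightarrow> S \<in> sets borel \<Longrightarrow> S \<subseteq> \<Omega> \<Longrightarrow>
     (\<And>x. x \<notin> S \<Longrightarrow> \<phi> x = 0) \<Longrightarrow>
     (\<integral>\<^sup>+ x. ennreal (\<bar>\<phi> x\<bar> powr p) \<partial>lborel) \<le> ennreal (C * measure lborel S powr (p * s / DIM('a))) * energy \<phi>"
proof -
  obtain R where R: "R > 0" "\<Omega> \<subseteq> ball 0 R"
    using bounded_subset_ballD[OF bounded_\<Omega>, of 0] by auto
  have \<Omega>fin: "emeasure lborel \<Omega> < \<infinity>" using bounded_\<Omega> by (rule emeasure_bounded_finite)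
  define N where "N = real DIM('a)"
  have N: "N > 0" by (simp add: N_def)
  define V where "V = unit_ball_vol N"
  have V: "V > 0" by (simp add: V_def N_def)
  define \<alpha> where "\<alpha> = p * s / N"
  \<comment> \<open>r0 is the radius of a ball of twice the volume of \<Omega>, the largest that can
    occur. For |x| < R and |y| < R + r0 the weights contribute at least the factor c.\<close>
  define r0 where "r0 = (2 * measure lborel \<Omega> / V) powr (1 / N)"
  define c where "c = 1 / (R powr \<beta> * (R + r0) powr \<beta>)"
  have r0: "r0 \<ge> 0" by (simp add: r0_def)
  have c: "c > 0" using R r0 by (simp add: c_def)
  define C where "C = 1 / (c / (2 / V) powr (1 + \<alpha>))"
  have C: "C > 0" using c V by (simp add: C_def)
  have "(\<integral>\<^sup>+ x. ennreal (\<bar>\<phi> x\<bar> powr p) \<partial>lborel) \<le> ennreal (C * measure lborel S powr \<alpha>) * energy \<phi>"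
    if [measurable]: "\<phi> \<in> borel_measurable borel" "S \<in> sets borel" and S: "S \<subseteq> \<Omega>" and \<phi>0: "\<And>x. x \<notin> S \<Longrightarrow> \<phi> x = 0" for \<phi> S
  proof -
    define m where "m = measure lborel S"
    have Sfin: "emeasure lborel S < \<infinity>"
      using emeasure_mono[OF S, of lborel] \<Omega>fin by (auto intro: order_le_less_trans)
    have em: "emeasure lborel S = ennreal m" using Sfin by (simp add: m_def emeasure_eq_ennreal_measure)
    show ?thesis
    proof (cases "m = 0")
      case True
      have "AE x in lborel. x \<notin> S" using em True by (intro AE_not_in) (auto simp: null_sets_def)
      then have "AE x in lborel. ennreal (\<bar>\<phi> x\<bar> powr p) = 0" by eventually_elim (use \<phi>0 p in auto)
      then have "(\<integral>\<^sup>+ x. ennreal (\<bar>\<phi> x\<bar> powr p) \<partial>lborel) = 0"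
        by (subst nn_integral_0_iff_AE) auto
      then show ?thesis by simp
    next
      case False
      then have m: "m > 0" by (simp add: m_def zero_less_measure_iff)
      define r where "r = (2 * m / V) powr (1 / N)"
      have r: "r > 0" using m V by (simp add: r_def)
      have mle: "m \<le> measure lborel \<Omega>"
        unfolding m_def using S \<Omega>fin by (intro measure_mono_fmeasurable) (auto simp: fmeasurable_def)
      have rr0: "r \<le> r0" unfolding r_def r0_def using m V mle N by (intro powr_mono2 divide_right_mono) auto
      have rN: "V * r ^ DIM('a) = 2 * m"
        using r m V N by (simp add: powr_realpow[symmetric] r_def powr_powr N_def)
      have rNs: "r powr (N + p * s) = (2 / V) powr (1 + \<alpha>) * m powr (1 + \<alpha>)"
      proof -
        have "r powr (N + p * s) = (2 * m / V) powr (1 + \<alpha>)"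
          unfolding r_def powr_powr using N by (simp add: \<alpha>_def field_simps)
        also have "\<dots> = ((2 / V) * m) powr (1 + \<alpha>)" by (simp add: field_simps)
        also have "\<dots> = (2 / V) powr (1 + \<alpha>) * m powr (1 + \<alpha>)"
          by (subst powr_mult) (use V m in auto)
        finally show ?thesis .
      qed
      define kmin where "kmin = c / r powr (N + p * s)"
      have kmin: "kmin > 0" using c r by (simp add: kmin_def)
      define \<kappa> where "\<kappa> = kmin * m"
      have inner: "ennreal \<kappa> \<le> (\<integral>\<^sup>+ y. indicator (- S) y * ennreal (knu s p \<beta> x y) \<partial>lborel)" if x: "x \<in> S" "x \<noteq> 0" for x
      proof -
        \<comment> \<open>The origin and x itself are removed because the kernel is 0 there by the
          division convention and the lower bound fails.\<close>
        let ?D = "ball x r - S - {0, x}"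
        have [measurable]: "?D \<in> sets borel" by simp
        have "ennreal (2 * m) = emeasure lborel (ball x r)"
          using r rN by (simp add: emeasure_ball V_def N_def)
        also have "\<dots> \<le> emeasure lborel (?D \<union> (S \<union> {0, x}))" by (intro emeasure_mono) auto
        also have "\<dots> \<le> emeasure lborel ?D + emeasure lborel (S \<union> {0, x})"
          by (intro emeasure_subadditive) auto
        also have "emeasure lborel (S \<union> {0, x}) \<le> emeasure lborel S + emeasure lborel {0, x}"
          by (intro emeasure_subadditive) auto
        also have "emeasure lborel {0, x} = 0" by (intro emeasure_lborel_countable) auto
        finally have "ennreal (2 * m) \<le> emeasure lborel ?D + ennreal m" by (simp add: em add_left_mono)
        then have "ennreal m + ennreal m \<le> ennreal m + emeasure lborel ?D" using m by (simp add: add.commute flip: ennreal_plus)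
        then have D: "ennreal m \<le> emeasure lborel ?D"
          unfolding ennreal_add_left_cancel_le by simp
        have "ennreal \<kappa> = ennreal kmin * ennreal m" using kmin m by (simp add: \<kappa>_def ennreal_mult)
        also have "\<dots> \<le> ennreal kmin * emeasure lborel ?D" by (intro mult_left_mono D) simp
        also have "\<dots> = (\<integral>\<^sup>+ y. ennreal kmin * indicator ?D y \<partial>lborel)" by (simp add: nn_integral_cmult_indicator)
        also have "\<dots> \<le> (\<integral>\<^sup>+ y. indicator (- S) y * ennreal (knu s p \<beta> x y) \<partial>lborel)"
        proof (rule nn_integral_mono)
          fix y
          show "ennreal kmin * indicator ?D y \<le> indicator (- S) y * ennreal (knu s p \<beta> x y)"
          proof (cases "y \<in> ?D")
            case True
            have xR: "norm x < R" using x S R by auto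
            have yR: "norm y < R + r0"
            proof -
              have "norm y \<le> norm x + norm (y - x)" using norm_triangle_sub by blast
              also have "norm (y - x) < r" using True by (simp add: dist_norm norm_minus_commute)
              finally show ?thesis using xR rr0 by linarith
            qed
            have d: "norm (x - y) \<le> r" "x \<noteq> y" using True by (auto simp: dist_norm)
            have "norm (x - y) powr (N + p * s) * norm x powr \<beta> * norm y powr \<beta> \<le> r powr (N + p * s) * R powr \<beta> * (R + r0) powr \<beta>"
              using d xR yR \<beta> p s N by (intro mult_mono powr_mono2) auto
            then have "1 / (r powr (N + p * s) * R powr \<beta> * (R + r0) powr \<beta>) \<le> knu s p \<beta> x y"
              unfolding knu_def N_def[symmetric] using d True x r R r0 by (intro divide_left_mono mult_pos_pos) auto
            then have "kmin \<le> knu s p \<beta> x y" by (simp add: kmin_def c_def mult_ac)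
            then show ?thesis using True by (simp add: ennreal_leI)
          qed simp
        qed
        finally show ?thesis .
      qed
      let ?f = "\<lambda>z. (indicator S (fst z) * ennreal (\<bar>\<phi> (fst z)\<bar> powr p)) * (indicator (- S) (snd z) * ennreal (knu s p \<beta> (fst z) (snd z)))"
      have kn: "(\<lambda>z. ennreal (knu s p \<beta> (fst z) (snd z))) \<in> borel_measurable (borel \<Otimes>\<^sub>M borel)"
        unfolding knu_def by measurable
      have fm [measurable]: "?f \<in> borel_measurable (lborel \<Otimes>\<^sub>M lborel)" using kn by measurable
      have kx: "(\<lambda>y. ennreal (knu s p \<beta> x y)) \<in> borel_measurable borel" for x unfolding knu_def by measurable
      have nz: "AE x in lborel. x \<noteq> (0::'a)" by (rule AE_I[where N="{0}"]) auto
      have "ennreal \<kappa> * (\<integral>\<^sup>+ x. ennreal (\<bar>\<phi> x\<bar> powr p) \<partial>lborel) = (\<integral>\<^sup>+ x. (indicator S x * ennreal (\<bar>\<phi> x\<bar> powr p)) * ennreal \<kappa> \<partial>lborel)"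
        by (subst nn_integral_cmult[symmetric]) (auto intro!: nn_integral_cong simp: indicator_def \<phi>0 mult.commute)
      also have "\<dots> \<le> (\<integral>\<^sup>+ x. (indicator S x * ennreal (\<bar>\<phi> x\<bar> powr p)) * (\<integral>\<^sup>+ y. indicator (- S) y * ennreal (knu s p \<beta> x y) \<partial>lborel) \<partial>lborel)"
      proof (rule nn_integral_mono_AE, use nz in eventually_elim)
        fix x :: 'a assume "x \<noteq> 0"
        then show "indicator S x * ennreal (\<bar>\<phi> x\<bar> powr p) * ennreal \<kappa> \<le> indicator S x * ennreal (\<bar>\<phi> x\<bar> powr p) * (\<integral>\<^sup>+ y. indicator (- S) y * ennreal (knu s p \<beta> x y) \<partial>lborel)"
          using inner[of x] by (cases "x \<in> S") (auto intro!: mult_left_mono)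
      qed
      also have "\<dots> = (\<integral>\<^sup>+ x. \<integral>\<^sup>+ y. ?f (x, y) \<partial>lborel \<partial>lborel)"
        using kx by (intro nn_integral_cong) (simp add: nn_integral_cmult)
      also have "\<dots> = (\<integral>\<^sup>+ z. ?f z \<partial>(lborel \<Otimes>\<^sub>M lborel))"
        by (rule lborel.nn_integral_fst[OF fm])
      also have "\<dots> \<le> (\<integral>\<^sup>+ z. ennreal (knu s p \<beta> (fst z) (snd z)) * ennreal (\<bar>dif \<phi> z\<bar> powr p) \<partial>(lborel \<Otimes>\<^sub>M lborel))"
        by (intro nn_integral_mono) (auto simp: indicator_def dif_def \<phi>0 mult.commute)
      also have "\<dots> = energy \<phi>" unfolding energy_def by (rule nn_integral_nu[symmetric]) measurable
      finally have le: "ennreal \<kappa> * (\<integral>\<^sup>+ x. ennreal (\<bar>\<phi> x\<bar> powr p) \<partial>lborel) \<le> energy \<phi>" .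
      have \<kappa>: "\<kappa> > 0" using kmin m by (simp add: \<kappa>_def)
      \<comment> \<open>\<kappa> is c m / r^(N + ps), and r^(N + ps) is a multiple of m^(1 +
        \<alpha>) because r^N is a multiple of m.\<close>
      have "1 / \<kappa> = C * m powr \<alpha>"
        unfolding \<kappa>_def kmin_def rNs C_def using m c V by (simp add: powr_add field_simps)
      then have "C * m powr \<alpha> * \<kappa> = 1" using \<kappa> by (simp add: field_simps)
      then have "(\<integral>\<^sup>+ x. ennreal (\<bar>\<phi> x\<bar> powr p) \<partial>lborel) = ennreal (C * m powr \<alpha>) * (ennreal \<kappa> * (\<integral>\<^sup>+ x. ennreal (\<bar>\<phi> x\<bar> powr p) \<partial>lborel))"
        using C \<kappa> m by (simp add: mult.assoc[symmetric] ennreal_mult[symmetric])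
      also have "\<dots> \<le> ennreal (C * m powr \<alpha>) * energy \<phi>" by (intro mult_left_mono le) simp
      finally show ?thesis by (simp add: m_def)
    qed
  qed
  then show thesis using C by (intro that[of C]) (auto simp: \<alpha>_def N_def)
qed

end

text \<open>At the limit 0 the factor |t|^(p-2) may be singular, so convergence is read off from
  |sgp p t| = |t|^(p-1).\<close>

lemma tendsto_sgp:
  assumes "p > 1" "(f \<longlongrightarrow> l) F"
  shows "((\<lambda>x. sgp p (f x)) \<longlongrightarrow> sgp p l) F"
proof (cases "l = 0")
  case True
  have "((\<lambda>x. \<bar>f x\<bar> powr (p - 1)) \<longlongrightarrow> \<bar>l\<bar> powr (p - 1)) F"
    using assms by (intro tendsto_powr' tendsto_rabs tendsto_const) auto
  then have "((\<lambda>x. \<bar>sgp p (f x)\<bar>) \<longlongrightarrow> 0) F" using assms(1) True by (simp add: abs_sgp)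
  then show ?thesis using True unfolding tendsto_rabs_zero_iff by simp
next
  case False
  then show ?thesis unfolding sgp_def by (intro tendsto_mult tendsto_powr tendsto_rabs tendsto_const assms) auto
qed

text \<open>The Riesz-Fischer argument: along a fast subsequence the increments are pointwise
  summable almost everywhere.\<close>

lemma Lp_Cauchy_AE_convergent_subseq:
  fixes f :: "nat \<Rightarrow> 'b \<Rightarrow> real"
  assumes p: "p > 1" and [measurable]: "\<And>n. f n \<in> borel_measurable M"
    and cau: "\<And>\<epsilon>. \<epsilon> > 0 \<Longrightarrow> \<exists>N. \<forall>n\<ge>N. \<forall>m\<ge>n. (\<integral>\<^sup>+ z. ennreal (\<bar>f n z - f m z\<bar> powr p) \<partial>M) \<le> ennreal \<epsilon>"
  obtains r where "strict_mono r" "AE z in M. convergent (\<lambda>n. f (r n) z)"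
proof -
  \<comment> \<open>Chosen so that after multiplication by 2^(np) the integrals are still at most
    2^(-n): the weighted terms h n then have finite sum almost everywhere, and h n z < 1 means that
    the increment is below 2^(-n).\<close>
  define \<epsilon> where "\<epsilon> n = (1/2) ^ n / (2 ^ n) powr p" for n :: nat
  have "\<epsilon> n > 0" for n by (simp add: \<epsilon>_def)
  then have "\<forall>n. \<exists>N. \<forall>i\<ge>N. \<forall>m\<ge>i. (\<integral>\<^sup>+ z. ennreal (\<bar>f i z - f m z\<bar> powr p) \<partial>M) \<le> ennreal (\<epsilon> n)"
    using cau by blast
  then obtain N where N: "\<And>n i m. i \<ge> N n \<Longrightarrow> m \<ge> i \<Longrightarrow> (\<integral>\<^sup>+ z. ennreal (\<bar>f i z - f m z\<bar> powr p) \<partial>M) \<le> ennreal (\<epsilon> n)"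
    by metis
  define r where "r = rec_nat (N 0) (\<lambda>n k. max (Suc k) (N (Suc n)))"
  have r_Suc: "r (Suc n) = max (Suc (r n)) (N (Suc n))" for n by (simp add: r_def)
  have rN: "r n \<ge> N n" for n by (cases n) (auto simp: r_def)
  have "strict_mono r" by (rule strict_mono_Suc_iff[THEN iffD2]) (auto simp: r_Suc)
  define h where "h n z = (2 ^ n) powr p * \<bar>f (r n) z - f (r (Suc n)) z\<bar> powr p" for n z
  have [measurable]: "h n \<in> borel_measurable M" for n unfolding h_def by measurable
  have hle: "(\<integral>\<^sup>+ z. ennreal (h n z) \<partial>M) \<le> ennreal ((1/2) ^ n)" for n
  proof -
    have "(\<integral>\<^sup>+ z. ennreal (h n z) \<partial>M) = ennreal ((2 ^ n) powr p) * (\<integral>\<^sup>+ z. ennreal (\<bar>f (r n) z - f (r (Suc n)) z\<bar> powr p) \<partial>M)"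
      unfolding h_def by (subst nn_integral_cmult[symmetric]) (auto simp: ennreal_mult)
    also have "\<dots> \<le> ennreal ((2 ^ n) powr p) * ennreal (\<epsilon> n)"
      by (intro mult_left_mono N rN) (auto simp: r_Suc)
    also have "\<dots> = ennreal ((1/2) ^ n)" by (simp add: \<epsilon>_def ennreal_mult[symmetric])
    finally show ?thesis .
  qed
  have "(\<integral>\<^sup>+ z. (\<Sum>n. ennreal (h n z)) \<partial>M) = (\<Sum>n. \<integral>\<^sup>+ z. ennreal (h n z) \<partial>M)"
    by (rule nn_integral_suminf) measurable
  also have "\<dots> \<le> (\<Sum>n. ennreal ((1/2) ^ n))" by (intro suminf_le hle) auto
  also have "\<dots> = ennreal 2"
    by (subst suminf_ennreal2) (auto simp: suminf_geometric)
  finally have fin: "(\<integral>\<^sup>+ z. (\<Sum>n. ennreal (h n z)) \<partial>M) \<noteq> \<infinity>" by (auto simp: top_unique)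
  have "AE z in M. (\<Sum>n. ennreal (h n z)) \<noteq> \<infinity>"
    using fin by (intro nn_integral_PInf_AE) measurable
  then have "AE z in M. convergent (\<lambda>n. f (r n) z)"
  proof eventually_elim
    fix z assume "(\<Sum>n. ennreal (h n z)) \<noteq> \<infinity>"
    then have "summable (\<lambda>n. h n z)" by (intro summable_suminf_not_top) (auto simp: h_def)
    then have "(\<lambda>n. h n z) \<longlonglongrightarrow> 0" by (rule summable_LIMSEQ_zero)
    then have ev: "\<forall>\<^sub>F n in sequentially. h n z < 1" by (rule order_tendstoD(2)) simp
    have "\<forall>\<^sub>F n in sequentially. norm (f (r (Suc n)) z - f (r n) z) \<le> (1/2) ^ n"
      using ev
    proof eventually_elim
      fix n assume "h n z < 1"
      let ?d = "\<bar>f (r n) z - f (r (Suc n)) z\<bar>"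
      have "(2 ^ n * ?d) powr p < 1 powr p" using \<open>h n z < 1\<close> by (simp add: h_def powr_mult)
      then have "2 ^ n * ?d < 1" using p by (metis powr_mono2 not_less less_eq_real_def zero_le_one order.strict_trans zero_less_one)
      then show "norm (f (r (Suc n)) z - f (r n) z) \<le> (1/2) ^ n"
        by (simp add: field_simps abs_minus_commute)
    qed
    then have "summable (\<lambda>n. f (r (Suc n)) z - f (r n) z)"
      by (rule summable_comparison_test_ev) (simp add: summable_geometric)
    then have "convergent (\<lambda>n. \<Sum>i<n. f (r (Suc i)) z - f (r i) z)" by (simp add: summable_iff_convergent)
    then have "convergent (\<lambda>n. f (r n) z - f (r 0) z)" using sum_lessThan_telescope[of "\<lambda>n. f (r n) z"] by simp
    then have "convergent (\<lambda>n. (f (r n) z - f (r 0) z) + f (r 0) z)" by (intro convergent_add convergent_const)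
    then show "convergent (\<lambda>n. f (r n) z)" by simp
  qed
  then show thesis using \<open>strict_mono r\<close> that by blast
qed

context weighted_fractional
begin

section \<open>The Poincare inequality and integrability in the energy class\<close>

lemma poincare:
  obtains C where "C > 0" "\<And>\<phi>. \<phi> \<in> borel_measurable borel \<Longrightarrow> (\<And>x. x \<notin> \<Omega> \<Longrightarrow> \<phi> x = 0) \<Longrightarrow>
     (\<integral>\<^sup>+ x. ennreal (\<bar>\<phi> x\<bar> powr p) \<partial>lborel) \<le> ennreal C * energy \<phi>"
proof -
  obtain C where C: "C > 0" "\<And>\<phi> S. \<phi> \<in> borel_measurable borel \<Longrightarrow> S \<in> sets borel \<Longrightarrow> S \<subseteq> \<Omega> \<Longrightarrow>
     (\<And>x. x \<notin> S \<Longrightarrow> \<phi> x = 0) \<Longrightarrow>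
     (\<integral>\<^sup>+ x. ennreal (\<bar>\<phi> x\<bar> powr p) \<partial>lborel) \<le> ennreal (C * measure lborel S powr (p * s / DIM('a))) * energy \<phi>"
    using faber_krahn by metis
  define K where "K = C * measure lborel \<Omega> powr (p * s / DIM('a)) + 1"
  have K: "K > 0" using C(1) by (simp add: K_def add_nonneg_pos)
  have "(\<integral>\<^sup>+ x. ennreal (\<bar>\<phi> x\<bar> powr p) \<partial>lborel) \<le> ennreal K * energy \<phi>"
    if "\<phi> \<in> borel_measurable borel" "\<And>x. x \<notin> \<Omega> \<Longrightarrow> \<phi> x = 0" for \<phi>
  proof -
    have "(\<integral>\<^sup>+ x. ennreal (\<bar>\<phi> x\<bar> powr p) \<partial>lborel) \<le> ennreal (C * measure lborel \<Omega> powr (p * s / DIM('a))) * energy \<phi>"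
      using that by (intro C(2)) auto
    also have "\<dots> \<le> ennreal K * energy \<phi>" by (intro mult_right_mono ennreal_leI) (auto simp: K_def)
    finally show ?thesis .
  qed
  with K show thesis by (rule that)
qed

lemma \<Omega>_finite: "emeasure lborel \<Omega> < \<infinity>"
  using bounded_\<Omega> by (rule emeasure_bounded_finite)

lemma integrable_indicator_\<Omega>: "integrable lborel (\<lambda>x. c * indicator \<Omega> x :: real)"
  using \<Omega>_finite by (intro integrable_mult_right) (simp add: integrable_indicator_iff)

lemma X_dif_integrable:
  assumes w: "w \<in> X" shows "integrable \<nu> (\<lambda>z. \<bar>dif w z\<bar> powr p)"
proof -
  note [measurable] = X_measurable[OF w]
  show ?thesis using X_energy[OF w] by (intro integrableI_nonneg) (auto simp: energy_def)
qed

lemma X_energy_eq: "w \<in> X \<Longrightarrow> energy w = ennreal (\<integral>z. \<bar>dif w z\<bar> powr p \<partial>\<nu>)"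
  unfolding energy_def by (intro nn_integral_eq_integral X_dif_integrable) auto

lemma X_powr_integrable:
  assumes w: "w \<in> X" shows "integrable lborel (\<lambda>x. \<bar>w x\<bar> powr p)"
proof -
  note [measurable] = X_measurable[OF w]
  obtain C where C: "\<And>\<phi>. \<phi> \<in> borel_measurable borel \<Longrightarrow> (\<And>x. x \<notin> \<Omega> \<Longrightarrow> \<phi> x = 0) \<Longrightarrow>
     (\<integral>\<^sup>+ x. ennreal (\<bar>\<phi> x\<bar> powr p) \<partial>lborel) \<le> ennreal C * energy \<phi>"
    using poincare by metis
  have "(\<integral>\<^sup>+ x. ennreal (\<bar>w x\<bar> powr p) \<partial>lborel) \<le> ennreal C * energy w"
    using X_zero[OF w] by (intro C) auto
  also have "\<dots> < \<infinity>" using X_energy[OF w] by (simp add: ennreal_mult_less_top)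
  finally show ?thesis by (intro integrableI_nonneg) auto
qed

text \<open>As 1 - p < 0, a large \<delta> makes the coefficient of |t|^p small, which gives
  coercivity, whereas a small \<delta> makes the constant term small, which gives continuity of the
  linear functional.\<close>

lemma abs_le_powr_split:
  assumes "\<delta> > 0" shows "\<bar>t\<bar> \<le> \<delta> + \<delta> powr (1 - p) * \<bar>t\<bar> powr p"
proof (cases "\<bar>t\<bar> \<le> \<delta>")
  case True
  then show ?thesis by (simp add: add_increasing2)
next
  case False
  have "1 = \<delta> powr (1 - p) * \<delta> powr (p - 1)" using assms by (simp flip: powr_add)
  also have "\<dots> \<le> \<delta> powr (1 - p) * \<bar>t\<bar> powr (p - 1)" using False assms p by (intro mult_left_mono powr_mono2) auto
  finally have "\<bar>t\<bar> * 1 \<le> \<bar>t\<bar> * (\<delta> powr (1 - p) * \<bar>t\<bar> powr (p - 1))" by (intro mult_left_mono) auto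
  also have "\<dots> = \<delta> powr (1 - p) * \<bar>t\<bar> powr p" using False assms by (simp add: powr_diff field_simps)
  finally show ?thesis using assms by simp
qed

lemma X_integrable_bounded_mult:
  assumes w: "w \<in> X" and [measurable]: "f \<in> borel_measurable borel" and f: "\<And>x. \<bar>f x\<bar> \<le> c"
  shows "integrable lborel (\<lambda>x. f x * w x)"
proof (rule Bochner_Integration.integrable_bound[where f="\<lambda>x. c * (indicator \<Omega> x + \<bar>w x\<bar> powr p)"])
  note [measurable] = X_measurable[OF w]
  show "integrable lborel (\<lambda>x. c * (indicator \<Omega> x + \<bar>w x\<bar> powr p))"
    using integrable_indicator_\<Omega>[of 1] X_powr_integrable[OF w]
    by (intro integrable_mult_right Bochner_Integration.integrable_add) auto
  have c: "c \<ge> 0" using f[of 0] by linarith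
  show "AE x in lborel. norm (f x * w x) \<le> norm (c * (indicator \<Omega> x + \<bar>w x\<bar> powr p))"
  proof (rule AE_I2)
    fix x
    have "\<bar>w x\<bar> \<le> indicator \<Omega> x + \<bar>w x\<bar> powr p"
      using abs_le_powr_split[of 1 "w x"] X_zero[OF w, of x] by (auto simp: indicator_def)
    then have "\<bar>f x\<bar> * \<bar>w x\<bar> \<le> c * (indicator \<Omega> x + \<bar>w x\<bar> powr p)" using f c by (intro mult_mono) auto
    then show "norm (f x * w x) \<le> norm (c * (indicator \<Omega> x + \<bar>w x\<bar> powr p))" using c by (simp add: abs_mult)
  qed
  show "(\<lambda>x. f x * w x) \<in> borel_measurable lborel" by measurable
qed

text \<open>A majorant uniform in the step t, for dominated convergence in the first
  variation.\<close>

lemma sgp_dif_bound: "\<bar>sgp p (a + t * b) * b\<bar> \<le> 2 powr p * (\<bar>a\<bar> powr p + \<bar>b\<bar> powr p)" if "\<bar>t\<bar> \<le> 1" for a b t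
proof -
  have "\<bar>t * b\<bar> \<le> \<bar>b\<bar>" using that by (simp add: abs_mult mult_left_le_one_le)
  then have 1: "\<bar>a + t * b\<bar> \<le> \<bar>a\<bar> + \<bar>b\<bar>" by linarith
  have "\<bar>sgp p (a + t * b) * b\<bar> \<le> (\<bar>a\<bar> + \<bar>b\<bar>) powr (p - 1) * (\<bar>a\<bar> + \<bar>b\<bar>)"
    unfolding abs_mult abs_sgp[OF p(1)] using 1 p by (intro mult_mono powr_mono2) auto
  also have "\<dots> = \<bar>\<bar>a\<bar> + \<bar>b\<bar>\<bar> powr p"
    by (cases "\<bar>a\<bar> + \<bar>b\<bar> = 0") (auto simp: powr_diff)
  also have "\<dots> \<le> 2 powr p * (\<bar>a\<bar> powr p + \<bar>b\<bar> powr p)" using abs_add_powr_le[of p "\<bar>a\<bar>" "\<bar>b\<bar>"] p by simp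
  finally show ?thesis .
qed

lemma X_sgp_integrable:
  assumes w: "w \<in> X" and \<psi>: "\<psi> \<in> X" and t: "\<bar>t\<bar> \<le> 1"
  shows "integrable \<nu> (\<lambda>z. sgp p (dif w z + t * dif \<psi> z) * dif \<psi> z)"
proof (rule Bochner_Integration.integrable_bound[where f="\<lambda>z. 2 powr p * (\<bar>dif w z\<bar> powr p + \<bar>dif \<psi> z\<bar> powr p)"])
  note [measurable] = X_measurable[OF w] X_measurable[OF \<psi>]
  show "integrable \<nu> (\<lambda>z. 2 powr p * (\<bar>dif w z\<bar> powr p + \<bar>dif \<psi> z\<bar> powr p))"
    using X_dif_integrable[OF w] X_dif_integrable[OF \<psi>] by (intro integrable_mult_right Bochner_Integration.integrable_add)
  show "AE z in \<nu>. norm (sgp p (dif w z + t * dif \<psi> z) * dif \<psi> z) \<le> norm (2 powr p * (\<bar>dif w z\<bar> powr p + \<bar>dif \<psi> z\<bar> powr p))"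
    using sgp_dif_bound[OF t] by (intro AE_I2) simp
  show "(\<lambda>z. sgp p (dif w z + t * dif \<psi> z) * dif \<psi> z) \<in> borel_measurable \<nu>" by measurable
qed

definition weak_solution :: "('a \<Rightarrow> real) \<Rightarrow> ('a \<Rightarrow> real) \<Rightarrow> bool" where
  "weak_solution f w \<longleftrightarrow> w \<in> X \<and> (\<forall>x. 0 \<le> w x) \<and>
     (\<forall>\<psi>\<in>X. integrable \<nu> (\<lambda>z. sgp p (dif w z) * dif \<psi> z) \<and>
        (1/2) * (\<integral>z. sgp p (dif w z) * dif \<psi> z \<partial>\<nu>) = (\<integral>x. f x * \<psi> x \<partial>lborel))"


section \<open>Weak solutions for bounded data\<close>

text \<open>The direct method for J(w) = e(w)/(2p) - \<integral> f w over X. The factor 1/(2p) makes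
  the derivative of the first term equal to half the integral of \<open>sgp\<close>, as in the
  equation.\<close>

lemma weak_solution_exists:
  assumes [measurable]: "f \<in> borel_measurable borel" and f: "\<And>x. 0 \<le> f x" "\<And>x. f x \<le> c"
  shows "\<exists>w. weak_solution f w"
proof -
  have fabs: "\<bar>f x\<bar> \<le> c" for x using f[of x] by simp
  have c0: "c \<ge> 0" using f[of 0] by linarith
  obtain CP where CP: "CP > 0" "\<And>\<phi>. \<phi> \<in> borel_measurable borel \<Longrightarrow> (\<And>x. x \<notin> \<Omega> \<Longrightarrow> \<phi> x = 0) \<Longrightarrow>
     (\<integral>\<^sup>+ x. ennreal (\<bar>\<phi> x\<bar> powr p) \<partial>lborel) \<le> ennreal CP * energy \<phi>"
    using poincare by metis

  \<comment> \<open>Coercivity of the functional\<close>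
  define e where "e w = (\<integral>z. \<bar>dif w z\<bar> powr p \<partial>\<nu>)" for w :: "'a \<Rightarrow> real"
  define l where "l w = (\<integral>x. f x * w x \<partial>lborel)" for w
  define J where "J w = e w / (2 * p) - l w" for w
  have en: "energy w = ennreal (e w)" if "w \<in> X" for w using X_energy_eq[OF that] by (simp add: e_def)
  have e0: "e w \<ge> 0" for w by (simp add: e_def)
  have pc: "(\<integral>x. \<bar>w x\<bar> powr p \<partial>lborel) \<le> CP * e w" if w: "w \<in> X" for w
  proof -
    have "ennreal (\<integral>x. \<bar>w x\<bar> powr p \<partial>lborel) = (\<integral>\<^sup>+ x. ennreal (\<bar>w x\<bar> powr p) \<partial>lborel)"
      by (intro nn_integral_eq_integral[symmetric] X_powr_integrable w) auto
    also have "\<dots> \<le> ennreal CP * energy w" using X_measurable[OF w] X_zero[OF w] by (intro CP) auto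
    also have "\<dots> = ennreal (CP * e w)" using CP e0 by (simp add: en[OF w] ennreal_mult)
    finally show ?thesis using CP(1) e0 by (subst (asm) ennreal_le_iff) auto
  qed
  note fint = X_integrable_bounded_mult[OF _ assms(1) fabs]
  have labs: "\<bar>l w\<bar> \<le> c * \<delta> * measure lborel \<Omega> + c * \<delta> powr (1 - p) * CP * e w" if w: "w \<in> X" and d: "\<delta> > 0" for w \<delta>
  proof -
    have "\<bar>l w\<bar> \<le> (\<integral>x. c * \<delta> * indicator \<Omega> x + c * \<delta> powr (1 - p) * \<bar>w x\<bar> powr p \<partial>lborel)"
      unfolding l_def
    proof (rule integral_abs_bound_integral)
      show "integrable lborel (\<lambda>x. c * \<delta> * indicator \<Omega> x + c * \<delta> powr (1 - p) * \<bar>w x\<bar> powr p)"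
        by (intro Bochner_Integration.integrable_add integrable_indicator_\<Omega> integrable_mult_right X_powr_integrable w)
      fix x
      have "\<bar>w x\<bar> \<le> \<delta> * indicator \<Omega> x + \<delta> powr (1 - p) * \<bar>w x\<bar> powr p"
        using abs_le_powr_split[OF d, of "w x"] X_zero[OF w, of x] by (auto simp: indicator_def)
      then have "\<bar>f x\<bar> * \<bar>w x\<bar> \<le> c * (\<delta> * indicator \<Omega> x + \<delta> powr (1 - p) * \<bar>w x\<bar> powr p)"
        using fabs c0 by (intro mult_mono) auto
      then show "\<bar>f x * w x\<bar> \<le> c * \<delta> * indicator \<Omega> x + c * \<delta> powr (1 - p) * \<bar>w x\<bar> powr p"
        by (simp add: abs_mult algebra_simps)
    qed (rule fint[OF w])
    also have "\<dots> = c * \<delta> * measure lborel \<Omega> + c * \<delta> powr (1 - p) * (\<integral>x. \<bar>w x\<bar> powr p \<partial>lborel)"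
      by (subst Bochner_Integration.integral_add)
         (use integrable_indicator_\<Omega>[of 1] in \<open>auto intro!: integrable_mult_right X_powr_integrable w\<close>)
    also have "\<dots> \<le> c * \<delta> * measure lborel \<Omega> + c * \<delta> powr (1 - p) * (CP * e w)"
      using c0 by (intro add_left_mono mult_left_mono pc w) auto
    finally show ?thesis by (simp add: mult.assoc)
  qed
  \<comment> \<open>The linear term may consume at most half of e/(2p), hence the target 1/(4p).
    Taking the power 1/(p-1) makes \<delta>^(1-p) the reciprocal of 4p(c+1)CP; c + 1 avoids a
    division by zero.\<close>
  obtain \<delta> where \<delta>: "\<delta> > 0" "c * \<delta> powr (1 - p) * CP \<le> 1 / (4 * p)"
  proof -
    define \<delta> where "\<delta> = (4 * p * (c + 1) * CP) powr (1 / (p - 1))"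
    have B: "4 * p * (c + 1) * CP > 0" using p c0 CP(1) by simp
    have "\<delta> powr (1 - p) = (4 * p * (c + 1) * CP) powr (1 / (p - 1) * (1 - p))"
      unfolding \<delta>_def powr_powr ..
    also have "1 / (p - 1) * (1 - p) = -1" using p by (simp add: field_simps)
    finally have "\<delta> powr (1 - p) = 1 / (4 * p * (c + 1) * CP)" using B by (simp add: powr_minus_divide)
    then have "c * \<delta> powr (1 - p) * CP = c / (4 * p * (c + 1))" using CP(1) by simp
    also have "\<dots> \<le> (c + 1) / (4 * p * (c + 1))" using c0 p by (intro divide_right_mono) auto
    also have "\<dots> = 1 / (4 * p)" using c0 by simp
    finally show thesis using B by (intro that[of \<delta>]) (auto simp: \<delta>_def)
  qed
  define K0 where "K0 = c * \<delta> * measure lborel \<Omega>"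
  have coer: "e w / (4 * p) - K0 \<le> J w" if w: "w \<in> X" for w
  proof -
    have "l w \<le> K0 + c * \<delta> powr (1 - p) * CP * e w" using labs[OF w \<delta>(1)] by (simp add: K0_def)
    also have "c * \<delta> powr (1 - p) * CP * e w \<le> 1 / (4 * p) * e w" by (intro mult_right_mono \<delta> e0)
    finally have "l w \<le> K0 + 1 / (4 * p) * e w" by simp
    moreover have "e w / (2 * p) = 1 / (4 * p) * e w + e w / (4 * p)" using p by (simp add: field_simps)
    ultimately show ?thesis by (simp add: J_def)
  qed
  have Jlow: "- K0 \<le> J w" if "w \<in> X" for w
  proof -
    have "0 \<le> e w / (4 * p)" using e0[of w] p by simp
    then show ?thesis using coer[OF that] by linarith
  qed
  have X0: "(\<lambda>_. 0) \<in> X" by (intro Cc_infty_X) (simp add: Cc_infty_def smooth_on_def Ck_on_const open_\<Omega>)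

  \<comment> \<open>A minimising sequence and its limit\<close>
  define I where "I = (INF w\<in>X. J w)"
  have bb: "bdd_below (J ` X)" using Jlow by (intro bdd_belowI[of _ "- K0"]) auto
  have Ile: "I \<le> J w" if "w \<in> X" for w unfolding I_def using that by (intro cINF_lower bb)
  have "\<exists>w\<in>X. J w < I + 1 / Suc n" for n
  proof -
    have "(INF w\<in>X. J w) < I + 1 / Suc n" unfolding I_def by simp
    then show ?thesis using X0 bb by (subst (asm) cINF_less_iff) auto
  qed
  then obtain w where w: "\<And>n. w n \<in> X" "\<And>n. J (w n) < I + 1 / Suc n" by metis
  note [measurable] = X_measurable[OF w(1)]
  define K where "K = max 0 (4 * p * (I + 1 + K0))"
  have eK: "e (w n) \<le> K" for n
  proof -
    have "1 / real (Suc n) \<le> 1" by simp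
    then have "e (w n) / (4 * p) \<le> I + 1 + K0" using coer[OF w(1), of n] w(2)[of n] by linarith
    then show ?thesis using p by (simp add: K_def field_simps)
  qed
  have lX: "l (\<lambda>x. a * u x + b * v x) = a * l u + b * l v" if "u \<in> X" "v \<in> X" for a b u v
  proof -
    have "l (\<lambda>x. a * u x + b * v x) = (\<integral>x. a * (f x * u x) + b * (f x * v x) \<partial>lborel)"
      unfolding l_def by (simp add: algebra_simps)
    also have "\<dots> = a * l u + b * l v" unfolding l_def
      using fint[OF that(1)] fint[OF that(2)] by simp
    finally show ?thesis .
  qed
  have cauchy: "\<exists>N. \<forall>n\<ge>N. \<forall>m\<ge>n. (\<integral>\<^sup>+ z. ennreal (\<bar>dif (w n) z - dif (w m) z\<bar> powr p) \<partial>\<nu>) \<le> ennreal \<epsilon>" if "\<epsilon> > 0" for \<epsilon>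
  \<comment> \<open>The linear part cancels at midpoints, so near minimality of J passes to the
    energies, multiplied by 2p.\<close>
  proof (rule Lp_uniform_convex_Cauchy[OF p(1), where e="\<lambda>n. e (w n)" and K=K and d="\<lambda>n. 2 * p * (1 / Suc n)"])
    show "(\<integral>\<^sup>+ z. ennreal (\<bar>dif (w n) z\<bar> powr p) \<partial>\<nu>) = ennreal (e (w n))" for n
      using en[OF w(1), of n] by (simp add: energy_def)
    show "ennreal ((e (w n) + e (w m)) / 2 - 2 * p * (1 / real (Suc n)))
        \<le> (\<integral>\<^sup>+ z. ennreal (\<bar>(dif (w n) z + dif (w m) z) / 2\<bar> powr p) \<partial>\<nu>)" if nm: "n \<le> m" for n m
    proof -
      let ?m = "\<lambda>x. 1/2 * w n x + 1/2 * w m x"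
      have mX: "?m \<in> X" by (intro X_lincomb w)
      have deq: "dif ?m z = (dif (w n) z + dif (w m) z) / 2" for z
        by (simp add: dif_def algebra_simps add_divide_distrib diff_divide_distrib)
      have eq: "(\<integral>\<^sup>+ z. ennreal (\<bar>(dif (w n) z + dif (w m) z) / 2\<bar> powr p) \<partial>\<nu>) = ennreal (e ?m)"
        unfolding en[OF mX, symmetric] energy_def deq ..
      have "1 / real (Suc m) \<le> 1 / real (Suc n)" using nm by (simp add: frac_le)
      moreover have "J ?m = e ?m / (2 * p) - (l (w n) + l (w m)) / 2" unfolding J_def lX[OF w(1) w(1)] by (simp add: add_divide_distrib)
      moreover have "J (w n) = e (w n) / (2 * p) - l (w n)" "J (w m) = e (w m) / (2 * p) - l (w m)" by (simp_all add: J_def)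
      ultimately have "(e (w n) / (2 * p) + e (w m) / (2 * p)) / 2 - 1 / real (Suc n) \<le> e ?m / (2 * p)"
        using Ile[OF mX] w(2)[of n] w(2)[of m] by argo
      then have "2 * p * ((e (w n) / (2 * p) + e (w m) / (2 * p)) / 2 - 1 / real (Suc n)) \<le> 2 * p * (e ?m / (2 * p))"
        using p by (intro mult_left_mono) auto
      moreover have "2 * p * ((e (w n) / (2 * p) + e (w m) / (2 * p)) / 2 - 1 / real (Suc n)) = (e (w n) + e (w m)) / 2 - 2 * p * (1 / real (Suc n))"
        using p by (simp add: right_diff_distrib add_divide_distrib distrib_left)
      ultimately have "(e (w n) + e (w m)) / 2 - 2 * p * (1 / real (Suc n)) \<le> e ?m" using p by simp
      then show ?thesis unfolding eq by (rule ennreal_leI)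
    qed
    have "(\<lambda>n. 2 * p * (1 / real (Suc n))) \<longlonglongrightarrow> 2 * p * 0"
      using LIMSEQ_inverse_real_of_nat by (intro tendsto_mult tendsto_const) (simp add: inverse_eq_divide)
    then show "(\<lambda>n. 2 * p * (1 / real (Suc n))) \<longlonglongrightarrow> 0" by simp
  qed (use that e0 eK in auto)
  have diffX: "(\<lambda>x. w n x - w m x) \<in> X" for n m
    using X_lincomb[OF w(1)[of n] w(1)[of m], of 1 "-1"] by simp
  have ecauchy: "\<exists>N. \<forall>n\<ge>N. \<forall>m\<ge>n. energy (\<lambda>x. w n x - w m x) \<le> ennreal \<epsilon>" if "\<epsilon> > 0" for \<epsilon>
  proof -
    have "energy (\<lambda>x. w n x - w m x) = (\<integral>\<^sup>+ z. ennreal (\<bar>dif (w n) z - dif (w m) z\<bar> powr p) \<partial>\<nu>)" for n m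
      unfolding energy_def by (intro nn_integral_cong) (simp add: dif_def algebra_simps)
    then show ?thesis using cauchy[OF that] by simp
  qed
  have pcau: "\<exists>N. \<forall>n\<ge>N. \<forall>m\<ge>n. (\<integral>\<^sup>+ x. ennreal (\<bar>w n x - w m x\<bar> powr p) \<partial>lborel) \<le> ennreal \<epsilon>" if "\<epsilon> > 0" for \<epsilon>
  proof -
    have "\<epsilon> / CP > 0" using that CP(1) by simp
    from ecauchy[OF this] obtain N where N: "\<And>n m. n \<ge> N \<Longrightarrow> m \<ge> n \<Longrightarrow> energy (\<lambda>x. w n x - w m x) \<le> ennreal (\<epsilon> / CP)"
      by blast
    have "(\<integral>\<^sup>+ x. ennreal (\<bar>w n x - w m x\<bar> powr p) \<partial>lborel) \<le> ennreal \<epsilon>" if "n \<ge> N" "m \<ge> n" for n m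
    proof -
      have "(\<integral>\<^sup>+ x. ennreal (\<bar>w n x - w m x\<bar> powr p) \<partial>lborel) \<le> ennreal CP * energy (\<lambda>x. w n x - w m x)"
        using X_zero[OF diffX] by (intro CP(2)) auto
      also have "\<dots> \<le> ennreal CP * ennreal (\<epsilon> / CP)" by (intro mult_left_mono N that) auto
      also have "\<dots> = ennreal \<epsilon>" using CP(1) \<open>\<epsilon> > 0\<close> by (simp add: ennreal_mult[symmetric])
      finally show ?thesis .
    qed
    then show ?thesis by blast
  qed
  have wm: "w n \<in> borel_measurable lborel" for n by measurable
  obtain r where r: "strict_mono r" "AE x in lborel. convergent (\<lambda>n. w (r n) x)"
    by (rule Lp_Cauchy_AE_convergent_subseq[OF p(1) wm pcau])
  \<comment> \<open>Where the subsequence diverges \<open>lim\<close> is arbitrary, but that happens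
    only on a null set inside \<Omega>; outside \<Omega> all terms are 0.\<close>
  define u where "u x = lim (\<lambda>n. w (r n) x)" for x
  have [measurable]: "u \<in> borel_measurable borel" unfolding u_def by measurable
  have u0: "u x = 0" if "x \<notin> \<Omega>" for x unfolding u_def using X_zero[OF w(1) that] by simp
  have ae: "AE x in lborel. (\<lambda>n. w (r n) x) \<longlonglongrightarrow> u x"
    using r(2) by eventually_elim (simp add: u_def convergent_LIMSEQ_iff)
  have aed: "AE z in \<nu>. (\<lambda>n. dif (w (r n)) z) \<longlonglongrightarrow> dif u z"
    using AE_nu[OF ae] by eventually_elim (auto simp: dif_def intro!: tendsto_intros)
  have rge: "r n \<ge> n" for n using r(1) by (rule seq_suble)
  have "(\<lambda>n. \<integral>\<^sup>+ z. ennreal (\<bar>dif (w (r n)) z - dif u z\<bar> powr p) \<partial>\<nu>) \<longlonglongrightarrow> 0"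
  proof (rule Lp_Cauchy_AE_limit[OF p(1) _ _ aed])
    fix \<epsilon> :: real assume "\<epsilon> > 0"
    then obtain N where N: "\<And>n m. n \<ge> N \<Longrightarrow> m \<ge> n \<Longrightarrow> (\<integral>\<^sup>+ z. ennreal (\<bar>dif (w n) z - dif (w m) z\<bar> powr p) \<partial>\<nu>) \<le> ennreal \<epsilon>"
      using cauchy by blast
    have "(\<integral>\<^sup>+ z. ennreal (\<bar>dif (w (r n)) z - dif (w (r m)) z\<bar> powr p) \<partial>\<nu>) \<le> ennreal \<epsilon>" if "n \<ge> N" "m \<ge> n" for n m
      using that rge[of n] r(1) by (intro N) (auto simp: strict_mono_less_eq)
    then show "\<exists>N. \<forall>n\<ge>N. \<forall>m\<ge>n. (\<integral>\<^sup>+ z. ennreal (\<bar>dif (w (r n)) z - dif (w (r m)) z\<bar> powr p) \<partial>\<nu>) \<le> ennreal \<epsilon>" by blast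
  qed measurable
  then have elim: "(\<lambda>n. energy (\<lambda>x. w (r n) x - u x)) \<longlonglongrightarrow> 0"
  proof (rule Lim_transform_eventually)
    show "\<forall>\<^sub>F n in sequentially. (\<integral>\<^sup>+ z. ennreal (\<bar>dif (w (r n)) z - dif u z\<bar> powr p) \<partial>\<nu>) = energy (\<lambda>x. w (r n) x - u x)"
      unfolding energy_def by (intro always_eventually allI nn_integral_cong) (simp add: dif_def algebra_simps)
  qed
  have eu: "energy u \<le> liminf (\<lambda>n. ennreal (e (w (r n))))"
  proof -
    have "energy u = (\<integral>\<^sup>+ z. liminf (\<lambda>n. ennreal (\<bar>dif (w (r n)) z\<bar> powr p)) \<partial>\<nu>)"
      unfolding energy_def
    proof (rule nn_integral_cong_AE, use aed in eventually_elim)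
      fix z assume "(\<lambda>n. dif (w (r n)) z) \<longlonglongrightarrow> dif u z"
      then have "(\<lambda>n. ennreal (\<bar>dif (w (r n)) z\<bar> powr p)) \<longlonglongrightarrow> ennreal (\<bar>dif u z\<bar> powr p)"
        using p by (intro tendsto_ennrealI tendsto_powr' tendsto_rabs tendsto_const) auto
      then show "ennreal (\<bar>dif u z\<bar> powr p) = liminf (\<lambda>n. ennreal (\<bar>dif (w (r n)) z\<bar> powr p))"
        by (intro lim_imp_Liminf[symmetric]) auto
    qed
    also have "\<dots> \<le> liminf (\<lambda>n. \<integral>\<^sup>+ z. ennreal (\<bar>dif (w (r n)) z\<bar> powr p) \<partial>\<nu>)"
      by (rule nn_integral_liminf) measurable
    finally show ?thesis using en[OF w(1)] by (simp add: energy_def)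
  qed
  have "liminf (\<lambda>n. ennreal (e (w (r n)))) \<le> ennreal K"
    by (rule Liminf_le) (auto intro!: always_eventually ennreal_leI eK)
  then have uen: "energy u < \<infinity>" using eu by (simp add: order_le_less_trans[of _ "ennreal K"])
  have uX: "u \<in> X"
  proof -
    have "(\<lambda>x. Tk k (u x)) \<in> W" if k: "k > 0" for k
    proof (rule W_closed_bounded[where w="\<lambda>n x. Tk k (w (r n) x)" and k=k and K=K])
      show "(\<lambda>x. Tk k (w (r n) x)) \<in> W" for n by (intro X_Tk w k)
      show "\<bar>Tk k (w (r n) x)\<bar> \<le> k" for n x using k by (auto simp: Tk_def max_def min_def)
      show "w2 (\<lambda>x. Tk k (w (r n) x)) \<le> ennreal K" for n
      proof -
        have "w2 (\<lambda>x. Tk k (w (r n) x)) \<le> energy (\<lambda>x. Tk k (w (r n) x))" by (rule w2_le_energy)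
        also have "\<dots> \<le> energy (w (r n))" by (intro energy_contraction Tk_lipschitz)
        also have "\<dots> \<le> ennreal K" unfolding en[OF w(1)] by (intro ennreal_leI eK)
        finally show ?thesis .
      qed
      show "AE x in lborel. (\<lambda>n. Tk k (w (r n) x)) \<longlonglongrightarrow> Tk k (u x)"
        using ae by eventually_elim (auto simp: Tk_def intro!: tendsto_intros)
    qed (use u0 k in \<open>auto simp: Tk_def\<close>)
    then show ?thesis using uen u0 unfolding X_def by auto
  qed
  have llim: "(\<lambda>n. l (w (r n))) \<longlonglongrightarrow> l u"
  proof -
    have dX: "(\<lambda>x. w (r n) x - u x) \<in> X" for n
      using X_lincomb[OF w(1)[of "r n"] uX, of 1 "-1"] by simp
    have "(\<lambda>n. e (\<lambda>x. w (r n) x - u x)) \<longlonglongrightarrow> 0"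
      using elim unfolding en[OF dX] by (simp add: ennreal_tendsto_0_iff e0)
    note e1 = this
    have "(\<lambda>n. l (w (r n)) - l u) \<longlonglongrightarrow> 0"
    proof (rule LIMSEQ_I)
      fix \<eta> :: real assume \<eta>: "\<eta> > 0"
      \<comment> \<open>The splitting bound for l is used with d small enough for the constant term;
        its energy coefficient M depends on d but is fixed, and the energies of the differences tend
        to 0.\<close>
      define d where "d = \<eta> / (2 * (c * measure lborel \<Omega> + 1))"
      have dpos: "d > 0" using \<eta> c0 by (simp add: d_def add_nonneg_pos)
      have d1: "c * d * measure lborel \<Omega> \<le> \<eta> / 2"
      proof -
        have A: "c * measure lborel \<Omega> \<ge> 0" using c0 by simp
        have "c * d * measure lborel \<Omega> = (c * measure lborel \<Omega>) * (\<eta> / (2 * (c * measure lborel \<Omega> + 1)))"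
          by (simp add: d_def)
        also have "\<dots> \<le> \<eta> / 2" using A \<eta> by (simp add: divide_le_eq mult_left_mono)
        finally show ?thesis .
      qed
      define M where "M = c * d powr (1 - p) * CP + 1"
      have M: "M > 0" unfolding M_def using c0 CP(1) by (simp add: add_nonneg_pos)
      obtain N where N: "\<And>n. n \<ge> N \<Longrightarrow> e (\<lambda>x. w (r n) x - u x) < \<eta> / 2 / M"
        using order_tendstoD(2)[OF e1, of "\<eta> / 2 / M"] \<eta> M by (auto simp: eventually_sequentially)
      have "norm (l (w (r n)) - l u - 0) < \<eta>" if "n \<ge> N" for n
      proof -
        have "l (w (r n)) - l u = l (\<lambda>x. w (r n) x - u x)" using lX[OF w(1)[of "r n"] uX, of 1 "-1"] by simp
        then have "\<bar>l (w (r n)) - l u\<bar> \<le> c * d * measure lborel \<Omega> + c * d powr (1 - p) * CP * e (\<lambda>x. w (r n) x - u x)"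
          using labs[OF dX dpos, of n] by simp
        also have "c * d powr (1 - p) * CP * e (\<lambda>x. w (r n) x - u x) \<le> M * e (\<lambda>x. w (r n) x - u x)"
          using e0 by (intro mult_right_mono) (auto simp: M_def)
        also have "M * e (\<lambda>x. w (r n) x - u x) < M * (\<eta> / 2 / M)" using N[OF that] M by (intro mult_strict_left_mono)
        also have "M * (\<eta> / 2 / M) = \<eta> / 2" using M by simp
        finally show ?thesis using d1 by simp
      qed
      then show "\<exists>N. \<forall>n\<ge>N. norm (l (w (r n)) - l u - 0) < \<eta>" by blast
    qed
    then show ?thesis by (simp add: LIM_zero_iff)
  qed
  have Jlim: "(\<lambda>n. J (w (r n))) \<longlonglongrightarrow> I"
  proof (rule tendsto_sandwich)
    show "\<forall>\<^sub>F n in sequentially. I \<le> J (w (r n))" using Ile[OF w(1)] by simp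
    show "\<forall>\<^sub>F n in sequentially. J (w (r n)) \<le> I + 1 / Suc n"
    proof (intro always_eventually allI)
      fix n
      have "1 / real (Suc (r n)) \<le> 1 / real (Suc n)" using rge[of n] by (simp add: frac_le)
      then show "J (w (r n)) \<le> I + 1 / Suc n" using w(2)[of "r n"] by linarith
    qed
    have "(\<lambda>n. I + 1 / real (Suc n)) \<longlonglongrightarrow> I + 0"
      using LIMSEQ_inverse_real_of_nat by (intro tendsto_intros) (simp add: inverse_eq_divide)
    then show "(\<lambda>n. I + 1 / real (Suc n)) \<longlonglongrightarrow> I" by simp
  qed simp
  \<comment> \<open>As J and l converge along the sequence, so do the energies, and Fatou's bound
    for e u becomes a bound by that limit.\<close>
  have Ju: "J u \<le> I"
  proof -
    have "(\<lambda>n. 2 * p * (J (w (r n)) + l (w (r n)))) \<longlonglongrightarrow> 2 * p * (I + l u)"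
      by (intro tendsto_intros Jlim llim)
    then have "(\<lambda>n. e (w (r n))) \<longlonglongrightarrow> 2 * p * (I + l u)" using p by (simp add: J_def)
    then have lim: "(\<lambda>n. ennreal (e (w (r n)))) \<longlonglongrightarrow> ennreal (2 * p * (I + l u))" by (rule tendsto_ennrealI)
    have nn: "0 \<le> 2 * p * (I + l u)"
      using \<open>(\<lambda>n. e (w (r n))) \<longlonglongrightarrow> 2 * p * (I + l u)\<close> by (rule LIMSEQ_le_const) (use e0 in auto)
    have "liminf (\<lambda>n. ennreal (e (w (r n)))) = ennreal (2 * p * (I + l u))"
      by (rule lim_imp_Liminf[OF _ lim]) simp
    then have "ennreal (e u) \<le> ennreal (2 * p * (I + l u))" using eu en[OF uX] by simp
    then have "e u \<le> 2 * p * (I + l u)" using nn by (subst (asm) ennreal_le_iff) auto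
    then have "e u / (2 * p) \<le> I + l u" using p by (simp add: divide_le_eq mult.commute)
    then show ?thesis by (simp add: J_def)
  qed

  \<comment> \<open>A nonnegative minimiser and its Euler-Lagrange equation\<close>
  define v where "v x = \<bar>u x\<bar>" for x
  have vX: "v \<in> X" unfolding v_def by (rule X_abs[OF uX])
  have v0: "v x \<ge> 0" for x by (simp add: v_def)
  have Jv: "J v \<le> I"
  proof -
    have "energy v \<le> energy u" unfolding v_def by (intro energy_contraction) auto
    then have "e v \<le> e u" unfolding en[OF uX] en[OF vX] using e0 by (subst (asm) ennreal_le_iff) auto
    moreover have "l u \<le> l v" unfolding l_def
      by (intro integral_mono fint uX vX mult_left_mono f) (simp add: v_def)
    ultimately have "J v \<le> J u" unfolding J_def using p by (intro diff_mono divide_right_mono) auto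
    then show ?thesis using Ju by linarith
  qed
  note [measurable] = X_measurable[OF vX]
  \<comment> \<open>A one-sided variation is enough, since \<psi> may be replaced by its negative at
    the end. Convexity at the perturbed point v + t \<psi> bounds its energy directly, so no
    differentiation under the integral is needed; then t tends to 0.\<close>
  have ineq: "l \<psi> \<le> (1/2) * (\<integral>z. sgp p (dif v z) * dif \<psi> z \<partial>\<nu>)" if \<psi>: "\<psi> \<in> X" for \<psi>
  proof -
    note [measurable] = X_measurable[OF \<psi>]
    define t where "t n = 1 / real (Suc n)" for n
    have t: "0 < t n" "\<bar>t n\<bar> \<le> 1" for n by (auto simp: t_def)
    have step: "l \<psi> \<le> (1/2) * (\<integral>z. sgp p (dif v z + t n * dif \<psi> z) * dif \<psi> z \<partial>\<nu>)" for n
    proof -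
      let ?g = "\<lambda>x. 1 * v x + t n * \<psi> x"
      have gX: "?g \<in> X" by (intro X_lincomb vX \<psi>)
      have dg: "dif ?g z = dif v z + t n * dif \<psi> z" for z by (simp add: dif_def algebra_simps)
      have "e ?g \<le> (\<integral>z. \<bar>dif v z\<bar> powr p + p * t n * (sgp p (dif v z + t n * dif \<psi> z) * dif \<psi> z) \<partial>\<nu>)"
        unfolding e_def
      proof (rule integral_mono)
        show "integrable \<nu> (\<lambda>z. \<bar>dif ?g z\<bar> powr p)" by (rule X_dif_integrable[OF gX])
        show "integrable \<nu> (\<lambda>z. \<bar>dif v z\<bar> powr p + p * t n * (sgp p (dif v z + t n * dif \<psi> z) * dif \<psi> z))"
          by (intro Bochner_Integration.integrable_add integrable_mult_right X_dif_integrable X_sgp_integrable vX \<psi> t)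
        show "\<bar>dif ?g z\<bar> powr p \<le> \<bar>dif v z\<bar> powr p + p * t n * (sgp p (dif v z + t n * dif \<psi> z) * dif \<psi> z)" for z
          unfolding dg using abs_powr_tangent[OF p(1), of "dif v z + t n * dif \<psi> z" "dif v z"] by (simp add: algebra_simps)
      qed
      also have "\<dots> = e v + p * t n * (\<integral>z. sgp p (dif v z + t n * dif \<psi> z) * dif \<psi> z \<partial>\<nu>)"
        unfolding e_def by (subst Bochner_Integration.integral_add)
          (auto intro!: X_dif_integrable integrable_mult_right X_sgp_integrable vX \<psi> t)
      finally have 1: "e ?g \<le> e v + p * t n * (\<integral>z. sgp p (dif v z + t n * dif \<psi> z) * dif \<psi> z \<partial>\<nu>)" .
      have "J v \<le> J ?g" using Jv Ile[OF gX] by linarith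
      then have "e v / (2 * p) + t n * l \<psi> \<le> e ?g / (2 * p)"
        unfolding J_def lX[OF vX \<psi>] by linarith
      also have "\<dots> \<le> (e v + p * t n * (\<integral>z. sgp p (dif v z + t n * dif \<psi> z) * dif \<psi> z \<partial>\<nu>)) / (2 * p)"
        using 1 p by (intro divide_right_mono) auto
      also have "\<dots> = e v / (2 * p) + t n * ((1/2) * (\<integral>z. sgp p (dif v z + t n * dif \<psi> z) * dif \<psi> z \<partial>\<nu>))"
        using p by (simp add: add_divide_distrib)
      finally have "t n * l \<psi> \<le> t n * ((1/2) * (\<integral>z. sgp p (dif v z + t n * dif \<psi> z) * dif \<psi> z \<partial>\<nu>))" by simp
      then show ?thesis by (rule mult_left_le_imp_le) (rule t)
    qed
    have "(\<lambda>n. \<integral>z. sgp p (dif v z + t n * dif \<psi> z) * dif \<psi> z \<partial>\<nu>) \<longlonglongrightarrow> (\<integral>z. sgp p (dif v z) * dif \<psi> z \<partial>\<nu>)"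
    proof (rule integral_dominated_convergence[where w="\<lambda>z. 2 powr p * (\<bar>dif v z\<bar> powr p + \<bar>dif \<psi> z\<bar> powr p)"])
      show "integrable \<nu> (\<lambda>z. 2 powr p * (\<bar>dif v z\<bar> powr p + \<bar>dif \<psi> z\<bar> powr p))"
        by (intro integrable_mult_right Bochner_Integration.integrable_add X_dif_integrable vX \<psi>)
      show "AE z in \<nu>. norm (sgp p (dif v z + t n * dif \<psi> z) * dif \<psi> z) \<le> 2 powr p * (\<bar>dif v z\<bar> powr p + \<bar>dif \<psi> z\<bar> powr p)" for n
        using sgp_dif_bound[OF t(2)] by (intro AE_I2) simp
      show "AE z in \<nu>. (\<lambda>n. sgp p (dif v z + t n * dif \<psi> z) * dif \<psi> z) \<longlonglongrightarrow> sgp p (dif v z) * dif \<psi> z"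
      proof (rule AE_I2)
        fix z
        have "t \<longlonglongrightarrow> 0" unfolding t_def using LIMSEQ_inverse_real_of_nat by (simp add: inverse_eq_divide)
        then have "(\<lambda>n. dif v z + t n * dif \<psi> z) \<longlonglongrightarrow> dif v z + 0 * dif \<psi> z" by (intro tendsto_intros)
        from tendsto_sgp[OF p(1) this] show "(\<lambda>n. sgp p (dif v z + t n * dif \<psi> z) * dif \<psi> z) \<longlonglongrightarrow> sgp p (dif v z) * dif \<psi> z"
          by (intro tendsto_mult tendsto_const) simp
      qed
    qed measurable
    then have "(\<lambda>n. (1/2) * (\<integral>z. sgp p (dif v z + t n * dif \<psi> z) * dif \<psi> z \<partial>\<nu>)) \<longlonglongrightarrow> (1/2) * (\<integral>z. sgp p (dif v z) * dif \<psi> z \<partial>\<nu>)"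
      by (rule tendsto_mult[OF tendsto_const])
    then show ?thesis by (rule LIMSEQ_le_const) (use step in auto)
  qed
  have "weak_solution f v"
    unfolding weak_solution_def
  proof (intro conjI allI ballI vX v0)
    fix \<psi> assume \<psi>: "\<psi> \<in> X"
    show "integrable \<nu> (\<lambda>z. sgp p (dif v z) * dif \<psi> z)" using X_sgp_integrable[OF vX \<psi>, of 0] by simp
    have m\<psi>: "(\<lambda>x. - \<psi> x) \<in> X" using X_lincomb[OF \<psi> \<psi>, of "-1" 0] by simp
    have "dif (\<lambda>x. - \<psi> x) z = - dif \<psi> z" for z by (simp add: dif_def)
    then have "- l \<psi> \<le> - ((1/2) * (\<integral>z. sgp p (dif v z) * dif \<psi> z \<partial>\<nu>))"
      using ineq[OF m\<psi>] by (simp add: l_def)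
    then show "(1/2) * (\<integral>z. sgp p (dif v z) * dif \<psi> z \<partial>\<nu>) = (\<integral>x. f x * \<psi> x \<partial>lborel)"
      using ineq[OF \<psi>] by (simp add: l_def)
  qed
  then show ?thesis by blast
qed

end

section \<open>An a priori bound for subsolutions\<close>

text \<open>Below \<open>m k\<close> is the measure of \<open>{u > k}\<close>, \<open>T k\<close> the integral of \<open>u\<close> to the power \<open>q\<close> over that set and
  \<open>I\<close> its integral over the whole domain.  At the level \<open>L\<close> where \<open>m\<close> first drops below a fixed threshold,
  the tails \<open>T (2 ^ j * L) / L powr q\<close> decay faster than any geometric sequence, up to an error
  proportional to \<open>\<eta> = G / L powr q\<close>.  The last premise, where the spectral gap \<open>d\<close> enters, then bounds \<open>\<eta>\<close> from below.\<close>

lemma level_iteration_bound: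
  fixes q \<alpha> A lam d G M :: real
  assumes q: "q > 0" and \<alpha>: "\<alpha> > 0" and A: "A \<ge> 0" and lam: "lam > 0" and d: "d > 0" and G: "G \<ge> 0" and M: "M \<ge> 0"
  obtains K where "\<And>m T I. \<lbrakk>\<And>k. k > 0 \<Longrightarrow> 0 \<le> m k; \<And>k. k > 0 \<Longrightarrow> m k \<le> M; \<And>k. k > 0 \<Longrightarrow> T k \<le> I;
      \<And>k l. 0 < k \<Longrightarrow> k \<le> l \<Longrightarrow> T l \<le> T k;
      \<And>k. k > 0 \<Longrightarrow> k powr q * m k \<le> T k;
      \<And>k. k > 0 \<Longrightarrow> I \<le> k powr q * M + T k;
      \<And>k. k > 0 \<Longrightarrow> T (2 * k) \<le> A * m k powr \<alpha> * (lam * T k + G);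
      \<And>k. k > 0 \<Longrightarrow> T k \<le> A * m k powr \<alpha> * (lam * T k + G) + 2 powr q * k powr q * m k;
      \<And>h k. 0 < h \<Longrightarrow> h \<le> k \<Longrightarrow> d * (h powr (q + 1) * m h) \<le> lam * k * T k + k * G\<rbrakk> \<Longrightarrow> I \<le> (K::real)"
proof -
  \<comment> \<open>Below this measure the factor A m^\<alpha> \<lambda> is at most 1/2, so that T k
    on the right of the premise for T k can be absorbed.\<close>
  define m0 where "m0 = (1 / (2 * (A + 1) * (lam + 1))) powr (1 / \<alpha>)"
  have m0: "m0 > 0" using A lam by (simp add: m0_def)
  have m0': "A * m0 powr \<alpha> * lam \<le> 1/2" "A * m0 powr \<alpha> \<le> 1"
  proof -
    define Y where "Y = 2 * (A + 1) * (lam + 1)"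
    have Y: "Y > 0" "A * lam \<le> 1/2 * Y" "A \<le> 1 * Y"
      using A lam by (auto simp: Y_def algebra_simps add_increasing intro!: add_pos_nonneg)
    have e: "m0 powr \<alpha> = 1 / Y" using A lam \<alpha> by (simp add: m0_def powr_powr Y_def)
    have "A * m0 powr \<alpha> * lam = A * lam / Y" by (simp add: e)
    also have "\<dots> \<le> 1/2" using Y by (subst pos_divide_le_eq)
    finally show "A * m0 powr \<alpha> * lam \<le> 1/2" .
    have "A * m0 powr \<alpha> = A / Y" by (simp add: e)
    also have "\<dots> \<le> 1" using Y by (subst pos_divide_le_eq)
    finally show "A * m0 powr \<alpha> \<le> 1" .
  qed
  \<comment> \<open>Absorbing half of T k doubles the remaining terms, which gives T k \<le> 2 G + B
    k^q. With \<eta> \<le> 1 this makes D = 2 + B a bound for T L / L^q.\<close>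
  define B where "B = 2 * 2 powr q * M"
  have B: "B \<ge> 0" using M by (simp add: B_def)
  define D where "D = 2 + B"
  have D: "D > 0" using B by (simp add: D_def)
  \<comment> \<open>By Chebyshev m (2^j L) is at most D / 2^(jq); its power \<alpha> therefore
    carries the factor \<kappa>^j.\<close>
  define \<kappa> where "\<kappa> = 2 powr (- (q * \<alpha>))"
  have \<kappa>: "0 < \<kappa>" "\<kappa> < 1" using q \<alpha> by (auto simp: \<kappa>_def powr_less_one)
  define P where "P = A * D powr \<alpha>"
  have P: "P \<ge> 0" using A by (simp add: P_def)
  \<comment> \<open>The recursion for the scaled tails \<tau> j is linear in \<tau> j and \<eta>; b
    solves it without \<eta>, and c collects the coefficient of \<eta>. Successive ratios of b tend
    to 0, so b beats even the factor 2^j that comes from testing at height 2^j L.\<close>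
  define b where "b = rec_nat D (\<lambda>j x. P * \<kappa> ^ j * lam * x)"
  have b: "b 0 = D" "b (Suc j) = P * \<kappa> ^ j * lam * b j" for j by (simp_all add: b_def)
  define c where "c = rec_nat 0 (\<lambda>j x. P * \<kappa> ^ j * (lam * x + 1))"
  have c: "c 0 = 0" "c (Suc j) = P * \<kappa> ^ j * (lam * c j + 1)" for j by (simp_all add: c_def)
  have b0: "b j \<ge> 0" for j by (induction j) (use b P \<kappa> lam D in auto)
  have c0: "c j \<ge> 0" for j by (induction j) (use c P \<kappa> lam in auto)
  have "(\<lambda>j. 2 * (P * lam) * \<kappa> ^ j) \<longlonglongrightarrow> 2 * (P * lam) * 0"
    using \<kappa> by (intro tendsto_mult tendsto_const LIMSEQ_power_zero) auto
  then have "\<forall>\<^sub>F j in sequentially. 2 * (P * lam) * \<kappa> ^ j < 1/2" by (rule order_tendstoD) simp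
  then obtain n0 where n0: "\<And>j. j \<ge> n0 \<Longrightarrow> 2 * (P * lam) * \<kappa> ^ j < 1/2" by (auto simp: eventually_sequentially)
  have "summable (\<lambda>j. 2 ^ j * b j)"
  proof (rule summable_ratio_test[where c="1/2" and N=n0])
    fix n assume "n \<ge> n0"
    have "2 ^ Suc n * b (Suc n) = (2 * (P * lam) * \<kappa> ^ n) * (2 ^ n * b n)" by (simp add: b)
    also have "\<dots> \<le> 1/2 * (2 ^ n * b n)" using n0[OF \<open>n \<ge> n0\<close>] b0[of n] by (intro mult_right_mono) auto
    finally show "norm (2 ^ Suc n * b (Suc n)) \<le> 1/2 * norm (2 ^ n * b n)" using b0[of n] b0[of "Suc n"] by simp
  qed simp
  then have lim: "(\<lambda>j. 2 ^ j * b j) \<longlonglongrightarrow> 0" by (rule summable_LIMSEQ_zero)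
  \<comment> \<open>In units of L^(q+1) this is the lower bound that the last premise yields at h =
    L/2, where m still exceeds m0. J is chosen so that the part of the right-hand side free of
    \<eta> uses at most half of it.\<close>
  define \<epsilon> where "\<epsilon> = d * (2 powr (- (q + 1)) * m0)"
  have \<epsilon>: "\<epsilon> > 0" using d m0 by (simp add: \<epsilon>_def)
  have "\<epsilon> / (2 * lam) > 0" using \<epsilon> lam by simp
  from order_tendstoD(2)[OF lim this] obtain J where "2 ^ J * b J < \<epsilon> / (2 * lam)"
    by (auto simp: eventually_sequentially)
  then have J: "lam * (2 ^ J * b J) \<le> \<epsilon> / 2" using lam by (simp add: field_simps)
  define Q where "Q = lam * (2 ^ J * c J) + 2 ^ J"
  have Q: "Q > 0" unfolding Q_def using lam c0[of J] by (intro add_nonneg_pos) auto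
  \<comment> \<open>The summands bound L^q in the three cases: L = 1 already works; \<eta> > 1, that
    is L^q < G; or the gap argument, which gives \<epsilon>/2 \<le> Q \<eta>.\<close>
  define \<Lambda> where "\<Lambda> = 1 + G + 2 * Q * G / \<epsilon>"
  have \<Lambda>: "\<Lambda> \<ge> 1" using G Q \<epsilon> by (simp add: \<Lambda>_def)
  have "I \<le> \<Lambda> * M + (2 * G + B * \<Lambda>)"
    if mn: "\<And>k. k > 0 \<Longrightarrow> 0 \<le> m k" and mM: "\<And>k. k > 0 \<Longrightarrow> m k \<le> M" and TI: "\<And>k. k > 0 \<Longrightarrow> T k \<le> I"
      and Tanti: "\<And>k l. 0 < k \<Longrightarrow> k \<le> l \<Longrightarrow> T l \<le> T k"
      and cheb: "\<And>k. k > 0 \<Longrightarrow> k powr q * m k \<le> T k"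
      and split: "\<And>k. k > 0 \<Longrightarrow> I \<le> k powr q * M + T k"
      and dbl: "\<And>k. k > 0 \<Longrightarrow> T (2 * k) \<le> A * m k powr \<alpha> * (lam * T k + G)"
      and same: "\<And>k. k > 0 \<Longrightarrow> T k \<le> A * m k powr \<alpha> * (lam * T k + G) + 2 powr q * k powr q * m k"
      and gap: "\<And>h k. 0 < h \<Longrightarrow> h \<le> k \<Longrightarrow> d * (h powr (q + 1) * m h) \<le> lam * k * T k + k * G"
    for m T :: "real \<Rightarrow> real" and I :: real
  proof -
    have T0: "T k \<ge> 0" if "k > 0" for k
      using cheb[OF that] mn[OF that] by (smt (verit) mult_nonneg_nonneg powr_ge_zero)
    have small: "T k \<le> 2 * G + B * k powr q" if k: "k > 0" and mk: "m k \<le> m0" for k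
    proof -
      have pw: "m k powr \<alpha> \<le> m0 powr \<alpha>" using mn[OF k] mk \<alpha> by (intro powr_mono2) auto
      have "A * m k powr \<alpha> * (lam * T k + G) \<le> A * m0 powr \<alpha> * (lam * T k + G)"
        using pw A lam T0[OF k] G by (intro mult_right_mono mult_left_mono add_nonneg_nonneg mult_nonneg_nonneg) auto
      also have "\<dots> = (A * m0 powr \<alpha> * lam) * T k + (A * m0 powr \<alpha>) * G" by (simp add: algebra_simps)
      also have "\<dots> \<le> 1/2 * T k + 1 * G" using m0' T0[OF k] G by (intro add_mono mult_right_mono) auto
      finally have 1: "A * m k powr \<alpha> * (lam * T k + G) \<le> 1/2 * T k + G" by simp
      have "2 powr q * k powr q * m k \<le> 2 powr q * k powr q * M" using mM[OF k] by (intro mult_left_mono) auto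
      then have "T k \<le> 1/2 * T k + G + 2 powr q * k powr q * M" using same[OF k] 1 by linarith
      then show ?thesis by (simp add: B_def algebra_simps)
    qed
    have "\<exists>L>0. m L \<le> m0 \<and> L powr q \<le> \<Lambda>"
    proof (cases "m 1 \<le> m0")
      case True
      then show ?thesis using \<Lambda> by (intro exI[of _ 1]) auto
    next
      case False
      \<comment> \<open>Only the finiteness of I is used here; its size influences i but none of the
        constants. The least such i > 0 provides the lower bound m (L/2) > m0.\<close>
      have "\<exists>i. m (2 ^ i) \<le> m0"
      proof -
        have "1 < (2::real) powr q" using q by simp
        then obtain i where i: "I / m0 < (2 powr q) ^ i" using real_arch_pow by blast
        have pw: "(2 ^ i) powr q = (2 powr q) ^ i"
          using two_power_powr[of i q] powr_realpow[of "2 powr q" i] by (simp add: powr_powr)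
        have "(2 powr q) ^ i * m (2 ^ i) \<le> I" using cheb[of "2 ^ i"] TI[of "2 ^ i"] by (simp add: pw)
        also have "I \<le> (2 powr q) ^ i * m0" using i m0 by (simp add: divide_less_eq)
        finally show ?thesis by (auto intro!: exI[of _ i])
      qed
      then obtain i where i: "m (2 ^ i) \<le> m0" "\<And>j. j < i \<Longrightarrow> \<not> m (2 ^ j) \<le> m0"
        using exists_least_iff[of "\<lambda>i. m (2 ^ i) \<le> m0"] by auto
      have "i \<noteq> 0" using i(1) False by (cases i) auto
      then obtain i' where i': "i = Suc i'" using not0_implies_Suc by blast
      define L :: real where "L = 2 ^ i"
      have L: "L > 0" "m L \<le> m0" "m (L / 2) > m0" using i(1) i(2)[of i'] i' by (auto simp: L_def)
      define \<eta> where "\<eta> = G / L powr q"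
      have Lq: "L powr q > 0" using L by simp
      have "L powr q \<le> \<Lambda>"
      proof (cases "\<eta> > 1")
        case True
        then have "L powr q < G" using Lq by (simp add: \<eta>_def less_divide_eq)
        moreover have "0 \<le> 2 * Q * G / \<epsilon>" using Q G \<epsilon> by simp
        ultimately show ?thesis by (simp add: \<Lambda>_def)
      next
        case False
        have GL: "G = \<eta> * L powr q" using Lq by (simp add: \<eta>_def)
        define \<tau> where "\<tau> j = T (2 ^ j * L) / L powr q" for j :: nat
        have T\<tau>: "T (2 ^ j * L) = \<tau> j * L powr q" for j using Lq by (simp add: \<tau>_def)
        have TL: "T L \<le> D * L powr q"
        proof -
          have "T L \<le> 2 * G + B * L powr q" by (rule small[OF L(1,2)])
          also have "\<dots> \<le> 2 * (1 * L powr q) + B * L powr q" using False Lq unfolding GL by (intro add_mono mult_left_mono mult_right_mono) auto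
          finally show ?thesis by (simp add: D_def algebra_simps)
        qed
        have mj: "m (2 ^ j * L) \<le> D / (2 ^ j) powr q" for j
        proof -
          have "(2 ^ j * L) powr q * m (2 ^ j * L) \<le> T (2 ^ j * L)" using L by (intro cheb) auto
          also have "\<dots> \<le> T L" using L(1) by (intro Tanti) (auto simp: mult_le_cancel_right1)
          also note TL
          finally have "(2 ^ j) powr q * L powr q * m (2 ^ j * L) \<le> D * L powr q" using L(1) by (simp add: powr_mult)
          then have "((2 ^ j) powr q * m (2 ^ j * L)) * L powr q \<le> D * L powr q" by (simp add: mult_ac)
          then have "(2 ^ j) powr q * m (2 ^ j * L) \<le> D" using Lq by (simp only: mult_le_cancel_right_pos)
          then show ?thesis by (simp add: le_divide_eq mult.commute)
        qed
        have mj\<alpha>: "A * m (2 ^ j * L) powr \<alpha> \<le> P * \<kappa> ^ j" for j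
        proof -
          have "m (2 ^ j * L) powr \<alpha> \<le> (D / (2 ^ j) powr q) powr \<alpha>"
            using mj mn L \<alpha> by (intro powr_mono2) auto
          also have "\<dots> = D powr \<alpha> / (2 ^ j) powr (q * \<alpha>)" using D by (simp add: powr_divide powr_powr)
          also have "\<dots> = D powr \<alpha> * \<kappa> ^ j"
          proof -
            have "\<kappa> ^ j = 2 powr (- (q * \<alpha>) * real j)"
              unfolding \<kappa>_def by (subst powr_realpow[symmetric]) (simp_all add: powr_powr)
            also have "\<dots> = 1 / 2 powr (q * \<alpha> * real j)" by (simp add: powr_minus_divide)
            finally show ?thesis by (simp add: two_power_powr)
          qed
          finally show ?thesis unfolding P_def mult.assoc using A by (intro mult_left_mono) auto
        qed
        have rec: "\<tau> (Suc j) \<le> P * \<kappa> ^ j * (lam * \<tau> j + \<eta>)" for j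
        proof -
          have "T (2 * (2 ^ j * L)) \<le> A * m (2 ^ j * L) powr \<alpha> * (lam * T (2 ^ j * L) + G)" using L by (intro dbl) auto
          also have "\<dots> \<le> P * \<kappa> ^ j * (lam * T (2 ^ j * L) + G)"
            using lam T0[of "2 ^ j * L"] L G by (intro mult_right_mono mj\<alpha> add_nonneg_nonneg mult_nonneg_nonneg) auto
          also have "\<dots> = P * \<kappa> ^ j * (lam * \<tau> j + \<eta>) * L powr q" unfolding T\<tau> GL by (simp add: algebra_simps)
          also have "2 * (2 ^ j * L) = 2 ^ Suc j * L" by simp
          finally have "\<tau> (Suc j) * L powr q \<le> P * \<kappa> ^ j * (lam * \<tau> j + \<eta>) * L powr q" unfolding T\<tau> .
          then show ?thesis using Lq by (simp only: mult_le_cancel_right_pos)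
        qed
        have bd: "\<tau> j \<le> b j + c j * \<eta>" for j
        proof (induction j)
          case 0
          show ?case using TL Lq by (simp add: \<tau>_def b c divide_le_eq)
        next
          case (Suc j)
          have "\<tau> (Suc j) \<le> P * \<kappa> ^ j * (lam * \<tau> j + \<eta>)" by (rule rec)
          also have "\<dots> \<le> P * \<kappa> ^ j * (lam * (b j + c j * \<eta>) + \<eta>)"
            using Suc P \<kappa> lam by (intro mult_left_mono add_right_mono) auto
          also have "\<dots> = b (Suc j) + c (Suc j) * \<eta>" by (simp add: b c algebra_simps)
          finally show ?case .
        qed
        have "d * ((L / 2) powr (q + 1) * m (L / 2)) \<le> lam * (2 ^ J * L) * T (2 ^ J * L) + (2 ^ J * L) * G"
        proof (rule gap)
          have "L / 2 \<le> 1 * L" using L by simp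
          also have "\<dots> \<le> 2 ^ J * L" using L by (intro mult_right_mono) auto
          finally show "L / 2 \<le> 2 ^ J * L" .
        qed (use L in auto)
        also have "\<dots> = (lam * (2 ^ J * \<tau> J) + 2 ^ J * \<eta>) * (L * L powr q)" unfolding T\<tau> GL by (simp add: algebra_simps)
        finally have 1: "d * ((L / 2) powr (q + 1) * m (L / 2)) \<le> (lam * (2 ^ J * \<tau> J) + 2 ^ J * \<eta>) * (L * L powr q)" .
        have "\<epsilon> * (L * L powr q) = d * ((L / 2) powr (q + 1) * m0)"
          using L by (simp add: \<epsilon>_def powr_divide powr_add powr_minus_divide powr_diff field_simps)
        also have "\<dots> \<le> d * ((L / 2) powr (q + 1) * m (L / 2))" using d L by (intro mult_left_mono) auto
        also note 1
        finally have "\<epsilon> \<le> lam * (2 ^ J * \<tau> J) + 2 ^ J * \<eta>" using L Lq by (simp only: mult_le_cancel_right_pos mult_pos_pos)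
        also have "\<dots> \<le> lam * (2 ^ J * (b J + c J * \<eta>)) + 2 ^ J * \<eta>"
          using lam bd[of J] by (intro add_right_mono mult_left_mono) auto
        also have "\<dots> = lam * (2 ^ J * b J) + Q * \<eta>" by (simp add: Q_def algebra_simps)
        also have "\<dots> \<le> \<epsilon> / 2 + Q * \<eta>" using J by simp
        finally have "\<epsilon> / 2 \<le> Q * \<eta>" by simp
        also have "Q * \<eta> = Q * G / L powr q" by (simp add: \<eta>_def)
        finally have "L powr q * \<epsilon> \<le> 2 * Q * G" using Lq by (simp add: le_divide_eq mult_ac)
        then have "L powr q \<le> 2 * Q * G / \<epsilon>" using \<epsilon> by (simp add: le_divide_eq)
        then show ?thesis using G by (simp add: \<Lambda>_def)
      qed
      then show ?thesis using L by blast
    qed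
    then obtain L where L: "L > 0" "m L \<le> m0" "L powr q \<le> \<Lambda>" by blast
    have "I \<le> L powr q * M + T L" by (rule split[OF L(1)])
    also have "\<dots> \<le> \<Lambda> * M + (2 * G + B * L powr q)" by (intro add_mono mult_right_mono small L M)
    also have "\<dots> \<le> \<Lambda> * M + (2 * G + B * \<Lambda>)" by (intro add_left_mono mult_left_mono L B)
    finally show ?thesis .
  qed
  then show thesis by (rule that[of "\<Lambda> * M + (2 * G + B * \<Lambda>)"])
qed

context weighted_fractional
begin

section \<open>Level sets and the tail estimate\<close>

lemma level_set_\<Omega>:
  fixes u :: "'a \<Rightarrow> real"
  assumes "\<And>x. x \<notin> \<Omega> \<Longrightarrow> u x = 0" "k \<ge> 0"
  shows "{x. u x > k} \<subseteq> \<Omega>"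
  using assms by (auto simp: not_less[symmetric]) (metis less_irrefl order_le_less_trans)

lemma level_set_emeasure:
  fixes u :: "'a \<Rightarrow> real"
  assumes [measurable]: "u \<in> borel_measurable borel" and "\<And>x. x \<notin> \<Omega> \<Longrightarrow> u x = 0" "k \<ge> 0"
  shows "emeasure lborel {x. u x > k} = ennreal (measure lborel {x. u x > k})"
    and "measure lborel {x. u x > k} \<le> measure lborel \<Omega>"
proof -
  have sub: "{x. u x > k} \<subseteq> \<Omega>" using assms(2,3) by (rule level_set_\<Omega>)
  have "emeasure lborel {x. u x > k} \<le> emeasure lborel \<Omega>" using sub by (intro emeasure_mono) auto
  then show "emeasure lborel {x. u x > k} = ennreal (measure lborel {x. u x > k})"
    using \<Omega>_finite by (intro emeasure_eq_ennreal_measure) (auto simp: top_unique)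
  show "measure lborel {x. u x > k} \<le> measure lborel \<Omega>"
    using sub \<Omega>_finite by (intro measure_mono_fmeasurable) (auto simp: fmeasurable_def)
qed

lemma dyadic_powr_bound:
  fixes v \<rho> q :: real
  assumes "q > 0" "\<rho> > 0" "v > 2 * \<rho>"
  obtains j :: nat where "v > 2 ^ Suc j * \<rho>" "v powr q \<le> (4 * 2 ^ j * \<rho>) powr q"
proof -
  have "\<exists>j. v \<le> 4 * 2 ^ j * \<rho>"
  proof -
    obtain j where "v / (4 * \<rho>) < 2 ^ j" using real_arch_pow[of 2 "v / (4 * \<rho>)"] by auto
    then have "v \<le> 4 * 2 ^ j * \<rho>" using assms by (simp add: divide_less_eq mult_ac less_imp_le)
    then show ?thesis ..
  qed
  then obtain j where j: "v \<le> 4 * 2 ^ j * \<rho>" "\<And>i. i < j \<Longrightarrow> \<not> v \<le> 4 * 2 ^ i * \<rho>"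
    using exists_least_iff[of "\<lambda>j. v \<le> 4 * 2 ^ j * \<rho>"] by auto
  have "v > 2 ^ Suc j * \<rho>"
  proof (cases j)
    case 0
    then show ?thesis using assms by simp
  next
    case (Suc i)
    then show ?thesis using j(2)[of i] by simp
  qed
  moreover have "v powr q \<le> (4 * 2 ^ j * \<rho>) powr q" using j(1) assms by (intro powr_mono2) auto
  ultimately show thesis by (rule that)
qed

text \<open>F bounds the energy of u per unit of height above k, up to the factor 2. The Faber-Krahn
  inequality for the slice between a and b gives m(b) (b - a)^q \<le> C1 m(a)^\<alpha> F. Used once,
  this is only a weak-type bound, and its dyadic sum diverges; used a second time, with the improved
  measure m(a), it gains the factor \<kappa>^j. Positivity of F is asked only when the level set has
  positive measure, since otherwise F may be 0.\<close>

lemma level_energy_bound: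
  obtains A where "A \<ge> 0" "\<And>u k F. \<lbrakk>u \<in> borel_measurable borel; \<And>x. x \<notin> \<Omega> \<Longrightarrow> u x = 0; k \<ge> 0;
      measure lborel {x. u x > k} > 0 \<Longrightarrow> F > 0;
      \<And>a b. k \<le> a \<Longrightarrow> a < b \<Longrightarrow> energy (\<lambda>x. clamp_real a b (u x)) \<le> ennreal (2 * (b - a) * F)\<rbrakk> \<Longrightarrow>
      (\<integral>\<^sup>+ x. indicator {x. u x > k} x * ennreal ((u x - k) powr (p - 1)) \<partial>lborel)
        \<le> ennreal (A * measure lborel {x. u x > k} powr (p * s / DIM('a)) * F)"
proof -
  define \<alpha> where "\<alpha> = p * s / DIM('a)"
  define q where "q = p - 1"
  have q: "q > 0" using p by (simp add: q_def)
  have \<alpha>: "\<alpha> > 0" using p s by (simp add: \<alpha>_def)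
  obtain C where C: "C > 0" "\<And>\<phi> S. \<phi> \<in> borel_measurable borel \<Longrightarrow> S \<in> sets borel \<Longrightarrow> S \<subseteq> \<Omega> \<Longrightarrow>
     (\<And>x. x \<notin> S \<Longrightarrow> \<phi> x = 0) \<Longrightarrow>
     (\<integral>\<^sup>+ x. ennreal (\<bar>\<phi> x\<bar> powr p) \<partial>lborel) \<le> ennreal (C * measure lborel S powr \<alpha>) * energy \<phi>"
    unfolding \<alpha>_def using faber_krahn by metis
  define C1 where "C1 = 2 * C"
  have C1: "C1 > 0" using C by (simp add: C1_def)
  define \<kappa> where "\<kappa> = 2 powr (- (q * \<alpha>))"
  have \<kappa>: "0 < \<kappa>" "\<kappa> < 1" using q \<alpha> by (auto simp: \<kappa>_def powr_less_one)
  define A where "A = 2 powr q + 4 powr q * C1 powr (1 + \<alpha>) * (1 / (1 - \<kappa>))"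
  have A0: "A \<ge> 0" using \<kappa> by (simp add: A_def)
  have "(\<integral>\<^sup>+ x. indicator {x. u x > k} x * ennreal ((u x - k) powr (p - 1)) \<partial>lborel)
        \<le> ennreal (A * measure lborel {x. u x > k} powr (p * s / DIM('a)) * F)"
    if [measurable]: "u \<in> borel_measurable borel" and u0: "\<And>x. x \<notin> \<Omega> \<Longrightarrow> u x = 0" and k: "k \<ge> 0"
      and Fpos: "measure lborel {x. u x > k} > 0 \<Longrightarrow> F > 0"
      and en: "\<And>a b. k \<le> a \<Longrightarrow> a < b \<Longrightarrow> energy (\<lambda>x. clamp_real a b (u x)) \<le> ennreal (2 * (b - a) * F)" for u k F
  proof -
    define m where "m t = measure lborel {x. u x > t}" for t
    have em: "emeasure lborel {x. u x > t} = ennreal (m t)" if "t \<ge> 0" for t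
      unfolding m_def using u0 that by (intro level_set_emeasure) auto
    have m0: "m t \<ge> 0" for t by (simp add: m_def)
    show ?thesis
    proof (cases "m k = 0")
      case True
      then have "AE x in lborel. x \<notin> {x. u x > k}" using em[OF k] by (intro AE_not_in) (auto simp: null_sets_def)
      then have "AE x in lborel. indicator {x. u x > k} x * ennreal ((u x - k) powr (p - 1)) = 0"
        by eventually_elim auto
      then have "(\<integral>\<^sup>+ x. indicator {x. u x > k} x * ennreal ((u x - k) powr (p - 1)) \<partial>lborel) = 0"
        by (subst nn_integral_0_iff_AE) auto
      then show ?thesis by simp
    next
      case False
      then have mk: "m k > 0" using m0[of k] by simp
      then have F: "F > 0" using Fpos by (simp add: m_def)
      have stepA: "m b * (b - a) powr q \<le> C1 * m a powr \<alpha> * F" if ab: "k \<le> a" "a < b" for a b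
      proof -
        define \<phi> where "\<phi> x = clamp_real a b (u x) - a" for x
        have [measurable]: "\<phi> \<in> borel_measurable borel" unfolding \<phi>_def by measurable
        have a0: "a \<ge> 0" using ab k by simp
        have "energy \<phi> = energy (\<lambda>x. clamp_real a b (u x))" unfolding energy_def \<phi>_def dif_def by simp
        then have enphi: "energy \<phi> \<le> ennreal (2 * (b - a) * F)" using en[OF ab] by simp
        have "ennreal ((b - a) powr p * m b) = ennreal ((b - a) powr p) * emeasure lborel {x. u x > b}"
          using em[of b] a0 ab m0 by (simp add: ennreal_mult)
        also have "\<dots> = (\<integral>\<^sup>+ x. ennreal ((b - a) powr p) * indicator {x. u x > b} x \<partial>lborel)"
          by (subst nn_integral_cmult_indicator) auto
        also have "\<dots> \<le> (\<integral>\<^sup>+ x. ennreal (\<bar>\<phi> x\<bar> powr p) \<partial>lborel)"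
          using ab by (intro nn_integral_mono) (auto simp: indicator_def \<phi>_def clamp_real_def)
        also have "\<dots> \<le> ennreal (C * measure lborel {x. u x > a} powr \<alpha>) * energy \<phi>"
          using level_set_\<Omega>[of u a, OF u0 a0] ab by (intro C(2)) (auto simp: \<phi>_def clamp_real_def)
        also have "\<dots> \<le> ennreal (C * m a powr \<alpha>) * ennreal (2 * (b - a) * F)"
          unfolding m_def by (intro mult_left_mono enphi) auto
        also have "\<dots> = ennreal (C1 * m a powr \<alpha> * F * (b - a))"
          using C(1) ab F by (subst ennreal_mult[symmetric]) (auto simp: C1_def mult_ac)
        finally have "(b - a) powr p * m b \<le> C1 * m a powr \<alpha> * F * (b - a)"
          using C1 F ab by (subst (asm) ennreal_le_iff) auto
        moreover have "(b - a) powr p = (b - a) powr q * (b - a)"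
          using ab by (simp add: q_def powr_diff)
        ultimately have "(m b * (b - a) powr q) * (b - a) \<le> (C1 * m a powr \<alpha> * F) * (b - a)" by (simp add: mult_ac)
        then show ?thesis using ab by (simp only: mult_le_cancel_right_pos diff_gt_0_iff_gt)
      qed
      \<comment> \<open>The natural height of the superlevel set: m(k)^\<alpha> F = m(k) \<rho>^q,
        so that the slice inequality becomes free of dimension.\<close>
      define \<rho> where "\<rho> = (F * m k powr (\<alpha> - 1)) powr (1 / q)"
      have \<rho>: "\<rho> > 0" using F mk by (simp add: \<rho>_def)
      have \<rho>q: "\<rho> powr q = F * m k powr (\<alpha> - 1)" using F mk q by (simp add: \<rho>_def powr_powr)
      have Fm: "m k powr \<alpha> * F = m k * \<rho> powr q" unfolding \<rho>q using mk by (simp add: powr_diff)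
      have s1: "m (k + 2 ^ j * \<rho>) \<le> C1 * m k / (2 ^ j) powr q" for j
      proof -
        have "m (k + 2 ^ j * \<rho>) * (k + 2 ^ j * \<rho> - k) powr q \<le> C1 * m k powr \<alpha> * F"
          using \<rho> by (intro stepA) auto
        also have "\<dots> = C1 * m k * \<rho> powr q" using Fm by (simp add: mult.assoc)
        finally have "(m (k + 2 ^ j * \<rho>) * (2 ^ j) powr q) * \<rho> powr q \<le> (C1 * m k) * \<rho> powr q"
          using \<rho> by (simp add: powr_mult mult_ac)
        then have "m (k + 2 ^ j * \<rho>) * (2 ^ j) powr q \<le> C1 * m k" by (rule mult_right_le_imp_le) (use \<rho> in simp)
        then show ?thesis by (simp add: le_divide_eq)
      qed
      have s2: "m (k + 2 ^ Suc j * \<rho>) * (4 * 2 ^ j * \<rho>) powr q \<le> 4 powr q * C1 powr (1 + \<alpha>) * \<kappa> ^ j * (m k powr \<alpha> * F)" for j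
      proof -
        let ?a = "k + 2 ^ j * \<rho>" and ?b = "k + 2 ^ Suc j * \<rho>"
        have ba: "?b - ?a = 2 ^ j * \<rho>" by simp
        have "m ?b * (?b - ?a) powr q \<le> C1 * m ?a powr \<alpha> * F" using \<rho> by (intro stepA) auto
        also have "\<dots> \<le> C1 * (C1 * m k / (2 ^ j) powr q) powr \<alpha> * F"
          using s1[of j] m0 C1 F \<alpha> by (intro mult_right_mono mult_left_mono powr_mono2) auto
        also have "\<dots> = C1 powr (1 + \<alpha>) * \<kappa> ^ j * (m k powr \<alpha> * F)"
        proof -
          have "\<kappa> ^ j = 2 powr (- (q * \<alpha>) * real j)"
            unfolding \<kappa>_def by (subst powr_realpow[symmetric]) (simp_all add: powr_powr)
          also have "\<dots> = 1 / 2 powr (q * \<alpha> * real j)" by (simp add: powr_minus_divide)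
          also have "2 powr (q * \<alpha> * real j) = ((2 ^ j) powr q) powr \<alpha>" by (simp add: two_power_powr powr_powr mult_ac)
          finally have "\<kappa> ^ j = 1 / ((2 ^ j) powr q) powr \<alpha>" .
          then show ?thesis using C1 mk by (simp add: powr_divide powr_mult powr_add mult_ac)
        qed
        finally have "m ?b * (2 ^ j * \<rho>) powr q \<le> C1 powr (1 + \<alpha>) * \<kappa> ^ j * (m k powr \<alpha> * F)" unfolding ba .
        then have "4 powr q * (m ?b * (2 ^ j * \<rho>) powr q) \<le> 4 powr q * (C1 powr (1 + \<alpha>) * \<kappa> ^ j * (m k powr \<alpha> * F))"
          by (intro mult_left_mono) auto
        moreover have "(4 * 2 ^ j * \<rho>) powr q = 4 powr q * (2 ^ j * \<rho>) powr q"
          using \<rho> by (simp add: powr_mult mult.assoc)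
        ultimately show ?thesis by (simp add: mult_ac)
      qed
      \<comment> \<open>Up to height 2 \<rho> the crude bound is enough. Beyond it each point is
        charged to a dyadic level j with 2^(j+1) \<rho> < u - k \<le> 4 2^j \<rho>, which explains
        the factor 4^q.\<close>
      have "(\<integral>\<^sup>+ x. indicator {x. u x > k} x * ennreal ((u x - k) powr q) \<partial>lborel)
        \<le> (\<integral>\<^sup>+ x. ennreal ((2 * \<rho>) powr q) * indicator {x. u x > k} x
             + (\<Sum>j. ennreal ((4 * 2 ^ j * \<rho>) powr q) * indicator {x. u x > k + 2 ^ Suc j * \<rho>} x) \<partial>lborel)"
      proof (rule nn_integral_mono)
        fix x
        show "indicator {x. u x > k} x * ennreal ((u x - k) powr q) \<le> ennreal ((2 * \<rho>) powr q) * indicator {x. u x > k} x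
             + (\<Sum>j. ennreal ((4 * 2 ^ j * \<rho>) powr q) * indicator {x. u x > k + 2 ^ Suc j * \<rho>} x)"
        proof (cases "u x - k > 2 * \<rho>")
          case True
          obtain j where j: "u x - k > 2 ^ Suc j * \<rho>" "(u x - k) powr q \<le> (4 * 2 ^ j * \<rho>) powr q"
            using dyadic_powr_bound[OF q \<rho> True] by blast
          have "indicator {x. u x > k} x * ennreal ((u x - k) powr q) \<le> ennreal ((u x - k) powr q)"
            by (simp add: indicator_def)
          also have "\<dots> \<le> (\<Sum>i\<in>{j}. ennreal ((4 * 2 ^ i * \<rho>) powr q) * indicator {x. u x > k + 2 ^ Suc i * \<rho>} x)"
            using j by (simp add: ennreal_leI)
          also have "\<dots> \<le> (\<Sum>i. ennreal ((4 * 2 ^ i * \<rho>) powr q) * indicator {x. u x > k + 2 ^ Suc i * \<rho>} x)"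
            by (rule sum_le_suminf) auto
          finally show ?thesis by (simp add: add_increasing)
        next
          case False
          have "indicator {x. u x > k} x * ennreal ((u x - k) powr q) \<le> ennreal ((2 * \<rho>) powr q) * indicator {x. u x > k} x"
            using False q by (auto simp: indicator_def intro!: ennreal_leI powr_mono2)
          then show ?thesis by (simp add: add_increasing2)
        qed
      qed
      also have "\<dots> = ennreal ((2 * \<rho>) powr q) * emeasure lborel {x. u x > k}
          + (\<Sum>j. ennreal ((4 * 2 ^ j * \<rho>) powr q) * emeasure lborel {x. u x > k + 2 ^ Suc j * \<rho>})"
        by (subst nn_integral_add, measurable) (subst nn_integral_suminf, measurable, simp add: nn_integral_cmult_indicator)
      also have "\<dots> \<le> ennreal (2 powr q * (m k powr \<alpha> * F)) + (\<Sum>j. ennreal (4 powr q * C1 powr (1 + \<alpha>) * (m k powr \<alpha> * F) * \<kappa> ^ j))"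
      proof (intro add_mono suminf_le allI)
        show "ennreal ((2 * \<rho>) powr q) * emeasure lborel {x. u x > k} \<le> ennreal (2 powr q * (m k powr \<alpha> * F))"
          unfolding Fm em[OF k] using \<rho> m0[of k] by (simp add: powr_mult ennreal_mult[symmetric] mult_ac)
        fix j
        have "ennreal ((4 * 2 ^ j * \<rho>) powr q) * emeasure lborel {x. u x > k + 2 ^ Suc j * \<rho>} = ennreal (m (k + 2 ^ Suc j * \<rho>) * (4 * 2 ^ j * \<rho>) powr q)"
          using em[of "k + 2 ^ Suc j * \<rho>"] k \<rho> m0 by (simp add: ennreal_mult[symmetric] mult.commute)
        also have "\<dots> \<le> ennreal (4 powr q * C1 powr (1 + \<alpha>) * (m k powr \<alpha> * F) * \<kappa> ^ j)"
          using s2[of j] by (intro ennreal_leI) (simp add: mult_ac)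
        finally show "ennreal ((4 * 2 ^ j * \<rho>) powr q) * emeasure lborel {x. u x > k + 2 ^ Suc j * \<rho>} \<le> ennreal (4 powr q * C1 powr (1 + \<alpha>) * (m k powr \<alpha> * F) * \<kappa> ^ j)" .
      qed auto
      also have "(\<Sum>j. ennreal (4 powr q * C1 powr (1 + \<alpha>) * (m k powr \<alpha> * F) * \<kappa> ^ j)) = ennreal (4 powr q * C1 powr (1 + \<alpha>) * (m k powr \<alpha> * F) * (1 / (1 - \<kappa>)))"
        using \<kappa> F by (subst suminf_ennreal2) (auto simp: suminf_geometric suminf_mult summable_geometric intro!: summable_mult)
      also have "ennreal (2 powr q * (m k powr \<alpha> * F)) + \<dots> = ennreal (A * m k powr \<alpha> * F)"
        using \<kappa> F by (subst ennreal_plus[symmetric]) (auto simp: A_def algebra_simps)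
      finally show ?thesis by (simp add: q_def \<alpha>_def m_def)
    qed
  qed
  with A0 show thesis by (rule that)
qed

text \<open>The clamp estimate is what a subsolution with datum \<lambda> u^(p-1) + g satisfies, and
  the last premise is the spectral inequality with \<lambda>' > \<lambda>. Together they supply the
  premises of the abstract iteration, with constants that do not depend on u.\<close>

lemma a_priori_bound:
  assumes lam: "0 < lam" "lam < lam'" and [measurable]: "g \<in> borel_measurable borel" and g: "\<And>x. 0 \<le> g x" "integrable lborel g"
  obtains K where "\<And>u. \<lbrakk>u \<in> borel_measurable borel; \<And>x. 0 \<le> u x; \<And>x. x \<notin> \<Omega> \<Longrightarrow> u x = 0;
      integrable lborel (\<lambda>x. u x powr (p - 1));
      \<And>a b. 0 \<le> a \<Longrightarrow> a < b \<Longrightarrow> energy (\<lambda>x. clamp_real a b (u x))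
         \<le> ennreal (2 * (\<integral>x. (lam * u x powr (p - 1) + g x) * (clamp_real a b (u x) - a) \<partial>lborel));
      \<And>k. k > 0 \<Longrightarrow> ennreal (2 * lam') * (\<integral>\<^sup>+ x. ennreal (clamp_real 0 k (u x) powr p) \<partial>lborel) \<le> energy (\<lambda>x. clamp_real 0 k (u x))\<rbrakk>
      \<Longrightarrow> (\<integral>x. u x powr (p - 1) \<partial>lborel) \<le> K"
proof -
  define \<alpha> where "\<alpha> = p * s / DIM('a)"
  define q where "q = p - 1"
  have q: "q > 0" using p by (simp add: q_def)
  have \<alpha>: "\<alpha> > 0" using p s by (simp add: \<alpha>_def)
  define G where "G = (\<integral>x. g x \<partial>lborel)"
  have G: "G \<ge> 0" unfolding G_def using g by simp
  obtain A0 where A0: "A0 \<ge> 0" "\<And>u k F. \<lbrakk>u \<in> borel_measurable borel; \<And>x. x \<notin> \<Omega> \<Longrightarrow> u x = 0; k \<ge> 0;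
      measure lborel {x. u x > k} > 0 \<Longrightarrow> F > 0;
      \<And>a b. k \<le> a \<Longrightarrow> a < b \<Longrightarrow> energy (\<lambda>x. clamp_real a b (u x)) \<le> ennreal (2 * (b - a) * F)\<rbrakk> \<Longrightarrow>
      (\<integral>\<^sup>+ x. indicator {x. u x > k} x * ennreal ((u x - k) powr (p - 1)) \<partial>lborel)
        \<le> ennreal (A0 * measure lborel {x. u x > k} powr (p * s / DIM('a)) * F)"
  proof (rule level_energy_bound, goal_cases)
    case (1 A)
    from 1(2,3) show ?case by (rule 1(1))
  qed
  note A0_bound = A0(2)[folded \<alpha>_def q_def]
  define A where "A = 2 powr q * A0"
  have A: "A \<ge> 0" using A0 by (simp add: A_def)
  have gap_pos: "lam' - lam > 0" using lam by simp
  obtain K where K: "\<And>m T I. \<lbrakk>\<And>k. k > 0 \<Longrightarrow> 0 \<le> m k; \<And>k. k > 0 \<Longrightarrow> m k \<le> measure lborel \<Omega>; \<And>k. k > 0 \<Longrightarrow> T k \<le> I;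
      \<And>k l. 0 < k \<Longrightarrow> k \<le> l \<Longrightarrow> T l \<le> T k;
      \<And>k. k > 0 \<Longrightarrow> k powr q * m k \<le> T k;
      \<And>k. k > 0 \<Longrightarrow> I \<le> k powr q * measure lborel \<Omega> + T k;
      \<And>k. k > 0 \<Longrightarrow> T (2 * k) \<le> A * m k powr \<alpha> * (lam * T k + G);
      \<And>k. k > 0 \<Longrightarrow> T k \<le> A * m k powr \<alpha> * (lam * T k + G) + 2 powr q * k powr q * m k;
      \<And>h k. 0 < h \<Longrightarrow> h \<le> k \<Longrightarrow> (lam' - lam) * (h powr (q + 1) * m h) \<le> lam * k * T k + k * G\<rbrakk> \<Longrightarrow> I \<le> (K::real)"
  proof (rule level_iteration_bound[OF q \<alpha> A lam(1) gap_pos G measure_nonneg[of lborel \<Omega>]], goal_cases)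
    case (1 K)
    from 1(2) show ?case by (rule 1(1))
  qed
  have "(\<integral>x. u x powr (p - 1) \<partial>lborel) \<le> K"
    if [measurable]: "u \<in> borel_measurable borel" and un: "\<And>x. 0 \<le> u x" and u0: "\<And>x. x \<notin> \<Omega> \<Longrightarrow> u x = 0"
      and uint: "integrable lborel (\<lambda>x. u x powr (p - 1))"
      and en: "\<And>a b. 0 \<le> a \<Longrightarrow> a < b \<Longrightarrow> energy (\<lambda>x. clamp_real a b (u x))
         \<le> ennreal (2 * (\<integral>x. (lam * u x powr (p - 1) + g x) * (clamp_real a b (u x) - a) \<partial>lborel))"
      and gap: "\<And>k. k > 0 \<Longrightarrow> ennreal (2 * lam') * (\<integral>\<^sup>+ x. ennreal (clamp_real 0 k (u x) powr p) \<partial>lborel) \<le> energy (\<lambda>x. clamp_real 0 k (u x))"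
    for u
  proof -
    define m where "m t = measure lborel {x. u x > t}" for t
    define T where "T t = (\<integral>x. indicator {x. u x > t} x * u x powr q \<partial>lborel)" for t
    define I where "I = (\<integral>x. u x powr q \<partial>lborel)"
    have uq: "integrable lborel (\<lambda>x. u x powr q)" using uint by (simp add: q_def)
    have Tint: "integrable lborel (\<lambda>x. indicator {x. u x > t} x * u x powr q)" for t
      by (rule Bochner_Integration.integrable_bound[OF uq]) (auto simp: indicator_def)
    have T0: "T t \<ge> 0" for t unfolding T_def by simp
    have m0: "m t \<ge> 0" for t by (simp add: m_def)
    have em: "emeasure lborel {x. u x > t} = ennreal (m t)" if "t \<ge> 0" for t
      unfolding m_def using u0 that by (intro level_set_emeasure) auto
    have mint: "integrable lborel (\<lambda>x. c * indicator {x. u x > t} x :: real)" if "t \<ge> 0" for t c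
      using em[OF that] by (intro integrable_mult_right) (simp add: integrable_indicator_iff)
    have mi: "(\<integral>x. c * indicator {x. u x > t} x \<partial>lborel) = c * m t" for t c by (simp add: m_def)
    \<comment> \<open>The test function is the clamp minus a, which vanishes where u \<le> k and is
      at most b - a elsewhere. Hence only the part of u^q over {u > k} enters F.\<close>
    have en': "energy (\<lambda>x. clamp_real a b (u x)) \<le> ennreal (2 * (b - a) * (lam * T k + G))" if k: "k \<ge> 0" and ab: "k \<le> a" "a < b" for k a b
    proof -
      let ?h = "\<lambda>x. (lam * u x powr q + g x) * (clamp_real a b (u x) - a)"
      let ?H = "\<lambda>x. (b - a) * (lam * (indicator {x. u x > k} x * u x powr q) + g x)"
      have Hint: "integrable lborel ?H" by (intro integrable_mult_right Bochner_Integration.integrable_add Tint g)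
      have le: "?h x \<le> ?H x" "0 \<le> ?h x" for x
      proof -
        have c: "0 \<le> clamp_real a b (u x) - a" "clamp_real a b (u x) - a \<le> b - a" using ab by (auto simp: clamp_real_def)
        have f: "0 \<le> lam * u x powr q + g x" using lam g by simp
        show "0 \<le> ?h x" using c f by simp
        show "?h x \<le> ?H x"
        proof (cases "u x > k")
          case True
          have "?h x \<le> (lam * u x powr q + g x) * (b - a)" using c f by (intro mult_left_mono)
          then show ?thesis using True by (simp add: mult_ac)
        next
          case False
          then have "clamp_real a b (u x) - a = 0" using ab by (simp add: clamp_real_def)
          then show ?thesis using ab g lam by simp
        qed
      qed
      have "integrable lborel ?h"
        by (rule Bochner_Integration.integrable_bound[OF Hint]) (use le in \<open>auto intro!: order_trans[OF le(1)]\<close>)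
      then have "(\<integral>x. ?h x \<partial>lborel) \<le> (\<integral>x. ?H x \<partial>lborel)" by (intro integral_mono Hint le)
      also have "\<dots> = (b - a) * (lam * T k + G)"
        using Tint[of k] g(2) by (simp add: T_def G_def)
      finally have "ennreal (2 * (\<integral>x. ?h x \<partial>lborel)) \<le> ennreal (2 * (b - a) * (lam * T k + G))"
        unfolding mult.assoc by (intro ennreal_leI mult_left_mono) auto
      moreover have "energy (\<lambda>x. clamp_real a b (u x)) \<le> ennreal (2 * (\<integral>x. ?h x \<partial>lborel))"
        using en[of a b] k ab by (simp add: q_def)
      ultimately show ?thesis by (rule order_trans[rotated])
    qed
    have cheb: "t powr q * m t \<le> T t" if t: "t > 0" for t
    proof -
      have "t powr q * m t = (\<integral>x. t powr q * indicator {x. u x > t} x \<partial>lborel)" by (simp only: mi)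
      also have "\<dots> \<le> T t" unfolding T_def
        using t q by (intro integral_mono mint Tint) (auto simp: indicator_def intro!: powr_mono2)
      finally show ?thesis .
    qed
    have core: "(\<integral>\<^sup>+ x. indicator {x. u x > k} x * ennreal ((u x - k) powr q) \<partial>lborel) \<le> ennreal (A0 * m k powr \<alpha> * (lam * T k + G))" if k: "k > 0" for k
      unfolding m_def
    proof (rule A0_bound)
      assume "measure lborel {x. u x > k} > 0"
      then have "0 < k powr q * m k" using k by (simp add: m_def)
      then have "T k > 0" using cheb[OF k] by linarith
      then show "0 < lam * T k + G" using lam G by (simp add: add_pos_nonneg)
    qed (use u0 k en' in auto)
    define V where "V k = (\<integral>x. indicator {x. u x > k} x * (u x - k) powr q \<partial>lborel)" for k
    have Vint: "integrable lborel (\<lambda>x. indicator {x. u x > k} x * (u x - k) powr q)" if "k > 0" for k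
      by (rule Bochner_Integration.integrable_bound[OF uq]) (use that q un in \<open>auto simp: indicator_def intro!: powr_mono2\<close>)
    have V: "V k \<le> A0 * m k powr \<alpha> * (lam * T k + G)" if k: "k > 0" for k
    proof -
      have "ennreal (V k) = (\<integral>\<^sup>+ x. ennreal (indicator {x. u x > k} x * (u x - k) powr q) \<partial>lborel)"
        unfolding V_def by (intro nn_integral_eq_integral[symmetric] Vint k) auto
      also have "\<dots> = (\<integral>\<^sup>+ x. indicator {x. u x > k} x * ennreal ((u x - k) powr q) \<partial>lborel)"
        by (intro nn_integral_cong) (auto simp: indicator_def)
      also note core[OF k]
      finally show ?thesis
        using A0(1) lam G T0[of k] by (subst (asm) ennreal_le_iff) (auto intro!: mult_nonneg_nonneg add_nonneg_nonneg)
    qed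
    have "I \<le> K"
    proof (rule K)
      fix k :: real assume k: "k > 0"
      show "0 \<le> m k" by (rule m0)
      show "m k \<le> measure lborel \<Omega>" unfolding m_def using u0 k by (intro level_set_emeasure) auto
      show "T k \<le> I" unfolding T_def I_def by (intro integral_mono Tint uq) (auto simp: indicator_def)
      show "k powr q * m k \<le> T k" by (rule cheb[OF k])
      show "I \<le> k powr q * measure lborel \<Omega> + T k"
      proof -
        have "I \<le> (\<integral>x. k powr q * indicator \<Omega> x + indicator {x. u x > k} x * u x powr q \<partial>lborel)"
          unfolding I_def
        proof (intro integral_mono uq Bochner_Integration.integrable_add integrable_indicator_\<Omega> Tint)
          fix x
          show "u x powr q \<le> k powr q * indicator \<Omega> x + indicator {x. u x > k} x * u x powr q"
            using u0[of x] un[of x] q k by (auto simp: indicator_def intro!: powr_mono2)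
        qed
        also have "\<dots> = k powr q * measure lborel \<Omega> + T k"
          unfolding T_def using integrable_indicator_\<Omega>[of "k powr q"]
          by (subst Bochner_Integration.integral_add) (auto intro: Tint)
        finally show ?thesis .
      qed
      show "T (2 * k) \<le> A * m k powr \<alpha> * (lam * T k + G)"
      proof -
        have "T (2 * k) \<le> (\<integral>x. 2 powr q * (indicator {x. u x > k} x * (u x - k) powr q) \<partial>lborel)"
          unfolding T_def
        proof (intro integral_mono Tint integrable_mult_right Vint k)
          fix x
          show "indicator {x. u x > 2 * k} x * u x powr q \<le> 2 powr q * (indicator {x. u x > k} x * (u x - k) powr q)"
          proof (cases "u x > 2 * k")
            case True
            then have "u x powr q \<le> (2 * (u x - k)) powr q" using k q by (intro powr_mono2) auto
            also have "\<dots> = 2 powr q * (u x - k) powr q" by (subst powr_mult) (use True k in auto)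
            finally show ?thesis using True k by simp
          qed simp
        qed
        also have "\<dots> = 2 powr q * V k" by (simp add: V_def)
        also have "\<dots> \<le> 2 powr q * (A0 * m k powr \<alpha> * (lam * T k + G))" by (intro mult_left_mono V k) auto
        finally show ?thesis by (simp add: A_def mult_ac)
      qed
      show "T k \<le> A * m k powr \<alpha> * (lam * T k + G) + 2 powr q * k powr q * m k"
      proof -
        have "T k \<le> (\<integral>x. 2 powr q * (indicator {x. u x > k} x * (u x - k) powr q) + 2 powr q * k powr q * indicator {x. u x > k} x \<partial>lborel)"
          unfolding T_def
        proof (intro integral_mono Tint Bochner_Integration.integrable_add integrable_mult_right Vint k mint)
          show "integrable lborel (\<lambda>x. indicator {x. u x > k} x :: real)" using mint[of k 1] k by simp
          fix x
          show "indicator {x. u x > k} x * u x powr q \<le> 2 powr q * (indicator {x. u x > k} x * (u x - k) powr q) + 2 powr q * k powr q * indicator {x. u x > k} x"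
            using abs_add_powr_le[of q "u x - k" k] q k un[of x] by (auto simp: indicator_def algebra_simps)
        qed
        also have "\<dots> = 2 powr q * V k + 2 powr q * k powr q * m k"
        proof -
          have i2: "integrable lborel (\<lambda>x. 2 powr q * k powr q * indicator {x. u x > k} x)" using k by (intro mint) auto
          show ?thesis unfolding V_def using mi[of "2 powr q * k powr q" k]
            by (subst Bochner_Integration.integral_add[OF integrable_mult_right[OF Vint[OF k]] i2]) simp
        qed
        also have "\<dots> \<le> 2 powr q * (A0 * m k powr \<alpha> * (lam * T k + G)) + 2 powr q * k powr q * m k"
          by (intro add_right_mono mult_left_mono V k) auto
        finally show ?thesis by (simp add: A_def mult_ac)
      qed
    next
      fix k l :: real assume "0 < k" "k \<le> l"
      then show "T l \<le> T k" unfolding T_def by (intro integral_mono Tint) (auto simp: indicator_def)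
    next
      fix h k :: real assume h: "0 < h" "h \<le> k"
      have k: "k > 0" using h by simp
      let ?c = "\<lambda>x. clamp_real 0 k (u x)"
      have cx: "?c x = (if u x > k then k else u x)" for x using un[of x] k by (auto simp: clamp_real_def)
      have pq: "t powr p = t * t powr q" if "t \<ge> 0" for t
        using that q by (cases "t = 0") (auto simp: q_def powr_diff)
      have cint: "integrable lborel (\<lambda>x. ?c x powr p)"
      proof (rule Bochner_Integration.integrable_bound[OF integrable_indicator_\<Omega>[of "k powr p"]])
        show "AE x in lborel. norm (?c x powr p) \<le> norm (k powr p * indicator \<Omega> x)"
          using u0 k p un by (intro AE_I2) (auto simp: indicator_def cx intro!: powr_mono2)
      qed measurable
      have "h powr p * m h \<le> (\<integral>x. ?c x powr p \<partial>lborel)"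
      proof -
        have "h powr p * m h = (\<integral>x. h powr p * indicator {x. u x > h} x \<partial>lborel)" by (simp only: mi)
        also have "\<dots> \<le> (\<integral>x. ?c x powr p \<partial>lborel)"
          using h p by (intro integral_mono mint cint) (auto simp: indicator_def cx intro!: powr_mono2)
        finally show ?thesis .
      qed
      note low = this
      \<comment> \<open>Where u \<le> k, the product of u^q with the truncation is the p-th power of
        the truncation, to be absorbed by the spectral gap; where u > k it is k u^q, which
        integrates to the tail T k.\<close>
      have rhs: "(\<integral>x. (lam * u x powr q + g x) * (?c x - 0) \<partial>lborel) \<le> lam * (\<integral>x. ?c x powr p \<partial>lborel) + (lam * k * T k + k * G)"
      proof -
        have "(\<integral>x. (lam * u x powr q + g x) * (?c x - 0) \<partial>lborel)
           \<le> (\<integral>x. lam * ?c x powr p + (lam * k * (indicator {x. u x > k} x * u x powr q) + k * g x) \<partial>lborel)"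
        proof (rule integral_mono)
          show R: "integrable lborel (\<lambda>x. lam * ?c x powr p + (lam * k * (indicator {x. u x > k} x * u x powr q) + k * g x))"
            by (intro Bochner_Integration.integrable_add integrable_mult_right cint Tint g)
          show le: "(lam * u x powr q + g x) * (?c x - 0) \<le> lam * ?c x powr p + (lam * k * (indicator {x. u x > k} x * u x powr q) + k * g x)" for x
          proof -
            have "g x * ?c x \<le> g x * k" using g(1)[of x] by (intro mult_left_mono) (auto simp: cx)
            moreover have "lam * u x powr q * ?c x \<le> lam * ?c x powr p + lam * k * (indicator {x. u x > k} x * u x powr q)"
              using lam k un[of x] pq[OF un[of x]] by (auto simp: cx indicator_def mult_ac)
            ultimately show ?thesis by (simp add: algebra_simps)
          qed
          show "integrable lborel (\<lambda>x. (lam * u x powr q + g x) * (?c x - 0))"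
          proof (rule Bochner_Integration.integrable_bound[OF R])
            have nn: "0 \<le> (lam * u x powr q + g x) * (?c x - 0)" for x using lam g(1)[of x] un[of x] k by (auto simp: cx)
            show "AE x in lborel. norm ((lam * u x powr q + g x) * (?c x - 0)) \<le> norm (lam * ?c x powr p + (lam * k * (indicator {x. u x > k} x * u x powr q) + k * g x))"
              using le nn by (intro AE_I2) (simp only: real_norm_def abs_of_nonneg abs_ge_self order_trans[OF le])
          qed measurable
        qed
        also have "\<dots> = lam * (\<integral>x. ?c x powr p \<partial>lborel) + (lam * k * T k + k * G)"
          using cint Tint[of k] g(2) by (simp add: T_def G_def)
        finally show ?thesis .
      qed
      have "ennreal (2 * lam') * ennreal (\<integral>x. ?c x powr p \<partial>lborel) = ennreal (2 * lam') * (\<integral>\<^sup>+ x. ennreal (?c x powr p) \<partial>lborel)"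
        by (subst nn_integral_eq_integral[OF cint]) auto
      also have "\<dots> \<le> energy ?c" by (rule gap[OF k])
      also have "\<dots> \<le> ennreal (2 * (\<integral>x. (lam * u x powr q + g x) * (?c x - 0) \<partial>lborel))"
        using en[of 0 k] k by (simp add: q_def)
      also have "\<dots> \<le> ennreal (2 * (lam * (\<integral>x. ?c x powr p \<partial>lborel) + (lam * k * T k + k * G)))"
        by (intro ennreal_leI mult_left_mono rhs) auto
      finally have "ennreal (2 * lam' * (\<integral>x. ?c x powr p \<partial>lborel)) \<le> ennreal (2 * (lam * (\<integral>x. ?c x powr p \<partial>lborel) + (lam * k * T k + k * G)))"
        using lam by (simp add: ennreal_mult)
      then have "2 * lam' * (\<integral>x. ?c x powr p \<partial>lborel) \<le> 2 * (lam * (\<integral>x. ?c x powr p \<partial>lborel) + (lam * k * T k + k * G))"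
        using lam k T0[of k] G by (subst (asm) ennreal_le_iff) (auto intro!: add_nonneg_nonneg mult_nonneg_nonneg)
      then have "(lam' - lam) * (\<integral>x. ?c x powr p \<partial>lborel) \<le> lam * k * T k + k * G" by (simp add: algebra_simps)
      moreover have "(lam' - lam) * (h powr p * m h) \<le> (lam' - lam) * (\<integral>x. ?c x powr p \<partial>lborel)"
        using lam by (intro mult_left_mono low) auto
      ultimately show "(lam' - lam) * (h powr (q + 1) * m h) \<le> lam * k * T k + k * G" by (simp add: q_def)
    qed
    then show ?thesis by (simp add: I_def q_def)
  qed
  then show thesis by (rule that)
qed

end

section \<open>Comparison\<close>

text \<open>Without the truncation of u at M the product would be nonnegative by monotonicity. The
  truncation can spoil the sign only if one of the two values exceeds M, and then the loss is at
  most |u1 - u2|^p.\<close>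

lemma comparison_pointwise_aux:
  fixes u1 u2 v1 v2 M p :: real
  assumes p: "p > 1" and UV: "v1 - v2 \<le> u1 - u2"
  shows "- (if u1 > M \<or> u2 > M then \<bar>u1 - u2\<bar> powr p else 0)
     \<le> (sgp p (u1 - u2) - sgp p (v1 - v2)) * (clamp_real 0 1 (min u1 M - v1) - clamp_real 0 1 (min u2 M - v2))"
proof -
  define e where "e = clamp_real 0 1 (min u1 M - v1) - clamp_real 0 1 (min u2 M - v2)"
  have sg: "sgp p (u1 - u2) - sgp p (v1 - v2) \<ge> 0" using sgp_mono[OF p UV] by simp
  show ?thesis
  proof (cases "e \<ge> 0")
    case True
    then have "0 \<le> (sgp p (u1 - u2) - sgp p (v1 - v2)) * e" using sg by simp
    then show ?thesis unfolding e_def[symmetric] by (auto simp: order_trans[of _ 0])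
  next
    case False
    \<comment> \<open>If the second factor is negative, both u1 - u2 and v1 - v2 are forced to be
      nonnegative, and its modulus is at most v1 - v2, hence at most u1 - u2.\<close>
    then have e1: "- e \<le> (v1 - v2) - (min u1 M - min u2 M)" and e2: "(v1 - v2) - (min u1 M - min u2 M) > 0"
      by (auto simp: e_def clamp_real_def max_def min_def split: if_splits)
    have U: "u1 - u2 \<ge> 0" "min u1 M - min u2 M \<ge> 0" "u1 > M \<or> u2 > M"
      using e2 UV by (auto simp: min_def split: if_splits)
    have V: "v1 - v2 > 0" using e2 U by linarith
    have eU: "- e \<le> u1 - u2" using e1 U UV by linarith
    have "sgp p (v1 - v2) \<ge> 0" using sgp_mono[OF p, of 0 "v1 - v2"] V by simp
    then have "(sgp p (u1 - u2) - sgp p (v1 - v2)) * (- e) \<le> sgp p (u1 - u2) * (u1 - u2)"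
      using eU False sg U by (intro mult_mono) auto
    also have "\<dots> = \<bar>u1 - u2\<bar> powr p" by (rule sgp_mult_self[OF p])
    finally show ?thesis using U unfolding e_def[symmetric] by simp
  qed
qed

lemma comparison_pointwise:
  fixes u1 u2 v1 v2 M p :: real
  assumes p: "p > 1"
  shows "- (if u1 > M \<or> u2 > M then \<bar>u1 - u2\<bar> powr p else 0)
     \<le> (sgp p (u1 - u2) - sgp p (v1 - v2)) * (clamp_real 0 1 (min u1 M - v1) - clamp_real 0 1 (min u2 M - v2))"
proof (cases "v1 - v2 \<le> u1 - u2")
  case True
  then show ?thesis by (rule comparison_pointwise_aux[OF p])
next
  case False
  have "- (if u2 > M \<or> u1 > M then \<bar>u2 - u1\<bar> powr p else 0)
     \<le> (sgp p (u2 - u1) - sgp p (v2 - v1)) * (clamp_real 0 1 (min u2 M - v2) - clamp_real 0 1 (min u1 M - v1))"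
    using False by (intro comparison_pointwise_aux[OF p]) simp
  moreover have "sgp p (u2 - u1) = - sgp p (u1 - u2)" "sgp p (v2 - v1) = - sgp p (v1 - v2)"
    using sgp_minus[of p "u1 - u2"] sgp_minus[of p "v1 - v2"] by simp_all
  moreover have "(- a - - b) * (d - c) = (a - b) * (c - d)" for a b c d :: real by (simp add: algebra_simps)
  moreover have "(if u2 > M \<or> u1 > M then \<bar>u2 - u1\<bar> powr p else 0) = (if u1 > M \<or> u2 > M then \<bar>u1 - u2\<bar> powr p else 0)"
    by (simp add: abs_minus_commute disj_commute)
  ultimately show ?thesis by (simp only:)
qed

lemma sgp_mult_pos:
  assumes "p > 1" "clamp_real 0 1 (u1 - v1) \<noteq> clamp_real 0 1 (u2 - v2)"
  shows "(sgp p (u1 - u2) - sgp p (v1 - v2)) * (clamp_real 0 1 (u1 - v1) - clamp_real 0 1 (u2 - v2)) > 0"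
proof (cases "u2 - v2 < u1 - v1")
  case True
  then have "clamp_real 0 1 (u1 - v1) > clamp_real 0 1 (u2 - v2)" using assms(2)
    by (auto simp: clamp_real_def max_def min_def split: if_splits)
  moreover have "sgp p (v1 - v2) < sgp p (u1 - u2)" using True assms(1) by (intro sgp_strict_mono) auto
  ultimately show ?thesis by simp
next
  case False
  then have "clamp_real 0 1 (u1 - v1) < clamp_real 0 1 (u2 - v2)" "u1 - v1 \<noteq> u2 - v2" using assms(2)
    by (auto simp: clamp_real_def max_def min_def split: if_splits)
  moreover from this have "sgp p (u1 - u2) < sgp p (v1 - v2)" using False assms(1) by (intro sgp_strict_mono) auto
  ultimately show ?thesis by (simp add: mult_neg_neg)
qed

context weighted_fractional
begin

text \<open>The function v need not have finite energy, so u - v is no test function; both are first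
  truncated at M. The resulting error lives where u > M and vanishes in the limit because u has
  finite energy. Requiring \<open>test\<close> only for these particular functions lets v be a weak
  solution or an entropy solution.\<close>

lemma comparison:
  assumes u: "u \<in> X" "\<And>x. 0 \<le> u x" and v: "v \<in> borel_measurable borel" "\<And>x. 0 \<le> v x" "\<And>x. x \<notin> \<Omega> \<Longrightarrow> v x = 0"
    and test: "\<And>M \<psi>. M > 0 \<Longrightarrow> \<psi> = (\<lambda>x. clamp_real 0 1 (Tk M (u x) - Tk M (v x))) \<Longrightarrow>
       \<psi> \<in> X \<and> integrable \<nu> (\<lambda>z. sgp p (dif v z) * dif \<psi> z) \<and>
       (\<integral>z. sgp p (dif u z) * dif \<psi> z \<partial>\<nu>) \<le> (\<integral>z. sgp p (dif v z) * dif \<psi> z \<partial>\<nu>)"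
  shows "AE x in lborel. u x \<le> v x"
proof -
  note [measurable] = X_measurable[OF u(1)] v(1)
  define \<psi> where "\<psi> n x = clamp_real 0 1 (Tk (real (Suc n)) (u x) - Tk (real (Suc n)) (v x))" for n x
  \<comment> \<open>Truncating v as well changes nothing here: where v exceeds the level, both
    differences are at most 0 and are clamped to 0. In particular the test function vanishes
    there.\<close>
  have \<psi>: "\<psi> n x = clamp_real 0 1 (min (u x) (Suc n) - v x)" for n x
    using u(2)[of x] v(2)[of x] by (auto simp: \<psi>_def clamp_real_def Tk_def max_def min_def)
  have t: "\<psi> n \<in> X" "integrable \<nu> (\<lambda>z. sgp p (dif v z) * dif (\<psi> n) z)"
      "(\<integral>z. sgp p (dif u z) * dif (\<psi> n) z \<partial>\<nu>) \<le> (\<integral>z. sgp p (dif v z) * dif (\<psi> n) z \<partial>\<nu>)" for n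
    using test[of "real (Suc n)" "\<psi> n"] by (auto simp: \<psi>_def[abs_def])
  define P where "P n z = (sgp p (dif u z) - sgp p (dif v z)) * dif (\<psi> n) z" for n z
  define R where "R n z = (if u (fst z) > real (Suc n) \<or> u (snd z) > real (Suc n) then \<bar>dif u z\<bar> powr p else 0)" for n :: nat and z
  have iu: "integrable \<nu> (\<lambda>z. sgp p (dif u z) * dif (\<psi> n) z)" for n using X_sgp_integrable[OF u(1) t(1), of 0] by simp
  have P: "integrable \<nu> (P n)" "(\<integral>z. P n z \<partial>\<nu>) \<le> 0" for n
    unfolding P_def left_diff_distrib using iu[of n] t(2,3)[of n] by simp_all
  have [measurable]: "R n \<in> borel_measurable \<nu>" for n unfolding R_def by measurable
  have R: "integrable \<nu> (R n)" for n
    by (rule Bochner_Integration.integrable_bound[OF X_dif_integrable[OF u(1)]]) (auto simp: R_def)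
  have Rlim: "(\<lambda>n. \<integral>z. R n z \<partial>\<nu>) \<longlonglongrightarrow> (\<integral>z. 0 \<partial>\<nu>)"
  proof (rule integral_dominated_convergence[OF _ _ X_dif_integrable[OF u(1)]])
    show "AE z in \<nu>. (\<lambda>n. R n z) \<longlonglongrightarrow> 0"
    proof (rule AE_I2)
      fix z
      obtain N where N: "u (fst z) \<le> real N" "u (snd z) \<le> real N"
        by (meson real_arch_simple order_trans max.cobounded1 max.cobounded2)
      have "\<forall>\<^sub>F n in sequentially. 0 = R n z"
        using N by (auto simp: R_def eventually_sequentially intro!: exI[of _ N])
      then show "(\<lambda>n. R n z) \<longlonglongrightarrow> 0" by (rule Lim_transform_eventually[OF tendsto_const])
    qed
  qed (auto simp: R_def)
  have PR: "0 \<le> P n z + R n z" for n z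
    using comparison_pointwise[OF p(1), of "real (Suc n)" "u (fst z)" "u (snd z)" "v (fst z)" "v (snd z)"]
    unfolding P_def R_def dif_def \<psi> by linarith
  have PRi: "(\<integral>\<^sup>+ z. ennreal (P n z + R n z) \<partial>\<nu>) \<le> ennreal (\<integral>z. R n z \<partial>\<nu>)" for n
  proof -
    have "(\<integral>\<^sup>+ z. ennreal (P n z + R n z) \<partial>\<nu>) = ennreal (\<integral>z. P n z + R n z \<partial>\<nu>)"
      using PR by (intro nn_integral_eq_integral Bochner_Integration.integrable_add P R) auto
    also have "\<dots> \<le> ennreal (\<integral>z. R n z \<partial>\<nu>)"
      using P R by (intro ennreal_leI) (simp add: Bochner_Integration.integral_add)
    finally show ?thesis .
  qed
  define \<psi>' where "\<psi>' x = clamp_real 0 1 (u x - v x)" for x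
  define Q where "Q z = (sgp p (dif u z) - sgp p (dif v z)) * dif \<psi>' z" for z
  have [measurable]: "\<psi>' \<in> borel_measurable borel" unfolding \<psi>'_def by measurable
  have [measurable]: "Q \<in> borel_measurable \<nu>" unfolding Q_def by measurable
  have [measurable]: "\<psi> n \<in> borel_measurable borel" for n by (rule X_measurable[OF t(1)])
  have [measurable]: "P n \<in> borel_measurable \<nu>" for n unfolding P_def by measurable
  have "(\<integral>\<^sup>+ z. ennreal (Q z) \<partial>\<nu>) = (\<integral>\<^sup>+ z. liminf (\<lambda>n. ennreal (P n z + R n z)) \<partial>\<nu>)"
  proof (rule nn_integral_cong)
    fix z :: "'a \<times> 'a"
    obtain N where N: "u (fst z) \<le> real N" "u (snd z) \<le> real N"
      by (meson real_arch_simple order_trans max.cobounded1 max.cobounded2)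
    have "\<forall>\<^sub>F n in sequentially. ennreal (Q z) = ennreal (P n z + R n z)"
      unfolding eventually_sequentially
    proof (intro exI[of _ N] allI impI)
      fix n assume n: "N \<le> n"
      have "u (fst z) \<le> real (Suc n)" "u (snd z) \<le> real (Suc n)" using N n by auto
      then have "min (u (fst z)) (Suc n) = u (fst z)" "min (u (snd z)) (Suc n) = u (snd z)" "R n z = 0"
        by (auto simp: R_def)
      then show "ennreal (Q z) = ennreal (P n z + R n z)" by (simp add: P_def Q_def dif_def \<psi> \<psi>'_def)
    qed
    then have "(\<lambda>n. ennreal (P n z + R n z)) \<longlonglongrightarrow> ennreal (Q z)" by (rule Lim_transform_eventually[OF tendsto_const])
    then show "ennreal (Q z) = liminf (\<lambda>n. ennreal (P n z + R n z))" by (intro lim_imp_Liminf[symmetric]) auto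
  qed
  also have "\<dots> \<le> liminf (\<lambda>n. \<integral>\<^sup>+ z. ennreal (P n z + R n z) \<partial>\<nu>)" by (rule nn_integral_liminf) measurable
  also have "\<dots> \<le> liminf (\<lambda>n. ennreal (\<integral>z. R n z \<partial>\<nu>))"
    by (intro Liminf_mono always_eventually allI PRi)
  also have "\<dots> = 0"
    using tendsto_ennrealI[OF Rlim] by (intro lim_imp_Liminf) auto
  finally have "(\<integral>\<^sup>+ z. ennreal (Q z) \<partial>\<nu>) = 0" by simp
  then have "AE z in \<nu>. ennreal (Q z) = 0" by (subst (asm) nn_integral_0_iff_AE) auto
  \<comment> \<open>Q is strictly positive wherever the clamped difference takes different values at
    the two points. It is therefore constant on almost all pairs; the energy is 0, and the Poincare
    inequality forces the function to vanish.\<close>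
  then have "AE z in \<nu>. ennreal (\<bar>dif \<psi>' z\<bar> powr p) = 0"
  proof eventually_elim
    fix z assume "ennreal (Q z) = 0"
    then have "Q z \<le> 0" by (simp add: ennreal_eq_0_iff)
    then have "\<psi>' (fst z) = \<psi>' (snd z)"
      using sgp_mult_pos[OF p(1), of "u (fst z)" "v (fst z)" "u (snd z)" "v (snd z)"]
      unfolding Q_def dif_def \<psi>'_def by fastforce
    then show "ennreal (\<bar>dif \<psi>' z\<bar> powr p) = 0" by (simp add: dif_def)
  qed
  then have "energy \<psi>' = 0" unfolding energy_def by (subst nn_integral_0_iff_AE) auto
  moreover obtain C where C: "\<And>\<phi>. \<phi> \<in> borel_measurable borel \<Longrightarrow> (\<And>x. x \<notin> \<Omega> \<Longrightarrow> \<phi> x = 0) \<Longrightarrow>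
     (\<integral>\<^sup>+ x. ennreal (\<bar>\<phi> x\<bar> powr p) \<partial>lborel) \<le> ennreal C * energy \<phi>"
    using poincare by metis
  moreover have "\<psi>' x = 0" if "x \<notin> \<Omega>" for x using X_zero[OF u(1) that] v(3)[OF that] by (simp add: \<psi>'_def clamp_real_def)
  ultimately have "(\<integral>\<^sup>+ x. ennreal (\<bar>\<psi>' x\<bar> powr p) \<partial>lborel) = 0" using C[of \<psi>'] by simp
  then have "AE x in lborel. ennreal (\<bar>\<psi>' x\<bar> powr p) = 0" by (subst (asm) nn_integral_0_iff_AE) auto
  then show ?thesis
    by eventually_elim (auto simp: ennreal_eq_0_iff \<psi>'_def clamp_real_def max_def min_def split: if_splits)
qed

text \<open>Tested with a truncation at height e and divided by e, the equation shows in the limit e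
  \<rightarrow> 0 the full quantity |w(x) - w(y)|^(p-1) wherever one of the values is 0. The bound
  involves only the L^1 norm of the datum and so survives the approximation.\<close>

lemma weak_solution_exterior:
  assumes w: "weak_solution f w" and [measurable]: "f \<in> borel_measurable borel" and f: "\<And>x. 0 \<le> f x" "integrable lborel f" "\<And>x. f x \<le> c"
  shows "(\<integral>\<^sup>+ z. indicator (- (\<Omega> \<times> \<Omega>)) z * ennreal (\<bar>dif w z\<bar> powr (p - 1)) \<partial>\<nu>) \<le> ennreal (2 * (\<integral>x. f x \<partial>lborel))"
proof -
  have wX: "w \<in> X" and w0: "\<And>x. 0 \<le> w x" using w by (auto simp: weak_solution_def)
  note [measurable] = X_measurable[OF wX]
  define e where "e n = 1 / real (Suc n)" for n
  have e: "e n > 0" for n by (simp add: e_def)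
  define \<psi> where "\<psi> n x = clamp_real 0 (e n) (w x)" for n x
  have \<psi>X: "\<psi> n \<in> X" for n unfolding \<psi>_def using e[of n] by (intro X_clamp wX) auto
  note [measurable] = X_measurable[OF \<psi>X]
  let ?g = "\<lambda>n z. real (Suc n) * (sgp p (dif w z) * dif (\<psi> n) z)"
  have gpos: "0 \<le> ?g n z" for n z
  proof -
    consider "w (fst z) \<le> w (snd z)" | "w (snd z) \<le> w (fst z)" by linarith
    then have "0 \<le> sgp p (dif w z) * dif (\<psi> n) z"
    proof cases
      case 1
      then have "sgp p (dif w z) \<le> sgp p 0" by (intro sgp_mono p) (simp add: dif_def)
      moreover have "dif (\<psi> n) z \<le> 0" using 1 by (auto simp: dif_def \<psi>_def clamp_real_def max_def min_def)
      ultimately show ?thesis by (simp add: mult_nonpos_nonpos)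
    next
      case 2
      then have "sgp p 0 \<le> sgp p (dif w z)" by (intro sgp_mono p) (simp add: dif_def)
      moreover have "dif (\<psi> n) z \<ge> 0" using 2 by (auto simp: dif_def \<psi>_def clamp_real_def max_def min_def)
      ultimately show ?thesis by simp
    qed
    then show ?thesis by simp
  qed
  have gi: "(\<integral>\<^sup>+ z. ennreal (?g n z) \<partial>\<nu>) \<le> ennreal (2 * (\<integral>x. f x \<partial>lborel))" for n
  proof -
    have int: "integrable \<nu> (\<lambda>z. sgp p (dif w z) * dif (\<psi> n) z)"
      and eq: "(1/2) * (\<integral>z. sgp p (dif w z) * dif (\<psi> n) z \<partial>\<nu>) = (\<integral>x. f x * \<psi> n x \<partial>lborel)"
      using w \<psi>X by (auto simp: weak_solution_def)
    have fabs: "\<bar>f x\<bar> \<le> c" for x using f(1,3)[of x] by simp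
    have "(\<integral>x. f x * \<psi> n x \<partial>lborel) \<le> (\<integral>x. e n * f x \<partial>lborel)"
    proof (rule integral_mono)
      show "integrable lborel (\<lambda>x. f x * \<psi> n x)" by (rule X_integrable_bounded_mult[OF \<psi>X _ fabs]) measurable
      show "integrable lborel (\<lambda>x. e n * f x)" using f(2) by simp
      show "f x * \<psi> n x \<le> e n * f x" for x
      proof -
        have "f x * \<psi> n x \<le> f x * e n" using f(1)[of x] e[of n] by (intro mult_left_mono) (auto simp: \<psi>_def clamp_real_def)
        then show ?thesis by (simp add: mult.commute)
      qed
    qed
    then have "(\<integral>z. sgp p (dif w z) * dif (\<psi> n) z \<partial>\<nu>) \<le> 2 * (e n * (\<integral>x. f x \<partial>lborel))" using eq by simp
    then have "real (Suc n) * (\<integral>z. sgp p (dif w z) * dif (\<psi> n) z \<partial>\<nu>) \<le> real (Suc n) * (2 * (e n * (\<integral>x. f x \<partial>lborel)))"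
      by (intro mult_left_mono) auto
    also have "\<dots> = 2 * (\<integral>x. f x \<partial>lborel)" by (simp add: e_def)
    finally have "(\<integral>z. ?g n z \<partial>\<nu>) \<le> 2 * (\<integral>x. f x \<partial>lborel)" by simp
    moreover have "(\<integral>\<^sup>+ z. ennreal (?g n z) \<partial>\<nu>) = ennreal (\<integral>z. ?g n z \<partial>\<nu>)"
      using int gpos by (intro nn_integral_eq_integral integrable_mult_right) auto
    ultimately show ?thesis by (simp add: ennreal_leI)
  qed
  have "(\<integral>\<^sup>+ z. indicator (- (\<Omega> \<times> \<Omega>)) z * ennreal (\<bar>dif w z\<bar> powr (p - 1)) \<partial>\<nu>) \<le> (\<integral>\<^sup>+ z. liminf (\<lambda>n. ennreal (?g n z)) \<partial>\<nu>)"
  proof (rule nn_integral_mono)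
    fix z :: "'a \<times> 'a"
    show "indicator (- (\<Omega> \<times> \<Omega>)) z * ennreal (\<bar>dif w z\<bar> powr (p - 1)) \<le> liminf (\<lambda>n. ennreal (?g n z))"
    proof (cases "z \<notin> \<Omega> \<times> \<Omega> \<and> dif w z \<noteq> 0")
      case True
      have out: "w (fst z) = 0 \<or> w (snd z) = 0" using True X_zero[OF wX] by (cases z) auto
      have pos: "\<bar>dif w z\<bar> > 0" using True by simp
      have "e \<longlonglongrightarrow> 0" unfolding e_def using LIMSEQ_inverse_real_of_nat by (simp add: inverse_eq_divide)
      from order_tendstoD(2)[OF this pos] have "\<forall>\<^sub>F n in sequentially. ennreal (\<bar>dif w z\<bar> powr (p - 1)) = ennreal (?g n z)"
      proof eventually_elim
        fix n assume n: "e n < \<bar>dif w z\<bar>"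
        have "dif (\<psi> n) z = sgn (dif w z) * e n"
          using out n e[of n] w0[of "fst z"] w0[of "snd z"] by (auto simp: dif_def \<psi>_def clamp_real_def)
        moreover have "sgp p (dif w z) * sgn (dif w z) = \<bar>sgp p (dif w z)\<bar>"
          by (auto simp: sgp_def abs_mult sgn_if)
        ultimately have "?g n z = \<bar>sgp p (dif w z)\<bar>" by (simp add: e_def)
        then show "ennreal (\<bar>dif w z\<bar> powr (p - 1)) = ennreal (?g n z)" using abs_sgp[OF p(1)] by simp
      qed
      then have "(\<lambda>n. ennreal (?g n z)) \<longlonglongrightarrow> ennreal (\<bar>dif w z\<bar> powr (p - 1))" by (rule Lim_transform_eventually[OF tendsto_const])
      then have "liminf (\<lambda>n. ennreal (?g n z)) = ennreal (\<bar>dif w z\<bar> powr (p - 1))" by (intro lim_imp_Liminf) auto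
      then show ?thesis using True by simp
    qed (auto simp: indicator_def)
  qed
  also have "\<dots> \<le> liminf (\<lambda>n. \<integral>\<^sup>+ z. ennreal (?g n z) \<partial>\<nu>)" by (rule nn_integral_liminf) measurable
  also have "\<dots> \<le> ennreal (2 * (\<integral>x. f x \<partial>lborel))"
    by (intro Liminf_le always_eventually allI gi) simp
  finally show ?thesis .
qed

end

section \<open>Entropy inequalities and their stability\<close>

text \<open>If the two factors have opposite signs, the increment of \<phi> exceeds that of w in
  modulus and dominates the truncated increment as well. The bound depends on neither w nor k, which
  is what Fatou's lemma needs.\<close>

lemma sgp_Tk_lower_bound:
  fixes w1 w2 \<phi>1 \<phi>2 k p :: real
  assumes p: "p > 1"
  shows "- (\<bar>\<phi>1 - \<phi>2\<bar> powr p) \<le> sgp p (w1 - w2) * (Tk k (w1 - \<phi>1) - Tk k (w2 - \<phi>2))"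
proof -
  have aux: "- (\<bar>\<phi>1 - \<phi>2\<bar> powr p) \<le> sgp p (w1 - w2) * (Tk k (w1 - \<phi>1) - Tk k (w2 - \<phi>2))"
    if U: "w1 - w2 \<ge> 0" for w1 w2 \<phi>1 \<phi>2 :: real
  proof (cases "Tk k (w1 - \<phi>1) - Tk k (w2 - \<phi>2) \<ge> 0")
    case True
    have "sgp p (w1 - w2) \<ge> 0" using sgp_mono[OF p, of 0 "w1 - w2"] U by simp
    then have "0 \<le> sgp p (w1 - w2) * (Tk k (w1 - \<phi>1) - Tk k (w2 - \<phi>2))" using True by simp
    then show ?thesis by (simp add: order_trans[of _ 0])
  next
    case False
    let ?e = "Tk k (w1 - \<phi>1) - Tk k (w2 - \<phi>2)"
    have "- ?e \<le> (\<phi>1 - \<phi>2) - (w1 - w2)" "(\<phi>1 - \<phi>2) - (w1 - w2) > 0"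
      using False by (auto simp: Tk_def max_def min_def split: if_splits)
    then have "sgp p (w1 - w2) * (- ?e) \<le> sgp p (\<phi>1 - \<phi>2) * (\<phi>1 - \<phi>2)"
      using U False sgp_mono[OF p, of 0 "\<phi>1 - \<phi>2"] by (intro mult_mono sgp_mono p) auto
    also have "\<dots> = \<bar>\<phi>1 - \<phi>2\<bar> powr p" by (rule sgp_mult_self[OF p])
    finally show ?thesis unfolding mult_minus_right by linarith
  qed
  show ?thesis
  proof (cases "w1 - w2 \<ge> 0")
    case True
    then show ?thesis by (rule aux)
  next
    case False
    have "- (\<bar>\<phi>2 - \<phi>1\<bar> powr p) \<le> sgp p (w2 - w1) * (Tk k (w2 - \<phi>2) - Tk k (w1 - \<phi>1))" using False by (intro aux) auto
    moreover have "sgp p (w2 - w1) = - sgp p (w1 - w2)" using sgp_minus[of p "w1 - w2"] by simp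
    moreover have "- a * (c - b) = a * (b - c)" for a b c :: real by (simp add: algebra_simps)
    ultimately show ?thesis by (simp only: abs_minus_commute)
  qed
qed

text \<open>The increment of a clamp has the sign of the increment of its argument and smaller
  modulus. This turns tests with clamps into energy bounds.\<close>

lemma clamp_energy_pointwise:
  fixes p :: real
  assumes p: "p > 1"
  shows "\<bar>clamp_real a b t1 - clamp_real a b t2\<bar> powr p \<le> sgp p (t1 - t2) * (clamp_real a b t1 - clamp_real a b t2)"
proof -
  have aux: "\<bar>clamp_real a b t1 - clamp_real a b t2\<bar> powr p \<le> sgp p (t1 - t2) * (clamp_real a b t1 - clamp_real a b t2)"
    if "t2 \<le> t1" for t1 t2
  proof -
    let ?c = "clamp_real a b t1 - clamp_real a b t2"
    have c: "0 \<le> ?c" using that by (auto simp: clamp_real_def max_def min_def)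
    moreover have "?c \<le> t1 - t2" using clamp_real_lipschitz[of a b t1 t2] that by simp
    ultimately have "sgp p ?c * ?c \<le> sgp p (t1 - t2) * ?c" by (intro mult_right_mono sgp_mono p)
    then show ?thesis by (simp add: sgp_mult_self[OF p])
  qed
  show ?thesis
  proof (cases "t2 \<le> t1")
    case False
    have "\<bar>clamp_real a b t2 - clamp_real a b t1\<bar> powr p \<le> sgp p (t2 - t1) * (clamp_real a b t2 - clamp_real a b t1)"
      using False by (intro aux) auto
    moreover have "sgp p (t2 - t1) = - sgp p (t1 - t2)" using sgp_minus[of p "t1 - t2"] by simp
    moreover have "- x * (z - y) = x * (y - z)" for x y z :: real by (simp add: algebra_simps)
    ultimately show ?thesis by (simp only: abs_minus_commute)
  qed (rule aux)
qed

context weighted_fractional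
begin

text \<open>Used twice: with w fixed, to pass from smooth test functions to all of W, and with
  \<phi> fixed, to pass from the approximations to the limit. Fatou's lemma is applied after adding
  an integrable minorant whose integral converges, so equality may become an inequality, but nothing
  else is lost.\<close>

lemma entropy_stability:
  assumes [measurable]: "\<And>n. w n \<in> borel_measurable borel" "u \<in> borel_measurable borel"
      "\<And>n. \<phi> n \<in> borel_measurable borel" "\<phi>' \<in> borel_measurable borel" "H \<in> borel_measurable \<nu>"
    and w0: "\<And>n x. x \<notin> \<Omega> \<Longrightarrow> w n x = 0" and \<phi>0: "\<And>n x. x \<notin> \<Omega> \<Longrightarrow> \<phi> n x = 0"
    and aew: "AE x in lborel. (\<lambda>n. w n x) \<longlonglongrightarrow> u x" and ae\<phi>: "AE x in lborel. (\<lambda>n. \<phi> n x) \<longlonglongrightarrow> \<phi>' x"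
    and \<phi>fin: "w2 \<phi>' < \<infinity>" and \<phi>lim: "(\<lambda>n. w2 (\<lambda>x. \<phi> n x - \<phi>' x)) \<longlonglongrightarrow> 0" "\<And>n. w2 (\<lambda>x. \<phi> n x - \<phi>' x) \<le> 1"
    and H0: "\<And>z. 0 \<le> H z" and Hfin: "(\<integral>\<^sup>+ z. indicator (- (\<Omega> \<times> \<Omega>)) z * ennreal (H z) \<partial>\<nu>) < \<infinity>"
    and Hle: "\<And>n. AE z in \<nu>. z \<notin> \<Omega> \<times> \<Omega> \<longrightarrow> \<bar>dif (w n) z\<bar> powr (p - 1) \<le> H z"
    and k: "k > 0"
    and F: "\<And>n. integrable \<nu> (\<lambda>z. sgp p (dif (w n) z) * dif (\<lambda>x. Tk k (w n x - \<phi> n x)) z)"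
      "\<And>n. (1/2) * (\<integral>z. sgp p (dif (w n) z) * dif (\<lambda>x. Tk k (w n x - \<phi> n x)) z \<partial>\<nu>) \<le> r n"
    and r: "r \<longlonglongrightarrow> \<rho>"
  shows "integrable \<nu> (\<lambda>z. sgp p (dif u z) * dif (\<lambda>x. Tk k (u x - \<phi>' x)) z) \<and>
    (1/2) * (\<integral>z. sgp p (dif u z) * dif (\<lambda>x. Tk k (u x - \<phi>' x)) z \<partial>\<nu>) \<le> \<rho>"
proof -
  define Fn where "Fn n z = sgp p (dif (w n) z) * dif (\<lambda>x. Tk k (w n x - \<phi> n x)) z" for n z
  define Fl where "Fl z = sgp p (dif u z) * dif (\<lambda>x. Tk k (u x - \<phi>' x)) z" for z
  define L1 where "L1 z = \<bar>indicator (\<Omega> \<times> \<Omega>) z * dif \<phi>' z\<bar> powr p" for z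
  define L2 where "L2 n z = \<bar>indicator (\<Omega> \<times> \<Omega>) z * dif (\<lambda>x. \<phi> n x - \<phi>' x) z\<bar> powr p" for n z
  define L3 where "L3 z = indicator (- (\<Omega> \<times> \<Omega>)) z * H z" for z
  define L where "L z = 2 powr p * L1 z + k * L3 z" for z
  define Ln where "Ln n z = L z + 2 powr p * L2 n z" for n z
  have [measurable]: "Fn n \<in> borel_measurable \<nu>" "L2 n \<in> borel_measurable \<nu>" "Ln n \<in> borel_measurable \<nu>" for n
    unfolding Fn_def Ln_def L_def L1_def L2_def L3_def by measurable
  have [measurable]: "Fl \<in> borel_measurable \<nu>" "L1 \<in> borel_measurable \<nu>" "L3 \<in> borel_measurable \<nu>" "L \<in> borel_measurable \<nu>"
    unfolding Fl_def L_def L1_def L3_def by measurable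
  have i1: "integrable \<nu> L1" using \<phi>fin by (intro integrableI_nonneg) (auto simp: L1_def w2_eq)
  have i3: "integrable \<nu> L3"
  proof (intro integrableI_nonneg)
    have "(\<integral>\<^sup>+ z. ennreal (L3 z) \<partial>\<nu>) = (\<integral>\<^sup>+ z. indicator (- (\<Omega> \<times> \<Omega>)) z * ennreal (H z) \<partial>\<nu>)"
      by (intro nn_integral_cong) (auto simp: L3_def indicator_def)
    then show "(\<integral>\<^sup>+ z. ennreal (L3 z) \<partial>\<nu>) < \<infinity>" using Hfin by simp
  qed (use H0 in \<open>auto simp: L3_def\<close>)
  have i2: "integrable \<nu> (L2 n)" for n
  proof (intro integrableI_nonneg)
    have "(\<integral>\<^sup>+ z. ennreal (L2 n z) \<partial>\<nu>) \<le> 1" using \<phi>lim(2)[of n] by (simp add: L2_def w2_eq)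
    then show "(\<integral>\<^sup>+ z. ennreal (L2 n z) \<partial>\<nu>) < \<infinity>" by (rule order_le_less_trans) simp
  qed (auto simp: L2_def)
  have iL: "integrable \<nu> L" unfolding L_def by (intro Bochner_Integration.integrable_add integrable_mult_right i1 i3)
  have iLn: "integrable \<nu> (Ln n)" for n unfolding Ln_def by (intro Bochner_Integration.integrable_add integrable_mult_right iL i2)
  have L2lim: "(\<lambda>n. \<integral>z. L2 n z \<partial>\<nu>) \<longlonglongrightarrow> 0"
  proof -
    have "ennreal (\<integral>z. L2 n z \<partial>\<nu>) = w2 (\<lambda>x. \<phi> n x - \<phi>' x)" for n
      unfolding w2_eq L2_def[symmetric]
      by (rule nn_integral_eq_integral[OF i2, symmetric]) (auto simp: L2_def)
    then have "(\<lambda>n. ennreal (\<integral>z. L2 n z \<partial>\<nu>)) \<longlonglongrightarrow> 0" using \<phi>lim(1) by simp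
    then show ?thesis by (simp add: ennreal_tendsto_0_iff L2_def)
  qed
  have pos: "AE z in \<nu>. 0 \<le> Fn n z + Ln n z" for n
    using Hle[of n]
  proof eventually_elim
    fix z assume Hz: "z \<notin> \<Omega> \<times> \<Omega> \<longrightarrow> \<bar>dif (w n) z\<bar> powr (p - 1) \<le> H z"
    show "0 \<le> Fn n z + Ln n z"
    proof (cases "z \<in> \<Omega> \<times> \<Omega>")
      case True
      have "- (\<bar>dif (\<phi> n) z\<bar> powr p) \<le> Fn n z"
        unfolding Fn_def dif_def by (rule sgp_Tk_lower_bound[OF p(1)])
      moreover have "\<bar>dif (\<phi> n) z\<bar> powr p \<le> 2 powr p * (\<bar>dif \<phi>' z\<bar> powr p + \<bar>dif (\<lambda>x. \<phi> n x - \<phi>' x) z\<bar> powr p)"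
        using abs_add_powr_le[of p "dif \<phi>' z" "dif (\<lambda>x. \<phi> n x - \<phi>' x) z"] p by (simp add: dif_def)
      ultimately show ?thesis using True by (simp add: Ln_def L_def L1_def L2_def L3_def algebra_simps)
    next
      case False
      \<comment> \<open>Off \<Omega> \<times> \<Omega> one of the two truncated values is 0, so the
        bound is k instead of 2 k.\<close>
      have "\<bar>dif (\<lambda>x. Tk k (w n x - \<phi> n x)) z\<bar> \<le> k"
        using False w0[of _ n] \<phi>0[of _ n] k by (cases z) (auto simp: dif_def Tk_def max_def min_def)
      then have "\<bar>Fn n z\<bar> \<le> H z * k"
        unfolding Fn_def abs_mult abs_sgp[OF p(1)] using Hz False H0 by (intro mult_mono) auto
      then show ?thesis using False by (simp add: Ln_def L_def L1_def L2_def L3_def algebra_simps)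
    qed
  qed
  have convr: "AE z in \<nu>. (\<lambda>n. Fn n z + Ln n z) \<longlonglongrightarrow> Fl z + L z"
    using AE_nu[OF aew] AE_nu[OF ae\<phi>]
  proof eventually_elim
    fix z assume A: "(\<lambda>n. w n (fst z)) \<longlonglongrightarrow> u (fst z) \<and> (\<lambda>n. w n (snd z)) \<longlonglongrightarrow> u (snd z)"
      and B: "(\<lambda>n. \<phi> n (fst z)) \<longlonglongrightarrow> \<phi>' (fst z) \<and> (\<lambda>n. \<phi> n (snd z)) \<longlonglongrightarrow> \<phi>' (snd z)"
    have 1: "(\<lambda>n. Fn n z) \<longlonglongrightarrow> Fl z" unfolding Fn_def Fl_def dif_def Tk_def using A B
      by (intro tendsto_mult tendsto_sgp[OF p(1)] tendsto_diff tendsto_max tendsto_min tendsto_const) auto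
    have "(\<lambda>n. dif (\<lambda>x. \<phi> n x - \<phi>' x) z) \<longlonglongrightarrow> (\<phi>' (fst z) - \<phi>' (fst z)) - (\<phi>' (snd z) - \<phi>' (snd z))"
      unfolding dif_def using B by (intro tendsto_diff tendsto_const) auto
    then have "(\<lambda>n. \<bar>indicator (\<Omega> \<times> \<Omega>) z * dif (\<lambda>x. \<phi> n x - \<phi>' x) z\<bar>) \<longlonglongrightarrow> \<bar>indicator (\<Omega> \<times> \<Omega>) z * 0\<bar>"
      by (intro tendsto_rabs tendsto_mult tendsto_const) simp
    then have "(\<lambda>n. L2 n z) \<longlonglongrightarrow> \<bar>indicator (\<Omega> \<times> \<Omega>) z * 0\<bar> powr p"
      unfolding L2_def using p by (intro tendsto_powr' tendsto_const) auto
    then have 2: "(\<lambda>n. L2 n z) \<longlonglongrightarrow> 0" using p by simp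
    have "(\<lambda>n. Fn n z + Ln n z) \<longlonglongrightarrow> Fl z + (L z + 2 powr p * 0)" unfolding Ln_def
      by (intro tendsto_intros 1 2)
    then show "(\<lambda>n. Fn n z + Ln n z) \<longlonglongrightarrow> Fl z + L z" by simp
  qed
  have conv: "AE z in \<nu>. (\<lambda>n. ennreal (Fn n z + Ln n z)) \<longlonglongrightarrow> ennreal (Fl z + L z)"
    using convr by eventually_elim (rule tendsto_ennrealI)
  have Fi: "integrable \<nu> (Fn n)" "(\<integral>z. Fn n z \<partial>\<nu>) \<le> 2 * r n" for n
    using F(1)[of n] F(2)[of n] unfolding Fn_def[symmetric] by simp_all
  define R where "R n = 2 * r n + ((\<integral>z. L z \<partial>\<nu>) + 2 powr p * (\<integral>z. L2 n z \<partial>\<nu>))" for n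
  have iLn_eq: "(\<integral>z. Ln n z \<partial>\<nu>) = (\<integral>z. L z \<partial>\<nu>) + 2 powr p * (\<integral>z. L2 n z \<partial>\<nu>)" for n
    unfolding Ln_def using iL i2[of n] by simp
  have Rlim: "R \<longlonglongrightarrow> 2 * \<rho> + ((\<integral>z. L z \<partial>\<nu>) + 2 powr p * 0)" unfolding R_def by (intro tendsto_intros r L2lim)
  have R0: "0 \<le> R n" for n
  proof -
    have "0 \<le> (\<integral>z. Fn n z + Ln n z \<partial>\<nu>)" by (rule integral_nonneg_AE[OF pos])
    also have "\<dots> = (\<integral>z. Fn n z \<partial>\<nu>) + (\<integral>z. Ln n z \<partial>\<nu>)" using Fi iLn by simp
    finally show ?thesis using Fi(2)[of n] unfolding R_def iLn_eq by linarith
  qed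
  have lim0: "0 \<le> 2 * \<rho> + (\<integral>z. L z \<partial>\<nu>)"
    using LIMSEQ_le_const[OF Rlim, of 0] R0 by auto
  have "(\<integral>\<^sup>+ z. ennreal (Fl z + L z) \<partial>\<nu>) = (\<integral>\<^sup>+ z. liminf (\<lambda>n. ennreal (Fn n z + Ln n z)) \<partial>\<nu>)"
    by (rule nn_integral_cong_AE, use conv in eventually_elim) (auto intro!: lim_imp_Liminf[symmetric])
  also have "\<dots> \<le> liminf (\<lambda>n. \<integral>\<^sup>+ z. ennreal (Fn n z + Ln n z) \<partial>\<nu>)" by (rule nn_integral_liminf) measurable
  also have "\<dots> \<le> liminf (\<lambda>n. ennreal (R n))"
  proof (intro Liminf_mono always_eventually allI)
    fix n
    have "(\<integral>\<^sup>+ z. ennreal (Fn n z + Ln n z) \<partial>\<nu>) = ennreal (\<integral>z. Fn n z + Ln n z \<partial>\<nu>)"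
      using pos by (intro nn_integral_eq_integral Bochner_Integration.integrable_add Fi iLn)
    also have "\<dots> \<le> ennreal (R n)"
      using Fi[of n] iLn[of n] iLn_eq[of n] by (intro ennreal_leI) (simp add: R_def)
    finally show "(\<integral>\<^sup>+ z. ennreal (Fn n z + Ln n z) \<partial>\<nu>) \<le> ennreal (R n)" .
  qed
  also have "\<dots> = ennreal (2 * \<rho> + (\<integral>z. L z \<partial>\<nu>))"
    using tendsto_ennrealI[OF Rlim] by (intro lim_imp_Liminf) auto
  finally have fat: "(\<integral>\<^sup>+ z. ennreal (Fl z + L z) \<partial>\<nu>) \<le> ennreal (2 * \<rho> + (\<integral>z. L z \<partial>\<nu>))" .
  have FLpos: "AE z in \<nu>. 0 \<le> Fl z + L z"
  proof -
    have "AE z in \<nu>. \<forall>n. 0 \<le> Fn n z + Ln n z" using pos by (simp add: AE_all_countable)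
    then show ?thesis using convr
      by eventually_elim (rule LIMSEQ_le_const, assumption, blast)
  qed
  have iFL: "integrable \<nu> (\<lambda>z. Fl z + L z)"
  proof (rule integrableI_nonneg[OF _ FLpos])
    show "(\<integral>\<^sup>+ z. ennreal (Fl z + L z) \<partial>\<nu>) < \<infinity>" using fat by (rule order_le_less_trans) simp
  qed measurable
  have iF: "integrable \<nu> Fl" using Bochner_Integration.integrable_diff[OF iFL iL] by simp
  have "ennreal (\<integral>z. Fl z + L z \<partial>\<nu>) \<le> ennreal (2 * \<rho> + (\<integral>z. L z \<partial>\<nu>))"
    using fat nn_integral_eq_integral[OF iFL FLpos] by simp
  then have "(\<integral>z. Fl z + L z \<partial>\<nu>) \<le> 2 * \<rho> + (\<integral>z. L z \<partial>\<nu>)" using lim0 by (subst (asm) ennreal_le_iff) auto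
  then have "(\<integral>z. Fl z \<partial>\<nu>) \<le> 2 * \<rho>" using iF iL by simp
  then show ?thesis using iF unfolding Fl_def[symmetric] by simp
qed

text \<open>T_k(w - \<phi>) need not belong to X when \<phi> lies only in W, since the energy of
  \<phi> off \<Omega> \<times> \<Omega> may be infinite. The inequality is obtained from smooth
  \<phi>, for which it is the weak equation.\<close>

lemma weak_solution_entropy:
  assumes w: "weak_solution f w" and [measurable]: "f \<in> borel_measurable borel" and f: "\<And>x. 0 \<le> f x" "integrable lborel f" "\<And>x. f x \<le> c"
    and \<phi>: "\<phi> \<in> W" and k: "k > 0"
  shows "integrable \<nu> (\<lambda>z. sgp p (dif w z) * dif (\<lambda>x. Tk k (w x - \<phi> x)) z) \<and>
    (1/2) * (\<integral>z. sgp p (dif w z) * dif (\<lambda>x. Tk k (w x - \<phi> x)) z \<partial>\<nu>) \<le> (\<integral>x. f x * Tk k (w x - \<phi> x) \<partial>lborel)"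
proof -
  have wX: "w \<in> X" using w by (auto simp: weak_solution_def)
  obtain \<eta> where \<eta>: "\<And>n. \<eta> n \<in> Cc_infty \<Omega>" "AE x in lborel. (\<lambda>n. \<eta> n x) \<longlonglongrightarrow> \<phi> x"
    "(\<lambda>n. w2 (\<lambda>x. \<eta> n x - \<phi> x)) \<longlonglongrightarrow> 0" "\<And>n. w2 (\<lambda>x. \<eta> n x - \<phi> x) \<le> 1"
    using W_AE_approx[OF \<phi>] by blast
  note [measurable] = X_measurable[OF wX] W_measurable[OF \<phi>] Cc_infty_measurable[OF \<eta>(1)]
  have tX: "(\<lambda>x. Tk k (w x - \<eta> n x)) \<in> X" for n
  proof -
    have "(\<lambda>x. 1 * w x + (-1) * \<eta> n x) \<in> X" by (intro X_lincomb wX Cc_infty_X \<eta>)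
    from X_clamp[OF this, of "- k" k] k show ?thesis by (simp add: Tk_eq_clamp)
  qed
  show ?thesis
  proof (rule entropy_stability[where w="\<lambda>_. w" and \<phi>=\<eta> and H="\<lambda>z. \<bar>dif w z\<bar> powr (p - 1)" and r="\<lambda>n. \<integral>x. f x * Tk k (w x - \<eta> n x) \<partial>lborel"])
    show "w2 \<phi> < \<infinity>" by (rule W_w2_finite[OF \<phi>])
    show "(\<integral>\<^sup>+ z. indicator (- (\<Omega> \<times> \<Omega>)) z * ennreal (\<bar>dif w z\<bar> powr (p - 1)) \<partial>\<nu>) < \<infinity>"
      by (rule order_le_less_trans[OF weak_solution_exterior[OF w _ f]]) auto
    show "integrable \<nu> (\<lambda>z. sgp p (dif w z) * dif (\<lambda>x. Tk k (w x - \<eta> n x)) z)"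
      "(1/2) * (\<integral>z. sgp p (dif w z) * dif (\<lambda>x. Tk k (w x - \<eta> n x)) z \<partial>\<nu>) \<le> (\<integral>x. f x * Tk k (w x - \<eta> n x) \<partial>lborel)" for n
      using w tX[of n] by (auto simp: weak_solution_def)
    show "(\<lambda>n. \<integral>x. f x * Tk k (w x - \<eta> n x) \<partial>lborel) \<longlonglongrightarrow> (\<integral>x. f x * Tk k (w x - \<phi> x) \<partial>lborel)"
    proof (rule integral_dominated_convergence[where w="\<lambda>x. k * f x"])
      show "integrable lborel (\<lambda>x. k * f x)" using f(2) by simp
      show "AE x in lborel. norm (f x * Tk k (w x - \<eta> n x)) \<le> k * f x" for n
      proof (rule AE_I2)
        fix x
        have "\<bar>f x\<bar> * \<bar>Tk k (w x - \<eta> n x)\<bar> \<le> \<bar>f x\<bar> * k" using k by (intro mult_left_mono) (auto simp: Tk_def max_def min_def)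
        then show "norm (f x * Tk k (w x - \<eta> n x)) \<le> k * f x" using f(1)[of x] by (simp add: abs_mult mult.commute)
      qed
      show "AE x in lborel. (\<lambda>n. f x * Tk k (w x - \<eta> n x)) \<longlonglongrightarrow> f x * Tk k (w x - \<phi> x)"
        using \<eta>(2) by eventually_elim (auto simp: Tk_def intro!: tendsto_intros)
    qed measurable
  qed (use X_zero[OF wX] Cc_infty_zero[OF \<eta>(1)] \<eta> k in \<open>auto\<close>)
qed


section \<open>Testing entropy solutions\<close>

lemma D_set_integral:
  assumes "\<And>z. z \<notin> D_set \<Omega> \<Longrightarrow> F z = (0::real)"
  shows "set_integrable \<nu> (D_set \<Omega>) F \<longleftrightarrow> integrable \<nu> F" "(\<integral>z\<in>D_set \<Omega>. F z \<partial>\<nu>) = (\<integral>z. F z \<partial>\<nu>)"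
proof -
  have eq: "indicator (D_set \<Omega>) z *\<^sub>R F z = F z" for z by (cases "z \<in> D_set \<Omega>") (auto simp: assms)
  show "set_integrable \<nu> (D_set \<Omega>) F \<longleftrightarrow> integrable \<nu> F" "(\<integral>z\<in>D_set \<Omega>. F z \<partial>\<nu>) = (\<integral>z. F z \<partial>\<nu>)"
    unfolding set_integrable_def set_lebesgue_integral_def eq by (rule refl)+
qed

lemma sgp_dif_zero_outside:
  assumes "\<And>x. x \<notin> \<Omega> \<Longrightarrow> v x = 0" "z \<notin> D_set \<Omega>"
  shows "sgp p (dif v z) * t = 0"
  using assms by (cases z) (auto simp: D_set_def dif_def)

text \<open>Off D both values of v are 0 and the integrand vanishes, so integrals over D may be
  taken over the whole space. If v does not vanish outside \<Omega>, both sides are false.\<close>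

lemma entropy_solution_eq:
  "entropy_solution s p \<beta> \<Omega> f v \<longleftrightarrow>
     v \<in> borel_measurable lborel \<and> (\<forall>x. x \<notin> \<Omega> \<longrightarrow> v x = 0) \<and>
     (\<forall>k>0. (\<lambda>x. Tk k (v x)) \<in> W) \<and>
     ((\<lambda>h. \<integral>\<^sup>+ z. indicator (Rh v h) z * ennreal (\<bar>dif v z\<bar> powr (p - 1)) \<partial>\<nu>) \<longlongrightarrow> 0) at_top \<and>
     (\<forall>k>0. \<forall>\<phi>\<in>W. (\<exists>C. AE x in lborel. \<bar>\<phi> x\<bar> \<le> C) \<longrightarrow>
        integrable \<nu> (\<lambda>z. sgp p (dif v z) * dif (\<lambda>x. Tk k (v x - \<phi> x)) z) \<and>
        (1/2) * (\<integral>z. sgp p (dif v z) * dif (\<lambda>x. Tk k (v x - \<phi> x)) z \<partial>\<nu>)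
              \<le> (\<integral>x\<in>\<Omega>. f x * Tk k (v x - \<phi> x) \<partial>lborel))"
proof (cases "\<forall>x. x \<notin> \<Omega> \<longrightarrow> v x = 0")
  case True
  have F: "(\<lambda>z. \<bar>v (fst z) - v (snd z)\<bar> powr (p - 2) * (v (fst z) - v (snd z))
             * (Tk k (v (fst z) - \<phi> (fst z)) - Tk k (v (snd z) - \<phi> (snd z))))
       = (\<lambda>z. sgp p (dif v z) * dif (\<lambda>x. Tk k (v x - \<phi> x)) z)" for k \<phi>
    by (simp add: sgp_def dif_def)
  have z: "sgp p (dif v z) * dif (\<lambda>x. Tk k (v x - \<phi> x)) z = 0" if "z \<notin> D_set \<Omega>" for z k \<phi>
    using True that by (intro sgp_dif_zero_outside) auto
  have D: "set_integrable \<nu> (D_set \<Omega>) (\<lambda>z. sgp p (dif v z) * dif (\<lambda>x. Tk k (v x - \<phi> x)) z)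
        \<longleftrightarrow> integrable \<nu> (\<lambda>z. sgp p (dif v z) * dif (\<lambda>x. Tk k (v x - \<phi> x)) z)"
      "(\<integral>z\<in>D_set \<Omega>. sgp p (dif v z) * dif (\<lambda>x. Tk k (v x - \<phi> x)) z \<partial>\<nu>)
        = (\<integral>z. sgp p (dif v z) * dif (\<lambda>x. Tk k (v x - \<phi> x)) z \<partial>\<nu>)" for k \<phi>
    using D_set_integral[of "\<lambda>z. sgp p (dif v z) * dif (\<lambda>x. Tk k (v x - \<phi> x)) z", OF z] by blast+
  show ?thesis unfolding entropy_solution_def Let_def F D by (simp add: dif_def)
next
  case False
  then show ?thesis unfolding entropy_solution_def by blast
qed

lemma zero_W: "(\<lambda>_. 0) \<in> W"
  by (intro Cc_infty_W) (simp add: Cc_infty_def smooth_on_def Ck_on_const open_\<Omega>)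

lemma dif_clamp_mono_mult:
  "0 \<le> sgp p (dif v z) * dif (\<lambda>x. clamp_real a b (v x)) z"
  using order_trans[OF _ clamp_energy_pointwise[OF p(1), of a b "v (fst z)" "v (snd z)"]] by (simp add: dif_def)

text \<open>The test function \<phi> = 0 makes the entropy integrand an integrable majorant of the
  p-th power of the truncated increment.\<close>

lemma entropy_solution_truncation_X:
  assumes v: "entropy_solution s p \<beta> \<Omega> f v" and M: "M > 0"
  shows "(\<lambda>x. Tk M (v x)) \<in> X"
proof (rule W_finite_energy_X)
  show "(\<lambda>x. Tk M (v x)) \<in> W" using v M by (simp add: entropy_solution_eq)
  have "\<exists>C. AE x in lborel. \<bar>(0::real)\<bar> \<le> C" by (intro exI[of _ 0]) simp
  then have int: "integrable \<nu> (\<lambda>z. sgp p (dif v z) * dif (\<lambda>x. Tk M (v x)) z)"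
    using v M zero_W unfolding entropy_solution_eq by fastforce
  have "energy (\<lambda>x. Tk M (v x)) \<le> (\<integral>\<^sup>+ z. ennreal (sgp p (dif v z) * dif (\<lambda>x. Tk M (v x)) z) \<partial>\<nu>)"
    unfolding energy_def dif_def Tk_eq_clamp by (intro nn_integral_mono ennreal_leI clamp_energy_pointwise p)
  also have "\<dots> = ennreal (\<integral>z. sgp p (dif v z) * dif (\<lambda>x. Tk M (v x)) z \<partial>\<nu>)"
    unfolding Tk_eq_clamp by (intro nn_integral_eq_integral int[unfolded Tk_eq_clamp] AE_I2 dif_clamp_mono_mult)
  also have "\<dots> < \<infinity>" by simp
  finally show "energy (\<lambda>x. Tk M (v x)) < \<infinity>" .
qed

text \<open>Testing with \<open>\<phi> = Tk h v + \<psi>\<close> and letting \<open>h\<close> tend to infinity.\<close>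

lemma entropy_solution_supersolution:
  assumes v: "entropy_solution s p \<beta> \<Omega> f v" and v0: "\<And>x. 0 \<le> v x" and f0: "set_integrable lborel \<Omega> f"
    and \<psi>: "\<psi> \<in> W" "\<And>x. 0 \<le> \<psi> x" "\<And>x. \<psi> x \<le> 1" "\<And>x. v x > M \<Longrightarrow> \<psi> x = 0"
  shows "integrable \<nu> (\<lambda>z. sgp p (dif v z) * dif \<psi> z)"
    and "(\<integral>x\<in>\<Omega>. f x * \<psi> x \<partial>lborel) \<le> (1/2) * (\<integral>z. sgp p (dif v z) * dif \<psi> z \<partial>\<nu>)"
proof -
  have [measurable]: "v \<in> borel_measurable borel" using v by (simp add: entropy_solution_eq)
  note [measurable] = W_measurable[OF \<psi>(1)]
  define fo where "fo x = indicator \<Omega> x * f x" for x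
  have fo: "integrable lborel fo" using f0 by (simp add: set_integrable_def fo_def[abs_def])
  then have [measurable]: "fo \<in> borel_measurable borel" by simp
  have setint: "(\<integral>x\<in>\<Omega>. f x * t x \<partial>lborel) = (\<integral>x. fo x * t x \<partial>lborel)" for t
    by (simp add: set_lebesgue_integral_def fo_def mult.assoc)
  have fob: "integrable lborel (\<lambda>x. fo x * t x)" if [measurable]: "t \<in> borel_measurable borel" and "\<And>x. \<bar>t x\<bar> \<le> 1" for t
  proof (rule Bochner_Integration.integrable_bound[OF fo])
    show "AE x in lborel. norm (fo x * t x) \<le> norm (fo x)" using that(2) by (intro AE_I2) (simp add: abs_mult mult_left_le)
  qed measurable
  define \<kappa> where "\<kappa> h x = clamp_real 0 1 (v x - h)" for h x
  have \<kappa>1: "\<bar>\<kappa> h x\<bar> \<le> 1" for h x by (auto simp: \<kappa>_def clamp_real_def)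
  have [measurable]: "\<kappa> h \<in> borel_measurable borel" for h unfolding \<kappa>_def by measurable
  have main: "integrable \<nu> (\<lambda>z. sgp p (dif v z) * dif \<psi> z) \<and>
     (\<integral>x. fo x * \<psi> x \<partial>lborel) - (\<integral>x. fo x * \<kappa> h x \<partial>lborel) \<le> (1/2) * (\<integral>z. sgp p (dif v z) * dif \<psi> z \<partial>\<nu>)"
    if h: "h \<ge> M" "h > 0" for h
  proof -
    let ?\<phi> = "\<lambda>x. 1 * Tk h (v x) + 1 * \<psi> x"
    have TW: "(\<lambda>x. Tk h (v x)) \<in> W" using v h by (simp add: entropy_solution_eq)
    have Tb: "\<bar>Tk h t\<bar> \<le> h" for t using h by (auto simp: Tk_def max_def min_def)
    have \<phi>W: "?\<phi> \<in> W" by (intro W_lincomb TW \<psi>)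
    have "\<bar>?\<phi> x\<bar> \<le> h + 1" for x using Tb[of "v x"] \<psi>(2,3)[of x] by auto
    then have b1: "\<exists>C. AE x in lborel. \<bar>?\<phi> x\<bar> \<le> C" by (intro exI[of _ "h + 1"]) simp
    have b2: "\<exists>C. AE x in lborel. \<bar>Tk h (v x)\<bar> \<le> C" using Tb by (intro exI[of _ h]) simp
    \<comment> \<open>Where v > h the function \<psi> vanishes because h \<ge> M, and where v \<le>
      h the excess \<kappa> vanishes. The two never interact, so T_1 splits.\<close>
    have e1: "Tk 1 (v x - ?\<phi> x) = \<kappa> h x - \<psi> x" for x
    proof (cases "v x > h")
      case True
      then have "\<psi> x = 0" using \<psi>(4) h by simp
      then show ?thesis using True h by (auto simp: Tk_def \<kappa>_def clamp_real_def)
    next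
      case False
      then show ?thesis using v0[of x] \<psi>(2,3)[of x] h by (auto simp: Tk_def \<kappa>_def clamp_real_def)
    qed
    have e2: "Tk 1 (v x - Tk h (v x)) = \<kappa> h x" for x
      using v0[of x] h by (auto simp: Tk_def \<kappa>_def clamp_real_def max_def min_def)
    have V: "\<forall>\<phi>\<in>W. (\<exists>C. AE x in lborel. \<bar>\<phi> x\<bar> \<le> C) \<longrightarrow>
        integrable \<nu> (\<lambda>z. sgp p (dif v z) * dif (\<lambda>x. Tk 1 (v x - \<phi> x)) z) \<and>
        (1/2) * (\<integral>z. sgp p (dif v z) * dif (\<lambda>x. Tk 1 (v x - \<phi> x)) z \<partial>\<nu>)
              \<le> (\<integral>x\<in>\<Omega>. f x * Tk 1 (v x - \<phi> x) \<partial>lborel)"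
      using v unfolding entropy_solution_eq by (meson zero_less_one)
    have V1: "integrable \<nu> (\<lambda>z. sgp p (dif v z) * dif (\<lambda>x. \<kappa> h x - \<psi> x) z)"
        "(1/2) * (\<integral>z. sgp p (dif v z) * dif (\<lambda>x. \<kappa> h x - \<psi> x) z \<partial>\<nu>) \<le> (\<integral>x. fo x * (\<kappa> h x - \<psi> x) \<partial>lborel)"
      using V[rule_format, OF \<phi>W b1] unfolding e1 setint by blast+
    \<comment> \<open>Testing with T_h v alone isolates the excess \<kappa>; the integrability for
      \<psi> then follows by subtraction.\<close>
    have V2: "integrable \<nu> (\<lambda>z. sgp p (dif v z) * dif (\<kappa> h) z)"
      using V[rule_format, OF TW b2] unfolding e2 by blast
    have eq: "sgp p (dif v z) * dif \<psi> z = sgp p (dif v z) * dif (\<kappa> h) z - sgp p (dif v z) * dif (\<lambda>x. \<kappa> h x - \<psi> x) z" for z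
      by (simp add: dif_def algebra_simps)
    have i: "integrable \<nu> (\<lambda>z. sgp p (dif v z) * dif \<psi> z)" unfolding eq by (intro Bochner_Integration.integrable_diff V1 V2)
    \<comment> \<open>The excess contributes with a favourable sign to the energy side, and on the
      data side its integral tends to 0 as h grows.\<close>
    have "0 \<le> (\<integral>z. sgp p (dif v z) * dif (\<kappa> h) z \<partial>\<nu>)"
    proof (rule integral_nonneg_AE, rule AE_I2)
      fix z
      have "dif (\<kappa> h) z = dif (\<lambda>x. clamp_real h (h + 1) (v x)) z" by (auto simp: dif_def \<kappa>_def clamp_real_def max_def min_def)
      then show "0 \<le> sgp p (dif v z) * dif (\<kappa> h) z" using dif_clamp_mono_mult by simp
    qed
    moreover have "(\<integral>z. sgp p (dif v z) * dif \<psi> z \<partial>\<nu>) = (\<integral>z. sgp p (dif v z) * dif (\<kappa> h) z \<partial>\<nu>) - (\<integral>z. sgp p (dif v z) * dif (\<lambda>x. \<kappa> h x - \<psi> x) z \<partial>\<nu>)"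
      unfolding eq using V1 V2 by simp
    moreover have "(\<integral>x. fo x * (\<kappa> h x - \<psi> x) \<partial>lborel) = (\<integral>x. fo x * \<kappa> h x \<partial>lborel) - (\<integral>x. fo x * \<psi> x \<partial>lborel)"
      unfolding right_diff_distrib using \<psi>(2,3) by (intro Bochner_Integration.integral_diff fob \<kappa>1) auto
    ultimately show ?thesis using V1(2) i by argo
  qed
  define h where "h n = \<bar>M\<bar> + real (Suc n)" for n
  have h: "h n \<ge> M" "h n > 0" for n by (auto simp: h_def)
  show "integrable \<nu> (\<lambda>z. sgp p (dif v z) * dif \<psi> z)" using main[OF h(1)[of 0] h(2)[of 0]] by blast
  have "(\<lambda>n. \<integral>x. fo x * \<kappa> (h n) x \<partial>lborel) \<longlonglongrightarrow> (\<integral>x. 0 \<partial>(lborel :: 'a measure))"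
  proof (rule integral_dominated_convergence[where w="\<lambda>x. \<bar>fo x\<bar>"])
    show "AE x in lborel. (\<lambda>n. fo x * \<kappa> (h n) x) \<longlonglongrightarrow> 0"
    proof (rule AE_I2)
      fix x
      obtain N where "v x \<le> real N" using real_arch_simple by blast
      then have "\<forall>\<^sub>F n in sequentially. 0 = fo x * \<kappa> (h n) x"
        by (auto simp: \<kappa>_def h_def clamp_real_def eventually_sequentially intro!: exI[of _ N])
      then show "(\<lambda>n. fo x * \<kappa> (h n) x) \<longlonglongrightarrow> 0" by (rule Lim_transform_eventually[OF tendsto_const])
    qed
    show "AE x in lborel. norm (fo x * \<kappa> (h n) x) \<le> \<bar>fo x\<bar>" for n using \<kappa>1 by (intro AE_I2) (simp add: abs_mult mult_left_le)
  qed (use fo in auto)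
  then have "(\<lambda>n. (\<integral>x. fo x * \<psi> x \<partial>lborel) - (\<integral>x. fo x * \<kappa> (h n) x \<partial>lborel)) \<longlonglongrightarrow> (\<integral>x. fo x * \<psi> x \<partial>lborel) - 0"
    by (intro tendsto_diff tendsto_const) simp
  then have "(\<integral>x. fo x * \<psi> x \<partial>lborel) - 0 \<le> (1/2) * (\<integral>z. sgp p (dif v z) * dif \<psi> z \<partial>\<nu>)"
    by (rule LIMSEQ_le_const2) (use main h in auto)
  then show "(\<integral>x\<in>\<Omega>. f x * \<psi> x \<partial>lborel) \<le> (1/2) * (\<integral>z. sgp p (dif v z) * dif \<psi> z \<partial>\<nu>)" by (simp add: setint)
qed

lemma truncated_difference_X:
  assumes "(\<lambda>x. Tk M (u x)) \<in> X" "(\<lambda>x. Tk M (v x)) \<in> X"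
  shows "(\<lambda>x. clamp_real 0 1 (Tk M (u x) - Tk M (v x))) \<in> X" "(\<lambda>x. clamp_real 0 1 (Tk M (u x) - Tk M (v x))) \<in> W"
proof -
  have "(\<lambda>x. 1 * Tk M (u x) + (-1) * Tk M (v x)) \<in> X" by (intro X_lincomb assms)
  then have "(\<lambda>x. Tk M (u x) - Tk M (v x)) \<in> X" by simp
  then show "(\<lambda>x. clamp_real 0 1 (Tk M (u x) - Tk M (v x))) \<in> X" "(\<lambda>x. clamp_real 0 1 (Tk M (u x) - Tk M (v x))) \<in> W"
    by (auto intro: X_clamp X_clamp_W)
qed

lemma X_Tk_X: "u \<in> X \<Longrightarrow> M > 0 \<Longrightarrow> (\<lambda>x. Tk M (u x)) \<in> X"
  unfolding Tk_eq_clamp by (intro X_clamp) auto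

text \<open>The quotient defining \<lambda>_1, cleared of its denominator; the factor 2 compensates
  the 1/2 in the numerator.\<close>

lemma lambda1_gap:
  assumes l: "0 < l" "ennreal l \<le> lambda1 s p \<beta> \<Omega>" and w: "w \<in> W"
  shows "ennreal (2 * l) * (\<integral>\<^sup>+ x. ennreal (\<bar>w x\<bar> powr p) \<partial>lborel) \<le> energy w"
proof -
  note [measurable] = W_measurable[OF w]
  define N where "N = (\<integral>\<^sup>+ x. ennreal (\<bar>w x\<bar> powr p) \<partial>lborel)"
  show ?thesis
  proof (cases "AE x in lborel. w x = 0")
    case True
    then have "N = 0" unfolding N_def by (subst nn_integral_0_iff_AE) (auto elim!: eventually_mono)
    then show ?thesis by (simp add: N_def)
  next
    case False
    have NO: "(\<integral>\<^sup>+ x. indicator \<Omega> x * ennreal (\<bar>w x\<bar> powr p) \<partial>lborel) = N"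
      unfolding N_def using W_zero[OF w] by (intro nn_integral_cong) (auto simp: indicator_def)
    have ED: "(\<integral>\<^sup>+ z. indicator (D_set \<Omega>) z * ennreal (\<bar>w (fst z) - w (snd z)\<bar> powr p) \<partial>\<nu>) = energy w"
      unfolding energy_def dif_def using W_zero[OF w]
      by (intro nn_integral_cong) (auto simp: indicator_def D_set_def)
    have "lambda1 s p \<beta> \<Omega> \<le> ((1/2) * energy w) / N"
      unfolding lambda1_def using w False by (intro INF_lower2[of w]) (auto simp: NO ED)
    then have le: "ennreal l \<le> ((1/2) * energy w) / N" using l(2) by (rule order_trans[rotated])
    have Ninf: "N \<noteq> top"
    proof
      assume "N = top"
      \<comment> \<open>Division by top gives 0 in ennreal, which contradicts l > 0.\<close>
      then show False using le l(1) by (simp add: divide_ennreal_def)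
    qed
    have N0: "N \<noteq> 0"
    proof
      assume "N = 0"
      then have "AE x in lborel. ennreal (\<bar>w x\<bar> powr p) = 0" unfolding N_def by (subst (asm) nn_integral_0_iff_AE) auto
      then have "AE x in lborel. w x = 0" by (rule eventually_mono) (simp add: ennreal_eq_0_iff)
      then show False using False by simp
    qed
    have "ennreal l * N \<le> ((1/2) * energy w) / N * N" by (intro mult_right_mono le) simp
    also have "\<dots> = (1/2) * energy w"
      using N0 Ninf by (simp add: ennreal_divide_times ennreal_divide_self less_top)
    finally have "2 * (ennreal l * N) \<le> 2 * ((1/2) * energy w)" by (intro mult_left_mono) auto
    also have "2 * ((1/2) * energy w) = energy w"
      by (simp add: mult.assoc[symmetric] ennreal_times_divide ennreal_divide_self)
    finally show ?thesis using l(1) by (simp add: N_def ennreal_mult mult.assoc)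
  qed
qed


section \<open>The minimal solution\<close>

lemma weak_solution_mono:
  assumes u1: "weak_solution f1 u1" and u2: "weak_solution f2 u2"
    and [measurable]: "f1 \<in> borel_measurable borel" "f2 \<in> borel_measurable borel"
    and b: "\<And>x. \<bar>f1 x\<bar> \<le> c1" "\<And>x. \<bar>f2 x\<bar> \<le> c2" and le: "AE x in lborel. f1 x \<le> f2 x"
  shows "AE x in lborel. u1 x \<le> u2 x"
proof (rule comparison)
  have X: "u1 \<in> X" "u2 \<in> X" using u1 u2 by (auto simp: weak_solution_def)
  show "u1 \<in> X" "u2 \<in> borel_measurable borel" using X X_measurable by auto
  show "0 \<le> u1 x" "0 \<le> u2 x" for x using u1 u2 by (auto simp: weak_solution_def)
  show "u2 x = 0" if "x \<notin> \<Omega>" for x using X_zero[OF X(2) that] .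
  fix M \<psi> assume M: "M > (0::real)" and \<psi>: "\<psi> = (\<lambda>x. clamp_real 0 1 (Tk M (u1 x) - Tk M (u2 x)))"
  have \<psi>X: "\<psi> \<in> X" unfolding \<psi> by (intro truncated_difference_X X_Tk_X X M)
  have i2: "integrable \<nu> (\<lambda>z. sgp p (dif u2 z) * dif \<psi> z)"
    and e1: "(1/2) * (\<integral>z. sgp p (dif u1 z) * dif \<psi> z \<partial>\<nu>) = (\<integral>x. f1 x * \<psi> x \<partial>lborel)"
    and e2: "(1/2) * (\<integral>z. sgp p (dif u2 z) * dif \<psi> z \<partial>\<nu>) = (\<integral>x. f2 x * \<psi> x \<partial>lborel)"
    using u1 u2 \<psi>X by (auto simp: weak_solution_def)
  have "(\<integral>x. f1 x * \<psi> x \<partial>lborel) \<le> (\<integral>x. f2 x * \<psi> x \<partial>lborel)"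
  proof (rule integral_mono_AE)
    show "integrable lborel (\<lambda>x. f1 x * \<psi> x)" "integrable lborel (\<lambda>x. f2 x * \<psi> x)"
      by (rule X_integrable_bounded_mult[OF \<psi>X _ b(1)] X_integrable_bounded_mult[OF \<psi>X _ b(2)]; measurable)+
    show "AE x in lborel. f1 x * \<psi> x \<le> f2 x * \<psi> x"
      using le by eventually_elim (auto simp: \<psi> clamp_real_def intro!: mult_right_mono)
  qed
  then show "\<psi> \<in> X \<and> integrable \<nu> (\<lambda>z. sgp p (dif u2 z) * dif \<psi> z) \<and>
       (\<integral>z. sgp p (dif u1 z) * dif \<psi> z \<partial>\<nu>) \<le> (\<integral>z. sgp p (dif u2 z) * dif \<psi> z \<partial>\<nu>)"
    using \<psi>X i2 e1 e2 by simp
qed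

text \<open>The clamp minus a is the difference of the clamps to [0, b] and [0, a] for w \<ge> 0,
  hence an admissible test function; subtracting a constant leaves increments unchanged.\<close>

lemma weak_solution_clamp_energy:
  assumes w: "weak_solution f w" and ab: "0 \<le> a" "a < b"
  shows "energy (\<lambda>x. clamp_real a b (w x)) \<le> ennreal (2 * (\<integral>x. f x * (clamp_real a b (w x) - a) \<partial>lborel))"
proof -
  have wX: "w \<in> X" and w0: "\<And>x. 0 \<le> w x" using w by (auto simp: weak_solution_def)
  let ?\<psi> = "\<lambda>x. clamp_real a b (w x) - a"
  have "(\<lambda>x. 1 * clamp_real 0 b (w x) + (-1) * clamp_real 0 a (w x)) \<in> X" using ab by (intro X_lincomb X_clamp wX) auto
  moreover have "1 * clamp_real 0 b (w x) + (-1) * clamp_real 0 a (w x) = ?\<psi> x" for x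
    using ab w0[of x] by (auto simp: clamp_real_def)
  ultimately have \<psi>X: "?\<psi> \<in> X" by simp
  have d: "dif ?\<psi> z = dif (\<lambda>x. clamp_real a b (w x)) z" for z by (simp add: dif_def)
  have int: "integrable \<nu> (\<lambda>z. sgp p (dif w z) * dif (\<lambda>x. clamp_real a b (w x)) z)"
    and eq: "(1/2) * (\<integral>z. sgp p (dif w z) * dif (\<lambda>x. clamp_real a b (w x)) z \<partial>\<nu>) = (\<integral>x. f x * ?\<psi> x \<partial>lborel)"
    using w \<psi>X unfolding weak_solution_def d[symmetric] by auto
  have "energy (\<lambda>x. clamp_real a b (w x)) \<le> (\<integral>\<^sup>+ z. ennreal (sgp p (dif w z) * dif (\<lambda>x. clamp_real a b (w x)) z) \<partial>\<nu>)"
    unfolding energy_def dif_def by (intro nn_integral_mono ennreal_leI clamp_energy_pointwise p)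
  also have "\<dots> = ennreal (\<integral>z. sgp p (dif w z) * dif (\<lambda>x. clamp_real a b (w x)) z \<partial>\<nu>)"
    by (intro nn_integral_eq_integral int AE_I2 dif_clamp_mono_mult)
  also have "(\<integral>z. sgp p (dif w z) * dif (\<lambda>x. clamp_real a b (w x)) z \<partial>\<nu>) = 2 * (\<integral>x. f x * ?\<psi> x \<partial>lborel)" using eq by simp
  finally show ?thesis .
qed

lemma X_powr_pred_integrable:
  assumes w: "w \<in> X" and w0: "\<And>x. 0 \<le> w x" shows "integrable lborel (\<lambda>x. w x powr (p - 1))"
proof (rule Bochner_Integration.integrable_bound[where f="\<lambda>x. 1 * indicator \<Omega> x + \<bar>w x\<bar> powr p"])
  note [measurable] = X_measurable[OF w]
  show "integrable lborel (\<lambda>x. 1 * indicator \<Omega> x + \<bar>w x\<bar> powr p)"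
    by (intro Bochner_Integration.integrable_add integrable_indicator_\<Omega> X_powr_integrable w)
  show "AE x in lborel. norm (w x powr (p - 1)) \<le> norm (1 * indicator \<Omega> x + \<bar>w x\<bar> powr p)"
  proof (rule AE_I2)
    fix x
    have "w x powr (p - 1) = \<bar>w x\<bar> powr (p - 1)" using w0[of x] by simp
    moreover have "\<bar>w x\<bar> powr (p - 1) \<le> 1 * indicator \<Omega> x + \<bar>w x\<bar> powr p"
    proof (cases "\<bar>w x\<bar> \<le> 1")
      case True
      show ?thesis
      proof (cases "x \<in> \<Omega>")
        case True
        have "\<bar>w x\<bar> powr (p - 1) \<le> 1 powr (p - 1)" using \<open>\<bar>w x\<bar> \<le> 1\<close> p by (intro powr_mono2) auto
        then show ?thesis using True by (simp add: add_increasing2)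
      next
        case False
        then show ?thesis using X_zero[OF w False] p by simp
      qed
    next
      case False
      then have "\<bar>w x\<bar> powr (p - 1) \<le> \<bar>w x\<bar> powr p" by (intro powr_mono) auto
      then show ?thesis by (simp add: add_increasing)
    qed
    ultimately show "norm (w x powr (p - 1)) \<le> norm (1 * indicator \<Omega> x + \<bar>w x\<bar> powr p)" by simp
  qed
  show "(\<lambda>x. w x powr (p - 1)) \<in> borel_measurable lborel" by measurable
qed

lemma minimal_entropy_solution:
  assumes lam: "0 < lam" "ennreal lam < lambda1 s p \<beta> \<Omega>" and gi: "set_integrable lborel \<Omega> g" and g0: "\<forall>x\<in>\<Omega>. 0 \<le> g x"
  shows "\<exists>u. pos_entropy_sol s p \<beta> \<Omega> lam g u \<and> (\<forall>v. pos_entropy_sol s p \<beta> \<Omega> lam g v \<longrightarrow> (AE x in lborel. u x \<le> v x))"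
proof -
  define q where "q = p - 1"
  have q: "q > 0" using p by (simp add: q_def)
  \<comment> \<open>The values of g outside \<Omega> are arbitrary, so g is extended by 0.\<close>
  define go where "go x = indicator \<Omega> x * g x" for x
  have go: "integrable lborel go" using gi by (simp add: set_integrable_def go_def[abs_def])
  then have [measurable]: "go \<in> borel_measurable borel" by simp
  have go0: "0 \<le> go x" "x \<notin> \<Omega> \<Longrightarrow> go x = 0" for x using g0 by (auto simp: go_def indicator_def)
  \<comment> \<open>\<lambda>_1 may be infinite; a finite value strictly above \<lambda> is enough
    for the gap.\<close>
  obtain l where l: "ennreal lam < l" "l < lambda1 s p \<beta> \<Omega>" using dense[OF lam(2)] by blast
  then obtain lam' where lam': "l = ennreal lam'" "lam < lam'" using lam(1) by (cases l) (auto simp: ennreal_less_iff)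

  \<comment> \<open>The approximating sequence\<close>
  define dat where "dat n w x = lam * min (real n) (w x) powr q + min (real n) (go x)" for n :: nat and w :: "'a \<Rightarrow> real" and x
  define c where "c n = lam * real n powr q + real n" for n
  have datm: "dat n w \<in> borel_measurable borel" if [measurable]: "w \<in> borel_measurable borel" for n w unfolding dat_def by measurable
  have dat0: "0 \<le> dat n w x" for n w x unfolding dat_def using lam go0(1)[of x] by simp
  have datc: "dat n w x \<le> c n" if "\<And>x. 0 \<le> w x" for n w x
    unfolding dat_def c_def using lam that q by (intro add_mono mult_left_mono powr_mono2) auto
  define U where "U = rec_nat (\<lambda>_. 0) (\<lambda>n w. SOME w'. weak_solution (dat n w) w')"
  have U0: "U 0 = (\<lambda>_. 0)" and US: "U (Suc n) = (SOME w'. weak_solution (dat n (U n)) w')" for n by (simp_all add: U_def)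
  have zX: "(\<lambda>_. 0) \<in> X" by (intro W_finite_energy_X zero_W) (simp add: energy_def dif_def)
  have sol_ex: "weak_solution (dat n w) (SOME w'. weak_solution (dat n w) w')" if "w \<in> X" "\<And>x. 0 \<le> w x" for n w
  proof -
    have "\<exists>w'. weak_solution (dat n w) w'"
    proof (rule weak_solution_exists)
      show "dat n w \<in> borel_measurable borel" by (rule datm[OF X_measurable[OF that(1)]])
      show "0 \<le> dat n w x" "dat n w x \<le> c n" for x using dat0 datc that(2) by auto
    qed
    then show ?thesis by (rule someI_ex)
  qed
  have "U n \<in> X \<and> (\<forall>x. 0 \<le> U n x)" for n
  proof (induction n)
    case 0
    show ?case using zX by (simp add: U0)
  next
    case (Suc n)
    then have "weak_solution (dat n (U n)) (U (Suc n))" unfolding US by (intro sol_ex) auto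
    then show ?case by (simp add: weak_solution_def)
  qed
  then have U: "U n \<in> X" "0 \<le> U n x" for n x by auto
  note [measurable] = X_measurable[OF U(1)]
  define f where "f n = dat n (U n)" for n
  have sol: "weak_solution (f n) (U (Suc n))" for n unfolding f_def US using U by (intro sol_ex) auto
  have [measurable]: "f n \<in> borel_measurable borel" for n unfolding f_def by (rule datm) measurable
  have f0: "0 \<le> f n x" and fc: "f n x \<le> c n" for n x unfolding f_def using dat0 datc U(2) by auto
  have fabs: "\<bar>f n x\<bar> \<le> c n" for n x using f0[of n x] fc[of n x] by simp
  have fint: "integrable lborel (f n)" for n
  proof (rule Bochner_Integration.integrable_bound[OF integrable_indicator_\<Omega>[of "c n"]])
    show "AE x in lborel. norm (f n x) \<le> norm (c n * indicator \<Omega> x)"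
    proof (rule AE_I2)
      fix x
      have "f n x = 0" if "x \<notin> \<Omega>" using X_zero[OF U(1) that] go0(2)[OF that] by (simp add: f_def dat_def)
      then show "norm (f n x) \<le> norm (c n * indicator \<Omega> x)" using fabs[of n x] by (auto simp: indicator_def)
    qed
  qed measurable
  have mono: "AE x in lborel. U n x \<le> U (Suc n) x" for n
  proof (induction n)
    case 0
    show ?case using U(2) by (simp add: U0)
  next
    case (Suc n)
    have "AE x in lborel. f n x \<le> f (Suc n) x"
      using Suc
    proof eventually_elim
      fix x assume "U n x \<le> U (Suc n) x"
      then have "min (real n) (U n x) powr q \<le> min (real (Suc n)) (U (Suc n) x) powr q"
        using q U(2)[of n x] by (intro powr_mono2) auto
      then show "f n x \<le> f (Suc n) x" unfolding f_def dat_def using lam by (intro add_mono mult_left_mono) auto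
    qed
    then show ?case by (intro weak_solution_mono[OF sol sol _ _ fabs fabs]) auto
  qed
  have fle: "f n x \<le> lam * U n x powr q + go x" for n x
    unfolding f_def dat_def using lam U(2)[of n x] q by (intro add_mono mult_left_mono powr_mono2) auto
  \<comment> \<open>Monotonicity replaces U n by U (Suc n) in the datum: each iterate is a
    subsolution of its own equation, the form required for the a priori bound.\<close>
  have fle': "AE x in lborel. f n x \<le> lam * U (Suc n) x powr q + go x" for n
    using mono[of n]
  proof eventually_elim
    fix x assume "U n x \<le> U (Suc n) x"
    then have "lam * U n x powr q \<le> lam * U (Suc n) x powr q" using lam q U(2)[of n x] by (intro mult_left_mono powr_mono2) auto
    then show "f n x \<le> lam * U (Suc n) x powr q + go x" using fle[of n x] by linarith
  qed
  have Uq: "integrable lborel (\<lambda>x. U n x powr q)" for n unfolding q_def using U by (intro X_powr_pred_integrable) auto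

  \<comment> \<open>The bound uniform along the sequence\<close>
  obtain K where K: "\<And>u. \<lbrakk>u \<in> borel_measurable borel; \<And>x. 0 \<le> u x; \<And>x. x \<notin> \<Omega> \<Longrightarrow> u x = 0;
      integrable lborel (\<lambda>x. u x powr (p - 1));
      \<And>a b. 0 \<le> a \<Longrightarrow> a < b \<Longrightarrow> energy (\<lambda>x. clamp_real a b (u x))
         \<le> ennreal (2 * (\<integral>x. (lam * u x powr (p - 1) + go x) * (clamp_real a b (u x) - a) \<partial>lborel));
      \<And>k. k > 0 \<Longrightarrow> ennreal (2 * lam') * (\<integral>\<^sup>+ x. ennreal (clamp_real 0 k (u x) powr p) \<partial>lborel) \<le> energy (\<lambda>x. clamp_real 0 k (u x))\<rbrakk>
      \<Longrightarrow> (\<integral>x. u x powr (p - 1) \<partial>lborel) \<le> K"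
  proof (rule a_priori_bound[OF lam(1) lam'(2) _ go0(1) go], goal_cases)
    case 1
    show ?case by measurable
  next
    case (2 K)
    from 2(2) show ?case by (rule 2(1))
  qed
  have clampE: "energy (\<lambda>x. clamp_real a b (U (Suc n) x)) \<le> ennreal (2 * (\<integral>x. (lam * U (Suc n) x powr q + go x) * (clamp_real a b (U (Suc n) x) - a) \<partial>lborel))"
    if ab: "0 \<le> a" "a < b" for a b n
  proof -
    let ?c = "\<lambda>x. clamp_real a b (U (Suc n) x) - a"
    have c: "0 \<le> ?c x" "?c x \<le> b - a" for x using ab by (auto simp: clamp_real_def)
    have bi: "integrable lborel (\<lambda>x. h x * ?c x)" if h: "integrable lborel h" for h
    proof (rule Bochner_Integration.integrable_bound[OF integrable_mult_left[OF h, of "b - a"]])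
      have [measurable]: "h \<in> borel_measurable borel" using h by simp
      show "(\<lambda>x. h x * ?c x) \<in> borel_measurable lborel" by measurable
      show "AE x in lborel. norm (h x * ?c x) \<le> norm (h x * (b - a))"
      proof (rule AE_I2)
        fix x
        have "\<bar>?c x\<bar> \<le> \<bar>b - a\<bar>" using c[of x] by linarith
        then show "norm (h x * ?c x) \<le> norm (h x * (b - a))" unfolding real_norm_def abs_mult by (intro mult_left_mono) auto
      qed
    qed
    have "(\<integral>x. f n x * ?c x \<partial>lborel) \<le> (\<integral>x. (lam * U (Suc n) x powr q + go x) * ?c x \<partial>lborel)"
    proof (rule integral_mono_AE)
      show "integrable lborel (\<lambda>x. f n x * ?c x)" by (rule bi[OF fint])
      show "integrable lborel (\<lambda>x. (lam * U (Suc n) x powr q + go x) * ?c x)"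
        using Uq go by (intro bi) auto
      show "AE x in lborel. f n x * ?c x \<le> (lam * U (Suc n) x powr q + go x) * ?c x"
        using fle'[of n] by eventually_elim (intro mult_right_mono c)
    qed
    then show ?thesis by (intro order_trans[OF weak_solution_clamp_energy[OF sol ab]] ennreal_leI) simp
  qed
  have UK: "(\<integral>x. U (Suc n) x powr q \<partial>lborel) \<le> K" for n
    unfolding q_def
  proof (rule K)
    fix k :: real assume k: "k > 0"
    have "ennreal (2 * lam') * (\<integral>\<^sup>+ x. ennreal (\<bar>clamp_real 0 k (U (Suc n) x)\<bar> powr p) \<partial>lborel) \<le> energy (\<lambda>x. clamp_real 0 k (U (Suc n) x))"
      using lam lam' l(2) U(1)[of "Suc n"] k by (intro lambda1_gap X_clamp_W) auto
    moreover have "\<bar>clamp_real 0 k t\<bar> = clamp_real 0 k t" for t by (simp add: clamp_real_def)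
    ultimately show "ennreal (2 * lam') * (\<integral>\<^sup>+ x. ennreal (clamp_real 0 k (U (Suc n) x) powr p) \<partial>lborel) \<le> energy (\<lambda>x. clamp_real 0 k (U (Suc n) x))" by simp
  next
    fix a b :: real assume "0 \<le> a" "a < b"
    then show "energy (\<lambda>x. clamp_real a b (U (Suc n) x)) \<le> ennreal (2 * (\<integral>x. (lam * U (Suc n) x powr (p - 1) + go x) * (clamp_real a b (U (Suc n) x) - a) \<partial>lborel))"
      using clampE by (simp add: q_def)
  qed (use U X_zero[OF U(1)] Uq[of "Suc n"] in \<open>auto simp: q_def\<close>)
  have UKn: "(\<integral>\<^sup>+ x. ennreal (U n x powr q) \<partial>lborel) \<le> ennreal K" for n
  proof (cases n)
    case 0
    then show ?thesis using q by (simp add: U0)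
  next
    case (Suc m)
    have "(\<integral>\<^sup>+ x. ennreal (U (Suc m) x powr q) \<partial>lborel) = ennreal (\<integral>x. U (Suc m) x powr q \<partial>lborel)"
      by (intro nn_integral_eq_integral Uq) auto
    then show ?thesis using UK[of m] Suc by (simp add: ennreal_leI)
  qed

  \<comment> \<open>The pointwise limit\<close>
  define u where "u x = enn2real (SUP n. ennreal (U n x))" for x
  have [measurable]: "u \<in> borel_measurable borel" unfolding u_def by measurable
  have u0: "0 \<le> u x" for x by (simp add: u_def)
  have uz: "u x = 0" if "x \<notin> \<Omega>" for x using X_zero[OF U(1) that] by (simp add: u_def)
  have Mono: "AE x in lborel. \<forall>n. U n x \<le> U (Suc n) x" using mono by (simp add: AE_all_countable)
  \<comment> \<open>Monotone convergence and the uniform bound show that the supremum is finite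
    almost everywhere; on the exceptional set \<open>enn2real\<close> gives u a harmless
    value.\<close>
  have "(\<integral>\<^sup>+ x. (SUP n. ennreal (U n x powr q)) \<partial>lborel) = (SUP n. \<integral>\<^sup>+ x. ennreal (U n x powr q) \<partial>lborel)"
  proof (rule nn_integral_monotone_convergence_SUP_AE)
    show "AE x in lborel. ennreal (U n x powr q) \<le> ennreal (U (Suc n) x powr q)" for n
      using mono[of n] by eventually_elim (use U(2) q in \<open>auto intro!: ennreal_leI powr_mono2\<close>)
  qed measurable
  also have "\<dots> \<le> ennreal K" by (intro SUP_least UKn)
  finally have supK: "(\<integral>\<^sup>+ x. (SUP n. ennreal (U n x powr q)) \<partial>lborel) \<le> ennreal K" .
  then have "(\<integral>\<^sup>+ x. (SUP n. ennreal (U n x powr q)) \<partial>lborel) \<noteq> \<infinity>" by (auto simp: top_unique)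
  then have fin: "AE x in lborel. (SUP n. ennreal (U n x powr q)) \<noteq> \<infinity>" by (intro nn_integral_PInf_AE) measurable
  have lim: "AE x in lborel. (\<lambda>n. U n x) \<longlonglongrightarrow> u x \<and> (\<forall>n. U n x \<le> u x)"
    using Mono fin
  proof eventually_elim
    fix x assume m: "\<forall>n. U n x \<le> U (Suc n) x" and "(SUP n. ennreal (U n x powr q)) \<noteq> \<infinity>"
    then obtain C where C: "(SUP n. ennreal (U n x powr q)) = ennreal C" "C \<ge> 0"
      by (cases "SUP n. ennreal (U n x powr q)") auto
    have Ub: "U n x \<le> C powr (1 / q)" for n
    proof -
      have "ennreal (U n x powr q) \<le> ennreal C" unfolding C(1)[symmetric] by (intro SUP_upper) auto
      then have "U n x powr q \<le> C" using C(2) by (subst (asm) ennreal_le_iff) auto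
      then have "(U n x powr q) powr (1 / q) \<le> C powr (1 / q)" using q by (intro powr_mono2) auto
      then show ?thesis using q U(2)[of n x] by (simp add: powr_powr)
    qed
    have inc: "incseq (\<lambda>n. U n x)" using m by (intro incseq_SucI) auto
    then obtain L where L: "(\<lambda>n. U n x) \<longlonglongrightarrow> L" "\<And>n. U n x \<le> L"
      using incseq_convergent[of "\<lambda>n. U n x" "C powr (1 / q)"] Ub by metis
    have L0: "0 \<le> L" using L(2)[of 0] U(2)[of 0 x] by linarith
    have "(\<lambda>n. ennreal (U n x)) \<longlonglongrightarrow> ennreal L" by (rule tendsto_ennrealI[OF L(1)])
    moreover have "(\<lambda>n. ennreal (U n x)) \<longlonglongrightarrow> (SUP n. ennreal (U n x))"
      using inc by (intro LIMSEQ_SUP) (auto simp: incseq_def intro!: ennreal_leI)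
    ultimately have "(SUP n. ennreal (U n x)) = ennreal L" using LIMSEQ_unique by blast
    then have "u x = L" using L0 by (simp add: u_def)
    then show "(\<lambda>n. U n x) \<longlonglongrightarrow> u x \<and> (\<forall>n. U n x \<le> u x)" using L by simp
  qed
  have uq: "integrable lborel (\<lambda>x. u x powr q)"
  proof (rule integrableI_nonneg)
    have "(\<integral>\<^sup>+ x. ennreal (u x powr q) \<partial>lborel) \<le> (\<integral>\<^sup>+ x. (SUP n. ennreal (U n x powr q)) \<partial>lborel)"
    proof (rule nn_integral_mono_AE, use lim in eventually_elim)
      fix x assume x: "(\<lambda>n. U n x) \<longlonglongrightarrow> u x \<and> (\<forall>n. U n x \<le> u x)"
      have "(\<lambda>n. ennreal (U n x powr q)) \<longlonglongrightarrow> ennreal (u x powr q)"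
        using x q U(2) by (intro tendsto_ennrealI tendsto_powr' tendsto_const) auto
      then show "ennreal (u x powr q) \<le> (SUP n. ennreal (U n x powr q))"
        by (rule LIMSEQ_le_const2) (auto intro!: SUP_upper)
    qed
    also note supK
    finally show "(\<integral>\<^sup>+ x. ennreal (u x powr q) \<partial>lborel) < \<infinity>" by (rule order_le_less_trans) simp
  qed auto
  define F where "F x = lam * u x powr q + go x" for x
  have F: "integrable lborel F" unfolding F_def[abs_def] using uq go by auto
  have [measurable]: "F \<in> borel_measurable borel" unfolding F_def by measurable
  have F0: "0 \<le> F x" for x using lam go0(1)[of x] by (simp add: F_def)
  have fF: "AE x in lborel. (\<lambda>n. f n x) \<longlonglongrightarrow> F x \<and> (\<forall>n. f n x \<le> F x)"
    using lim
  proof eventually_elim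
    fix x assume x: "(\<lambda>n. U n x) \<longlonglongrightarrow> u x \<and> (\<forall>n. U n x \<le> u x)"
    have le: "f n x \<le> F x" for n
    proof -
      have "lam * U n x powr q \<le> lam * u x powr q" using x lam q U(2)[of n x] by (intro mult_left_mono powr_mono2) auto
      then show ?thesis using fle[of n x] by (simp add: F_def)
    qed
    obtain N where N: "u x \<le> real N" "go x \<le> real N" by (meson real_arch_simple order_trans max.cobounded1 max.cobounded2)
    have "(\<lambda>n. lam * U n x powr q + go x) \<longlonglongrightarrow> lam * u x powr q + go x"
      using x q U(2) by (intro tendsto_add tendsto_mult tendsto_const tendsto_powr') auto
    moreover have "\<forall>\<^sub>F n in sequentially. lam * U n x powr q + go x = f n x"
      unfolding eventually_sequentially
    proof (intro exI[of _ N] allI impI)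
      fix n assume "N \<le> n"
      then have "go x \<le> real n" "U n x \<le> real n" using N x by (auto intro: order_trans)
      then show "lam * U n x powr q + go x = f n x" by (simp add: f_def dat_def min_def)
    qed
    ultimately have "(\<lambda>n. f n x) \<longlonglongrightarrow> F x" unfolding F_def by (rule Lim_transform_eventually)
    then show "(\<lambda>n. f n x) \<longlonglongrightarrow> F x \<and> (\<forall>n. f n x \<le> F x)" using le by blast
  qed
  have fintF: "(\<integral>x. f n x \<partial>lborel) \<le> (\<integral>x. F x \<partial>lborel)" for n
    by (rule integral_mono_AE[OF fint F], rule eventually_mono[OF fF]) blast
  have limS: "AE x in lborel. (\<lambda>n. U (Suc n) x) \<longlonglongrightarrow> u x" by (rule eventually_mono[OF lim]) (rule LIMSEQ_Suc, erule conjunct1)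

  \<comment> \<open>The limit is an entropy solution\<close>
  have TW: "(\<lambda>x. Tk k (u x)) \<in> W" if k: "k > 0" for k
  proof (rule W_closed_bounded[where w="\<lambda>n x. Tk k (U (Suc n) x)" and k=k and K="2 * (k * (\<integral>x. F x \<partial>lborel))"])
    show "(\<lambda>x. Tk k (U (Suc n) x)) \<in> W" for n by (intro X_Tk U k)
    show "\<bar>Tk k (U (Suc n) x)\<bar> \<le> k" for n x using k by (auto simp: Tk_def max_def min_def)
    show "w2 (\<lambda>x. Tk k (U (Suc n) x)) \<le> ennreal (2 * (k * (\<integral>x. F x \<partial>lborel)))" for n
    proof -
      let ?c = "\<lambda>x. clamp_real 0 k (U (Suc n) x)"
      have eq: "Tk k (U (Suc n) x) = ?c x" for x using k U(2)[of "Suc n" x] by (auto simp: Tk_def clamp_real_def)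
      have "w2 (\<lambda>x. Tk k (U (Suc n) x)) \<le> energy ?c" unfolding eq by (rule w2_le_energy)
      also have "\<dots> \<le> ennreal (2 * (\<integral>x. f n x * (?c x - 0) \<partial>lborel))" by (rule weak_solution_clamp_energy[OF sol]) (use k in auto)
      also have "\<dots> \<le> ennreal (2 * (k * (\<integral>x. F x \<partial>lborel)))"
      proof (intro ennreal_leI mult_left_mono)
        have "(\<integral>x. f n x * (?c x - 0) \<partial>lborel) \<le> (\<integral>x. k * f n x \<partial>lborel)"
        proof (rule integral_mono)
          show "integrable lborel (\<lambda>x. f n x * (?c x - 0))"
          proof -
            have "?c \<in> X" using k by (intro X_clamp U) auto
            from X_integrable_bounded_mult[OF this _ fabs[of n]] show ?thesis by simp
          qed
          show "integrable lborel (\<lambda>x. k * f n x)" using fint by simp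
          fix x
          have "f n x * ?c x \<le> f n x * k" using f0[of n x] k by (intro mult_left_mono) (auto simp: clamp_real_def)
          then show "f n x * (?c x - 0) \<le> k * f n x" by (simp add: mult.commute)
        qed
        also have "\<dots> \<le> k * (\<integral>x. F x \<partial>lborel)" using fintF[of n] k by simp
        finally show "(\<integral>x. f n x * (?c x - 0) \<partial>lborel) \<le> k * (\<integral>x. F x \<partial>lborel)" .
      qed simp
      finally show ?thesis .
    qed
    show "AE x in lborel. (\<lambda>n. Tk k (U (Suc n) x)) \<longlonglongrightarrow> Tk k (u x)"
      using limS by eventually_elim (auto simp: Tk_def intro!: tendsto_intros)
  qed (use uz k in \<open>auto simp: Tk_def\<close>)
  have Ext: "(\<integral>\<^sup>+ z. indicator (- (\<Omega> \<times> \<Omega>)) z * ennreal (\<bar>dif u z\<bar> powr (p - 1)) \<partial>\<nu>) < \<infinity>"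
  proof -
    have "(\<integral>\<^sup>+ z. indicator (- (\<Omega> \<times> \<Omega>)) z * ennreal (\<bar>dif u z\<bar> powr (p - 1)) \<partial>\<nu>)
      = (\<integral>\<^sup>+ z. liminf (\<lambda>n. indicator (- (\<Omega> \<times> \<Omega>)) z * ennreal (\<bar>dif (U (Suc n)) z\<bar> powr (p - 1))) \<partial>\<nu>)"
    proof (rule nn_integral_cong_AE, use AE_nu[OF limS] in eventually_elim)
      fix z assume z: "(\<lambda>n. U (Suc n) (fst z)) \<longlonglongrightarrow> u (fst z) \<and> (\<lambda>n. U (Suc n) (snd z)) \<longlonglongrightarrow> u (snd z)"
      have "(\<lambda>n. ennreal (\<bar>dif (U (Suc n)) z\<bar> powr (p - 1))) \<longlonglongrightarrow> ennreal (\<bar>dif u z\<bar> powr (p - 1))"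
        unfolding dif_def using z p by (intro tendsto_ennrealI tendsto_powr' tendsto_rabs tendsto_diff tendsto_const) auto
      then have "(\<lambda>n. indicator (- (\<Omega> \<times> \<Omega>)) z * ennreal (\<bar>dif (U (Suc n)) z\<bar> powr (p - 1))) \<longlonglongrightarrow> indicator (- (\<Omega> \<times> \<Omega>)) z * ennreal (\<bar>dif u z\<bar> powr (p - 1))"
        by (intro ennreal_tendsto_cmult) (auto simp: indicator_def)
      then show "indicator (- (\<Omega> \<times> \<Omega>)) z * ennreal (\<bar>dif u z\<bar> powr (p - 1)) = liminf (\<lambda>n. indicator (- (\<Omega> \<times> \<Omega>)) z * ennreal (\<bar>dif (U (Suc n)) z\<bar> powr (p - 1)))"
        by (intro lim_imp_Liminf[symmetric]) auto
    qed
    also have "\<dots> \<le> liminf (\<lambda>n. \<integral>\<^sup>+ z. indicator (- (\<Omega> \<times> \<Omega>)) z * ennreal (\<bar>dif (U (Suc n)) z\<bar> powr (p - 1)) \<partial>\<nu>)"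
      by (rule nn_integral_liminf) measurable
    also have "\<dots> \<le> ennreal (2 * (\<integral>x. F x \<partial>lborel))"
    proof (intro Liminf_le always_eventually allI)
      fix n
      have "(\<integral>\<^sup>+ z. indicator (- (\<Omega> \<times> \<Omega>)) z * ennreal (\<bar>dif (U (Suc n)) z\<bar> powr (p - 1)) \<partial>\<nu>) \<le> ennreal (2 * (\<integral>x. f n x \<partial>lborel))"
        by (rule weak_solution_exterior[OF sol _ f0 fint fc]) measurable
      also have "\<dots> \<le> ennreal (2 * (\<integral>x. F x \<partial>lborel))" using fintF[of n] by (intro ennreal_leI) simp
      finally show "(\<integral>\<^sup>+ z. indicator (- (\<Omega> \<times> \<Omega>)) z * ennreal (\<bar>dif (U (Suc n)) z\<bar> powr (p - 1)) \<partial>\<nu>) \<le> ennreal (2 * (\<integral>x. F x \<partial>lborel))" .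
    qed simp
    finally show ?thesis by (rule order_le_less_trans) simp
  qed
  have ineq: "integrable \<nu> (\<lambda>z. sgp p (dif u z) * dif (\<lambda>x. Tk k (u x - \<phi> x)) z) \<and>
      (1/2) * (\<integral>z. sgp p (dif u z) * dif (\<lambda>x. Tk k (u x - \<phi> x)) z \<partial>\<nu>) \<le> (\<integral>x. F x * Tk k (u x - \<phi> x) \<partial>lborel)"
    if k: "k > 0" and \<phi>: "\<phi> \<in> W" for k \<phi>
  proof -
    note [measurable] = W_measurable[OF \<phi>]
    have zero: "w2 (\<lambda>x. \<phi> x - \<phi> x) = 0" using p by (simp add: wpart2_def)
    show ?thesis
    proof (rule entropy_stability[where w="\<lambda>n. U (Suc n)" and \<phi>="\<lambda>_. \<phi>" and H="\<lambda>z. \<bar>dif u z\<bar> powr (p - 1)" and r="\<lambda>n. \<integral>x. f n x * Tk k (U (Suc n) x - \<phi> x) \<partial>lborel"])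
      show "w2 \<phi> < \<infinity>" by (rule W_w2_finite[OF \<phi>])
      show "(\<lambda>n. w2 (\<lambda>x. \<phi> x - \<phi> x)) \<longlonglongrightarrow> 0" "w2 (\<lambda>x. \<phi> x - \<phi> x) \<le> 1" unfolding zero by simp_all
      \<comment> \<open>Off \<Omega> \<times> \<Omega> one value is 0, so the increment of U is at
        most that of u simply because 0 \<le> U \<le> u; inside no such comparison of increments is
        available.\<close>
      show "AE z in \<nu>. z \<notin> \<Omega> \<times> \<Omega> \<longrightarrow> \<bar>dif (U (Suc n)) z\<bar> powr (p - 1) \<le> \<bar>dif u z\<bar> powr (p - 1)" for n
        using AE_nu[OF lim]
      proof eventually_elim
        fix z assume z: "((\<lambda>n. U n (fst z)) \<longlonglongrightarrow> u (fst z) \<and> (\<forall>n. U n (fst z) \<le> u (fst z))) \<and> ((\<lambda>n. U n (snd z)) \<longlonglongrightarrow> u (snd z) \<and> (\<forall>n. U n (snd z) \<le> u (snd z)))"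
        show "z \<notin> \<Omega> \<times> \<Omega> \<longrightarrow> \<bar>dif (U (Suc n)) z\<bar> powr (p - 1) \<le> \<bar>dif u z\<bar> powr (p - 1)"
        proof
          assume "z \<notin> \<Omega> \<times> \<Omega>"
          then consider "fst z \<notin> \<Omega>" | "snd z \<notin> \<Omega>" by (cases z) auto
          then have "\<bar>dif (U (Suc n)) z\<bar> \<le> \<bar>dif u z\<bar>"
          proof cases
            case 1
            then show ?thesis using z U(2)[of "Suc n" "snd z"] u0[of "snd z"] X_zero[OF U(1) 1] uz[OF 1] by (simp add: dif_def)
          next
            case 2
            then show ?thesis using z U(2)[of "Suc n" "fst z"] u0[of "fst z"] X_zero[OF U(1) 2] uz[OF 2] by (simp add: dif_def)
          qed
          then show "\<bar>dif (U (Suc n)) z\<bar> powr (p - 1) \<le> \<bar>dif u z\<bar> powr (p - 1)" using p by (intro powr_mono2) auto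
        qed
      qed
      show "integrable \<nu> (\<lambda>z. sgp p (dif (U (Suc n)) z) * dif (\<lambda>x. Tk k (U (Suc n) x - \<phi> x)) z)"
        "(1/2) * (\<integral>z. sgp p (dif (U (Suc n)) z) * dif (\<lambda>x. Tk k (U (Suc n) x - \<phi> x)) z \<partial>\<nu>) \<le> (\<integral>x. f n x * Tk k (U (Suc n) x - \<phi> x) \<partial>lborel)" for n
        using weak_solution_entropy[OF sol[of n] _ f0 fint fc \<phi> k] by auto
      show "(\<lambda>n. \<integral>x. f n x * Tk k (U (Suc n) x - \<phi> x) \<partial>lborel) \<longlonglongrightarrow> (\<integral>x. F x * Tk k (u x - \<phi> x) \<partial>lborel)"
      proof (rule integral_dominated_convergence[where w="\<lambda>x. F x * k"])
        show "integrable lborel (\<lambda>x. F x * k)" using F by simp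
        show "AE x in lborel. norm (f n x * Tk k (U (Suc n) x - \<phi> x)) \<le> F x * k" for n
          using fF
        proof eventually_elim
          fix x assume x: "(\<lambda>n. f n x) \<longlonglongrightarrow> F x \<and> (\<forall>n. f n x \<le> F x)"
          have "\<bar>f n x\<bar> * \<bar>Tk k (U (Suc n) x - \<phi> x)\<bar> \<le> F x * k"
            using x f0[of n x] F0[of x] k by (intro mult_mono) (auto simp: Tk_def max_def min_def)
          then show "norm (f n x * Tk k (U (Suc n) x - \<phi> x)) \<le> F x * k" by (simp add: abs_mult)
        qed
        show "AE x in lborel. (\<lambda>n. f n x * Tk k (U (Suc n) x - \<phi> x)) \<longlonglongrightarrow> F x * Tk k (u x - \<phi> x)"
          using fF limS by eventually_elim (auto simp: Tk_def intro!: tendsto_intros)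
      qed measurable
    qed (use X_zero[OF U(1)] W_zero[OF \<phi>] limS Ext k in auto)
  qed
  have setF: "(\<integral>x\<in>\<Omega>. (lam * u x powr q + g x) * t x \<partial>lborel) = (\<integral>x. F x * t x \<partial>lborel)" for t
  proof -
    have eq: "indicator \<Omega> x *\<^sub>R ((lam * u x powr q + g x) * t x) = F x * t x" for x
      using uz[of x] q by (cases "x \<in> \<Omega>") (auto simp: F_def go_def)
    show ?thesis unfolding set_lebesgue_integral_def eq ..
  qed
  \<comment> \<open>The decay condition follows from the inequality just proved, with k = 1 and
    \<phi> = T_h u. As u \<ge> 0, on R_h one value is at least h + 1 and the other at most h, so the
    clamp to [h, h + 1] has increment of modulus 1 and the integrand is exactly |u(x) -
    u(y)|^(p-1).\<close>
  have Rhlim: "((\<lambda>h. \<integral>\<^sup>+ z. indicator (Rh u h) z * ennreal (\<bar>dif u z\<bar> powr (p - 1)) \<partial>\<nu>) \<longlongrightarrow> 0) at_top"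
  proof -
    have bound: "(\<integral>\<^sup>+ z. indicator (Rh u h) z * ennreal (\<bar>dif u z\<bar> powr (p - 1)) \<partial>\<nu>) \<le> ennreal (2 * (\<integral>x. F x * Tk 1 (u x - Tk h (u x)) \<partial>lborel))"
      if h: "h > 0" for h
    proof -
      let ?G = "\<lambda>z. sgp p (dif u z) * dif (\<lambda>x. Tk 1 (u x - Tk h (u x))) z"
      have e: "dif (\<lambda>x. Tk 1 (u x - Tk h (u x))) z = dif (\<lambda>x. clamp_real h (h + 1) (u x)) z" for z
        using u0[of "fst z"] u0[of "snd z"] h by (auto simp: dif_def Tk_def clamp_real_def max_def min_def)
      have G0: "0 \<le> ?G z" for z unfolding e by (rule dif_clamp_mono_mult)
      have "(\<integral>\<^sup>+ z. indicator (Rh u h) z * ennreal (\<bar>dif u z\<bar> powr (p - 1)) \<partial>\<nu>) \<le> (\<integral>\<^sup>+ z. ennreal (?G z) \<partial>\<nu>)"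
      proof (rule nn_integral_mono)
        fix z :: "'a \<times> 'a"
        show "indicator (Rh u h) z * ennreal (\<bar>dif u z\<bar> powr (p - 1)) \<le> ennreal (?G z)"
        proof (cases "z \<in> Rh u h")
          case True
          have "0 \<le> u (fst z) * u (snd z)" using u0 by simp
          then consider "u (fst z) \<ge> h + 1" "u (snd z) \<le> h" | "u (snd z) \<ge> h + 1" "u (fst z) \<le> h"
            using True u0[of "fst z"] u0[of "snd z"] by (cases z) (auto simp: Rh_def max_def min_def split: if_splits)
          then have "?G z = \<bar>dif u z\<bar> powr (p - 1)"
          proof cases
            case 1
            then have "dif (\<lambda>x. clamp_real h (h + 1) (u x)) z = 1" by (simp add: dif_def clamp_real_def)
            then show ?thesis unfolding e using 1 p by (simp add: dif_def sgp_nonneg_eq)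
          next
            case 2
            then have "dif (\<lambda>x. clamp_real h (h + 1) (u x)) z = -1" by (simp add: dif_def clamp_real_def)
            moreover have "sgp p (dif u z) = - (\<bar>dif u z\<bar> powr (p - 1))"
              using 2 p sgp_minus[of p "- dif u z"] sgp_nonneg_eq[of p "- dif u z"] by (simp add: dif_def)
            ultimately show ?thesis unfolding e by simp
          qed
          then show ?thesis using True by simp
        qed simp
      qed
      also have "\<dots> = ennreal (\<integral>z. ?G z \<partial>\<nu>)"
        using ineq[OF zero_less_one TW[OF h]] by (intro nn_integral_eq_integral AE_I2 G0) auto
      also have "\<dots> \<le> ennreal (2 * (\<integral>x. F x * Tk 1 (u x - Tk h (u x)) \<partial>lborel))"
        using ineq[OF zero_less_one TW[OF h]] by (intro ennreal_leI) auto
      finally show ?thesis .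
    qed
    have "((\<lambda>h. \<integral>x. F x * Tk 1 (u x - Tk h (u x)) \<partial>lborel) \<longlongrightarrow> (\<integral>x. 0 \<partial>(lborel :: 'a measure))) at_top"
    proof (rule integral_dominated_convergence_at_top[where w=F])
      show "AE x in lborel. ((\<lambda>h. F x * Tk 1 (u x - Tk h (u x))) \<longlongrightarrow> 0) at_top"
      proof (rule AE_I2)
        fix x
        have "\<forall>\<^sub>F h in at_top. 0 = F x * Tk 1 (u x - Tk h (u x))"
          using eventually_ge_at_top[of "u x"] by eventually_elim (use u0[of x] in \<open>auto simp: Tk_def\<close>)
        then show "((\<lambda>h. F x * Tk 1 (u x - Tk h (u x))) \<longlongrightarrow> 0) at_top" by (rule Lim_transform_eventually[OF tendsto_const])
      qed
      show "\<forall>\<^sub>F h in at_top. AE x in lborel. norm (F x * Tk 1 (u x - Tk h (u x))) \<le> F x"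
      proof (intro always_eventually allI AE_I2)
        fix h x
        have "\<bar>Tk 1 (u x - Tk h (u x))\<bar> \<le> 1" by (auto simp: Tk_def max_def min_def)
        then have "\<bar>F x\<bar> * \<bar>Tk 1 (u x - Tk h (u x))\<bar> \<le> \<bar>F x\<bar> * 1" by (intro mult_left_mono) auto
        then show "norm (F x * Tk 1 (u x - Tk h (u x))) \<le> F x" using F0[of x] by (simp add: abs_mult)
      qed
    qed (use F in auto)
    then have "((\<lambda>h. ennreal (2 * (\<integral>x. F x * Tk 1 (u x - Tk h (u x)) \<partial>lborel))) \<longlongrightarrow> ennreal (2 * 0)) at_top"
      by (intro tendsto_ennrealI tendsto_mult tendsto_const) simp
    then have up: "((\<lambda>h. ennreal (2 * (\<integral>x. F x * Tk 1 (u x - Tk h (u x)) \<partial>lborel))) \<longlongrightarrow> 0) at_top" by simp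
    have ev: "\<forall>\<^sub>F h in at_top. (\<integral>\<^sup>+ z. indicator (Rh u h) z * ennreal (\<bar>dif u z\<bar> powr (p - 1)) \<partial>\<nu>) \<le> ennreal (2 * (\<integral>x. F x * Tk 1 (u x - Tk h (u x)) \<partial>lborel))"
      using eventually_gt_at_top[of 0] by eventually_elim (rule bound)
    show ?thesis by (rule tendsto_sandwich[OF _ ev tendsto_const up]) simp
  qed
  have "pos_entropy_sol s p \<beta> \<Omega> lam g u"
    unfolding pos_entropy_sol_def entropy_solution_eq
  proof (intro conjI allI impI ballI)
    show "set_integrable lborel \<Omega> (\<lambda>x. u x powr (p - 1))"
      unfolding set_integrable_def using uq by (intro integrable_mult_indicator) (auto simp: q_def)
    show "integrable \<nu> (\<lambda>z. sgp p (dif u z) * dif (\<lambda>x. Tk k (u x - \<phi> x)) z)" if "k > 0" "\<phi> \<in> W" for k \<phi>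
      using ineq[OF that] by blast
    show "(1/2) * (\<integral>z. sgp p (dif u z) * dif (\<lambda>x. Tk k (u x - \<phi> x)) z \<partial>\<nu>)
        \<le> (\<integral>x\<in>\<Omega>. (lam * u x powr (p - 1) + g x) * Tk k (u x - \<phi> x) \<partial>lborel)" if "k > 0" "\<phi> \<in> W" for k \<phi>
      using ineq[OF that] setF[of "\<lambda>x. Tk k (u x - \<phi> x)"] by (simp add: q_def)
  qed (use u0 uz TW Rhlim in auto)

  \<comment> \<open>Minimality\<close>
  moreover have "AE x in lborel. u x \<le> v x" if v: "pos_entropy_sol s p \<beta> \<Omega> lam g v" for v
  proof -
    let ?fv = "\<lambda>x. lam * v x powr (p - 1) + g x"
    have vm [measurable]: "v \<in> borel_measurable borel" and v0: "\<And>x. 0 \<le> v x" and vq: "set_integrable lborel \<Omega> (\<lambda>x. v x powr (p - 1))"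
      and ve: "entropy_solution s p \<beta> \<Omega> ?fv v" using v by (auto simp: pos_entropy_sol_def)
    have vz: "v x = 0" if "x \<notin> \<Omega>" for x using ve that by (simp add: entropy_solution_eq)
    have fv: "set_integrable lborel \<Omega> ?fv"
      using vq gi by (intro set_integral_add set_integrable_mult_right) auto
    have "AE x in lborel. U n x \<le> v x" for n
    proof (induction n)
      case 0
      show ?case using v0 by (simp add: U0)
    next
      case (Suc n)
      show ?case
      proof (rule comparison[OF U(1) U(2) vm v0 vz])
        fix M \<psi> assume M: "M > (0::real)" and \<psi>: "\<psi> = (\<lambda>x. clamp_real 0 1 (Tk M (U (Suc n) x) - Tk M (v x)))"
        have \<psi>X: "\<psi> \<in> X" and \<psi>W: "\<psi> \<in> W" unfolding \<psi>
          using truncated_difference_X[OF X_Tk_X[OF U(1) M] entropy_solution_truncation_X[OF ve M]] by auto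
        note [measurable] = X_measurable[OF \<psi>X]
        have \<psi>01: "0 \<le> \<psi> x" "\<psi> x \<le> 1" for x by (auto simp: \<psi> clamp_real_def)
        have \<psi>v: "\<psi> x = 0" if "v x > M" for x using that M by (auto simp: \<psi> clamp_real_def Tk_def)
        have i: "integrable \<nu> (\<lambda>z. sgp p (dif v z) * dif \<psi> z)"
          and le: "(\<integral>x\<in>\<Omega>. ?fv x * \<psi> x \<partial>lborel) \<le> (1/2) * (\<integral>z. sgp p (dif v z) * dif \<psi> z \<partial>\<nu>)"
          using entropy_solution_supersolution[OF ve v0 fv \<psi>W \<psi>01 \<psi>v] by auto
        have eq: "(1/2) * (\<integral>z. sgp p (dif (U (Suc n)) z) * dif \<psi> z \<partial>\<nu>) = (\<integral>x. f n x * \<psi> x \<partial>lborel)"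
          using sol[of n] \<psi>X by (auto simp: weak_solution_def)
        \<comment> \<open>By the induction hypothesis the datum of the next iterate lies below the
          datum of v, so v acts as a supersolution for the next comparison.\<close>
        have "(\<integral>x. f n x * \<psi> x \<partial>lborel) \<le> (\<integral>x. indicator \<Omega> x *\<^sub>R (?fv x * \<psi> x) \<partial>lborel)"
        proof (rule integral_mono_AE)
          show "integrable lborel (\<lambda>x. f n x * \<psi> x)" by (rule X_integrable_bounded_mult[OF \<psi>X _ fabs]) measurable
          show "integrable lborel (\<lambda>x. indicator \<Omega> x *\<^sub>R (?fv x * \<psi> x))"
          proof (rule Bochner_Integration.integrable_bound[OF fv[unfolded set_integrable_def]])
            have "(\<lambda>x. indicator \<Omega> x *\<^sub>R ?fv x) \<in> borel_measurable lborel" using fv unfolding set_integrable_def by (rule borel_measurable_integrable)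
            then have "(\<lambda>x. (indicator \<Omega> x *\<^sub>R ?fv x) * \<psi> x) \<in> borel_measurable lborel" by measurable
            then show "(\<lambda>x. indicator \<Omega> x *\<^sub>R (?fv x * \<psi> x)) \<in> borel_measurable lborel" by (simp add: mult.assoc)
            show "AE x in lborel. norm (indicator \<Omega> x *\<^sub>R (?fv x * \<psi> x)) \<le> norm (indicator \<Omega> x *\<^sub>R ?fv x)"
              using \<psi>01 by (intro AE_I2) (auto simp: indicator_def abs_mult mult_left_le)
          qed
          show "AE x in lborel. f n x * \<psi> x \<le> indicator \<Omega> x *\<^sub>R (?fv x * \<psi> x)"
            using Suc
          proof eventually_elim
            fix x assume Uv: "U n x \<le> v x"
            show "f n x * \<psi> x \<le> indicator \<Omega> x *\<^sub>R (?fv x * \<psi> x)"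
            proof (cases "x \<in> \<Omega>")
              case True
              have "lam * U n x powr q \<le> lam * v x powr q" using Uv lam q U(2)[of n x] by (intro mult_left_mono powr_mono2) auto
              then have "f n x \<le> ?fv x" using fle[of n x] True by (simp add: go_def q_def)
              then show ?thesis using True \<psi>01[of x] by (simp add: mult_right_mono)
            next
              case False
              then show ?thesis using X_zero[OF \<psi>X False] by simp
            qed
          qed
        qed
        then have "(1/2) * (\<integral>z. sgp p (dif (U (Suc n)) z) * dif \<psi> z \<partial>\<nu>) \<le> (1/2) * (\<integral>z. sgp p (dif v z) * dif \<psi> z \<partial>\<nu>)"
          using eq le by (simp add: set_lebesgue_integral_def)
        then show "\<psi> \<in> X \<and> integrable \<nu> (\<lambda>z. sgp p (dif v z) * dif \<psi> z) \<and>
           (\<integral>z. sgp p (dif (U (Suc n)) z) * dif \<psi> z \<partial>\<nu>) \<le> (\<integral>z. sgp p (dif v z) * dif \<psi> z \<partial>\<nu>)"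
          using \<psi>X i by simp
      qed
    qed
    then have "AE x in lborel. \<forall>n. U n x \<le> v x" by (simp add: AE_all_countable)
    then show ?thesis using lim by eventually_elim (auto intro: LIMSEQ_le_const2)
  qed
  ultimately show ?thesis by blast
qed

end

theorem theorem4p2:
  fixes \<Omega> :: "'a::euclidean_space set" and s p \<beta> lam :: real and g :: "'a \<Rightarrow> real"
  assumes "0 < s" "s < 1" "1 < p" "p < real DIM('a)" "p * s < real DIM('a)"
    and "0 \<le> \<beta>" "\<beta> < (real DIM('a) - p * s) / 2"
    and "smooth_bounded_domain \<Omega>" "0 \<in> \<Omega>"
    and "0 < lam" "ennreal lam < lambda1 s p \<beta> \<Omega>"
    and "set_integrable lborel \<Omega> g" "\<forall>x\<in>\<Omega>. g x \<ge> 0"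
    and "\<not> (AE x in lborel. x \<in> \<Omega> \<longrightarrow> g x = 0)"
  shows "\<exists>u. pos_entropy_sol s p \<beta> \<Omega> lam g u \<and>
           (\<forall>v. pos_entropy_sol s p \<beta> \<Omega> lam g v \<longrightarrow> (AE x in lborel. u x \<le> v x))"
proof -
  interpret weighted_fractional s p \<beta> \<Omega>
    using assms by unfold_locales (auto simp: smooth_bounded_domain_def)
  show ?thesis using assms by (intro minimal_entropy_solution)
qed

end
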